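(* Let $k$ be an algebraically closed field and $S=k[x,y,z]$. Any graded artinian Gorenstein algebra $S/I$ with Hilbert function $(1,3,6,6,3,1)$ has the Weak Lefschetz Property, unless the characteristic of $k$ is $3$ and, after a linear change of variables, $I=(x^2y,\;x^2z,\;y^3,\;z^3,\;x^4+y^2z^2)$.
   Context: $S=k[x,y,z]$ has the standard grading and $I$ is a homogeneous ideal. $A=S/I$ is Gorenstein artinian if it is finite-dimensional over $k$ and its socle $\{a\in A: a\cdot(x,y,z)=0\}$ is one-dimensional. Hilbert function $(h_0,\dots,h_e)$ means $\dim_k[A]_i=h_i$ for $0\le i\le e$ and $[A]_i=0$ for $i>e$. $A$ has the Weak Lefschetz Property if there is a linear form $L\in[A]_1$ such that for every $i\ge0$ the multiplication map $\times L:[A]_i\to[A]_{i+1}$ is injective or surjective. *)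

theory Defs
  imports
    "HOL-Algebra.Algebraic_Closure_Type"
    "HOL-Algebra.Embedded_Algebras"
    "HOL-Algebra.QuotRing"
    "HOL-Analysis.Cartesian_Space"
    "HOL-Library.Poly_Mapping"
begin

text \<open>
  Elements of \<open>k[x,y,z]\<close> are finitely supported functions from exponent vectors to coefficients,
  with the convolution product of \<^theory>\<open>HOL-Library.Poly_Mapping\<close>. The variables are indexed by
  the three-element type \<open>3\<close>, with \<open>x\<close>, \<open>y\<close>, \<open>z\<close> at the indices \<open>0\<close>, \<open>1\<close>, \<open>2\<close>.
\<close>

type_synonym monom3 = "3 \<Rightarrow>\<^sub>0 nat"
type_synonym 'k poly3 = "monom3 \<Rightarrow>\<^sub>0 'k"

definition pconst :: "'k::comm_ring_1 \<Rightarrow> 'k poly3"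
  where "pconst c = Poly_Mapping.single 0 c"

definition pvar :: "3 \<Rightarrow> 'k::comm_ring_1 poly3"
  where "pvar i = Poly_Mapping.single (Poly_Mapping.single i 1) 1"

definition monom_degree :: "monom3 \<Rightarrow> nat"
  where "monom_degree m = (\<Sum>i\<in>UNIV. Poly_Mapping.lookup m i)"

definition forms :: "nat \<Rightarrow> 'k::comm_ring_1 poly3 set"
  where "forms d = {f. \<forall>m\<in>Poly_Mapping.keys f. monom_degree m = d}"

abbreviation polyring :: "'k::comm_ring_1 poly3 ring"
  where "polyring \<equiv> ring_of_type_algebra"

definition homogeneous_ideal :: "'k::comm_ring_1 poly3 set \<Rightarrow> bool"
  where "homogeneous_ideal I \<longleftrightarrow> (\<exists>G \<subseteq> (\<Union>d. forms d). I = Idl\<^bsub>polyring\<^esub> G)"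

abbreviation quot :: "'k::comm_ring_1 poly3 set \<Rightarrow> 'k poly3 set ring"
  where "quot I \<equiv> polyring Quot I"

abbreviation residue_class :: "'k::comm_ring_1 poly3 set \<Rightarrow> 'k poly3 \<Rightarrow> 'k poly3 set"
  where "residue_class I f \<equiv> I +>\<^bsub>polyring\<^esub> f"

definition graded_part :: "'k::comm_ring_1 poly3 set \<Rightarrow> nat \<Rightarrow> 'k poly3 set set"
  where "graded_part I d = residue_class I ` forms d"

text \<open>
  The image of \<open>k\<close> in \<open>S/I\<close>. For a proper ideal \<open>I\<close> it is a subfield isomorphic to \<open>k\<close>, and the
  dimension over it in the sense of \<^theory>\<open>HOL-Algebra.Embedded_Algebras\<close> is the dimension over \<open>k\<close>.
  (If \<open>I\<close> is the unit ideal, the zero ring only has dimension 0.)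
\<close>

definition scalars :: "'k::comm_ring_1 poly3 set \<Rightarrow> 'k poly3 set set"
  where "scalars I = range (\<lambda>c. residue_class I (pconst c))"

definition socle :: "'k::comm_ring_1 poly3 set \<Rightarrow> 'k poly3 set set"
  where "socle I = {a \<in> carrier (quot I).
    \<forall>f \<in> Idl\<^bsub>polyring\<^esub> (range pvar). a \<otimes>\<^bsub>quot I\<^esub> residue_class I f = \<zero>\<^bsub>quot I\<^esub>}"

definition gorenstein_artinian :: "'k::field poly3 set \<Rightarrow> bool"
  where "gorenstein_artinian I \<longleftrightarrow>
    ring.finite_dimension (quot I) (scalars I) (carrier (quot I)) \<and>
    ring.dimension (quot I) 1 (scalars I) (socle I)"

definition has_hilbert_function :: "'k::field poly3 set \<Rightarrow> nat list \<Rightarrow> bool"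
  where "has_hilbert_function I h \<longleftrightarrow>
    (\<forall>i. ring.dimension (quot I) (if i < length h then h ! i else 0) (scalars I) (graded_part I i))"

definition weak_lefschetz :: "'k::field poly3 set \<Rightarrow> bool"
  where "weak_lefschetz I \<longleftrightarrow> (\<exists>L \<in> graded_part I 1. \<forall>i.
    inj_on (\<lambda>a. L \<otimes>\<^bsub>quot I\<^esub> a) (graded_part I i) \<or>
    (\<lambda>a. L \<otimes>\<^bsub>quot I\<^esub> a) ` graded_part I i = graded_part I (Suc i))"

text \<open>The \<open>k\<close>-algebra endomorphism sending the \<open>i\<close>-th variable to \<open>\<Sum>j. M\<^sub>i\<^sub>j x\<^sub>j\<close>.\<close>

definition linear_subst :: "'k::field^3^3 \<Rightarrow> 'k poly3 \<Rightarrow> 'k poly3"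
  where "linear_subst M f = (\<Sum>m\<in>Poly_Mapping.keys f. pconst (Poly_Mapping.lookup f m) *
    (\<Prod>i\<in>UNIV. (\<Sum>j\<in>UNIV. pconst (M $ i $ j) * pvar j) ^ Poly_Mapping.lookup m i))"

definition equal_up_to_linear_change :: "'k::field poly3 set \<Rightarrow> 'k poly3 set \<Rightarrow> bool"
  where "equal_up_to_linear_change I J \<longleftrightarrow> (\<exists>M. invertible M \<and> linear_subst M ` I = J)"

definition exceptional_ideal :: "'k::field poly3 set"
  where "exceptional_ideal =
    (let x = pvar 0; y = pvar 1; z = pvar 2
     in Idl\<^bsub>polyring\<^esub> {x^2 * y, x^2 * z, y^3, z^3, x^4 + y^2 * z^2})"

end

theory Submission
  imports Defs
begin

text \<open>
  Write \<open>A = S/I\<close> and \<open>V = I\<^sub>3\<close>, a space of four cubics. Since \<open>A\<close> is Gorenstein, multiplication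
  \<open>A\<^sub>i \<rightarrow> A\<^sub>i\<^sub>+\<^sub>1\<close> by a linear form \<open>L\<close> is injective or surjective in all degrees if it is injective on
  \<open>A\<^sub>2 = S\<^sub>2\<close>, so if the property fails, every \<open>L\<close> divides a nonzero element of \<open>V\<close>.

  The socle functional \<open>\<phi>\<close> on \<open>S\<^sub>5\<close> defines an alternating form \<open>\<phi> (det (p, a, b))\<close> on triples of quadrics,
  where \<open>p = (x, y, z)\<close>. On a complement of the multiples of \<open>p\<close> it lives in the odd dimension 15, so it has
  a radical, and an element \<open>a\<close> of it gives cubics \<open>p \<times> a\<close> in \<open>V\<close> with the linear syzygy \<open>p \<cdot> (p \<times> a) = 0\<close>.
  If they are linearly independent, a point at which \<open>a\<close> is parallel to \<open>p\<close> is used as the origin of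
  coordinates, and the failure for lines through this point and then for all other lines is contradictory.
  If they are dependent, \<open>V\<close> contains \<open>u\<^sub>1 q\<close> and \<open>u\<^sub>2 q\<close> for a quadric \<open>q\<close> and independent linear
  forms \<open>u\<^sub>1, u\<^sub>2\<close>. Restricting to lines excludes conics and pairs of lines. For a double line \<open>q = x\<^sup>2\<close>, the failure on
  lines is a differential condition on the other two cubics modulo \<open>x\<close>; it makes them dependent
  unless the characteristic is 2 or 3. Characteristic 2 contradicts the Gorenstein property, and
  characteristic 3 leads to the exceptional ideal.
\<close>

section \<open>Linear systems over a field\<close>

text \<open>The obstacle is that failure holds on every line but gives no control over the cubic it
  supplies. On a one-parameter family of lines it becomes an identity of polynomials in the
  parameter, and the contradiction comes from a leading coefficient that cannot vanish. The pairing
  of quadrics with \<open>A_3\<close> guarantees this: at a common zero of the cubics, evaluation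
  would be represented by a quadric \<open>Q\<close> with \<open>l Q\<close> in \<open>I\<close> for
  all linear \<open>l\<close> vanishing there, which is already a relation of the dependent type.
  Hence there are no base points in the independent case. The number 15 is 18 - 3: triples of
  quadrics modulo the linear multiples of \<open>p\<close>. The small characteristics enter through
  a Wronskian. On a double line the restrictions of the two remaining cubics must have Wronskian
  zero; for the pencil of \<open>y^3\<close>, \<open>z^3\<close> this happens only in characteristic
  3, and for the pencil of \<open>m y^2\<close>, \<open>m z^2\<close> only in characteristic
  2.\<close>

lemma eliminate_column:
  fixes A :: "nat \<Rightarrow> 'i \<Rightarrow> 'a::idom"
  assumes "finite J" "p \<in> J" "A m p \<noteq> 0" and x': "\<exists>j\<in>J - {p}. x' j \<noteq> 0"
    "\<forall>i<m. (\<Sum>j\<in>J - {p}. (A i j * A m p - A i p * A m j) * x' j) = 0"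
  shows "\<exists>x. (\<exists>j\<in>J. x j \<noteq> 0) \<and> (\<forall>i<Suc m. (\<Sum>j\<in>J. A i j * x j) = 0)"
proof -
  define s where "s = (\<Sum>j\<in>J - {p}. A m j * x' j)"
  \<comment> \<open>Fraction-free back substitution: the pivot scales the other unknowns instead of
    dividing \<open>s\<close>. The argument thus works over an integral domain, in particular for
    the polynomial matrices of \<open>polynomial_kernel\<close>.\<close>
  define x where "x j = (if j = p then - s else A m p * x' j)" for j
  have split: "(\<Sum>j\<in>J. A i j * x j) = - (A i p * s) + A m p * (\<Sum>j\<in>J - {p}. A i j * x' j)" for i
  proof -
    have "(\<Sum>j\<in>J. A i j * x j) = A i p * x p + (\<Sum>j\<in>J - {p}. A i j * x j)"
      using assms(1,2) by (rule sum.remove)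
    moreover have "(\<Sum>j\<in>J - {p}. A i j * x j) = A m p * (\<Sum>j\<in>J - {p}. A i j * x' j)"
      unfolding sum_distrib_left by (rule sum.cong) (auto simp: x_def)
    ultimately show ?thesis by (simp add: x_def)
  qed
  have "(\<Sum>j\<in>J. A i j * x j) = 0" if "i < Suc m" for i
  proof (cases "i = m")
    case True
    then show ?thesis using split[of m] by (simp add: s_def)
  next
    case False
    with that have "i < m" by simp
    then have "0 = (\<Sum>j\<in>J - {p}. (A i j * A m p - A i p * A m j) * x' j)" using x'(2) by simp
    also have "\<dots> = A m p * (\<Sum>j\<in>J - {p}. A i j * x' j) - A i p * s"
      unfolding s_def sum_distrib_left sum_subtractf[symmetric]
      by (rule sum.cong) (auto simp: algebra_simps)
    finally show ?thesis using split[of i] by simp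
  qed
  moreover have "\<exists>j\<in>J. x j \<noteq> 0" using x'(1) assms(3) by (auto simp: x_def)
  ultimately show ?thesis by blast
qed

lemma homogeneous_system_nontrivial:
  fixes A :: "nat \<Rightarrow> 'i \<Rightarrow> 'a::idom"
  assumes "finite J" "m < card J"
  shows "\<exists>x. (\<exists>j\<in>J. x j \<noteq> 0) \<and> (\<forall>i<m. (\<Sum>j\<in>J. A i j * x j) = 0)"
  using assms
proof (induction m arbitrary: J A)
  case 0
  then show ?case by (intro exI[of _ "\<lambda>_. 1"]) (auto simp: card_gt_0_iff)
next
  case (Suc m)
  show ?case
  proof (cases "\<forall>j\<in>J. A m j = 0")
    case True
    obtain x where x: "\<exists>j\<in>J. x j \<noteq> 0" "\<forall>i<m. (\<Sum>j\<in>J. A i j * x j) = 0"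
      using Suc.IH[of J A] Suc.prems by auto
    have "\<forall>i<Suc m. (\<Sum>j\<in>J. A i j * x j) = 0"
      using x(2) True by (auto simp: less_Suc_eq)
    then show ?thesis using x(1) by blast
  next
    case False
    then obtain p where p: "p \<in> J" "A m p \<noteq> 0" by blast
    have "m < card (J - {p})" using Suc.prems p by simp
    then obtain x' where x': "\<exists>j\<in>J - {p}. x' j \<noteq> 0"
        "\<forall>i<m. (\<Sum>j\<in>J - {p}. (A i j * A m p - A i p * A m j) * x' j) = 0"
      using Suc.IH[of "J - {p}" "\<lambda>i j. A i j * A m p - A i p * A m j"] Suc.prems by auto
    then show ?thesis
      using eliminate_column[where A = A and m = m, OF Suc.prems(1) p] by blast
  qed
qed

text \<open>Elimination commutes with specialisation wherever the pivot does not vanish, so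
  singularity at almost all values passes to the smaller matrix. The finite exceptional set
  \<open>F\<close> is part of the statement so that each induction step can add the roots of its
  pivot.\<close>

lemma polynomial_kernel:
  fixes N :: "nat \<Rightarrow> 'i \<Rightarrow> 'a::field poly"
  assumes inf: "infinite (UNIV :: 'a set)" and "finite F" "finite J" "card J = n"
    and sing: "\<And>\<tau>. \<tau> \<notin> F \<Longrightarrow> \<exists>w. (\<exists>j\<in>J. w j \<noteq> 0) \<and> (\<forall>i<n. (\<Sum>j\<in>J. poly (N i j) \<tau> * w j) = 0)"
  shows "\<exists>w. (\<exists>j\<in>J. w j \<noteq> 0) \<and> (\<forall>i<n. (\<Sum>j\<in>J. N i j * w j) = 0)"
  using assms(2-)
proof (induction n arbitrary: J N F)
  case 0
  then have "J = {}" by simp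
  moreover obtain \<tau> where "\<tau> \<notin> F" using inf 0 by (metis ex_new_if_finite)
  ultimately show ?case using 0(4)[of \<tau>] by simp
next
  case (Suc n)
  show ?case
  proof (cases "\<forall>j\<in>J. N n j = 0")
    case True
    \<comment> \<open>A zero row leaves only \<open>n\<close> equations for \<open>Suc n\<close>
      unknowns.\<close>
    obtain x where x: "\<exists>j\<in>J. x j \<noteq> 0" "\<forall>i<n. (\<Sum>j\<in>J. N i j * x j) = 0"
      using homogeneous_system_nontrivial[of J n N] Suc.prems by auto
    have "\<forall>i<Suc n. (\<Sum>j\<in>J. N i j * x j) = 0"
      using x(2) True by (auto simp: less_Suc_eq)
    then show ?thesis using x(1) by blast
  next
    case False
    then obtain p where p: "p \<in> J" "N n p \<noteq> 0" by blast
    define N' where "N' i j = N i j * N n p - N i p * N n j" for i j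
    define F' where "F' = F \<union> {\<tau>. poly (N n p) \<tau> = 0}"
    have F': "finite F'" using Suc.prems(1) p(2) by (simp add: F'_def poly_roots_finite)
    have "\<exists>w. (\<exists>j\<in>J - {p}. w j \<noteq> 0) \<and> (\<forall>i<n. (\<Sum>j\<in>J - {p}. poly (N' i j) \<tau> * w j) = 0)" if "\<tau> \<notin> F'" for \<tau>
    proof -
      have \<tau>: "\<tau> \<notin> F" "poly (N n p) \<tau> \<noteq> 0" using that by (auto simp: F'_def)
      obtain w where w: "\<exists>j\<in>J. w j \<noteq> 0" "\<forall>i<Suc n. (\<Sum>j\<in>J. poly (N i j) \<tau> * w j) = 0"
        using Suc.prems(4)[OF \<tau>(1)] by blast
      define r where "r i = (\<Sum>j\<in>J - {p}. poly (N i j) \<tau> * w j)" for i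
      have r: "poly (N i p) \<tau> * w p + r i = 0" if "i < Suc n" for i
        using w(2) that sum.remove[OF Suc.prems(2) p(1), of "\<lambda>j. poly (N i j) \<tau> * w j"] by (simp add: r_def)
      have "\<exists>j\<in>J - {p}. w j \<noteq> 0"
      proof (rule ccontr)
        assume "\<not> ?thesis"
        then have "r n = 0" "w p \<noteq> 0" using w(1) by (auto simp: r_def)
        then show False using r[of n] \<tau>(2) by simp
      qed
      moreover have "(\<Sum>j\<in>J - {p}. poly (N' i j) \<tau> * w j) = 0" if "i < n" for i
      proof -
        have "(\<Sum>j\<in>J - {p}. poly (N' i j) \<tau> * w j) = poly (N n p) \<tau> * r i - poly (N i p) \<tau> * r n"
          unfolding r_def N'_def sum_distrib_left sum_subtractf[symmetric]
          by (rule sum.cong) (auto simp: algebra_simps)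
        moreover have "r i = - (poly (N i p) \<tau> * w p)" "r n = - (poly (N n p) \<tau> * w p)"
          using r[of i] r[of n] that by (auto simp: eq_neg_iff_add_eq_0 add.commute)
        ultimately show ?thesis by (simp add: algebra_simps)
      qed
      ultimately show ?thesis by blast
    qed
    then obtain x' where "\<exists>j\<in>J - {p}. x' j \<noteq> 0" "\<forall>i<n. (\<Sum>j\<in>J - {p}. N' i j * x' j) = 0"
      using Suc.IH[of F' "J - {p}" N'] F' Suc.prems p by auto
    then show ?thesis
      using eliminate_column[where A = N and m = n, OF Suc.prems(2) p] unfolding N'_def by blast
  qed
qed

text \<open>Splitting off a hyperbolic plane leaves an alternating form on two indices fewer; with
  an odd number of indices this ends in the zero form on a nonempty set. The diagonal is assumed to
  vanish separately because skew symmetry does not give this in characteristic 2.\<close>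

lemma odd_alternating_radical:
  fixes B :: "'i \<Rightarrow> 'i \<Rightarrow> 'a::field"
  assumes "finite J" "odd (card J)"
    and "\<And>i. i \<in> J \<Longrightarrow> B i i = 0" "\<And>i j. i \<in> J \<Longrightarrow> j \<in> J \<Longrightarrow> B i j = - B j i"
  shows "\<exists>x. (\<exists>i\<in>J. x i \<noteq> 0) \<and> (\<forall>j\<in>J. (\<Sum>i\<in>J. x i * B i j) = 0)"
  using assms
proof (induction "card J" arbitrary: J B rule: less_induct)
  case less
  show ?case
  proof (cases "\<forall>i\<in>J. \<forall>j\<in>J. B i j = 0")
    case True
    moreover have "J \<noteq> {}" using less.prems(2) by auto
    ultimately show ?thesis by (intro exI[of _ "\<lambda>_. 1"]) auto
  next
    case False
    then obtain p q where pq: "p \<in> J" "q \<in> J" "B p q \<noteq> 0" by blast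
    then have neq: "p \<noteq> q" using less.prems(3) by auto
    define b where "b = B p q"
    have b: "b \<noteq> 0" "B q p = - b" "B p q = b" "B p p = 0" "B q q = 0"
      using pq(3) less.prems(3)[OF pq(1)] less.prems(3)[OF pq(2)] less.prems(4)[OF pq(2,1)] by (simp_all add: b_def)
    define J' where "J' = J - {p, q}"
    \<comment> \<open>The form on the vectors
      \<open>e_i - (B i q / b) e_p + (B i p / b) e_q\<close>, the projections to the orthogonal
      complement of the plane spanned by \<open>e_p\<close> and \<open>e_q\<close>.\<close>
    define B' where "B' i j = B i j - B i q / b * B p j + B i p / b * B q j" for i j
    have J: "J = insert p (insert q J')" "p \<notin> insert q J'" "q \<notin> J'" "finite J'"
      using pq neq less.prems(1) by (auto simp: J'_def)
    have card: "card J = Suc (Suc (card J'))" using J by simp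
    have alt: "B' i i = 0" if "i \<in> J'" for i
    proof -
      have "i \<in> J" using that J by auto
      then have "B i i = 0" "B p i = - B i p" "B q i = - B i q"
        using less.prems(3,4) pq by blast+
      then show ?thesis by (simp add: B'_def)
    qed
    have skew: "B' i j = - B' j i" if "i \<in> J'" "j \<in> J'" for i j
    proof -
      have "i \<in> J" "j \<in> J" using that J by auto
      then have F: "B i j = - B j i" "B p i = - B i p" "B q i = - B i q" "B p j = - B j p" "B q j = - B j q"
        using less.prems(4) pq by blast+
      show ?thesis unfolding B'_def divide_inverse F by (simp add: algebra_simps)
    qed
    have "\<exists>x. (\<exists>i\<in>J'. x i \<noteq> 0) \<and> (\<forall>j\<in>J'. (\<Sum>i\<in>J'. x i * B' i j) = 0)"
    proof (rule less.hyps)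
      show "card J' < card J" "finite J'" "odd (card J')" using card J(4) less.prems(2) by simp_all
    qed (fact alt skew)+
    then obtain x' where x': "\<exists>i\<in>J'. x' i \<noteq> 0" "\<And>j. j \<in> J' \<Longrightarrow> (\<Sum>i\<in>J'. x' i * B' i j) = 0"
      by blast
    define sp where "sp = (\<Sum>i\<in>J'. x' i * B i p)"
    define sq where "sq = (\<Sum>i\<in>J'. x' i * B i q)"
    define x where "x i = (if i = p then - sq / b else if i = q then sp / b else x' i)" for i
    have split: "(\<Sum>i\<in>J. x i * B i j) = - sq / b * B p j + sp / b * B q j + (\<Sum>i\<in>J'. x' i * B i j)" for j
    proof -
      have "(\<Sum>i\<in>J. x i * B i j) = x p * B p j + (x q * B q j + (\<Sum>i\<in>J'. x i * B i j))"
        unfolding J(1) using J(2,3,4) by simp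
      moreover have "(\<Sum>i\<in>J'. x i * B i j) = (\<Sum>i\<in>J'. x' i * B i j)"
        by (rule sum.cong) (use J(2,3) in \<open>auto simp: x_def\<close>)
      ultimately show ?thesis using neq by (simp add: x_def)
    qed
    have "(\<Sum>i\<in>J. x i * B i j) = 0" if j: "j \<in> J" for j
    proof -
      consider "j = p" | "j = q" | "j \<in> J'" using j J(1) by blast
      then show ?thesis
      proof cases
        case 1
        then show ?thesis using split[of p] b by (simp add: sp_def)
      next
        case 2
        then show ?thesis using split[of q] b by (simp add: sq_def)
      next
        case 3
        then have "0 = (\<Sum>i\<in>J'. x' i * B' i j)" using x'(2) by simp
        also have "\<dots> = (\<Sum>i\<in>J'. x' i * B i j) - B p j / b * sq + B q j / b * sp"
          unfolding sp_def sq_def B'_def sum_distrib_left sum_subtractf[symmetric] sum.distrib[symmetric]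
          by (rule sum.cong) (auto simp: algebra_simps)
        finally show ?thesis using split[of j] by (simp add: algebra_simps)
      qed
    qed
    moreover have "\<exists>i\<in>J. x i \<noteq> 0" using x'(1) J by (auto simp: x_def)
    ultimately show ?thesis by blast
  qed
qed

section \<open>Polynomial functions over an infinite field\<close>

lemma alg_closed_infinite: "infinite (UNIV :: 'a::alg_closed_field set)"
proof
  assume fin: "finite (UNIV :: 'a set)"
  define p :: "'a poly" where "p = (\<Prod>a\<in>UNIV. [:- a, 1:]) + 1"
  have "degree (\<Prod>a\<in>UNIV. [:- a, 1::'a:]) = card (UNIV :: 'a set)"
    by (subst degree_prod_eq_sum_degree) auto
  moreover have "card (UNIV :: 'a set) > 0" using fin by (simp add: card_gt_0_iff)
  ultimately have "degree p > 0" by (simp add: p_def degree_add_eq_left)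
  then obtain x where "poly p x = 0" using alg_closed_imp_poly_has_root by blast
  moreover have "poly (\<Prod>a\<in>UNIV. [:- a, 1:]) x = 0"
    unfolding poly_prod using fin by (intro prod_zero) auto
  ultimately show False by (simp add: p_def)
qed

text \<open>One value \<open>s\<close> is exempt for the sake of
  \<open>form_zero_of_vanishing\<close>, where a coordinate can be cancelled only when it is
  nonzero.\<close>

lemma poly_eq_zero_infinite:
  fixes p :: "'a::alg_closed_field poly"
  assumes "\<And>t. t \<noteq> s \<Longrightarrow> poly p t = 0"
  shows "p = 0"
proof (rule ccontr)
  assume "p \<noteq> 0"
  then have "finite (insert s {t. poly p t = 0})" by (simp add: poly_roots_finite)
  moreover have "insert s {t. poly p t = 0} = UNIV" using assms by auto
  ultimately show False using alg_closed_infinite by metis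
qed

lemma poly_fun_zero:
  fixes p :: "'a::alg_closed_field poly"
  assumes "\<And>t. poly p t = 0"
  shows "p = 0"
  using assms by (rule poly_eq_zero_infinite)

section \<open>Substitution homomorphisms\<close>

text \<open>One notion for the embedding of constants, evaluation at a point, restriction to a line
  and linear substitution, so that \<open>unital_homD\<close> provides the rewrite rules of all
  four.\<close>

definition unital_hom :: "('a::comm_ring_1 \<Rightarrow> 'b::comm_ring_1) \<Rightarrow> bool"
  where "unital_hom h \<longleftrightarrow> h 1 = 1 \<and> (\<forall>a b. h (a + b) = h a + h b \<and> h (a * b) = h a * h b)"

lemma unital_homD:
  assumes "unital_hom h"
  shows "h 0 = 0" "h 1 = 1" "h (a + b) = h a + h b" "h (a * b) = h a * h b"
    "h (- a) = - h a" "h (a - b) = h a - h b" "h (a ^ n) = h a ^ n" "h (numeral k) = numeral k"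
    "h (sum g S) = (\<Sum>s\<in>S. h (g s))" "h (prod g S) = (\<Prod>s\<in>S. h (g s))"
proof -
  have add: "h (a + b) = h a + h b" and mult: "h (a * b) = h a * h b" and one: "h 1 = 1" for a b
    using assms by (auto simp: unital_hom_def)
  show zero: "h 0 = 0" using add[of 0 0] by simp
  have neg: "h (- a) = - h a" for a using add[of a "- a"] zero by (simp add: eq_neg_iff_add_eq_0 add.commute)
  show "h 1 = 1" "h (a + b) = h a + h b" "h (a * b) = h a * h b" by (fact one add mult)+
  show "h (- a) = - h a" by (fact neg)
  show "h (a - b) = h a - h b" using add[of a "- b"] neg by simp
  show "h (a ^ n) = h a ^ n" by (induction n) (simp_all add: one mult)
  have "h (of_nat m) = of_nat m" for m by (induction m) (simp_all add: zero one add)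
  from this[of "numeral k"] show "h (numeral k) = numeral k" by simp
  show "h (sum g S) = (\<Sum>s\<in>S. h (g s))"
    by (induction S rule: infinite_finite_induct) (simp_all add: zero add)
  show "h (prod g S) = (\<Prod>s\<in>S. h (g s))"
    by (induction S rule: infinite_finite_induct) (simp_all add: one mult)
qed

abbreviation C :: "'k::comm_ring_1 \<Rightarrow> 'k poly3" where "C \<equiv> pconst"

lemma unital_hom_pconst: "unital_hom pconst"
  by (auto simp: unital_hom_def pconst_def single_add mult_single)

lemmas C_simps = unital_homD[OF unital_hom_pconst]

text \<open>The map given by the universal property of the polynomial ring, with \<open>h\<close> on
  coefficients and \<open>v\<close> on variables. \<open>ev\<close>, \<open>linear_subst\<close> and
  the restriction to a line in \<open>no_common_factor\<close> are instances.\<close>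

definition insertion :: "('k::comm_ring_1 \<Rightarrow> 'b::comm_ring_1) \<Rightarrow> (3 \<Rightarrow> 'b) \<Rightarrow> 'k poly3 \<Rightarrow> 'b"
  where "insertion h v f = (\<Sum>m\<in>Poly_Mapping.keys f. h (Poly_Mapping.lookup f m) *
    (\<Prod>i\<in>UNIV. v i ^ Poly_Mapping.lookup m i))"

lemma sum_of_singles: "f = (\<Sum>m\<in>Poly_Mapping.keys f. Poly_Mapping.single m (Poly_Mapping.lookup f m))"
  by (rule poly_mapping_eqI) (auto simp: lookup_sum lookup_single when_def in_keys_iff)

lemma poly_mapping_single_induct [case_names single add]:
  fixes f :: "'a \<Rightarrow>\<^sub>0 'b::comm_monoid_add"
  assumes "\<And>m c. P (Poly_Mapping.single m c)" "\<And>f g. P f \<Longrightarrow> P g \<Longrightarrow> P (f + g)"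
  shows "P f"
proof -
  have "P 0" using assms(1)[of undefined 0] by simp
  then have "P (\<Sum>m\<in>S. Poly_Mapping.single m (c m))" for S c
    by (induction S rule: infinite_finite_induct) (auto intro: assms)
  then show ?thesis using sum_of_singles[of f] by metis
qed

lemma prod_single: "finite S \<Longrightarrow> (\<Prod>i\<in>S. Poly_Mapping.single (a i) (1::'k::comm_ring_1)) = Poly_Mapping.single (\<Sum>i\<in>S. a i) 1"
  by (induction S rule: finite_induct) (simp_all add: mult_single)

lemma pvar_power: "pvar i ^ n = Poly_Mapping.single (Poly_Mapping.single i n) 1"
  by (induction n) (simp_all add: pvar_def mult_single single_add[symmetric])

lemma single_eq_prod_pvar:
  "Poly_Mapping.single m c = C c * (\<Prod>i\<in>UNIV. pvar i ^ Poly_Mapping.lookup m i)"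
proof -
  have "(\<Sum>i\<in>UNIV. Poly_Mapping.single i (Poly_Mapping.lookup m i)) = m"
    by (rule poly_mapping_eqI) (simp add: lookup_sum lookup_single when_def)
  then show ?thesis by (simp add: pvar_power prod_single pconst_def mult_single)
qed

lemma poly3_induct [case_names const var add mult]:
  assumes "\<And>c. P (C c)" "\<And>i. P (pvar i)" "\<And>f g. P f \<Longrightarrow> P g \<Longrightarrow> P (f + g)" "\<And>f g. P f \<Longrightarrow> P g \<Longrightarrow> P (f * g)"
  shows "P f"
proof (induction f rule: poly_mapping_single_induct)
  case (single m c)
  have one: "P 1" using assms(1)[of 1] by (simp add: C_simps)
  have pow: "P (pvar i ^ n)" for i n by (induction n) (auto intro: assms one)
  have "P (\<Prod>i\<in>S. pvar i ^ Poly_Mapping.lookup m i)" for S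
    by (induction S rule: infinite_finite_induct) (auto intro: assms one pow)
  then show ?case unfolding single_eq_prod_pvar by (intro assms)
qed (intro assms)

context
  fixes h :: "'k::comm_ring_1 \<Rightarrow> 'b::comm_ring_1" and v :: "3 \<Rightarrow> 'b"
  assumes h: "unital_hom h"
begin

lemma insertion_superset:
  assumes "finite S" "Poly_Mapping.keys f \<subseteq> S"
  shows "insertion h v f = (\<Sum>m\<in>S. h (Poly_Mapping.lookup f m) * (\<Prod>i\<in>UNIV. v i ^ Poly_Mapping.lookup m i))"
  unfolding insertion_def
  by (rule sum.mono_neutral_left) (use assms in \<open>auto simp: in_keys_iff unital_homD[OF h]\<close>)

lemma insertion_add: "insertion h v (f + g) = insertion h v f + insertion h v g"
proof -
  define S where "S = Poly_Mapping.keys f \<union> Poly_Mapping.keys g"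
  have S: "finite S" "Poly_Mapping.keys f \<subseteq> S" "Poly_Mapping.keys g \<subseteq> S" "Poly_Mapping.keys (f + g) \<subseteq> S"
    using keys_add[of f g] by (auto simp: S_def)
  show ?thesis
    by (simp add: insertion_superset[OF S(1,2)] insertion_superset[OF S(1,3)] insertion_superset[OF S(1,4)]
        lookup_add unital_homD[OF h] algebra_simps sum.distrib)
qed

lemma insertion_single: "insertion h v (Poly_Mapping.single m c) = h c * (\<Prod>i\<in>UNIV. v i ^ Poly_Mapping.lookup m i)"
  using insertion_superset[of "{m}" "Poly_Mapping.single m c"] by simp

lemma insertion_hom: "unital_hom (insertion h v)"
  unfolding unital_hom_def
proof (intro conjI allI)
  show "insertion h v 1 = 1"
    unfolding single_one[symmetric] insertion_single by (simp add: unital_homD[OF h])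
  fix f g :: "'k poly3"
  show "insertion h v (f + g) = insertion h v f + insertion h v g" by (fact insertion_add)
  show "insertion h v (f * g) = insertion h v f * insertion h v g"
  proof (induction f rule: poly_mapping_single_induct)
    case (single m c)
    show ?case
    proof (induction g rule: poly_mapping_single_induct)
      case (single n d)
      show ?case
        by (simp add: insertion_single mult_single unital_homD[OF h] lookup_add power_add prod.distrib)
    next
      case (add g1 g2)
      then show ?case by (simp add: insertion_add distrib_left)
    qed
  next
    case (add f1 f2)
    then show ?case by (simp add: insertion_add distrib_right)
  qed
qed

lemma insertion_const: "insertion h v (C c) = h c"
  by (simp add: pconst_def insertion_single)

lemma insertion_var: "insertion h v (pvar i) = v i"
proof -
  have "(\<Prod>j\<in>UNIV. v j ^ Poly_Mapping.lookup (Poly_Mapping.single i 1) j) = (\<Prod>j\<in>UNIV. if j = i then v j else 1)"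
    by (rule prod.cong) (auto simp: lookup_single when_def)
  then show ?thesis by (simp add: pvar_def insertion_single unital_homD[OF h])
qed

end

lemma linear_subst_eq: "linear_subst M = insertion pconst (\<lambda>i. \<Sum>j\<in>UNIV. C (M $ i $ j) * pvar j)"
  by (rule ext) (simp add: linear_subst_def insertion_def)

definition ev :: "(3 \<Rightarrow> 'k::comm_ring_1) \<Rightarrow> 'k poly3 \<Rightarrow> 'k" where "ev v = insertion (\<lambda>a. a) v"

lemma unital_hom_id: "unital_hom (\<lambda>a. a)" by (simp add: unital_hom_def)

lemma ev_hom: "unital_hom (ev v)" unfolding ev_def by (rule insertion_hom[OF unital_hom_id])

lemma ev_const [simp]: "ev v (C c) = c" unfolding ev_def by (rule insertion_const[OF unital_hom_id])
lemma ev_var [simp]: "ev v (pvar i) = v i" unfolding ev_def by (rule insertion_var[OF unital_hom_id])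
lemmas ev_simps [simp] = unital_homD[OF ev_hom]

lemma C_eq_0_iff [simp]: "C a = 0 \<longleftrightarrow> a = 0" by (metis ev_const C_simps(1))

lemma ev_along_polynomial_curve:
  fixes V :: "3 \<Rightarrow> 'k::comm_ring_1 poly"
  shows "\<exists>p. \<forall>t. poly p t = ev (\<lambda>i. poly (V i) t) f"
proof (induction f rule: poly3_induct)
  case (const c) show ?case by (intro exI[of _ "[:c:]"]) simp
next
  case (var i) show ?case by (intro exI[of _ "V i"]) simp
next
  case (add f g)
  then obtain p q where "\<forall>t. poly p t = ev (\<lambda>i. poly (V i) t) f" "\<forall>t. poly q t = ev (\<lambda>i. poly (V i) t) g" by blast
  then show ?case by (intro exI[of _ "p + q"]) simp
next
  case (mult f g)
  then obtain p q where "\<forall>t. poly p t = ev (\<lambda>i. poly (V i) t) f" "\<forall>t. poly q t = ev (\<lambda>i. poly (V i) t) g" by blast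
  then show ?case by (intro exI[of _ "p * q"]) simp
qed

section \<open>Forms\<close>

lemma in_forms_iff: "f \<in> forms d \<longleftrightarrow> (\<forall>m. Poly_Mapping.lookup f m \<noteq> 0 \<longrightarrow> monom_degree m = d)"
  by (auto simp: forms_def in_keys_iff)

lemma monom_degree_add: "monom_degree (m + n) = monom_degree m + monom_degree n"
  by (simp add: monom_degree_def lookup_add sum.distrib)

lemma lookup_C_mult: "Poly_Mapping.lookup (C c * f) m = c * Poly_Mapping.lookup f m"
proof (induction f rule: poly_mapping_single_induct)
  case (single n d)
  then show ?case by (simp add: pconst_def mult_single lookup_single when_def)
next
  case (add f g)
  then show ?case by (simp add: distrib_left lookup_add)
qed

lemma forms_0 [simp, intro]: "0 \<in> forms d" by (simp add: in_forms_iff)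
lemma forms_add [intro]: "f \<in> forms d \<Longrightarrow> g \<in> forms d \<Longrightarrow> f + g \<in> forms d"
  by (auto simp: in_forms_iff lookup_add) (metis add.right_neutral)
lemma forms_uminus [intro]: "f \<in> forms d \<Longrightarrow> - f \<in> forms d"
  by (auto simp: in_forms_iff)
lemma forms_diff [intro]: "f \<in> forms d \<Longrightarrow> g \<in> forms d \<Longrightarrow> f - g \<in> forms d"
  using forms_add[of f d "- g"] by auto
lemma forms_C_mult [intro]: "f \<in> forms d \<Longrightarrow> C c * f \<in> forms d"
  unfolding in_forms_iff lookup_C_mult by (metis mult_zero_right)
lemma forms_sum [intro]: "(\<And>s. s \<in> S \<Longrightarrow> g s \<in> forms d) \<Longrightarrow> sum g S \<in> forms d"
  by (induction S rule: infinite_finite_induct) auto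
lemma forms_mult: "f \<in> forms d \<Longrightarrow> g \<in> forms e \<Longrightarrow> f * g \<in> forms (d + e)"
  unfolding forms_def using keys_mult[of f g] by (fastforce simp: monom_degree_add)
lemma forms_mult' [intro]: "f \<in> forms d \<Longrightarrow> g \<in> forms e \<Longrightarrow> n = d + e \<Longrightarrow> f * g \<in> forms n"
  using forms_mult by blast
lemma forms_C [intro]: "C c \<in> forms 0"
  by (auto simp: in_forms_iff pconst_def lookup_single when_def monom_degree_def)
lemma forms_power [intro]: "f \<in> forms d \<Longrightarrow> n = d * k \<Longrightarrow> f ^ k \<in> forms n"
proof (induction k arbitrary: n)
  case 0
  then show ?case using forms_C[of 1] by (simp add: C_simps)
qed (auto intro: forms_mult')
lemma forms_single: "monom_degree m = d \<Longrightarrow> Poly_Mapping.single m c \<in> forms d"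
  by (auto simp: in_forms_iff lookup_single when_def)
lemma forms_pvar [simp, intro]: "pvar i \<in> forms 1"
  unfolding pvar_def by (rule forms_single) (simp add: monom_degree_def lookup_single when_def)

lemma forms_pvar_Suc [simp, intro]: "pvar i \<in> forms (Suc 0)" using forms_pvar by simp

lemma forms_0D: "f \<in> forms 0 \<Longrightarrow> \<exists>c. f = C c"
proof -
  assume f: "f \<in> forms 0"
  have "Poly_Mapping.lookup f m = Poly_Mapping.lookup (C (Poly_Mapping.lookup f 0)) m" for m
  proof (cases "m = 0")
    case False
    then have "monom_degree m \<noteq> 0"
      by (auto simp: monom_degree_def intro!: poly_mapping_eqI)
    then have "Poly_Mapping.lookup f m = 0" using f by (auto simp: in_forms_iff)
    then show ?thesis using False by (simp add: pconst_def lookup_single)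
  qed (simp add: pconst_def)
  then show ?thesis by (blast intro: poly_mapping_eqI)
qed

lemma forms_SucD:
  assumes "f \<in> forms (Suc n)"
  shows "\<exists>g. (\<forall>i. g i \<in> forms n) \<and> f = (\<Sum>i\<in>UNIV. pvar i * g i)"
proof -
  define T where "T = {f::'a poly3. \<exists>g. (\<forall>i. g i \<in> forms n) \<and> f = (\<Sum>i\<in>UNIV. pvar i * g i)}"
  have zero: "0 \<in> T" unfolding T_def by (intro CollectI exI[of _ "\<lambda>_. 0"]) auto
  have add: "f + g \<in> T" if "f \<in> T" "g \<in> T" for f g
  proof -
    obtain f' where f': "\<forall>i. f' i \<in> forms n" "f = (\<Sum>i\<in>UNIV. pvar i * f' i)"
      using \<open>f \<in> T\<close> unfolding T_def by auto
    obtain g' where g': "\<forall>i. g' i \<in> forms n" "g = (\<Sum>i\<in>UNIV. pvar i * g' i)"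
      using \<open>g \<in> T\<close> unfolding T_def by auto
    note f' g'
    then show ?thesis
      unfolding T_def by (intro CollectI exI[of _ "\<lambda>i. f' i + g' i"]) (auto simp: distrib_left sum.distrib)
  qed
  have sing: "Poly_Mapping.single m c \<in> T" if m: "monom_degree m = Suc n" for m and c :: 'a
  proof -
    obtain i where i: "Poly_Mapping.lookup m i > 0"
      using m unfolding monom_degree_def by (metis Suc_neq_Zero gr0I sum.neutral)
    define m' where "m' = m - Poly_Mapping.single i 1"
    have mm: "m = Poly_Mapping.single i 1 + m'"
      using i by (intro poly_mapping_eqI) (auto simp: m'_def lookup_add lookup_minus lookup_single when_def)
    have "monom_degree (Poly_Mapping.single i 1) = 1"
      by (simp add: monom_degree_def lookup_single when_def)
    then have "monom_degree m' = n" using m mm by (simp add: monom_degree_add)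
    moreover have "Poly_Mapping.single m c = (\<Sum>j\<in>UNIV. pvar j * (if j = i then Poly_Mapping.single m' c else 0))"
      unfolding mm by (simp add: pvar_def mult_single if_distrib[of "\<lambda>t. _ * t"] cong: if_cong)
    ultimately show ?thesis
      unfolding T_def by (intro CollectI exI[of _ "\<lambda>j. if j = i then Poly_Mapping.single m' c else 0"])
        (auto intro: forms_single)
  qed
  have "(\<Sum>m\<in>S. Poly_Mapping.single m (Poly_Mapping.lookup f m)) \<in> T" if "S \<subseteq> Poly_Mapping.keys f" for S
    using that assms by (induction S rule: infinite_finite_induct) (auto intro: zero add sing simp: forms_def)
  then have "f \<in> T" using sum_of_singles[of f] by (metis order_refl)
  then show ?thesis by (simp add: T_def)
qed

definition hcomp :: "nat \<Rightarrow> 'k::comm_ring_1 poly3 \<Rightarrow> 'k poly3"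
  where "hcomp d f = (\<Sum>m\<in>{m\<in>Poly_Mapping.keys f. monom_degree m = d}. Poly_Mapping.single m (Poly_Mapping.lookup f m))"

lemma lookup_hcomp: "Poly_Mapping.lookup (hcomp d f) m = (if monom_degree m = d then Poly_Mapping.lookup f m else 0)"
  by (auto simp: hcomp_def lookup_sum lookup_single when_def in_keys_iff)

lemma hcomp_forms [intro]: "hcomp d f \<in> forms d"
  by (simp add: in_forms_iff lookup_hcomp)
lemma hcomp_add: "hcomp d (f + g) = hcomp d f + hcomp d g"
  by (rule poly_mapping_eqI) (simp add: lookup_hcomp lookup_add)
lemma hcomp_C_mult: "hcomp d (C c * f) = C c * hcomp d f"
  by (rule poly_mapping_eqI) (simp add: lookup_hcomp lookup_C_mult)
lemma hcomp_of_form: "f \<in> forms e \<Longrightarrow> hcomp d f = (if d = e then f else 0)"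
  by (rule poly_mapping_eqI) (auto simp: lookup_hcomp in_forms_iff)
lemma hcomp_0 [simp]: "hcomp d 0 = 0" using hcomp_of_form[of 0 d d] by simp
lemma sum_hcomp: "\<exists>N. f = (\<Sum>d<N. hcomp d f)"
proof -
  obtain N where N: "\<forall>m\<in>Poly_Mapping.keys f. monom_degree m < N"
    using finite_nat_set_iff_bounded[of "monom_degree ` Poly_Mapping.keys f"] by auto
  have "f = (\<Sum>d<N. hcomp d f)"
  proof (rule poly_mapping_eqI)
    fix m show "Poly_Mapping.lookup f m = Poly_Mapping.lookup (\<Sum>d<N. hcomp d f) m"
      using N by (cases "m \<in> Poly_Mapping.keys f") (auto simp: lookup_sum lookup_hcomp in_keys_iff)
  qed
  then show ?thesis ..
qed
lemma hcomp_pvar_mult: "hcomp d (pvar i * f) = (if d = 0 then 0 else pvar i * hcomp (d - 1) f)"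
proof (induction f rule: poly_mapping_single_induct)
  case (single m c)
  have s: "Poly_Mapping.single m c \<in> forms (monom_degree m)" by (rule forms_single) simp
  then have "pvar i * Poly_Mapping.single m c \<in> forms (Suc (monom_degree m))"
    by (intro forms_mult'[OF forms_pvar]) auto
  then show ?case using s by (auto simp: hcomp_of_form)
next
  case (add f g)
  then show ?case by (simp add: distrib_left hcomp_add)
qed

section \<open>Bases of the space of linear forms\<close>

text \<open>Projective coordinates. Independence is encoded by points: any three values can be
  prescribed for the coordinates. Proofs use it in this form, choosing a vector for
  \<open>ev\<close> and reading off a value.\<close>

definition basis3 :: "'k::comm_ring_1 poly3 \<Rightarrow> 'k poly3 \<Rightarrow> 'k poly3 \<Rightarrow> bool"
  where "basis3 x y z \<longleftrightarrow> x \<in> forms 1 \<and> y \<in> forms 1 \<and> z \<in> forms 1 \<and>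
    (\<forall>l\<in>forms 1. \<exists>a b c. l = C a * x + C b * y + C c * z) \<and>
    (\<forall>a b c. \<exists>v. ev v x = a \<and> ev v y = b \<and> ev v z = c)"

lemma basis3_forms: "basis3 x y z \<Longrightarrow> x \<in> forms 1" "basis3 x y z \<Longrightarrow> y \<in> forms 1" "basis3 x y z \<Longrightarrow> z \<in> forms 1"
  by (auto simp: basis3_def)

lemma basis3_span: "basis3 x y z \<Longrightarrow> l \<in> forms 1 \<Longrightarrow> \<exists>a b c. l = C a * x + C b * y + C c * z"
  by (auto simp: basis3_def)

lemma basis3_ev: "basis3 x y z \<Longrightarrow> \<exists>v. ev v x = a \<and> ev v y = b \<and> ev v z = c"
  by (auto simp: basis3_def)

lemma UNIV_three: "(UNIV :: 3 set) = {0, 1, 2}" and three_neq: "(0::3) \<noteq> 1" "(0::3) \<noteq> 2" "(1::3) \<noteq> 2"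
proof -
  have "(3::3) = 0" by simp
  then show "(UNIV :: 3 set) = {0, 1, 2}" using UNIV_3 by auto
qed simp_all

lemma sum_three: "(\<Sum>i\<in>(UNIV :: 3 set). g i) = g 0 + g 1 + g 2"
  unfolding UNIV_three by (simp add: three_neq add.assoc)

lemma basis3_pvar: "basis3 (pvar 0 :: 'k::comm_ring_1 poly3) (pvar 1) (pvar 2)"
  unfolding basis3_def
proof (intro conjI ballI allI)
  fix l :: "'k poly3" assume "l \<in> forms 1"
  then obtain g where g: "\<forall>i. g i \<in> forms 0" "l = (\<Sum>i\<in>UNIV. pvar i * g i)"
    using forms_SucD[of l 0] by auto
  then have "\<exists>c. g i = C c" for i using forms_0D by blast
  then obtain c where "g i = C (c i)" for i by metis
  then show "\<exists>a b d. l = C a * pvar 0 + C b * pvar 1 + C d * pvar 2"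
    using g(2) by (intro exI[of _ "c 0"] exI[of _ "c 1"] exI[of _ "c 2"]) (simp add: sum_three mult.commute)
next
  fix a b c :: 'k
  show "\<exists>v. ev v (pvar 0) = a \<and> ev v (pvar 1) = b \<and> ev v (pvar 2) = c"
    by (intro exI[of _ "\<lambda>i. if i = 0 then a else if i = 1 then b else c"]) (simp add: three_neq three_neq[symmetric])
qed auto

lemma basis3_swap12: "basis3 x y z \<Longrightarrow> basis3 y x z"
proof -
  assume b: "basis3 x y z"
  have "\<exists>a b c. l = C a * y + C b * x + C c * z" if l: "l \<in> forms 1" for l
  proof -
    obtain p q r where "l = C p * x + C q * y + C r * z" using basis3_span[OF b l] by blast
    then have "l = C q * y + C p * x + C r * z" by simp
    then show ?thesis by blast
  qed
  then show ?thesis using b unfolding basis3_def by blast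
qed
lemma basis3_swap23: "basis3 x y z \<Longrightarrow> basis3 x z y"
proof -
  assume b: "basis3 x y z"
  have "\<exists>a b c. l = C a * x + C b * z + C c * y" if l: "l \<in> forms 1" for l
  proof -
    obtain p q r where "l = C p * x + C q * y + C r * z" using basis3_span[OF b l] by blast
    then have "l = C p * x + C r * z + C q * y" by simp
    then show ?thesis by blast
  qed
  then show ?thesis using b unfolding basis3_def by blast
qed
lemma basis3_swap13: "basis3 x y z \<Longrightarrow> basis3 z y x"
  by (blast intro: basis3_swap12 basis3_swap23)

lemma basis3_change1:
  fixes x :: "'k::field poly3"
  assumes "basis3 x y z" "a \<noteq> 0" "l = C a * x + C b * y + C c * z"
  shows "basis3 l y z"
  unfolding basis3_def
proof (intro conjI ballI allI)
  show "y \<in> forms 1" "z \<in> forms 1" using basis3_forms[OF assms(1)] by blast+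
  show "l \<in> forms 1" unfolding assms(3) by (intro forms_add forms_C_mult basis3_forms[OF assms(1)])
  fix l' :: "'k poly3" assume "l' \<in> forms 1"
  then obtain a' b' c' where l': "l' = C a' * x + C b' * y + C c' * z" using basis3_span assms by blast
  have "C a * C (1 / a) = 1" using assms(2) by (simp add: C_simps(4)[symmetric] C_simps(2))
  then have x: "x = C (1 / a) * (l - C b * y - C c * z)"
    unfolding assms(3) by (simp add: algebra_simps)
  show "\<exists>a b c. l' = C a * l + C b * y + C c * z"
    unfolding l' by (intro exI[of _ "a' / a"] exI[of _ "b' - a' / a * b"] exI[of _ "c' - a' / a * c"], subst x)
      (simp add: divide_inverse C_simps algebra_simps)
next
  fix a' b' c'
  obtain v where "ev v x = (a' - b * b' - c * c') / a" "ev v y = b'" "ev v z = c'" using basis3_ev assms(1) by blast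
  then show "\<exists>v. ev v l = a' \<and> ev v y = b' \<and> ev v z = c'"
    using assms(2,3) by (intro exI[of _ v]) simp
qed

lemma basis3_change2:
  fixes x :: "'k::field poly3"
  assumes "basis3 x y z" "b \<noteq> 0" "l = C a * x + C b * y + C c * z"
  shows "basis3 x l z"
  using basis3_change1[OF basis3_swap12[OF assms(1)] assms(2), of l a c] assms(3) basis3_swap12
  by (simp add: add.commute add.left_commute)

lemma basis3_change3:
  fixes x :: "'k::field poly3"
  assumes "basis3 x y z" "c \<noteq> 0" "l = C a * x + C b * y + C c * z"
  shows "basis3 x y l"
  using basis3_change1[OF basis3_swap13[OF assms(1)] assms(2), of l b a] assms(3) basis3_swap13
  by (simp add: add.commute add.left_commute)

lemma ex_basis3:
  fixes l :: "'k::field poly3"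
  assumes "l \<in> forms 1" "l \<noteq> 0"
  shows "\<exists>y z. basis3 l y z"
proof -
  obtain a b c where l: "l = C a * pvar 0 + C b * pvar 1 + C c * pvar 2"
    using basis3_span[OF basis3_pvar assms(1)] by blast
  have "a \<noteq> 0 \<or> b \<noteq> 0 \<or> c \<noteq> 0" using assms(2) unfolding l by (auto simp: C_simps)
  then consider "a \<noteq> 0" | "b \<noteq> 0" | "c \<noteq> 0" by blast
  then show ?thesis
  proof cases
    case 1
    then show ?thesis using basis3_change1[OF basis3_pvar _ l] by blast
  next
    case 2
    then show ?thesis using basis3_change2[OF basis3_pvar _ l] basis3_swap12 by blast
  next
    case 3
    then show ?thesis using basis3_change3[OF basis3_pvar _ l] basis3_swap13 by blast
  qed
qed

lemma basis3_nonzero: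
  fixes x :: "'k::comm_ring_1 poly3"
  assumes "basis3 x y z" shows "x \<noteq> 0" "y \<noteq> 0" "z \<noteq> 0"
  using basis3_ev[OF assms, of 1 1 1] by auto

lemma basis3_SucD:
  assumes "basis3 x y z" "f \<in> forms (Suc n)"
  shows "\<exists>g\<in>forms n. \<exists>h\<in>forms n. \<exists>k\<in>forms n. f = x * g + y * h + z * k"
proof -
  obtain g where g: "\<forall>i. g i \<in> forms n" "f = (\<Sum>i\<in>UNIV. pvar i * g i)" using forms_SucD assms(2) by blast
  have "\<forall>i. \<exists>a b c. pvar i = C a * x + C b * y + C c * z" using basis3_span[OF assms(1)] by blast
  then obtain a b c where abc: "\<And>i. pvar i = C (a i) * x + C (b i) * y + C (c i) * z" by metis
  have "f = x * (\<Sum>i\<in>UNIV. C (a i) * g i) + y * (\<Sum>i\<in>UNIV. C (b i) * g i) + z * (\<Sum>i\<in>UNIV. C (c i) * g i)"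
    unfolding g(2) by (subst abc) (simp add: sum_distrib_left sum.distrib[symmetric] algebra_simps)
  then show ?thesis using g(1) by blast
qed

lemma forms_1E:
  assumes "basis3 x y z" "f \<in> forms 1"
  obtains a b c where "f = C a * x + C b * y + C c * z"
  using basis3_span[OF assms] by blast

lemma forms_2E:
  fixes x :: "'k::field poly3"
  assumes "basis3 x y z" "f \<in> forms 2"
  obtains a b c d e g where "f = C a * x^2 + C b * (x*y) + C c * (x*z) + C d * y^2 + C e * (y*z) + C g * z^2"
proof -
  obtain u v w where uvw: "u \<in> forms 1" "v \<in> forms 1" "w \<in> forms 1" and f: "f = x * u + y * v + z * w"
    using basis3_SucD[OF assms(1), of f 1] assms(2) by (auto simp: numeral_2_eq_2)
  obtain u1 u2 u3 where u: "u = C u1 * x + C u2 * y + C u3 * z" using forms_1E[OF assms(1) uvw(1)] .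
  obtain v1 v2 v3 where v: "v = C v1 * x + C v2 * y + C v3 * z" using forms_1E[OF assms(1) uvw(2)] .
  obtain w1 w2 w3 where w: "w = C w1 * x + C w2 * y + C w3 * z" using forms_1E[OF assms(1) uvw(3)] .
  have "f = C u1 * x^2 + C (u2 + v1) * (x*y) + C (u3 + w1) * (x*z) + C v2 * y^2 + C (v3 + w2) * (y*z) + C w3 * z^2"
    unfolding f u v w C_simps by Groebner_Basis.algebra
  then show ?thesis using that by blast
qed

lemma forms_3E:
  fixes x :: "'k::field poly3"
  assumes "basis3 x y z" "f \<in> forms 3"
  obtains a b c d e g h i j k where "f = C a * x^3 + C b * (x^2*y) + C c * (x^2*z) + C d * (x*y^2) + C e * (x*y*z) +
    C g * (x*z^2) + C h * y^3 + C i * (y^2*z) + C j * (y*z^2) + C k * z^3"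
proof -
  obtain u v w where uvw: "u \<in> forms 2" "v \<in> forms 2" "w \<in> forms 2" and f: "f = x * u + y * v + z * w"
    using basis3_SucD[OF assms(1), of f 2] assms(2) by (auto simp: numeral_2_eq_2 numeral_3_eq_3)
  obtain u1 u2 u3 u4 u5 u6 where u: "u = C u1 * x^2 + C u2 * (x*y) + C u3 * (x*z) + C u4 * y^2 + C u5 * (y*z) + C u6 * z^2"
    using forms_2E[OF assms(1) uvw(1)] .
  obtain v1 v2 v3 v4 v5 v6 where v: "v = C v1 * x^2 + C v2 * (x*y) + C v3 * (x*z) + C v4 * y^2 + C v5 * (y*z) + C v6 * z^2"
    using forms_2E[OF assms(1) uvw(2)] .
  obtain w1 w2 w3 w4 w5 w6 where w: "w = C w1 * x^2 + C w2 * (x*y) + C w3 * (x*z) + C w4 * y^2 + C w5 * (y*z) + C w6 * z^2"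
    using forms_2E[OF assms(1) uvw(3)] .
  have "f = C u1 * x^3 + C (u2 + v1) * (x^2*y) + C (u3 + w1) * (x^2*z) + C (u4 + v2) * (x*y^2) + C (u5 + v3 + w2) * (x*y*z) +
    C (u6 + w3) * (x*z^2) + C v4 * y^3 + C (v5 + w4) * (y^2*z) + C (v6 + w5) * (y*z^2) + C w6 * z^3"
    unfolding f u v w C_simps by Groebner_Basis.algebra
  then show ?thesis using that by blast
qed

section \<open>Binary forms and division by a linear form\<close>

definition binary_forms :: "'k::comm_ring_1 poly3 \<Rightarrow> 'k poly3 \<Rightarrow> nat \<Rightarrow> 'k poly3 set"
  where "binary_forms y z n = {(\<Sum>i\<le>n. C (c i) * y^i * z^(n - i)) | c. True}"

lemma binary_forms_add: "f \<in> binary_forms y z n \<Longrightarrow> g \<in> binary_forms y z n \<Longrightarrow> f + g \<in> binary_forms y z n"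
proof -
  assume "f \<in> binary_forms y z n" "g \<in> binary_forms y z n"
  then obtain c d where "f = (\<Sum>i\<le>n. C (c i) * y^i * z^(n - i))" "g = (\<Sum>i\<le>n. C (d i) * y^i * z^(n - i))"
    by (auto simp: binary_forms_def)
  then have "f + g = (\<Sum>i\<le>n. C (c i + d i) * y^i * z^(n - i))"
    by (simp add: sum.distrib[symmetric] C_simps algebra_simps)
  then show ?thesis unfolding binary_forms_def mem_Collect_eq by (intro exI[of _ "\<lambda>i. c i + d i"]) simp
qed

lemma binary_forms_mult_right: "f \<in> binary_forms y z n \<Longrightarrow> z * f \<in> binary_forms y z (Suc n)"
proof -
  assume "f \<in> binary_forms y z n"
  then obtain c where "f = (\<Sum>i\<le>n. C (c i) * y^i * z^(n - i))" by (auto simp: binary_forms_def)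
  then have "z * f = (\<Sum>i\<le>n. C (c i) * y^i * z^(Suc n - i))"
    by (simp add: sum_distrib_left Suc_diff_le algebra_simps)
  then have "z * f = (\<Sum>i\<le>Suc n. C (if i \<le> n then c i else 0) * y^i * z^(Suc n - i))"
    by (simp add: C_simps)
  then show ?thesis unfolding binary_forms_def mem_Collect_eq by (intro exI[of _ "\<lambda>i. if i \<le> n then c i else 0"]) simp
qed

lemma binary_forms_mult_left: "f \<in> binary_forms y z n \<Longrightarrow> y * f \<in> binary_forms y z (Suc n)"
proof -
  assume "f \<in> binary_forms y z n"
  then obtain c where "f = (\<Sum>i\<le>n. C (c i) * y^i * z^(n - i))" by (auto simp: binary_forms_def)
  then have "y * f = (\<Sum>i\<le>n. C (c i) * y^Suc i * z^(Suc n - Suc i))"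
    by (simp add: sum_distrib_left algebra_simps)
  also have "\<dots> = (\<Sum>i\<le>Suc n. C (if i = 0 then 0 else c (i - 1)) * y^i * z^(Suc n - i))"
    by (subst sum.atMost_Suc_shift) (simp add: C_simps)
  finally show ?thesis unfolding binary_forms_def mem_Collect_eq by (intro exI[of _ "\<lambda>i. if i = 0 then 0 else c (i - 1)"]) simp
qed

lemma binary_forms_subset_forms: "y \<in> forms 1 \<Longrightarrow> z \<in> forms 1 \<Longrightarrow> f \<in> binary_forms y z n \<Longrightarrow> f \<in> forms n"
  unfolding binary_forms_def by (auto intro!: forms_sum forms_mult'[OF forms_mult'[OF forms_C forms_power refl] forms_power])

text \<open>The remainder is the restriction to the line \<open>x = 0\<close>, written in the
  coordinates \<open>y\<close>, \<open>z\<close>. Degree 0 is treated apart because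
  \<open>n - 1\<close> is truncated there.\<close>

lemma division_by_variable:
  assumes "basis3 x y z" "f \<in> forms n"
  shows "\<exists>g h. f = x * g + h \<and> h \<in> binary_forms y z n \<and> (if n = 0 then g = 0 else g \<in> forms (n - 1))"
  using assms(2)
proof (induction n arbitrary: f)
  case 0
  then obtain c where "f = C c" using forms_0D by blast
  then have "f \<in> binary_forms y z 0" unfolding binary_forms_def mem_Collect_eq by (intro exI[of _ "\<lambda>_. c"]) simp
  then show ?case by (intro exI[of _ 0] exI[of _ f]) simp
next
  case (Suc n)
  obtain u v w where uvw: "u \<in> forms n" "v \<in> forms n" "w \<in> forms n" and f: "f = x * u + y * v + z * w"
    using basis3_SucD[OF assms(1) Suc.prems] by blast
  obtain g1 h1 where 1: "v = x * g1 + h1" "h1 \<in> binary_forms y z n" "if n = 0 then g1 = 0 else g1 \<in> forms (n - 1)"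
    using Suc.IH[OF uvw(2)] by blast
  obtain g2 h2 where 2: "w = x * g2 + h2" "h2 \<in> binary_forms y z n" "if n = 0 then g2 = 0 else g2 \<in> forms (n - 1)"
    using Suc.IH[OF uvw(3)] by blast
  have "f = x * (u + y * g1 + z * g2) + (y * h1 + z * h2)" unfolding f 1 2 by (simp add: algebra_simps)
  moreover have "y * h1 + z * h2 \<in> binary_forms y z (Suc n)"
    by (intro binary_forms_add binary_forms_mult_left binary_forms_mult_right 1 2)
  moreover have "u + y * g1 + z * g2 \<in> forms n"
    using uvw(1) 1(3) 2(3) basis3_forms[OF assms(1)] by (cases "n = 0") (auto intro!: forms_add forms_mult'[of _ 1])
  ultimately show ?case by auto
qed

lemma binary_form_poly:
  assumes "h \<in> binary_forms y z n"
  obtains p where "\<And>v t. ev v y = t \<Longrightarrow> ev v z = 1 \<Longrightarrow> ev v h = poly p t" "p = 0 \<Longrightarrow> h = 0"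
proof -
  obtain c where c: "h = (\<Sum>i\<le>n. C (c i) * y^i * z^(n - i))" using assms by (auto simp: binary_forms_def)
  define p where "p = (\<Sum>i\<le>n. monom (c i) i)"
  have "ev v h = poly p t" if "ev v y = t" "ev v z = 1" for v t
    using that by (simp add: c p_def poly_sum poly_monom)
  moreover have "h = 0" if "p = 0"
  proof -
    have "c i = 0" if "i \<le> n" for i
    proof -
      have "coeff p i = c i" using that by (simp add: p_def coeff_sum)
      then show ?thesis using \<open>p = 0\<close> by simp
    qed
    then show ?thesis by (simp add: c C_simps)
  qed
  ultimately show ?thesis using that by blast
qed

lemma binary_form_vanishing:
  fixes x :: "'k::alg_closed_field poly3"
  assumes b: "basis3 x y z" and h: "h \<in> binary_forms y z n" and "\<And>v. ev v x = 0 \<Longrightarrow> ev v h = 0"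
  shows "h = 0"
proof -
  obtain p where p: "\<And>v t. ev v y = t \<Longrightarrow> ev v z = 1 \<Longrightarrow> ev v h = poly p t" "p = 0 \<Longrightarrow> h = 0"
    using binary_form_poly[OF h] by blast
  have "poly p t = 0" for t
    using basis3_ev[OF b, of 0 t 1] p(1) assms(3) by metis
  then show ?thesis using p(2) poly_fun_zero by blast
qed

lemma dvd_of_vanishing:
  fixes x :: "'k::alg_closed_field poly3"
  assumes b: "basis3 x y z" and f: "f \<in> forms n" and v: "\<And>v. ev v x = 0 \<Longrightarrow> ev v f = 0"
  shows "\<exists>g. f = x * g \<and> (if n = 0 then g = 0 else g \<in> forms (n - 1))"
proof -
  obtain g h where gh: "f = x * g + h" "h \<in> binary_forms y z n" "if n = 0 then g = 0 else g \<in> forms (n - 1)"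
    using division_by_variable[OF b f] by blast
  have "h = 0" by (rule binary_form_vanishing[OF b gh(2)]) (use v gh(1) in auto)
  then show ?thesis using gh by auto
qed

lemma dvd_formsE:
  fixes x :: "'k::alg_closed_field poly3"
  assumes "x \<in> forms 1" "x \<noteq> 0" "f \<in> forms (Suc n)" "x dvd f"
  obtains g where "g \<in> forms n" "f = x * g"
proof -
  obtain y z where b: "basis3 x y z" using ex_basis3 assms by blast
  show ?thesis using dvd_of_vanishing[OF b assms(3)] assms(4) that by (auto simp: dvd_def)
qed

text \<open>On the line \<open>x = 0\<close>, dehomogenised by \<open>z = 1\<close>, the two factors
  become polynomials in one variable with product zero. This substitutes for unique factorisation
  throughout.\<close>

lemma linear_prime:
  fixes x :: "'k::alg_closed_field poly3"
  assumes x: "x \<in> forms 1" "x \<noteq> 0" and fg: "f \<in> forms m" "g \<in> forms n" "x dvd f * g"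
  shows "x dvd f \<or> x dvd g"
proof -
  obtain y z where b: "basis3 x y z" using ex_basis3 x by blast
  obtain f1 f2 where f: "f = x * f1 + f2" "f2 \<in> binary_forms y z m" using division_by_variable[OF b fg(1)] by blast
  obtain g1 g2 where g: "g = x * g1 + g2" "g2 \<in> binary_forms y z n" using division_by_variable[OF b fg(2)] by blast
  obtain p where p: "\<And>v t. ev v y = t \<Longrightarrow> ev v z = 1 \<Longrightarrow> ev v f2 = poly p t" "p = 0 \<Longrightarrow> f2 = 0"
    using binary_form_poly[OF f(2)] by blast
  obtain q where q: "\<And>v t. ev v y = t \<Longrightarrow> ev v z = 1 \<Longrightarrow> ev v g2 = poly q t" "q = 0 \<Longrightarrow> g2 = 0"
    using binary_form_poly[OF g(2)] by blast
  obtain e where e: "f * g = x * e" using fg(3) by blast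
  have "poly (p * q) t = 0" for t
  proof -
    obtain v where v: "ev v x = 0" "ev v y = t" "ev v z = 1" using basis3_ev[OF b] by blast
    have "ev v f * ev v g = 0" using arg_cong[OF e, of "ev v"] v by simp
    then show ?thesis using v p(1)[of v t] q(1)[of v t] f(1) g(1) by simp
  qed
  then have "p * q = 0" by (rule poly_fun_zero)
  then have "f2 = 0 \<or> g2 = 0" using p(2) q(2) by auto
  then show ?thesis using f g by auto
qed

text \<open>Such a form is divisible by the first variable. The quotient vanishes where this
  variable is nonzero, and then everywhere, since it is polynomial in the first coordinate.
  Pointwise determinants thereby become identities between forms.\<close>

lemma form_zero_of_vanishing:
  fixes f :: "'k::alg_closed_field poly3"
  assumes "f \<in> forms n" "\<And>v. ev v f = 0"
  shows "f = 0"
  using assms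
proof (induction n arbitrary: f)
  case 0
  then obtain c where "f = C c" using forms_0D by blast
  then show ?case using 0(2) by simp
next
  case (Suc n)
  define x :: "'k poly3" where "x = pvar 0"
  obtain g where g: "f = x * g" "g \<in> forms n"
    using dvd_of_vanishing[OF basis3_pvar Suc.prems(1)] Suc.prems(2) by (auto simp: x_def)
  have "ev v g = 0" for v
  proof -
    define V where "V i = (if i = 0 then [:0, 1:] else [:v i:])" for i
    obtain p where p: "\<And>t. poly p t = ev (\<lambda>i. poly (V i) t) g" using ev_along_polynomial_curve[of V g] by blast
    have "poly p t = 0" if "t \<noteq> 0" for t
      using Suc.prems(2)[of "\<lambda>i. poly (V i) t"] that by (simp add: g x_def p V_def)
    then have "p = 0" by (rule poly_eq_zero_infinite)
    moreover have "(\<lambda>i. poly (V i) (v 0)) = v" by (auto simp: V_def)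
    ultimately show ?thesis using p[of "v 0"] by simp
  qed
  then have "g = 0" using Suc.IH[OF g(2)] by blast
  then show ?case using g by simp
qed

section \<open>Linear dependence of forms\<close>

text \<open>The subspace \<open>N\<close> is either \<open>{0}\<close>, for counts among forms, or
  an ideal, for counts in the quotient.\<close>

lemma dependent_mod:
  fixes f g :: "nat \<Rightarrow> 'k::field poly3"
  assumes N: "0 \<in> N" "\<And>f g. f \<in> N \<Longrightarrow> g \<in> N \<Longrightarrow> f + g \<in> N" "\<And>c f. f \<in> N \<Longrightarrow> C c * f \<in> N"
    and "m < n" and f: "\<And>i. i < n \<Longrightarrow> \<exists>c. f i - (\<Sum>j<m. C (c j) * g j) \<in> N"
  shows "\<exists>u. (\<exists>i<n. u i \<noteq> 0) \<and> (\<Sum>i<n. C (u i) * f i) \<in> N"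
proof -
  obtain c where c: "\<And>i. i < n \<Longrightarrow> f i - (\<Sum>j<m. C (c i j) * g j) \<in> N" using f by metis
  obtain u where u: "\<exists>i\<in>{..<n}. u i \<noteq> 0" "\<forall>j<m. (\<Sum>i\<in>{..<n}. c i j * u i) = 0"
    using homogeneous_system_nontrivial[of "{..<n}" m "\<lambda>j i. c i j"] \<open>m < n\<close> by auto
  have sum_N: "(\<Sum>i\<in>S. C (u i) * (f i - (\<Sum>j<m. C (c i j) * g j))) \<in> N" if "S \<subseteq> {..<n}" for S
    using that by (induction S rule: infinite_finite_induct) (auto intro: N c)
  have "(\<Sum>i<n. C (u i) * (\<Sum>j<m. C (c i j) * g j)) = (\<Sum>j<m. (\<Sum>i<n. C (u i) * (C (c i j) * g j)))"
    unfolding sum_distrib_left by (rule sum.swap)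
  also have "\<dots> = (\<Sum>j<m. C (\<Sum>i<n. c i j * u i) * g j)"
    by (rule sum.cong[OF refl]) (simp only: C_simps sum_distrib_left mult_ac)
  also have "\<dots> = 0" using u(2) by (simp add: C_simps)
  finally have "(\<Sum>i<n. C (u i) * f i) = (\<Sum>i<n. C (u i) * (f i - (\<Sum>j<m. C (c i j) * g j)))"
    by (simp add: right_diff_distrib sum_subtractf)
  then have "(\<Sum>i<n. C (u i) * f i) \<in> N" using sum_N[of "{..<n}"] by simp
  then show ?thesis using u(1) by blast
qed

lemma dependent_of_span:
  fixes f g :: "nat \<Rightarrow> 'k::field poly3"
  assumes "m < n" and "\<And>i. i < n \<Longrightarrow> \<exists>c. f i = (\<Sum>j<m. C (c j) * g j)"
  shows "\<exists>u. (\<exists>i<n. u i \<noteq> 0) \<and> (\<Sum>i<n. C (u i) * f i) = 0"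
  using dependent_mod[of "{0}" m n f g] assms by simp

lemma cubic_polynomial_zero:
  fixes a :: "'k::alg_closed_field"
  assumes "\<And>t. a + b * t + c * t^2 + d * t^3 = 0"
  shows "a = 0" "b = 0" "c = 0" "d = 0"
proof -
  have "poly [:a, b, c, d:] t = 0" for t
    using assms[of t] by (simp add: algebra_simps power2_eq_square power3_eq_cube)
  then have "[:a, b, c, d:] = 0" by (rule poly_fun_zero)
  then show "a = 0" "b = 0" "c = 0" "d = 0" by simp_all
qed

lemma cubic_coeffs_zero:
  fixes x :: "'k::alg_closed_field poly3"
  assumes b: "basis3 x y z" and "C a * x^3 + C b * (x^2*y) + C c * (x^2*z) + C d * (x*y^2) + C e * (x*y*z) +
    C g * (x*z^2) + C h * y^3 + C i * (y^2*z) + C j * (y*z^2) + C k * z^3 = 0"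
  shows "a = 0" "b = 0" "c = 0" "d = 0" "e = 0" "g = 0" "h = 0" "i = 0" "j = 0" "k = 0"
proof -
  have *: "a * r^3 + b * (r^2 * s) + c * (r^2*t) + d * (r * s^2) + e * (r * s * t) +
    g * (r*t^2) + h * s^3 + i * (s^2*t) + j * (s * t^2) + k * t^3 = 0" for r s t
  proof -
    obtain v where "ev v x = r" "ev v y = s" "ev v z = t" using basis3_ev[OF b] by blast
    then show ?thesis using arg_cong[OF assms(2), of "ev v"] by simp
  qed
  have t: "a * r^3 + b * (r^2 * s) + d * (r * s^2) + h * s^3 = 0" "c * r^2 + e * (r * s) + i * s^2 = 0"
    "g * r + j * s = 0" "k = 0" for r s
    using cubic_polynomial_zero[of "a * r^3 + b * (r^2 * s) + d * (r * s^2) + h * s^3" "c * r^2 + e * (r * s) + i * s^2"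
      "g * r + j * s" k] *[of r s] by (simp_all add: algebra_simps)
  have 0: "a * r^3 = 0" "b * r^2 = 0" "d * r = 0" "h = 0" for r
    using cubic_polynomial_zero[of "a * r^3" "b * r^2" "d * r" h] t(1)[of r] by (simp_all add: algebra_simps)
  have 1: "c * r^2 = 0" "e * r = 0" "i = 0" for r
    using cubic_polynomial_zero[of "c * r^2" "e * r" i 0] t(2)[of r] by (simp_all add: algebra_simps)
  have 2: "g = 0" "j = 0" using t(3)[of 1 0] t(3)[of 0 1] by simp_all
  show "a = 0" "b = 0" "c = 0" "d = 0" "e = 0" "g = 0" "h = 0" "i = 0" "j = 0" "k = 0"
    using 0(1-3)[of 1] 0(4) 1(1,2)[of 1] 1(3) 2 t(4) by simp_all
qed

lemma quadric_coeffs_zero: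
  fixes x :: "'k::alg_closed_field poly3"
  assumes b: "basis3 x y z" and "C a * x^2 + C b * (x*y) + C c * (x*z) + C d * y^2 + C e * (y*z) + C g * z^2 = 0"
  shows "a = 0" "b = 0" "c = 0" "d = 0" "e = 0" "g = 0"
proof -
  have "x * (C a * x^2 + C b * (x*y) + C c * (x*z) + C d * y^2 + C e * (y*z) + C g * z^2) = 0"
    using assms(2) by simp
  then have "C a * x^3 + C b * (x^2*y) + C c * (x^2*z) + C d * (x*y^2) + C e * (x*y*z) +
    C g * (x*z^2) + C 0 * y^3 + C 0 * (y^2*z) + C 0 * (y*z^2) + C 0 * z^3 = 0"
    by (simp add: algebra_simps power2_eq_square power3_eq_cube C_simps)
  from cubic_coeffs_zero[OF b this] show "a = 0" "b = 0" "c = 0" "d = 0" "e = 0" "g = 0" by auto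
qed

lemma linear_coeffs_zero:
  fixes x :: "'k::alg_closed_field poly3"
  assumes b: "basis3 x y z" and e: "C a * x + C b * y + C c * z = 0"
  shows "a = 0" "b = 0" "c = 0"
proof -
  have "a * r + b * s + c * t = 0" for r s t
  proof -
    obtain v where "ev v x = r" "ev v y = s" "ev v z = t" using basis3_ev[OF b] by blast
    then show ?thesis using arg_cong[OF e, of "ev v"] by simp
  qed
  from this[of 1 0 0] this[of 0 1 0] this[of 0 0 1] show "a = 0" "b = 0" "c = 0" by simp_all
qed

section \<open>Monomial bases of the quadrics and of the cubics\<close>

definition quadric_monomial :: "'k::comm_ring_1 poly3 \<Rightarrow> 'k poly3 \<Rightarrow> 'k poly3 \<Rightarrow> nat \<Rightarrow> 'k poly3"
  where "quadric_monomial x y z = (!) [x^2, x*y, x*z, y^2, y*z, z^2]"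

definition cubic_monomial :: "'k::comm_ring_1 poly3 \<Rightarrow> 'k poly3 \<Rightarrow> 'k poly3 \<Rightarrow> nat \<Rightarrow> 'k poly3"
  where "cubic_monomial x y z = (!) [x^3, x^2*y, x^2*z, x*y^2, x*y*z, x*z^2, y^3, y^2*z, y*z^2, z^3]"

lemma sum_lessThan_add: "(\<Sum>i<m + n. F i) = (\<Sum>i<m. F i) + (\<Sum>j<n. F (j + m :: nat) :: 'b::comm_monoid_add)"
  by (induction n) (simp_all add: ac_simps)

lemma all_less_6: "(\<forall>i<6. P i) \<longleftrightarrow> P 0 \<and> P 1 \<and> P 2 \<and> P 3 \<and> P 4 \<and> P (5::nat)"
  by (simp add: numeral_eq_Suc All_less_Suc conj_ac)

lemma all_less_10: "(\<forall>i<10. P i) \<longleftrightarrow> P 0 \<and> P 1 \<and> P 2 \<and> P 3 \<and> P 4 \<and> P 5 \<and> P 6 \<and> P 7 \<and> P 8 \<and> P (9::nat)"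
  by (simp add: numeral_eq_Suc All_less_Suc conj_ac)

lemma sum_less_6: "(\<Sum>j<6. F j) = F 0 + F 1 + F 2 + F 3 + F 4 + F (5::nat)"
  by (simp add: numeral_eq_Suc add.assoc)

lemma sum_less_10: "(\<Sum>j<10. F j) = F 0 + F 1 + F 2 + F 3 + F 4 + F 5 + F 6 + F 7 + F 8 + F (9::nat)"
  by (simp add: numeral_eq_Suc add.assoc)

lemma quadric_sum: "(\<Sum>j<6. C (c j) * quadric_monomial x y z j) =
    C (c 0) * x^2 + C (c 1) * (x*y) + C (c 2) * (x*z) + C (c 3) * y^2 + C (c 4) * (y*z) + C (c 5) * z^2"
  by (simp add: sum_less_6 quadric_monomial_def)

lemma cubic_sum: "(\<Sum>j<10. C (c j) * cubic_monomial x y z j) =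
    C (c 0) * x^3 + C (c 1) * (x^2*y) + C (c 2) * (x^2*z) + C (c 3) * (x*y^2) + C (c 4) * (x*y*z) +
    C (c 5) * (x*z^2) + C (c 6) * y^3 + C (c 7) * (y^2*z) + C (c 8) * (y*z^2) + C (c 9) * z^3"
  by (simp add: sum_less_10 cubic_monomial_def)

lemma quadric_monomial_forms:
  assumes "basis3 x y z" "j < 6" shows "quadric_monomial x y z j \<in> forms 2"
proof -
  have "\<forall>j<6. quadric_monomial x y z j \<in> forms 2"
    unfolding all_less_6 using basis3_forms[OF assms(1)] by (auto simp: quadric_monomial_def)
  then show ?thesis using assms(2) by blast
qed

lemma cubic_monomial_forms:
  assumes "basis3 x y z" "j < 10" shows "cubic_monomial x y z j \<in> forms 3"
proof -
  note b = basis3_forms[OF assms(1)]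
  have sq: "x^2 \<in> forms 2" "y^2 \<in> forms 2" "z^2 \<in> forms 2" "x * y \<in> forms 2" using b by auto
  have "\<forall>j<10. cubic_monomial x y z j \<in> forms 3"
    unfolding all_less_10 using b sq by (auto simp: cubic_monomial_def)
  then show ?thesis using assms(2) by blast
qed

lemma quadric_span:
  fixes x :: "'k::field poly3"
  assumes "basis3 x y z" "f \<in> forms 2"
  shows "\<exists>c. f = (\<Sum>j<6. C (c j) * quadric_monomial x y z j)"
proof -
  obtain a b c d e g where f: "f = C a * x^2 + C b * (x*y) + C c * (x*z) + C d * y^2 + C e * (y*z) + C g * z^2"
    using forms_2E[OF assms] .
  show ?thesis unfolding quadric_sum by (intro exI[of _ "(!) [a, b, c, d, e, g]"]) (simp add: f)
qed

lemma cubic_span: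
  fixes x :: "'k::field poly3"
  assumes "basis3 x y z" "f \<in> forms 3"
  shows "\<exists>c. f = (\<Sum>j<10. C (c j) * cubic_monomial x y z j)"
proof -
  obtain a b c d e g h i j k where f: "f = C a * x^3 + C b * (x^2*y) + C c * (x^2*z) + C d * (x*y^2) + C e * (x*y*z) +
    C g * (x*z^2) + C h * y^3 + C i * (y^2*z) + C j * (y*z^2) + C k * z^3"
    using forms_3E[OF assms] .
  show ?thesis unfolding cubic_sum by (intro exI[of _ "(!) [a, b, c, d, e, g, h, i, j, k]"]) (simp add: f)
qed

lemma quadric_indep:
  fixes x :: "'k::alg_closed_field poly3"
  assumes "basis3 x y z" "(\<Sum>j<6. C (c j) * quadric_monomial x y z j) = 0" "j < 6"
  shows "c j = 0"
proof -
  have "\<forall>j<6. c j = 0"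
    unfolding all_less_6 using quadric_coeffs_zero[OF assms(1) assms(2)[unfolded quadric_sum]] by simp
  then show ?thesis using assms(3) by blast
qed

lemma cubic_indep:
  fixes x :: "'k::alg_closed_field poly3"
  assumes "basis3 x y z" "(\<Sum>j<10. C (c j) * cubic_monomial x y z j) = 0" "j < 10"
  shows "c j = 0"
proof -
  have "\<forall>j<10. c j = 0"
    unfolding all_less_10 using cubic_coeffs_zero[OF assms(1) assms(2)[unfolded cubic_sum]] by simp
  then show ?thesis using assms(3) by blast
qed

definition indep2 :: "'k::comm_ring_1 poly3 \<Rightarrow> 'k poly3 \<Rightarrow> bool"
  where "indep2 a b \<longleftrightarrow> (\<forall>p q. C p * a + C q * b = 0 \<longrightarrow> p = 0 \<and> q = 0)"

definition indep3 :: "'k::comm_ring_1 poly3 \<Rightarrow> 'k poly3 \<Rightarrow> 'k poly3 \<Rightarrow> bool"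
  where "indep3 a b c \<longleftrightarrow> (\<forall>p q r. C p * a + C q * b + C r * c = 0 \<longrightarrow> p = 0 \<and> q = 0 \<and> r = 0)"

definition indep4 :: "'k::comm_ring_1 poly3 \<Rightarrow> 'k poly3 \<Rightarrow> 'k poly3 \<Rightarrow> 'k poly3 \<Rightarrow> bool"
  where "indep4 a b c d \<longleftrightarrow> (\<forall>p q r s. C p * a + C q * b + C r * c + C s * d = 0 \<longrightarrow> p = 0 \<and> q = 0 \<and> r = 0 \<and> s = 0)"

lemma C_inverse: "(c::'k::field) \<noteq> 0 \<Longrightarrow> C (inverse c) * (C c * f) = f"
  by (simp add: mult.assoc[symmetric] C_simps(4)[symmetric] C_simps(2))

lemma solve_for:
  fixes c :: "'k::field"
  assumes "C c * f + g = 0" "c \<noteq> 0"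
  shows "f = - (C (inverse c) * g)"
proof -
  have "C c * f = - g" using assms(1) by (simp add: eq_neg_iff_add_eq_0)
  then have "C (inverse c) * (C c * f) = - (C (inverse c) * g)" by simp
  then show ?thesis using C_inverse[OF assms(2)] by simp
qed

section \<open>Ideals of Gorenstein algebras with Hilbert function (1,3,6,6,3,1)\<close>

text \<open>The hypotheses in terms of polynomials. \<open>no_quadrics\<close> says that
  \<open>A_2\<close> has the full dimension 6, \<open>no_socle\<close> that the pairing of
  \<open>A_d\<close> with \<open>A_(5-d)\<close> is nondegenerate. \<phi> is an isomorphism from
  \<open>A_5\<close> to the field, constrained on quintic forms only, and \<open>g\<close> lifts a
  basis of \<open>A_3\<close>, so that \<open>I_3\<close> has dimension 10 - 6 = 4.\<close>

locale gorenstein_ideal =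
  fixes I :: "'k::alg_closed_field poly3 set" and \<phi> :: "'k poly3 \<Rightarrow> 'k" and g :: "nat \<Rightarrow> 'k poly3"
  assumes zero [simp, intro]: "0 \<in> I"
    and add [intro]: "\<And>p q. p \<in> I \<Longrightarrow> q \<in> I \<Longrightarrow> p + q \<in> I"
    and mult [intro]: "\<And>p q. q \<in> I \<Longrightarrow> p * q \<in> I"
    and no_quadrics: "\<And>q. q \<in> forms 2 \<Longrightarrow> q \<in> I \<Longrightarrow> q = 0"
    and no_socle: "\<And>p d e. p \<in> forms d \<Longrightarrow> d + e = 5 \<Longrightarrow> (\<And>q. q \<in> forms e \<Longrightarrow> q * p \<in> I) \<Longrightarrow> p \<in> I"
    and degree_6: "\<And>p. p \<in> forms 6 \<Longrightarrow> p \<in> I"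
    and \<phi>_add: "\<And>p q. p \<in> forms 5 \<Longrightarrow> q \<in> forms 5 \<Longrightarrow> \<phi> (p + q) = \<phi> p + \<phi> q"
    and \<phi>_C: "\<And>c p. p \<in> forms 5 \<Longrightarrow> \<phi> (C c * p) = c * \<phi> p"
    and \<phi>_kernel: "\<And>p. p \<in> forms 5 \<Longrightarrow> \<phi> p = 0 \<longleftrightarrow> p \<in> I"
    and g_forms: "\<And>j. j < 6 \<Longrightarrow> g j \<in> forms 3"
    and g_span: "\<And>f. f \<in> forms 3 \<Longrightarrow> \<exists>c. f - (\<Sum>j<6. C (c j) * g j) \<in> I"
    and g_indep: "\<And>c j. (\<Sum>j<6. C (c j) * g j) \<in> I \<Longrightarrow> j < 6 \<Longrightarrow> c j = 0"
begin

lemma mult_right [intro]: "q \<in> I \<Longrightarrow> q * p \<in> I" using mult[of q p] by (simp add: mult.commute)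
lemma uminus [intro]: "q \<in> I \<Longrightarrow> - q \<in> I" using mult[of q "-1"] by simp
lemma diff [intro]: "p \<in> I \<Longrightarrow> q \<in> I \<Longrightarrow> p - q \<in> I" using add[of p "- q"] by auto
lemma sum_mem [intro]: "(\<And>s. s \<in> S \<Longrightarrow> F s \<in> I) \<Longrightarrow> sum F S \<in> I"
  by (induction S rule: infinite_finite_induct) auto
lemma mem_of_diff: "p - q \<in> I \<Longrightarrow> q \<in> I \<Longrightarrow> p \<in> I" using add[of "p - q" q] by simp
lemma C_mult_mem: "C c * p \<in> I \<Longrightarrow> c \<noteq> 0 \<Longrightarrow> p \<in> I"
  using mult[of "C c * p" "C (inverse c)"] C_inverse[of c p] by simp

lemma \<phi>_0 [simp]: "\<phi> 0 = 0" using \<phi>_kernel[of 0] by simp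
lemma \<phi>_uminus: "p \<in> forms 5 \<Longrightarrow> \<phi> (- p) = - \<phi> p"
  using \<phi>_C[of p "-1"] by (simp add: C_simps)
lemma \<phi>_diff: "p \<in> forms 5 \<Longrightarrow> q \<in> forms 5 \<Longrightarrow> \<phi> (p - q) = \<phi> p - \<phi> q"
  using \<phi>_add[of p "- q"] \<phi>_uminus[of q] by auto
lemma \<phi>_sum: "(\<And>s. s \<in> S \<Longrightarrow> F s \<in> forms 5) \<Longrightarrow> \<phi> (sum F S) = (\<Sum>s\<in>S. \<phi> (F s))"
  by (induction S rule: infinite_finite_induct) (auto simp: \<phi>_add forms_sum)
lemma forms_5: "p \<in> forms 2 \<Longrightarrow> q \<in> forms 3 \<Longrightarrow> p * q \<in> forms 5" by (auto intro: forms_mult')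

lemma quadric_kills:
  assumes "q \<in> forms 2" "\<And>p. p \<in> forms 3 \<Longrightarrow> p * q \<in> I"
  shows "q = 0"
  using no_quadrics[OF assms(1)] no_socle[OF assms(1), of 3] assms(2) by simp

lemma quadric_socle:
  assumes b: "basis3 x y z" and q: "q \<in> forms 2" "x * q \<in> I" "y * q \<in> I" "z * q \<in> I"
  shows "q = 0"
proof (rule quadric_kills[OF q(1)])
  fix p :: "'k poly3" assume "p \<in> forms 3"
  then obtain u v w where "p = x * u + y * v + z * w"
    using basis3_SucD[OF b, of p 2] by (auto simp: numeral_3_eq_3 numeral_2_eq_2)
  then have "p * q = u * (x * q) + v * (y * q) + w * (z * q)" by (simp add: algebra_simps)
  then show "p * q \<in> I" using q by auto
qed

text \<open>Since \<open>S\<^sub>2\<close> and \<open>S\<^sub>3 / I\<^sub>3\<close> have the same dimension, the pairing is perfect.\<close>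

lemma duality:
  assumes \<theta>_add: "\<And>p q. p \<in> forms 3 \<Longrightarrow> q \<in> forms 3 \<Longrightarrow> \<theta> (p + q) = \<theta> p + \<theta> q"
    and \<theta>_C: "\<And>c p. p \<in> forms 3 \<Longrightarrow> \<theta> (C c * p) = c * \<theta> p"
    and \<theta>_I: "\<And>p. p \<in> forms 3 \<Longrightarrow> p \<in> I \<Longrightarrow> \<theta> p = 0"
  shows "\<exists>Q\<in>forms 2. \<forall>f\<in>forms 3. \<phi> (Q * f) = \<theta> f"
proof -
  let ?m = "quadric_monomial (pvar 0) (pvar 1) (pvar 2) :: nat \<Rightarrow> 'k poly3"
  have m: "?m i \<in> forms 2" if "i < 6" for i using quadric_monomial_forms[OF basis3_pvar that] .
  \<comment> \<open>Seven unknowns for six equations: the coefficients of \<open>Q\<close>, and in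
    \<open>u 6\<close> a factor for \<theta>. Nondegeneracy of the pairing will show that this
    factor is nonzero.\<close>
  obtain u where u: "\<exists>j\<in>{..<7}. u j \<noteq> 0"
    "\<forall>i<6. (\<Sum>j\<in>{..<7}. (if j < 6 then \<phi> (?m j * g i) else - \<theta> (g i)) * u j) = 0"
    using homogeneous_system_nontrivial[of "{..<7}" 6 "\<lambda>i j. if j < 6 then \<phi> (?m j * g i) else - \<theta> (g i)"] by auto
  define Q where "Q = (\<Sum>j<6. C (u j) * ?m j)"
  have Q: "Q \<in> forms 2" unfolding Q_def by (intro forms_sum forms_C_mult m) auto
  have Qg: "\<phi> (Q * g i) = u 6 * \<theta> (g i)" if "i < 6" for i
  proof -
    have 7: "{..<7} = insert 6 {..<(6::nat)}" by auto
    have "\<phi> (Q * g i) = (\<Sum>j<6. \<phi> (C (u j) * (?m j * g i)))"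
      unfolding Q_def sum_distrib_right mult.assoc
      by (rule \<phi>_sum) (auto intro!: forms_C_mult forms_5 m g_forms that)
    also have "\<dots> = (\<Sum>j<6. \<phi> (?m j * g i) * u j)"
      by (rule sum.cong) (auto simp: \<phi>_C forms_5 m g_forms that)
    also have "\<dots> = u 6 * \<theta> (g i)" using u(2)[rule_format, OF that] unfolding 7 by (simp add: algebra_simps)
    finally show ?thesis .
  qed
  have Qf: "\<phi> (Q * f) = u 6 * \<theta> f" if f: "f \<in> forms 3" for f
  proof -
    obtain c where c: "f - (\<Sum>j<6. C (c j) * g j) \<in> I" using g_span[OF f] by blast
    define h where "h = (\<Sum>j<6. C (c j) * g j)"
    have h: "h \<in> forms 3" unfolding h_def by (intro forms_sum forms_C_mult g_forms) auto
    have fh: "f - h \<in> forms 3" "f - h \<in> I" using f h c by (auto simp: h_def)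
    have sumS: "\<theta> (sum F S) = (\<Sum>s\<in>S. \<theta> (F s))" if "\<And>s. s \<in> S \<Longrightarrow> F s \<in> forms 3" for F and S :: "nat set"
      using that \<theta>_C[of 0 0] by (induction S rule: infinite_finite_induct) (auto simp: \<theta>_add forms_sum)
    have "\<phi> (Q * h) = (\<Sum>j<6. \<phi> (C (c j) * (Q * g j)))"
      unfolding h_def sum_distrib_left mult.left_commute[of Q]
      by (rule \<phi>_sum) (auto intro!: forms_C_mult forms_5 Q g_forms)
    also have "\<dots> = (\<Sum>j<6. u 6 * \<theta> (C (c j) * g j))"
      by (rule sum.cong) (auto simp: \<phi>_C forms_5 Q g_forms Qg \<theta>_C)
    also have "\<dots> = u 6 * \<theta> h" unfolding h_def
      by (subst sumS) (auto intro!: g_forms forms_C_mult simp: sum_distrib_left)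
    finally have "\<phi> (Q * h) = u 6 * \<theta> h" .
    moreover have "\<phi> (Q * (f - h)) = 0" using \<phi>_kernel[OF forms_5[OF Q fh(1)]] fh(2) by blast
    moreover have "\<theta> (f - h) = 0" using \<theta>_I fh by blast
    ultimately show ?thesis
      using \<phi>_add[OF forms_5[OF Q fh(1)] forms_5[OF Q h]] \<theta>_add[OF fh(1) h] by (simp add: algebra_simps)
  qed
  have u6: "u 6 \<noteq> 0"
  proof
    assume 0: "u 6 = 0"
    have "Q = 0"
    proof (rule quadric_kills[OF Q])
      fix p :: "'k poly3" assume p: "p \<in> forms 3"
      show "p * Q \<in> I" using Qf[OF p] 0 \<phi>_kernel[OF forms_5[OF Q p]] by (simp add: mult.commute)
    qed
    then have "u j = 0" if "j < 6" for j using quadric_indep[OF basis3_pvar _ that] by (simp add: Q_def)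
    then have "u j = 0" if "j < 7" for j using that 0 by (cases "j = 6") auto
    then show False using u(1) by auto
  qed
  show ?thesis
  proof (intro bexI[of _ "C (inverse (u 6)) * Q"] ballI)
    fix f :: "'k poly3" assume f: "f \<in> forms 3"
    show "\<phi> (C (inverse (u 6)) * Q * f) = \<theta> f"
      using \<phi>_C[OF forms_5[OF Q f], of "inverse (u 6)"] Qf[OF f] u6 by (simp add: mult.assoc)
  qed (use Q in auto)
qed

text \<open>Five cubics of the ideal and the six \<open>g j\<close> are eleven elements of a
  ten-dimensional space, and the \<open>g j\<close> are independent modulo \<open>I\<close>.\<close>

lemma cubics_dependent:
  assumes f: "\<And>i::nat. i < 5 \<Longrightarrow> f i \<in> forms 3 \<and> f i \<in> I"
  shows "\<exists>u. (\<exists>i<5. u i \<noteq> 0) \<and> (\<Sum>i<5. C (u i) * f i) = 0"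
proof -
  define F where "F i = (if i < 5 then f i else g (i - 5))" for i :: nat
  have "F i \<in> forms 3" if "i < 11" for i using f g_forms that by (auto simp: F_def)
  then have "\<exists>c. F i = (\<Sum>j<10. C (c j) * cubic_monomial (pvar 0) (pvar 1) (pvar 2) j)" if "i < 11" for i
    using that by (intro cubic_span[OF basis3_pvar]) blast
  then have "\<exists>u. (\<exists>i<11. u i \<noteq> 0) \<and> (\<Sum>i<11. C (u i) * F i) = 0"
    by (intro dependent_of_span[where m = 10]) auto
  then obtain u where u: "\<exists>i<11. u i \<noteq> 0" "(\<Sum>i<11. C (u i) * F i) = 0" by blast
  have "(\<Sum>i<11. C (u i) * F i) = (\<Sum>i<5. C (u i) * F i) + (\<Sum>j<6. C (u (j + 5)) * g j)"
    using sum_lessThan_add[of "\<lambda>i. C (u i) * F i" 5 6] by (simp add: F_def)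
  also have "(\<Sum>i<5. C (u i) * F i) = (\<Sum>i<5. C (u i) * f i)" by (simp add: F_def)
  finally have eq: "(\<Sum>i<5. C (u i) * f i) + (\<Sum>j<6. C (u (j + 5)) * g j) = 0" using u(2) by simp
  then have "(\<Sum>j<6. C (u (j + 5)) * g j) = - (\<Sum>i<5. C (u i) * f i)" by (simp add: eq_neg_iff_add_eq_0 add.commute)
  then have "(\<Sum>j<6. C (u (j + 5)) * g j) \<in> I" using f by (auto intro!: uminus sum_mem)
  then have 0: "u (j + 5) = 0" if "j < 6" for j using g_indep[of "\<lambda>j. u (j + 5)"] that by blast
  have "u i = 0" if "5 \<le> i" "i < 11" for i using 0[of "i - 5"] that by simp
  then have "\<exists>i<5. u i \<noteq> 0" using u(1) by (metis not_le)
  moreover have "(\<Sum>i<5. C (u i) * f i) = 0" using eq 0 by (simp add: C_simps)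
  ultimately show ?thesis by blast
qed

text \<open>If \<open>n\<close> cubics spanned \<open>I_3\<close>, then together with the
  \<open>g j\<close> they would span all cubics, so \<open>6 + n\<close> would be at least
  10.\<close>

lemma cubics_not_spanned:
  assumes "n < 4" and f: "\<And>i::nat. i < n \<Longrightarrow> f i \<in> forms 3 \<and> f i \<in> I"
  shows "\<exists>d\<in>forms 3. d \<in> I \<and> \<not> (\<exists>c. d = (\<Sum>i<n. C (c i) * f i))"
proof (rule ccontr)
  assume "\<not> ?thesis"
  then have span: "\<exists>c. d = (\<Sum>i<n. C (c i) * f i)" if "d \<in> forms 3" "d \<in> I" for d using that by blast
  define F where "F i = (if i < 6 then g i else f (i - 6))" for i :: nat
  let ?m = "cubic_monomial (pvar 0) (pvar 1) (pvar 2) :: nat \<Rightarrow> 'k poly3"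
  have "\<exists>c. h = (\<Sum>j<6 + n. C (c j) * F j)" if h: "h \<in> forms 3" for h
  proof -
    obtain c where c: "h - (\<Sum>j<6. C (c j) * g j) \<in> I" using g_span[OF h] by blast
    have "h - (\<Sum>j<6. C (c j) * g j) \<in> forms 3" using h by (auto intro!: forms_diff forms_sum g_forms)
    then obtain d where d: "h - (\<Sum>j<6. C (c j) * g j) = (\<Sum>i<n. C (d i) * f i)" using span c by blast
    define e where "e j = (if j < 6 then c j else d (j - 6))" for j :: nat
    have "(\<Sum>j<6 + n. C (e j) * F j) = (\<Sum>j<6. C (e j) * F j) + (\<Sum>i<n. C (d i) * f i)"
      using sum_lessThan_add[of "\<lambda>j. C (e j) * F j" 6 n] by (simp add: F_def e_def)
    also have "(\<Sum>j<6. C (e j) * F j) = (\<Sum>j<6. C (c j) * g j)" by (simp add: F_def e_def)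
    finally have "h = (\<Sum>j<6 + n. C (e j) * F j)" using d by (simp add: algebra_simps)
    then show ?thesis by blast
  qed
  then have "\<exists>c. ?m i = (\<Sum>j<6 + n. C (c j) * F j)" if "i < 10" for i
    using cubic_monomial_forms[OF basis3_pvar that] by blast
  then have "\<exists>u. (\<exists>i<10. u i \<noteq> 0) \<and> (\<Sum>i<10. C (u i) * ?m i) = 0"
    using \<open>n < 4\<close> by (intro dependent_of_span[where m = "6 + n"]) auto
  then obtain u where u: "\<exists>i<10. u i \<noteq> 0" "(\<Sum>i<10. C (u i) * ?m i) = 0" by blast
  then show False using cubic_indep[OF basis3_pvar u(2)] by blast
qed

lemma extend_to_basis3:
  assumes "a \<in> forms 3" "b \<in> forms 3" "a \<in> I" "b \<in> I" "indep2 a b"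
  obtains c where "c \<in> forms 3" "c \<in> I" "indep3 a b c"
proof -
  define f where "f = (!) [a, b]"
  have "\<forall>i<2. f i \<in> forms 3 \<and> f i \<in> I" using assms by (simp add: f_def numeral_2_eq_2 All_less_Suc)
  then obtain c where c: "c \<in> forms 3" "c \<in> I" "\<not> (\<exists>e. c = (\<Sum>i<2. C (e i) * f i))"
    using cubics_not_spanned[of 2 f] by auto
  have "indep3 a b c" unfolding indep3_def
  proof (intro allI impI)
    fix p q r assume e: "C p * a + C q * b + C r * c = 0"
    have "r = 0"
    proof (rule ccontr)
      assume r: "r \<noteq> 0"
      have "c = - (C (inverse r) * (C p * a + C q * b))" using solve_for[of r c] e r by (simp add: add.commute)
      then have "c = (\<Sum>i<2. C ([- inverse r * p, - inverse r * q] ! i) * f i)"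
        by (simp add: f_def numeral_2_eq_2 C_simps algebra_simps)
      then have "\<exists>e. c = (\<Sum>i<2. C (e i) * f i)" by (rule exI[where x = "(!) [- inverse r * p, - inverse r * q]"])
      then show False using c(3) by contradiction
    qed
    then show "p = 0 \<and> q = 0 \<and> r = 0" using e assms(5) by (simp add: indep2_def C_simps)
  qed
  then show ?thesis using that c by blast
qed

lemma extend_to_basis4:
  assumes "a \<in> forms 3" "b \<in> forms 3" "c \<in> forms 3" "a \<in> I" "b \<in> I" "c \<in> I" "indep3 a b c"
  obtains d where "d \<in> forms 3" "d \<in> I" "indep4 a b c d"
proof -
  define f where "f = (!) [a, b, c]"
  have "\<forall>i<3. f i \<in> forms 3 \<and> f i \<in> I" using assms by (simp add: f_def numeral_3_eq_3 All_less_Suc)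
  then obtain d where d: "d \<in> forms 3" "d \<in> I" "\<not> (\<exists>e. d = (\<Sum>i<3. C (e i) * f i))"
    using cubics_not_spanned[of 3 f] by auto
  have "indep4 a b c d" unfolding indep4_def
  proof (intro allI impI)
    fix p q r s assume e: "C p * a + C q * b + C r * c + C s * d = 0"
    have "s = 0"
    proof (rule ccontr)
      assume s: "s \<noteq> 0"
      have "d = - (C (inverse s) * (C p * a + C q * b + C r * c))" using solve_for[of s d] e s by (simp add: add.commute)
      then have "d = (\<Sum>i<3. C ([- inverse s * p, - inverse s * q, - inverse s * r] ! i) * f i)"
        by (simp add: f_def numeral_3_eq_3 C_simps algebra_simps)
      then have "\<exists>e. d = (\<Sum>i<3. C (e i) * f i)"
        by (rule exI[where x = "(!) [- inverse s * p, - inverse s * q, - inverse s * r]"])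
      then show False using d(3) by contradiction
    qed
    then show "p = 0 \<and> q = 0 \<and> r = 0 \<and> s = 0" using e assms(7) by (simp add: indep3_def C_simps)
  qed
  then show ?thesis using that d by blast
qed

lemma cubics_span:
  assumes "a \<in> forms 3" "b \<in> forms 3" "c \<in> forms 3" "d \<in> forms 3" "a \<in> I" "b \<in> I" "c \<in> I" "d \<in> I" "indep4 a b c d"
    and "f \<in> forms 3" "f \<in> I"
  obtains p q r s where "f = C p * a + C q * b + C r * c + C s * d"
proof -
  define F where "F = (!) [f, a, b, c, d]"
  have "\<forall>i<5. F i \<in> forms 3 \<and> F i \<in> I" using assms by (simp add: F_def numeral_eq_Suc All_less_Suc)
  then obtain u where u: "\<exists>i<5. u i \<noteq> 0" "(\<Sum>i<5. C (u i) * F i) = 0" using cubics_dependent[of F] by blast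
  have e: "C (u 0) * f + (C (u 1) * a + C (u 2) * b + C (u 3) * c + C (u 4) * d) = 0"
    using u(2) by (simp add: F_def numeral_eq_Suc add.assoc)
  have "u 0 \<noteq> 0"
  proof
    assume 0: "u 0 = 0"
    then have "u 1 = 0" "u 2 = 0" "u 3 = 0" "u 4 = 0" using e assms(9) by (simp_all add: indep4_def C_simps)
    with 0 have "\<forall>i<5. u i = 0" by (simp add: numeral_eq_Suc All_less_Suc)
    then show False using u(1) by blast
  qed
  from solve_for[OF e this] have "f = C (- inverse (u 0) * u 1) * a + C (- inverse (u 0) * u 2) * b +
      C (- inverse (u 0) * u 3) * c + C (- inverse (u 0) * u 4) * d"
    by (simp add: C_simps algebra_simps)
  then show ?thesis using that by blast
qed

end

section \<open>Base points and common factors\<close>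

text \<open>A root of the dehomogenised polynomial gives the factor \<open>y - t z\<close>. If that
  polynomial is constant, the form is a multiple of a power of \<open>z\<close>.\<close>

lemma binary_linear_factor:
  fixes x :: "'k::alg_closed_field poly3"
  assumes b: "basis3 x y z" and h: "h \<in> binary_forms y z (Suc n)"
  obtains a c where "a \<noteq> 0 \<or> c \<noteq> 0" "(C a * y + C c * z) dvd h"
proof -
  obtain e where e: "h = (\<Sum>i\<le>Suc n. C (e i) * y^i * z^(Suc n - i))" using h by (auto simp: binary_forms_def)
  show ?thesis
  proof (cases "\<forall>i<Suc n. e (Suc i) = 0")
    case True
    then have "h = C (e 0) * z ^ Suc n"
      unfolding e by (subst sum.atMost_Suc_shift) (simp add: C_simps)
    then have "(C 0 * y + C 1 * z) dvd h" by (simp add: C_simps)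
    then show ?thesis using that[of 0 1] by simp
  next
    case False
    then obtain i where i: "i < Suc n" "e (Suc i) \<noteq> 0" by blast
    define p where "p = (\<Sum>i\<le>Suc n. monom (e i) i)"
    have "coeff p (Suc i) = e (Suc i)" using i by (simp add: p_def coeff_sum)
    then have "degree p > 0" using i(2) le_degree[of p "Suc i"] by auto
    then obtain t where t: "poly p t = 0" using alg_closed_imp_poly_has_root by blast
    have b': "basis3 (C 1 * y + C (- t) * z) x z"
      using basis3_change1[OF basis3_swap12[OF b], of 1 "C 1 * y + C (- t) * z" 0 "- t"] by (simp add: C_simps)
    have hf: "h \<in> forms (Suc n)" using binary_forms_subset_forms[OF _ _ h] basis3_forms[OF b] by blast
    have "ev v h = 0" if v: "ev v (C 1 * y + C (- t) * z) = 0" for v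
    proof -
      have y: "ev v y = t * ev v z" using v by simp
      have "ev v h = (\<Sum>i\<le>Suc n. e i * t ^ i * ev v z ^ Suc n)"
        unfolding e ev_simps ev_const y
        by (rule sum.cong[OF refl]) (simp add: power_mult_distrib mult.assoc power_add[symmetric] del: power_Suc)
      also have "\<dots> = poly p t * ev v z ^ Suc n" by (simp add: p_def poly_sum poly_monom sum_distrib_right del: power_Suc sum.atMost_Suc)
      finally show ?thesis using t by simp
    qed
    then have "(C 1 * y + C (- t) * z) dvd h" using dvd_of_vanishing[OF b' hf] by (metis dvd_triv_left)
    then show ?thesis using that[of 1 "- t"] by simp
  qed
qed

lemma basis3_binary:
  fixes x :: "'k::alg_closed_field poly3"
  assumes b: "basis3 x y z" and "a \<noteq> 0 \<or> c \<noteq> 0" "m = C a * y + C c * z"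
  shows "\<exists>w. (w = y \<or> w = z) \<and> basis3 x m w"
proof (cases "a = 0")
  case True
  then have "basis3 x y m" using basis3_change3[OF b, of c m 0 a] assms by (simp add: C_simps)
  then show ?thesis using basis3_swap23 by blast
next
  case False
  then have "basis3 x m z" using basis3_change2[OF b, of a m 0 c] assms by (simp add: C_simps)
  then show ?thesis by blast
qed

lemma basis3_not_dvd:
  fixes x :: "'k::alg_closed_field poly3"
  assumes "basis3 x y z"
  shows "\<not> x dvd y" "\<not> x dvd z" "\<not> y dvd x" "\<not> y dvd z" "\<not> z dvd x" "\<not> z dvd y"
proof -
  have *: "\<not> x dvd y" if b: "basis3 x y z" for x y z :: "'k poly3"
  proof
    assume "x dvd y"
    then obtain k where k: "y = x * k" by blast
    obtain v where "ev v x = 0" "ev v y = 1" using basis3_ev[OF b] by blast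
    then show False using arg_cong[OF k, of "ev v"] by simp
  qed
  note b = assms
  show "\<not> x dvd y" "\<not> x dvd z" "\<not> y dvd x" "\<not> y dvd z" "\<not> z dvd x" "\<not> z dvd y"
    using *[OF b] *[OF basis3_swap23[OF b]] *[OF basis3_swap12[OF b]] *[OF basis3_swap23[OF basis3_swap12[OF b]]]
      *[OF basis3_swap12[OF basis3_swap23[OF b]]] *[OF basis3_swap23[OF basis3_swap13[OF b]]]
      *[OF basis3_swap13[OF b]] by blast+
qed

context gorenstein_ideal
begin

lemma cubic_mem:
  assumes "p \<in> forms 3" "\<And>h. h \<in> forms 2 \<Longrightarrow> \<phi> (h * p) = 0"
  shows "p \<in> I"
  using no_socle[of p 3 2] \<phi>_kernel[OF forms_5] assms by simp

text \<open>The relation meant is \<open>y (x q) - x (y q) = 0\<close> between the two members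
  \<open>x q\<close> and \<open>y q\<close> of \<open>I_3\<close>.\<close>

definition two_term_syzygy :: bool
  where "two_term_syzygy \<longleftrightarrow> (\<exists>x y z q. basis3 x y z \<and> q \<in> forms 2 \<and> q \<noteq> 0 \<and> x * q \<in> I \<and> y * q \<in> I)"

text \<open>Evaluation at a common zero of the cubics is a functional on \<open>A_3\<close>, hence
  pairing with some quadric \<open>Q\<close>. If \<open>l\<close> vanishes at the point, then
  \<open>\<phi> (Q * (l * h)) = 0\<close> for all quadrics \<open>h\<close>, and so
  \<open>l Q\<close> lies in \<open>I\<close>.\<close>

lemma base_point:
  assumes b: "basis3 x y z"
    and v: "\<And>f v. f \<in> forms 3 \<Longrightarrow> f \<in> I \<Longrightarrow> ev v x = 0 \<Longrightarrow> ev v y = 0 \<Longrightarrow> ev v f = 0"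
  shows two_term_syzygy
proof -
  obtain v where v0: "ev v x = 0" "ev v y = 0" "ev v z = 1" using basis3_ev[OF b] by blast
  obtain Q where Q: "Q \<in> forms 2" "\<forall>f\<in>forms 3. \<phi> (Q * f) = ev v f"
    using duality[of "ev v"] v v0 by auto
  note bf = basis3_forms[OF b]
  have "z^3 \<in> forms 3" using bf by auto
  then have "\<phi> (Q * z^3) = 1" using Q v0 by simp
  then have "Q \<noteq> 0" by auto
  moreover have "l * Q \<in> I" if l: "l \<in> forms 1" "ev v l = 0" for l
  proof (rule cubic_mem)
    show "l * Q \<in> forms 3" using l Q by (auto intro: forms_mult')
    fix h :: "'k poly3" assume h: "h \<in> forms 2"
    then have "l * h \<in> forms 3" using l by (auto intro: forms_mult')
    then have "\<phi> (Q * (l * h)) = 0" using Q l by simp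
    then show "\<phi> (h * (l * Q)) = 0" by (simp add: ac_simps)
  qed
  ultimately show ?thesis using b Q(1) v0 bf unfolding two_term_syzygy_def by blast
qed

text \<open>A common linear factor \<open>x\<close> makes every point of the line \<open>x = 0\<close> a base point. The four
  quadrics dual to the coefficient functionals on cubics of that line would then all be
  multiples of \<open>x\<close>, but there is only a three-dimensional space of such quadrics.\<close>

lemma no_common_factor:
  assumes x: "x \<in> forms 1" "x \<noteq> 0" and dv: "\<And>f. f \<in> forms 3 \<Longrightarrow> f \<in> I \<Longrightarrow> x dvd f"
  shows False
proof -
  obtain y z where b: "basis3 x y z" using ex_basis3 x by blast
  note bf = basis3_forms[OF b]
  obtain v where v: "ev v x = 0" "ev v y = 1" "ev v z = 0" using basis3_ev[OF b] by blast
  obtain w where w: "ev w x = 0" "ev w y = 0" "ev w z = 1" using basis3_ev[OF b] by blast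
  \<comment> \<open>Restriction to the line \<open>x = 0\<close> with the parametrisation
    \<open>y = 1\<close>, \<open>z = s\<close>: on cubics, the coefficient of \<open>s^j\<close> is
    that of \<open>y^(3-j) z^j\<close>.\<close>
  define \<psi> where "\<psi> = insertion (\<lambda>c::'k. [:c:]) (\<lambda>i. [:v i, w i:])"
  have hom: "unital_hom (\<lambda>c::'k. [:c:])" by (simp add: unital_hom_def one_pCons)
  have \<psi>h: "unital_hom \<psi>" unfolding \<psi>_def by (rule insertion_hom[OF hom])
  note \<psi> = unital_homD[OF \<psi>h]
  have \<psi>C: "\<psi> (C c) = [:c:]" for c unfolding \<psi>_def by (rule insertion_const[OF hom])
  have lin: "\<psi> l = [:ev v l, ev w l:]" if l: "l \<in> forms 1" for l
  proof -
    obtain a b c where "l = C a * pvar 0 + C b * pvar 1 + C c * pvar 2" using basis3_span[OF basis3_pvar l] by blast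
    then show ?thesis by (simp add: \<psi> \<psi>C) (simp add: \<psi>_def insertion_var[OF hom])
  qed
  have xyz: "\<psi> x = 0" "\<psi> y = 1" "\<psi> z = [:0, 1:]" using lin bf v w by (simp_all add: one_pCons)
  have I0: "\<psi> p = 0" if "p \<in> forms 3" "p \<in> I" for p
    using dv[OF that] xyz(1) by (auto simp: dvd_def \<psi>)
  have "\<exists>Q\<in>forms 2. \<forall>f\<in>forms 3. \<phi> (Q * f) = coeff (\<psi> f) j" for j
    by (rule duality) (auto simp: \<psi> \<psi>C I0)
  then obtain Q where Q: "\<And>j. Q j \<in> forms 2" "\<And>j f. f \<in> forms 3 \<Longrightarrow> \<phi> (Q j * f) = coeff (\<psi> f) j" by metis
  have Qy: "\<phi> (h * (y * Q j)) = coeff (\<psi> h) j" if "h \<in> forms 2" for h j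
  proof -
    have "y * h \<in> forms 3" using bf that by (auto intro: forms_mult')
    then show ?thesis using Q(2)[of "y * h" j] by (simp add: \<psi> xyz ac_simps)
  qed
  have Qz: "\<phi> (h * (z * Q j)) = coeff ([:0, 1:] * \<psi> h) j" if "h \<in> forms 2" for h j
  proof -
    have "z * h \<in> forms 3" using bf that by (auto intro: forms_mult')
    then show ?thesis using Q(2)[of "z * h" j] by (simp add: \<psi> xyz ac_simps)
  qed
  have c3: "coeff (\<psi> h) 3 = 0" if h: "h \<in> forms 2" for h
  proof -
    obtain a1 a2 a3 a4 a5 a6 where e: "h = C a1 * x^2 + C a2 * (x*y) + C a3 * (x*z) + C a4 * y^2 + C a5 * (y*z) + C a6 * z^2"
      using forms_2E[OF b h] .
    have "\<psi> h = [:a4, a5, a6:]" by (simp add: e \<psi> \<psi>C xyz power2_eq_square)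
    then show ?thesis by (simp add: numeral_3_eq_3)
  qed
  have l3: "l * Q j \<in> forms 3" if "l \<in> forms 1" for l j by (rule forms_mult'[OF that Q(1)]) simp
  have mem0: "z * Q 0 \<in> I" by (rule cubic_mem) (auto simp: Qz l3[OF bf(3)])
  have mem3: "y * Q 3 \<in> I" by (rule cubic_mem) (auto simp: Qy c3 l3[OF bf(2)])
  \<comment> \<open>Both products represent the same functional on quadrics: the coefficient of
    \<open>y h\<close> at \<open>j\<close> is that of \<open>z h\<close> at
    \<open>j + 1\<close>.\<close>
  have mem: "y * Q j - z * Q (Suc j) \<in> I" for j
  proof (rule cubic_mem)
    fix h :: "'k poly3" assume h: "h \<in> forms 2"
    have "\<phi> (h * (y * Q j - z * Q (Suc j))) = \<phi> (h * (y * Q j)) - \<phi> (h * (z * Q (Suc j)))"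
      unfolding right_diff_distrib by (intro \<phi>_diff forms_5 h l3 bf)
    then show "\<phi> (h * (y * Q j - z * Q (Suc j))) = 0" using h by (simp add: Qy Qz)
  qed (auto intro: l3 bf)
  note nd = basis3_not_dvd[OF b]
  have pr: "x dvd Q j" if "x dvd l * Q j" "l = y \<or> l = z" for l j
    using linear_prime[OF x _ Q(1) that(1), of 1] that(2) bf nd by blast
  have x0: "x dvd Q 0" using pr[OF dv[OF l3 mem0]] bf by blast
  have x3: "x dvd Q 3" using pr[OF dv[OF l3 mem3]] bf by blast
  \<comment> \<open>Divisibility by \<open>x\<close> is handed on along the chain
    \<open>y Q_j - z Q_(j+1)\<close>, which starts at \<open>z Q_0\<close>.\<close>
  have xs: "x dvd Q (Suc j)" if "x dvd Q j" for j
  proof -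
    have "x dvd y * Q j - z * Q (Suc j)" by (rule dv[OF _ mem]) (auto intro: l3 bf)
    then have "x dvd z * Q (Suc j)" using that by (metis dvd_diff_right_iff dvd_mult)
    then show ?thesis using pr by blast
  qed
  have xQ: "x dvd Q j" for j by (induction j) (auto intro: x0 xs)
  have "\<exists>l\<in>forms 1. Q j = x * l" for j
    using dvd_formsE[OF x _ xQ[of j], of 1] Q(1)[of j] by (metis numeral_2_eq_2 One_nat_def)
  then obtain l where l: "\<And>j. l j \<in> forms 1" "\<And>j. Q j = x * l j" by metis
  have "\<exists>u. (\<exists>i<4. u i \<noteq> 0) \<and> (\<Sum>i<4. C (u i) * l i) = 0"
  proof (rule dependent_of_span[where m = 3])
    fix i :: nat
    obtain a b c where "l i = C a * x + C b * y + C c * z" using forms_1E[OF b l(1)] .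
    then show "\<exists>c. l i = (\<Sum>j<3. C (c j) * [x, y, z] ! j)"
      by (intro exI[of _ "(!) [a, b, c]"]) (simp add: numeral_3_eq_3)
  qed simp
  then obtain u where u: "\<exists>i<4. u i \<noteq> 0" "(\<Sum>i<4. C (u i) * l i) = 0" by blast
  have "(\<Sum>i<4. C (u i) * Q i) = x * (\<Sum>i<4. C (u i) * l i)" by (simp add: l(2) sum_distrib_left mult.left_commute)
  then have z: "(\<Sum>i<4. C (u i) * Q i) = 0" using u(2) by simp
  \<comment> \<open>Pairing the relation with \<open>y^(3-j) z^j\<close> isolates its coefficient at
    \<open>j\<close>.\<close>
  have "u j = 0" if j: "j < 4" for j
  proof -
    define f where "f = y^(3 - j) * z^j"
    have f: "f \<in> forms 3" unfolding f_def using j bf by (intro forms_mult'[OF forms_power forms_power]) auto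
    have zj: "[:0, 1::'k:] ^ j = monom 1 j" by (induction j) (simp_all add: monom_Suc one_pCons monom_0)
    have "0 = \<phi> ((\<Sum>i<4. C (u i) * Q i) * f)" using z by simp
    also have "\<dots> = (\<Sum>i<4. \<phi> (C (u i) * (Q i * f)))"
      unfolding sum_distrib_right mult.assoc by (rule \<phi>_sum) (auto intro: forms_5 Q f)
    also have "\<dots> = (\<Sum>i<4. u i * coeff (\<psi> f) i)"
      by (rule sum.cong) (auto simp: \<phi>_C forms_5 Q f)
    also have "\<dots> = u j" using j by (simp add: f_def \<psi> xyz zj if_distrib cong: if_cong)
    finally show ?thesis by simp
  qed
  then show False using u(1) by blast
qed

section \<open>Linear syzygies of the cubics\<close>

text \<open>Exactness of the Koszul complex: a vector orthogonal to \<open>(x, y, z)\<close> is a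
  cross product with it. Reduction modulo \<open>x\<close> leaves a relation between
  \<open>y\<close> and \<open>z\<close>, which is solved by divisibility.\<close>

lemma koszul:
  fixes x :: "'k poly3"
  assumes b: "basis3 x y z" and c: "c1 \<in> forms 3" "c2 \<in> forms 3" "c3 \<in> forms 3" and e: "x * c1 + y * c2 + z * c3 = 0"
  obtains a b' c where "a \<in> forms 2" "b' \<in> forms 2" "c \<in> forms 2"
    "c1 = z * b' - y * c" "c2 = x * c - z * a" "c3 = y * a - x * b'"
proof -
  note bf = basis3_forms[OF b]
  obtain g2 h2 where 2: "c2 = x * g2 + h2" "h2 \<in> binary_forms y z 3" "g2 \<in> forms 2"
    using division_by_variable[OF b c(2)] by auto
  obtain g3 h3 where 3: "c3 = x * g3 + h3" "h3 \<in> binary_forms y z 3" "g3 \<in> forms 2"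
    using division_by_variable[OF b c(3)] by auto
  have eq: "y * h2 + z * h3 = - (x * (c1 + y * g2 + z * g3))"
    using e unfolding 2 3 by (simp add: algebra_simps) (simp add: eq_neg_iff_add_eq_0 algebra_simps)
  have yz: "y * h2 + z * h3 = 0"
  proof (rule binary_form_vanishing[OF b])
    show "y * h2 + z * h3 \<in> binary_forms y z (Suc 3)"
      by (intro binary_forms_add binary_forms_mult_left binary_forms_mult_right 2 3)
  qed (simp add: eq)
  have h: "h2 \<in> forms 3" "h3 \<in> forms 3" using binary_forms_subset_forms bf 2 3 by blast+
  have "y * h2 = z * (- h3)" using yz by (simp add: eq_neg_iff_add_eq_0)
  then have "z dvd y * h2" by (metis dvd_triv_left)
  then have "z dvd h2" using linear_prime[OF bf(3) _ bf(2) h(1)] basis3_nonzero[OF b] basis3_not_dvd[OF b] by blast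
  then obtain k where k: "k \<in> forms 2" "h2 = z * k"
    using dvd_formsE[OF bf(3) basis3_nonzero(3)[OF b], of h2 2] h by (metis numeral_3_eq_3 numeral_2_eq_2)
  have "z * (y * k + h3) = 0" using yz unfolding k by (simp add: algebra_simps)
  then have h3: "h3 = - (y * k)" using basis3_nonzero[OF b] by (simp add: eq_neg_iff_add_eq_0 add.commute)
  have "x * (c1 + y * g2 + z * g3) = 0" using eq yz by simp
  then have "c1 + y * g2 + z * g3 = 0" using basis3_nonzero(1)[OF b] by (simp only: mult_eq_0_iff) simp
  then have c1: "c1 = - (y * g2) - z * g3" by (simp add: algebra_simps eq_neg_iff_add_eq_0)
  show ?thesis
  proof (rule that)
    show "- k \<in> forms 2" "- g3 \<in> forms 2" "g2 \<in> forms 2" using k 2 3 by auto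
  qed (simp_all add: c1 2 3 k h3)
qed

text \<open>Eliminating \<open>c3\<close> turns the syzygy into \<open>x' c1 + y' c2 = 0\<close>
  with independent linear forms \<open>x'\<close>, \<open>y'\<close>. Primality of \<open>x'\<close>
  then makes \<open>c1\<close> and \<open>c2\<close> multiples of one quadric.\<close>

lemma two_term_of_dependent:
  assumes b: "basis3 x y z" and c: "c1 \<in> forms 3" "c2 \<in> forms 3" "c3 \<in> forms 3" "c1 \<in> I" "c2 \<in> I" "c3 \<in> I"
    and e: "x * c1 + y * c2 + z * c3 = 0" and nz: "c1 \<noteq> 0 \<or> c2 \<noteq> 0 \<or> c3 \<noteq> 0"
    and rel: "C p * c1 + C q * c2 + C r * c3 = 0" "r \<noteq> 0"
  shows two_term_syzygy
proof -
  define m n where "m = - (inverse r * p)" and "n = - (inverse r * q)"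
  have c3: "c3 = C m * c1 + C n * c2"
    using solve_for[of r c3 "C p * c1 + C q * c2"] rel by (simp add: m_def n_def C_simps algebra_simps)
  define x' y' where "x' = x + C m * z" and "y' = y + C n * z"
  have "basis3 x' y z" using basis3_change1[OF b, of 1 x' 0 m] by (simp add: x'_def C_simps)
  then have b': "basis3 x' y' z" using basis3_change2[of x' y z 1 y' 0 n] by (simp add: y'_def C_simps)
  note bf = basis3_forms[OF b']
  have e': "x' * c1 + y' * c2 = 0" using e unfolding c3 x'_def y'_def by (simp add: algebra_simps)
  then have "y' * c2 = x' * (- c1)" by (simp add: eq_neg_iff_add_eq_0 add.commute)
  then have "x' dvd y' * c2" by (metis dvd_triv_left)
  then have "x' dvd c2" using linear_prime[OF bf(1) _ bf(2) c(2)] basis3_nonzero[OF b'] basis3_not_dvd[OF b'] by blast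
  then obtain k where k: "k \<in> forms 2" "c2 = x' * k"
    using dvd_formsE[OF bf(1) basis3_nonzero(1)[OF b'], of c2 2] c by (metis numeral_3_eq_3 numeral_2_eq_2)
  have "x' * (c1 + y' * k) = 0" using e' unfolding k by (simp add: algebra_simps)
  then have c1: "c1 = - (y' * k)" using basis3_nonzero[OF b'] by (simp add: eq_neg_iff_add_eq_0)
  have "k \<noteq> 0" using nz c1 k c3 by auto
  moreover have "x' * k \<in> I" "y' * k \<in> I" using c(5) k uminus[OF c(4)] c1 by auto
  ultimately show ?thesis using b' k(1) unfolding two_term_syzygy_def by blast
qed

definition syzygy :: "'k poly3 \<Rightarrow> 'k poly3 \<Rightarrow> 'k poly3 \<Rightarrow> 'k poly3 \<Rightarrow> 'k poly3 \<Rightarrow> 'k poly3 \<Rightarrow> bool"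
  where "syzygy x y z c1 c2 c3 \<longleftrightarrow> basis3 x y z \<and> c1 \<in> forms 3 \<and> c2 \<in> forms 3 \<and> c3 \<in> forms 3 \<and>
    c1 \<in> I \<and> c2 \<in> I \<and> c3 \<in> I \<and> x * c1 + y * c2 + z * c3 = 0 \<and> indep3 c1 c2 c3"

lemma all_less_15: "(\<forall>i<15. P i) \<longleftrightarrow> P 0 \<and> P 1 \<and> P 2 \<and> P 3 \<and> P 4 \<and> P 5 \<and> P 6 \<and> P 7 \<and> P 8 \<and> P 9 \<and>
    P 10 \<and> P 11 \<and> P 12 \<and> P 13 \<and> P (14::nat)"
  by (simp add: numeral_eq_Suc All_less_Suc conj_ac)

lemma sum_less_15: "(\<Sum>j<15. F j) = F 0 + F 1 + F 2 + F 3 + F 4 + F 5 + F 6 + F 7 + F 8 + F 9 +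
    F 10 + F 11 + F 12 + F 13 + F (14::nat)"
  by (simp add: numeral_eq_Suc add.assoc)

text \<open>The alternating form \<open>\<phi> (det (p, a, a'))\<close> with \<open>p = (x, y, z)\<close> on triples of quadrics vanishes
  if \<open>a\<close> is a multiple of \<open>p\<close>. A complement of these multiples has the odd dimension 15, so the form has a
  further radical element \<open>a\<close>, for which the entries of \<open>p \<times> a\<close> lie in the ideal.\<close>

lemma ex_linear_syzygy:
  assumes bb: "basis3 x y z"
  shows "\<exists>a b c. a \<in> forms 2 \<and> b \<in> forms 2 \<and> c \<in> forms 2 \<and> z * b - y * c \<in> I \<and> x * c - z * a \<in> I \<and> y * a - x * b \<in> I \<and>
    (z * b - y * c \<noteq> 0 \<or> x * c - z * a \<noteq> 0 \<or> y * a - x * b \<noteq> 0)"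
proof -
  note bf = basis3_forms[OF bb]
  \<comment> \<open>The 15 monomial vectors omit \<open>x^2\<close> in the first entry,
    \<open>y^2\<close> in the second and \<open>z^2\<close> in the third. Exactly these occur in
    \<open>x p\<close>, \<open>y p\<close> and \<open>z p\<close>, so the span is a complement of
    the multiples of \<open>p\<close>.\<close>
  define A where "A = (!) [y^2, z^2, x*y, x*z, y*z, 0, 0, 0, 0, 0, 0, 0, 0, 0, 0]"
  define B where "B = (!) [0, 0, 0, 0, 0, x^2, z^2, x*y, x*z, y*z, 0, 0, 0, 0, 0]"
  define D where "D = (!) [0, 0, 0, 0, 0, 0, 0, 0, 0, 0, x^2, y^2, x*y, x*z, y*z]"
  have m2: "x^2 \<in> forms 2" "y^2 \<in> forms 2" "z^2 \<in> forms 2" "x*y \<in> forms 2" "x*z \<in> forms 2" "y*z \<in> forms 2"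
    using bf by auto
  have "\<forall>i<15. A i \<in> forms 2 \<and> B i \<in> forms 2 \<and> D i \<in> forms 2"
    unfolding all_less_15 using m2 by (simp add: A_def B_def D_def)
  then have ABD: "A i \<in> forms 2" "B i \<in> forms 2" "D i \<in> forms 2" if "i < 15" for i :: nat using that by auto
  define det where "det a b c a' b' c' = x * (b * c' - c * b') + y * (c * a' - a * c') + z * (a * b' - b * a')"
    for a b c a' b' c' :: "'k poly3"
  have det5: "det a b c a' b' c' \<in> forms 5"
    if "a \<in> forms 2" "b \<in> forms 2" "c \<in> forms 2" "a' \<in> forms 2" "b' \<in> forms 2" "c' \<in> forms 2" for a b c a' b' c'
  proof -
    have "p * q \<in> forms 4" if "p \<in> forms 2" "q \<in> forms 2" for p q :: "'k poly3" using that by (auto intro: forms_mult')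
    note m = this
    have d: "p * q - r * s \<in> forms 4" if "p \<in> forms 2" "q \<in> forms 2" "r \<in> forms 2" "s \<in> forms 2"
      for p q r s :: "'k poly3" using that by (intro forms_diff m)
    have l: "l * p \<in> forms 5" if "l \<in> forms 1" "p \<in> forms 4" for l p :: "'k poly3"
      using that by (rule forms_mult') simp
    show ?thesis unfolding det_def using that by (intro forms_add l bf d)
  qed
  define \<beta> where "\<beta> i j = \<phi> (det (A i) (B i) (D i) (A j) (B j) (D j))" for i j
  have "\<exists>u. (\<exists>i\<in>{..<15}. u i \<noteq> 0) \<and> (\<forall>j\<in>{..<15}. (\<Sum>i\<in>{..<15}. u i * \<beta> i j) = 0)"
  proof (rule odd_alternating_radical)
    fix i :: nat
    show "\<beta> i i = 0" by (simp add: \<beta>_def det_def mult.commute)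
    fix j :: nat assume ij: "i \<in> {..<15}" "j \<in> {..<15}"
    have "det (A i) (B i) (D i) (A j) (B j) (D j) = - det (A j) (B j) (D j) (A i) (B i) (D i)"
      by (simp add: det_def algebra_simps)
    then show "\<beta> i j = - \<beta> j i" using ij ABD by (simp add: \<beta>_def \<phi>_uminus det5)
  qed auto
  then obtain u where u: "\<exists>i<15. u i \<noteq> 0" "\<And>j. j < 15 \<Longrightarrow> (\<Sum>i<15. u i * \<beta> i j) = 0" by auto
  define a where "a = (\<Sum>i<15. C (u i) * A i)"
  define b where "b = (\<Sum>i<15. C (u i) * B i)"
  define c where "c = (\<Sum>i<15. C (u i) * D i)"
  have abc: "a \<in> forms 2" "b \<in> forms 2" "c \<in> forms 2"
    unfolding a_def b_def c_def by (auto intro!: forms_sum forms_C_mult ABD)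
  have rad: "\<phi> (det a b c (A j) (B j) (D j)) = 0" if j: "j < 15" for j :: nat
  proof -
    have "det a b c (A j) (B j) (D j) = (\<Sum>i<15. C (u i) * det (A i) (B i) (D i) (A j) (B j) (D j))"
      unfolding det_def a_def b_def c_def
      by (simp add: sum_distrib_left sum_distrib_right sum.distrib[symmetric] sum_subtractf[symmetric] algebra_simps)
    then have "\<phi> (det a b c (A j) (B j) (D j)) = (\<Sum>i<15. \<phi> (C (u i) * det (A i) (B i) (D i) (A j) (B j) (D j)))"
      by (simp only:) (rule \<phi>_sum, auto intro!: forms_C_mult det5 ABD j)
    also have "\<dots> = (\<Sum>i<15. u i * \<beta> i j)"
      by (rule sum.cong) (auto simp: \<beta>_def \<phi>_C det5 ABD j)
    finally show ?thesis using u(2)[OF j] by simp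
  qed
  define P where "P = z * b - y * c"
  define Q where "Q = x * c - z * a"
  define R where "R = y * a - x * b"
  have PQR: "P \<in> forms 3" "Q \<in> forms 3" "R \<in> forms 3"
    unfolding P_def Q_def R_def using abc bf by (auto intro!: forms_diff forms_mult'[of _ 1 _ 2])
  have det_eq: "det a b c a' b' c' = - (a' * P + b' * Q + c' * R)" for a' b' c'
    unfolding det_def P_def Q_def R_def by (simp add: algebra_simps)
  have rad': "\<phi> (A j * P + B j * Q + D j * R) = 0" if "j < 15" for j :: nat
  proof -
    have "A j * P + B j * Q + D j * R \<in> forms 5"
      by (intro forms_add forms_5 ABD PQR that)
    from \<phi>_uminus[OF this] show ?thesis using rad[OF that] unfolding det_eq by simp
  qed
  have rP: "\<phi> (y^2 * P) = 0" "\<phi> (z^2 * P) = 0" "\<phi> (x*y * P) = 0" "\<phi> (x*z * P) = 0" "\<phi> (y*z * P) = 0"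
    using rad'[of 0] rad'[of 1] rad'[of 2] rad'[of 3] rad'[of 4] by (simp_all add: A_def B_def D_def)
  have rQ: "\<phi> (x^2 * Q) = 0" "\<phi> (z^2 * Q) = 0" "\<phi> (x*y * Q) = 0" "\<phi> (x*z * Q) = 0" "\<phi> (y*z * Q) = 0"
    using rad'[of 5] rad'[of 6] rad'[of 7] rad'[of 8] rad'[of 9] by (simp_all add: A_def B_def D_def)
  have rR: "\<phi> (x^2 * R) = 0" "\<phi> (y^2 * R) = 0" "\<phi> (x*y * R) = 0" "\<phi> (x*z * R) = 0" "\<phi> (y*z * R) = 0"
    using rad'[of 10] rad'[of 11] rad'[of 12] rad'[of 13] rad'[of 14] by (simp_all add: A_def B_def D_def)
  have pid: "x * P + y * Q + z * R = 0" unfolding P_def Q_def R_def by (simp add: algebra_simps)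
  \<comment> \<open>Pairing with a multiple \<open>l p\<close> gives zero because \<open>p\<close>
    is orthogonal to \<open>(P, Q, R)\<close>. This supplies the three omitted monomials.\<close>
  have sum0: "\<phi> (l * x * P) + \<phi> (l * y * Q) + \<phi> (l * z * R) = 0" if l: "l \<in> forms 1" for l
  proof -
    have f: "l * x * P \<in> forms 5" "l * y * Q \<in> forms 5" "l * z * R \<in> forms 5"
      using l bf PQR by (auto intro!: forms_5 forms_mult'[of l 1])
    have "l * x * P + l * y * Q + l * z * R = l * (x * P + y * Q + z * R)" by (simp add: algebra_simps)
    then have "\<phi> (l * x * P + l * y * Q + l * z * R) = 0" using pid by simp
    then show ?thesis using f by (simp add: \<phi>_add forms_add)
  qed
  have rP6: "\<phi> (x^2 * P) = 0" using sum0[OF bf(1)] rQ(3) rR(4) by (simp add: power2_eq_square)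
  have rQ6: "\<phi> (y^2 * Q) = 0" using sum0[OF bf(2)] rP(3) rR(5) by (simp add: power2_eq_square mult.commute[of y x])
  have rR6: "\<phi> (z^2 * R) = 0" using sum0[OF bf(3)] rP(4) rQ(5)
    by (simp add: power2_eq_square mult.commute[of z x] mult.commute[of z y])
  have mem: "T \<in> I" if T: "T \<in> forms 3" "\<phi> (x^2 * T) = 0" "\<phi> (x*y * T) = 0" "\<phi> (x*z * T) = 0"
      "\<phi> (y^2 * T) = 0" "\<phi> (y*z * T) = 0" "\<phi> (z^2 * T) = 0" for T
  proof (rule cubic_mem[OF T(1)])
    fix h :: "'k poly3" assume "h \<in> forms 2"
    then obtain a1 a2 a3 a4 a5 a6 where e: "h = C a1 * x^2 + C a2 * (x*y) + C a3 * (x*z) + C a4 * y^2 + C a5 * (y*z) + C a6 * z^2"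
      using forms_2E[OF bb] by blast
    have f: "x^2 * T \<in> forms 5" "x*y * T \<in> forms 5" "x*z * T \<in> forms 5" "y^2 * T \<in> forms 5" "y*z * T \<in> forms 5" "z^2 * T \<in> forms 5"
      using m2 T(1) forms_5 by blast+
    have "h * T = C a1 * (x^2 * T) + C a2 * (x*y * T) + C a3 * (x*z * T) + C a4 * (y^2 * T) + C a5 * (y*z * T) + C a6 * (z^2 * T)"
      unfolding e by (simp add: distrib_right mult.assoc)
    then show "\<phi> (h * T) = 0" using f T by (simp add: \<phi>_add \<phi>_C forms_add forms_C_mult)
  qed
  have PI: "P \<in> I" by (intro mem PQR rP rP6)
  have QI: "Q \<in> I" by (intro mem PQR rQ rQ6)
  have RI: "R \<in> I" by (intro mem PQR rR rR6)
  have a: "a = C (u 0) * y^2 + C (u 1) * z^2 + C (u 2) * (x*y) + C (u 3) * (x*z) + C (u 4) * (y*z)"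
    unfolding a_def sum_less_15 by (simp add: A_def)
  have b: "b = C (u 5) * x^2 + C (u 6) * z^2 + C (u 7) * (x*y) + C (u 8) * (x*z) + C (u 9) * (y*z)"
    unfolding b_def sum_less_15 by (simp add: B_def)
  have c: "c = C (u 10) * x^2 + C (u 11) * y^2 + C (u 12) * (x*y) + C (u 13) * (x*z) + C (u 14) * (y*z)"
    unfolding c_def sum_less_15 by (simp add: D_def)
  \<comment> \<open>If the cross product were zero, \<open>(a, b, c)\<close> would be a multiple of
    \<open>p\<close>, which the complement excludes. The coefficients of \<open>R\<close> and then
    those of \<open>P\<close> suffice to see that all \<open>u i\<close> vanish.\<close>
  have "P \<noteq> 0 \<or> Q \<noteq> 0 \<or> R \<noteq> 0"
  proof (rule ccontr)
    assume "\<not> ?thesis"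
    then have PR: "P = 0" "R = 0" by auto
    have "C (- u 5) * x^3 + C (- u 7) * (x^2*y) + C (- u 8) * (x^2*z) + C (u 2) * (x*y^2) + C (u 3 - u 9) * (x*y*z) +
        C (- u 6) * (x*z^2) + C (u 0) * y^3 + C (u 4) * (y^2*z) + C (u 1) * (y*z^2) + C 0 * z^3 = R"
      unfolding R_def a b C_simps by Groebner_Basis.algebra
    from cubic_coeffs_zero[OF bb this[unfolded PR]]
    have 1: "u 0 = 0" "u 1 = 0" "u 2 = 0" "u 4 = 0" "u 5 = 0" "u 6 = 0" "u 7 = 0" "u 8 = 0" "u 3 = u 9" by simp_all
    have "C 0 * x^3 + C (- u 10) * (x^2*y) + C (u 5) * (x^2*z) + C (- u 12) * (x*y^2) + C (u 7 - u 13) * (x*y*z) +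
        C (u 8) * (x*z^2) + C (- u 11) * y^3 + C (- u 14) * (y^2*z) + C (u 9) * (y*z^2) + C (u 6) * z^3 = P"
      unfolding P_def b c C_simps by Groebner_Basis.algebra
    from cubic_coeffs_zero[OF bb this[unfolded PR]] 1
    have "\<forall>i<15. u i = 0" unfolding all_less_15 by simp
    then show False using u(1) by blast
  qed
  then show ?thesis using PI QI RI abc unfolding P_def Q_def R_def by blast
qed

lemma ex_syzygy:
  assumes "\<not> two_term_syzygy"
  shows "\<exists>x y z c1 c2 c3. syzygy x y z c1 c2 c3"
proof -
  let ?x = "pvar 0 :: 'k poly3" and ?y = "pvar 1 :: 'k poly3" and ?z = "pvar 2 :: 'k poly3"
  note b = basis3_pvar[where 'k = 'k]
  obtain a b' c where abc: "a \<in> forms 2" "b' \<in> forms 2" "c \<in> forms 2" "?z * b' - ?y * c \<in> I" "?x * c - ?z * a \<in> I" "?y * a - ?x * b' \<in> I"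
    "?z * b' - ?y * c \<noteq> 0 \<or> ?x * c - ?z * a \<noteq> 0 \<or> ?y * a - ?x * b' \<noteq> 0"
    using ex_linear_syzygy[OF b] by blast
  define c1 c2 c3 where "c1 = ?z * b' - ?y * c" and "c2 = ?x * c - ?z * a" and "c3 = ?y * a - ?x * b'"
  have f: "c1 \<in> forms 3" "c2 \<in> forms 3" "c3 \<in> forms 3"
    unfolding c1_def c2_def c3_def using abc by (auto intro!: forms_diff forms_mult'[of _ 1 _ 2])
  have I: "c1 \<in> I" "c2 \<in> I" "c3 \<in> I" using abc by (auto simp: c1_def c2_def c3_def)
  have nz: "c1 \<noteq> 0 \<or> c2 \<noteq> 0 \<or> c3 \<noteq> 0" using abc(7) by (simp only: c1_def c2_def c3_def)
  have e: "?x * c1 + ?y * c2 + ?z * c3 = 0" unfolding c1_def c2_def c3_def by (simp add: algebra_simps)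
  have "p = 0 \<and> q = 0 \<and> r = 0" if rel: "C p * c1 + C q * c2 + C r * c3 = 0" for p q r
  proof (intro conjI; rule ccontr)
    assume "p \<noteq> 0"
    then have two_term_syzygy
      using two_term_of_dependent[OF basis3_swap13[OF b] f(3,2,1) I(3,2,1), of r q p] e nz rel by (simp add: ac_simps)
    then show False using assms by contradiction
  next
    assume "q \<noteq> 0"
    then have two_term_syzygy
      using two_term_of_dependent[OF basis3_swap23[OF b] f(1,3,2) I(1,3,2), of p r q] e nz rel by (simp add: ac_simps)
    then show False using assms by contradiction
  next
    assume "r \<noteq> 0"
    then have two_term_syzygy
      using two_term_of_dependent[OF b f I e nz rel] by blast
    then show False using assms by contradiction
  qed
  then have "indep3 c1 c2 c3" by (simp add: indep3_def)
  then have "syzygy ?x ?y ?z c1 c2 c3" unfolding syzygy_def using b f I e by blast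
  then show ?thesis by blast
qed

end

lemma binary_forms_C_mult: "f \<in> binary_forms y z n \<Longrightarrow> C a * f \<in> binary_forms y z n"
proof -
  assume "f \<in> binary_forms y z n"
  then obtain c where "f = (\<Sum>i\<le>n. C (c i) * y^i * z^(n - i))" by (auto simp: binary_forms_def)
  then have "C a * f = (\<Sum>i\<le>n. C (a * c i) * y^i * z^(n - i))"
    by (simp add: sum_distrib_left C_simps algebra_simps)
  then show ?thesis unfolding binary_forms_def mem_Collect_eq by (intro exI[of _ "\<lambda>i. a * c i"]) simp
qed

lemma binary_forms_diff: "f \<in> binary_forms y z n \<Longrightarrow> g \<in> binary_forms y z n \<Longrightarrow> f - g \<in> binary_forms y z n"
  using binary_forms_add[of f y z n "C (-1) * g"] binary_forms_C_mult[of g y z n "-1"] by (simp add: C_simps)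

lemma binary_forms_1: "C a * y + C b * z \<in> binary_forms y z 1"
  unfolding binary_forms_def mem_Collect_eq
  by (intro exI[of _ "\<lambda>i. if i = 0 then b else a"]) (simp add: add.commute)

lemma binary_ev:
  assumes "f \<in> binary_forms y z n" "ev v y = ev w y" "ev v z = ev w z"
  shows "ev v f = ev w f"
  using assms by (auto simp: binary_forms_def)

lemma binary_ev_0:
  assumes "f \<in> binary_forms y z (Suc n)" "ev v y = 0" "ev v z = 0"
  shows "ev v f = 0"
proof -
  obtain c where c: "f = (\<Sum>i\<le>Suc n. C (c i) * y^i * z^(Suc n - i))" using assms(1) by (auto simp: binary_forms_def)
  show ?thesis unfolding c ev_simps using assms(2,3)
    by (intro sum.neutral ballI) (auto simp: zero_power2 power_0_left)
qed

lemma ev_on_axis: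
  fixes x :: "'k::alg_closed_field poly3"
  assumes "basis3 x y z" "f \<in> forms 3"
  shows "\<exists>k. \<forall>v. ev v x = 0 \<longrightarrow> ev v y = 0 \<longrightarrow> ev v f = k * ev v z ^ 3"
proof -
  obtain a b c d e g h i j k where "f = C a * x^3 + C b * (x^2*y) + C c * (x^2*z) + C d * (x*y^2) + C e * (x*y*z) +
    C g * (x*z^2) + C h * y^3 + C i * (y^2*z) + C j * (y*z^2) + C k * z^3" using forms_3E[OF assms] .
  then show ?thesis by (intro exI[of _ k]) simp
qed

lemma dvdI_vanishing:
  fixes x :: "'k::alg_closed_field poly3"
  assumes "basis3 x y z" "f \<in> forms n" "\<And>v. ev v x = 0 \<Longrightarrow> ev v f = 0"
  shows "x dvd f"
proof -
  obtain g where "f = x * g" using dvd_of_vanishing[OF assms] by blast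
  then show ?thesis by simp
qed

definition span3 :: "'k::comm_ring_1 poly3 \<Rightarrow> 'k poly3 \<Rightarrow> 'k poly3 \<Rightarrow> 'k poly3 set"
  where "span3 a b c = {C p * a + C q * b + C r * c | p q r. True}"

lemma span3_swap12: "span3 b a c = span3 a b c"
proof -
  have "span3 b a c \<subseteq> span3 a b c" for a b c :: "'k::comm_ring_1 poly3"
  proof
    fix f assume "f \<in> span3 b a c"
    then obtain p q r where "f = C p * b + C q * a + C r * c" by (auto simp: span3_def)
    then have "f = C q * a + C p * b + C r * c" by simp
    then show "f \<in> span3 a b c" unfolding span3_def by blast
  qed
  then show ?thesis by blast
qed

lemma span3_swap23: "span3 a c b = span3 a b c"
proof -
  have "span3 a c b \<subseteq> span3 a b c" for a b c :: "'k::comm_ring_1 poly3"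
  proof
    fix f assume "f \<in> span3 a c b"
    then obtain p q r where "f = C p * a + C q * c + C r * b" by (auto simp: span3_def)
    then have "f = C p * a + C r * b + C q * c" by (simp add: ac_simps)
    then show "f \<in> span3 a b c" unfolding span3_def by blast
  qed
  then show ?thesis by blast
qed

lemma indep3_swap12: "indep3 a b c \<Longrightarrow> indep3 b a c"
  unfolding indep3_def
proof (intro allI impI)
  fix p q r assume "\<forall>p q r. C p * a + C q * b + C r * c = 0 \<longrightarrow> p = 0 \<and> q = 0 \<and> r = 0" "C p * b + C q * a + C r * c = 0"
  moreover from this(2) have "C q * a + C p * b + C r * c = 0" by (simp add: ac_simps)
  ultimately show "p = 0 \<and> q = 0 \<and> r = 0" by blast
qed

lemma indep3_swap23: "indep3 a b c \<Longrightarrow> indep3 a c b"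
  unfolding indep3_def
proof (intro allI impI)
  fix p q r assume "\<forall>p q r. C p * a + C q * b + C r * c = 0 \<longrightarrow> p = 0 \<and> q = 0 \<and> r = 0" "C p * a + C q * c + C r * b = 0"
  moreover from this(2) have "C p * a + C r * b + C q * c = 0" by (simp add: ac_simps)
  ultimately show "p = 0 \<and> q = 0 \<and> r = 0" by blast
qed

lemma span3_self: "a \<in> span3 a b c" "b \<in> span3 a b c" "c \<in> span3 a b c"
proof -
  have "a = C 1 * a + C 0 * b + C 0 * c" "b = C 0 * a + C 1 * b + C 0 * c" "c = C 0 * a + C 0 * b + C 1 * c"
    by (simp_all add: C_simps)
  then show "a \<in> span3 a b c" "b \<in> span3 a b c" "c \<in> span3 a b c" unfolding span3_def by blast+
qed

section \<open>Changes of coordinates for a linear syzygy\<close>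

context gorenstein_ideal
begin

lemma syzygyD:
  assumes "syzygy x y z c1 c2 c3"
  shows "basis3 x y z" "c1 \<in> forms 3" "c2 \<in> forms 3" "c3 \<in> forms 3" "c1 \<in> I" "c2 \<in> I" "c3 \<in> I"
    "x * c1 + y * c2 + z * c3 = 0" "indep3 c1 c2 c3"
  using assms by (auto simp: syzygy_def)

lemma syzygy_swap12: "syzygy x y z c1 c2 c3 \<Longrightarrow> syzygy y x z c2 c1 c3"
proof -
  assume s: "syzygy x y z c1 c2 c3"
  have "indep3 c2 c1 c3" using syzygyD(9)[OF s] by (rule indep3_swap12)
  then show ?thesis using syzygyD[OF s] basis3_swap12 unfolding syzygy_def by (simp add: add.commute)
qed

lemma syzygy_swap23: "syzygy x y z c1 c2 c3 \<Longrightarrow> syzygy x z y c1 c3 c2"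
proof -
  assume s: "syzygy x y z c1 c2 c3"
  have "indep3 c1 c3 c2" using syzygyD(9)[OF s] by (rule indep3_swap23)
  moreover have "x * c1 + z * c3 + y * c2 = 0" using syzygyD(8)[OF s] by (simp add: ac_simps)
  ultimately show ?thesis using syzygyD[OF s] basis3_swap23 unfolding syzygy_def by blast
qed

text \<open>The cubics are transformed contragrediently to the linear forms, which preserves both
  the relation and the net of cubics.\<close>

lemma syzygy_change1:
  assumes s: "syzygy x y z c1 c2 c3" and a: "a \<noteq> 0" and l: "l = C a * x + C b * y + C c * z"
  shows "\<exists>d1 d2 d3. syzygy l y z d1 d2 d3 \<and> span3 d1 d2 d3 = span3 c1 c2 c3"
proof -
  define d1 d2 d3 where "d1 = C (1/a) * c1" and "d2 = c2 - C (b/a) * c1" and "d3 = c3 - C (c/a) * c1"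
  note sD = syzygyD[OF s]
  have one: "C a * C (1/a) = 1" using a by (simp add: C_simps(4)[symmetric] C_simps(2))
  have frac: "C (b/a) = C b * C (1/a)" "C (c/a) = C c * C (1/a)" by (simp_all add: C_simps(4)[symmetric])
  have "l * d1 + y * d2 + z * d3 = (C a * C (1/a)) * (x * c1) + y * c2 + z * c3"
    unfolding l d1_def d2_def d3_def frac by (simp add: algebra_simps)
  then have e: "l * d1 + y * d2 + z * d3 = 0" using one sD by simp
  have ex: "C p * d1 + C q * d2 + C r * d3 = C (p/a - q*b/a - r*c/a) * c1 + C q * c2 + C r * c3" for p q r
    unfolding d1_def d2_def d3_def by (simp add: divide_inverse C_simps algebra_simps)
  have ex': "C p * c1 + C q * c2 + C r * c3 = C (p*a + q*b + r*c) * d1 + C q * d2 + C r * d3" for p q r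
    unfolding ex using a by (simp add: add_divide_distrib)
  have "indep3 d1 d2 d3" unfolding indep3_def ex
  proof (intro allI impI)
    fix p q r assume "C (p/a - q*b/a - r*c/a) * c1 + C q * c2 + C r * c3 = 0"
    then have "p/a - q*b/a - r*c/a = 0" "q = 0" "r = 0" using sD(9) unfolding indep3_def by blast+
    then show "p = 0 \<and> q = 0 \<and> r = 0" using a by simp
  qed
  moreover have "span3 d1 d2 d3 = span3 c1 c2 c3"
    unfolding span3_def using ex ex' by (auto; metis)
  moreover have "basis3 l y z" using basis3_change1[OF sD(1) a l] .
  moreover have "d1 \<in> forms 3" "d2 \<in> forms 3" "d3 \<in> forms 3" "d1 \<in> I" "d2 \<in> I" "d3 \<in> I"
    using sD unfolding d1_def d2_def d3_def by auto
  ultimately show ?thesis using e unfolding syzygy_def by blast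
qed

lemma syzygy_change2:
  assumes s: "syzygy x y z c1 c2 c3" and "b \<noteq> 0" "l = C a * x + C b * y + C c * z"
  shows "\<exists>d1 d2 d3. syzygy x l z d1 d2 d3 \<and> span3 d1 d2 d3 = span3 c1 c2 c3"
proof -
  obtain d1 d2 d3 where "syzygy l x z d1 d2 d3" "span3 d1 d2 d3 = span3 c2 c1 c3"
    using syzygy_change1[OF syzygy_swap12[OF s] assms(2), of l a c] assms(3) by (auto simp: ac_simps)
  then show ?thesis using syzygy_swap12 span3_swap12 by metis
qed

lemma syzygy_change3:
  assumes s: "syzygy x y z c1 c2 c3" and "c \<noteq> 0" "l = C a * x + C b * y + C c * z"
  shows "\<exists>d1 d2 d3. syzygy x y l d1 d2 d3 \<and> span3 d1 d2 d3 = span3 c1 c2 c3"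
proof -
  obtain d1 d2 d3 where "syzygy x l y d1 d2 d3" "span3 d1 d2 d3 = span3 c1 c3 c2"
    using syzygy_change2[OF syzygy_swap23[OF s] assms(2), of l a b] assms(3) by (auto simp: ac_simps)
  then show ?thesis using syzygy_swap23 span3_swap23 by metis
qed

lemma syzygy_first:
  assumes s: "syzygy x y z c1 c2 c3" and l: "l \<in> forms 1" "l \<noteq> 0"
  shows "\<exists>y' z' d1 d2 d3. syzygy l y' z' d1 d2 d3 \<and> span3 d1 d2 d3 = span3 c1 c2 c3"
proof -
  obtain a b c where e: "l = C a * x + C b * y + C c * z" using forms_1E[OF syzygyD(1)[OF s] l(1)] .
  have "a \<noteq> 0 \<or> b \<noteq> 0 \<or> c \<noteq> 0" using l(2) unfolding e by (auto simp: C_simps)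
  then consider "a \<noteq> 0" | "b \<noteq> 0" | "c \<noteq> 0" by blast
  then show ?thesis
  proof cases
    case 1
    show ?thesis using syzygy_change1[OF s 1 e] by blast
  next
    case 2
    obtain d1 d2 d3 where "syzygy x l z d1 d2 d3" "span3 d1 d2 d3 = span3 c1 c2 c3"
      using syzygy_change2[OF s 2 e] by blast
    then show ?thesis using syzygy_swap12 span3_swap12 by metis
  next
    case 3
    obtain d1 d2 d3 where d: "syzygy x y l d1 d2 d3" "span3 d1 d2 d3 = span3 c1 c2 c3"
      using syzygy_change3[OF s 3 e] by blast
    have "syzygy l x y d3 d1 d2" using syzygy_swap12[OF syzygy_swap23[OF d(1)]] .
    moreover have "span3 d3 d1 d2 = span3 c1 c2 c3" using d(2) span3_swap12 span3_swap23 by metis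
    ultimately show ?thesis by blast
  qed
qed

text \<open>On the line \<open>l = 0\<close> only the fourth basis cubic \<open>d\<close> survives,
  and a zero of \<open>d\<close> on that line is a base point.\<close>

lemma syzygy_common_factor:
  assumes s: "syzygy x y z c1 c2 c3" and l: "l \<in> forms 1" "l \<noteq> 0" "l dvd c1" "l dvd c2" "l dvd c3"
  shows two_term_syzygy
proof -
  note sD = syzygyD[OF s]
  obtain d where d: "d \<in> forms 3" "d \<in> I" "indep4 c1 c2 c3 d"
    using extend_to_basis4[OF sD(2-7) sD(9)] .
  obtain y' z' where b: "basis3 l y' z'" using ex_basis3[OF l(1,2)] by blast
  obtain d' e where e: "d = l * d' + e" "e \<in> binary_forms y' z' 3" using division_by_variable[OF b d(1)] by blast
  obtain a c where ac: "a \<noteq> 0 \<or> c \<noteq> 0" "(C a * y' + C c * z') dvd e"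
    using binary_linear_factor[OF b, of e 2] e(2) by (auto simp: numeral_3_eq_3 numeral_2_eq_2)
  define m where "m = C a * y' + C c * z'"
  obtain w where b': "basis3 l m w" using basis3_binary[OF b ac(1) m_def] by blast
  show ?thesis
  proof (rule base_point[OF b'])
    fix f v assume f: "f \<in> forms 3" "f \<in> I" and v: "ev v l = 0" "ev v m = 0"
    obtain p q r t where "f = C p * c1 + C q * c2 + C r * c3 + C t * d"
      using cubics_span[OF sD(2-4) d(1) sD(5-7) d(2,3) f] .
    moreover have "ev v c1 = 0" "ev v c2 = 0" "ev v c3 = 0" using l(3-5) v(1) by (auto simp: dvd_def)
    moreover have "ev v e = 0" using ac(2) v(2) unfolding m_def[symmetric] by (auto simp: dvd_def)
    ultimately show "ev v f = 0" using e(1) v(1) by simp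
  qed
qed

end

section \<open>Failure of the weak Lefschetz property\<close>

text \<open>By \<open>weak_lefschetz_iff\<close>, multiplication from degree 2 to degree 3 decides
  the property, so failure means a kernel there for every linear form.\<close>

locale lefschetz_failure = gorenstein_ideal +
  assumes failure: "\<And>l. l \<in> forms 1 \<Longrightarrow> l \<noteq> 0 \<Longrightarrow> \<exists>q\<in>forms 2. q \<noteq> 0 \<and> l * q \<in> I"
begin

lemma failure_combination:
  assumes "indep4 a b c d" and abcd: "a \<in> forms 3" "b \<in> forms 3" "c \<in> forms 3" "d \<in> forms 3" "a \<in> I" "b \<in> I" "c \<in> I" "d \<in> I"
    and l: "l \<in> forms 1" "l \<noteq> 0"
  obtains p q r s where "l dvd C p * a + C q * b + C r * c + C s * d" "p \<noteq> 0 \<or> q \<noteq> 0 \<or> r \<noteq> 0 \<or> s \<noteq> 0"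
proof -
  obtain Q where Q: "Q \<in> forms 2" "Q \<noteq> 0" "l * Q \<in> I" using failure l by blast
  have "l * Q \<in> forms 3" by (rule forms_mult'[OF l(1) Q(1)]) simp
  then obtain p q r s where e: "l * Q = C p * a + C q * b + C r * c + C s * d"
    using cubics_span[OF abcd assms(1) _ Q(3)] by blast
  have "l * Q \<noteq> 0" using Q(2) l(2) by simp
  then have "p \<noteq> 0 \<or> q \<noteq> 0 \<or> r \<noteq> 0 \<or> s \<noteq> 0" unfolding e by (auto simp: C_simps)
  moreover have "l dvd C p * a + C q * b + C r * c + C s * d" unfolding e[symmetric] by simp
  ultimately show ?thesis using that by blast
qed

text \<open>Lines \<open>x + t y = 0\<close>: the cubics of the ideal divisible by \<open>x + t y\<close> are the kernel of a
  matrix over \<open>k[t]\<close>. In a kernel vector of minimal degree the coordinate at \<open>d\<close> has a root, or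
  else the leading coefficient of the vector yields a combination divisible by \<open>y\<close>.\<close>

lemma pencil_divisor:
  assumes c: "c1 \<in> forms 3" "c2 \<in> forms 3" "c3 \<in> forms 3" "d \<in> forms 3" "c1 \<in> I" "c2 \<in> I" "c3 \<in> I" "d \<in> I"
    and ind: "indep4 c1 c2 c3 d"
  obtains l p q r where "l \<in> forms 1" "l \<noteq> 0" "p \<noteq> 0 \<or> q \<noteq> 0 \<or> r \<noteq> 0" "l dvd C p * c1 + C q * c2 + C r * c3"
proof -
  let ?x = "pvar 0 :: 'a poly3" and ?y = "pvar 1 :: 'a poly3" and ?z = "pvar 2 :: 'a poly3"
  note b = basis3_pvar[where 'k = 'a]
  define f where "f = (!) [c1, c2, c3, d]"
  have f3: "f j \<in> forms 3" if "j < 4" for j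
  proof -
    have "\<forall>j<4. f j \<in> forms 3" using c by (simp add: f_def numeral_eq_Suc All_less_Suc)
    then show ?thesis using that by blast
  qed
  have "\<exists>e. f j = (\<Sum>i<10. C (e i) * cubic_monomial ?x ?y ?z i)" if "j < 4" for j
    using cubic_span[OF b f3[OF that]] .
  then obtain e where e: "\<And>j. j < 4 \<Longrightarrow> f j = (\<Sum>i<10. C (e j i) * cubic_monomial ?x ?y ?z i)" by metis
  have comb: "(\<Sum>j<4. C (w j) * f j) = (\<Sum>i<10. C (\<Sum>j<4. w j * e j i) * cubic_monomial ?x ?y ?z i)" for w
  proof -
    have "(\<Sum>j<4. C (w j) * f j) = (\<Sum>j<4. \<Sum>i<10. C (w j) * (C (e j i) * cubic_monomial ?x ?y ?z i))"
      by (simp add: e sum_distrib_left)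
    also have "\<dots> = (\<Sum>i<10. \<Sum>j<4. C (w j) * (C (e j i) * cubic_monomial ?x ?y ?z i))" by (rule sum.swap)
    also have "\<dots> = (\<Sum>i<10. C (\<Sum>j<4. w j * e j i) * cubic_monomial ?x ?y ?z i)"
      by (rule sum.cong[OF refl]) (simp add: C_simps sum_distrib_right mult.assoc)
    finally show ?thesis .
  qed
  have comb0: "w j = 0" if "(\<Sum>j<4. C (w j) * f j) = 0" "j < 4" for w j
  proof -
    have "C (w 0) * c1 + C (w 1) * c2 + C (w 2) * c3 + C (w 3) * d = 0"
      using that(1) by (simp add: f_def numeral_eq_Suc add.assoc)
    then have "w 0 = 0" "w 1 = 0" "w 2 = 0" "w 3 = 0" using ind by (simp_all add: indep4_def)
    then have "\<forall>j<4. w j = 0" by (simp add: numeral_eq_Suc All_less_Suc)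
    then show ?thesis using that(2) by blast
  qed
  \<comment> \<open>Row \<open>i\<close> holds the coefficient of \<open>y^i z^(3-i)\<close> after
    the substitution \<open>x = - t y\<close>. It has degree at most \<open>i\<close> in
    \<open>t\<close>, and its coefficient at \<open>t^i\<close> is, up to sign, the coefficient of
    \<open>x^i z^(3-i)\<close>.\<close>
  define N where "N = (\<lambda>i j. [[:e j 9:], [:e j 8, - e j 5:], [:e j 7, - e j 4, e j 2:],
      [:e j 6, - e j 3, e j 1, - e j 0:]] ! i)"
  define l where "l t = ?x + C t * ?y" for t
  have lb: "basis3 (l t) ?y ?z" for t
    using basis3_change1[OF b, of 1 "l t" t 0] by (simp add: l_def C_simps)
  have all4: "(\<forall>i<4. P i) \<longleftrightarrow> P 0 \<and> P 1 \<and> P 2 \<and> P (3::nat)" for P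
    by (simp add: numeral_eq_Suc All_less_Suc conj_ac)
  have restrict: "ev v (\<Sum>j<4. C (w j) * f j) =
      (\<Sum>j<4. w j * poly (N 3 j) t) * r^3 + (\<Sum>j<4. w j * poly (N 2 j) t) * (r^2 * s) +
      (\<Sum>j<4. w j * poly (N 1 j) t) * (r * s^2) + (\<Sum>j<4. w j * poly (N 0 j) t) * s^3"
    if "ev v ?x = - t * r" "ev v ?y = r" "ev v ?z = s" for v w t r s
  proof -
    have 1: "ev v (f j) = poly (N 3 j) t * r^3 + poly (N 2 j) t * (r^2 * s) + poly (N 1 j) t * (r * s^2) + poly (N 0 j) t * s^3"
      if "j < 4" for j
      unfolding e[OF that] cubic_sum using \<open>ev v ?x = - t * r\<close> \<open>ev v ?y = r\<close> \<open>ev v ?z = s\<close>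
      by (simp add: N_def) (simp add: algebra_simps power2_eq_square power3_eq_cube)
    have "ev v (\<Sum>j<4. C (w j) * f j) = (\<Sum>j<4. w j * ev v (f j))" by simp
    also have "\<dots> = (\<Sum>j<4. w j * (poly (N 3 j) t * r^3 + poly (N 2 j) t * (r^2 * s) + poly (N 1 j) t * (r * s^2) + poly (N 0 j) t * s^3))"
      by (rule sum.cong[OF refl]) (simp add: 1)
    also have "\<dots> = (\<Sum>j<4. w j * poly (N 3 j) t) * r^3 + (\<Sum>j<4. w j * poly (N 2 j) t) * (r^2 * s) +
      (\<Sum>j<4. w j * poly (N 1 j) t) * (r * s^2) + (\<Sum>j<4. w j * poly (N 0 j) t) * s^3"
      by (simp add: sum_distrib_right sum.distrib distrib_left mult.assoc)
    finally show ?thesis .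
  qed
  have dvd_kernel: "l t dvd (\<Sum>j<4. C (w j) * f j) \<longleftrightarrow> (\<forall>i<4. (\<Sum>j<4. w j * poly (N i j) t) = 0)" for t w
  proof
    assume "l t dvd (\<Sum>j<4. C (w j) * f j)"
    then obtain k where k: "(\<Sum>j<4. C (w j) * f j) = l t * k" by blast
    have "(\<Sum>j<4. w j * poly (N 3 j) t) + (\<Sum>j<4. w j * poly (N 2 j) t) * s +
      (\<Sum>j<4. w j * poly (N 1 j) t) * s^2 + (\<Sum>j<4. w j * poly (N 0 j) t) * s^3 = 0" for s
    proof -
      obtain v where v: "ev v ?x = - t" "ev v ?y = 1" "ev v ?z = s" using basis3_ev[OF b] by blast
      then have "ev v (l t) = 0" by (simp add: l_def)
      then have "ev v (\<Sum>j<4. C (w j) * f j) = 0" unfolding k by simp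
      then show ?thesis using restrict[of v t 1 s w] v by simp
    qed
    from cubic_polynomial_zero[OF this] show "\<forall>i<4. (\<Sum>j<4. w j * poly (N i j) t) = 0" by (simp add: all4)
  next
    assume *: "\<forall>i<4. (\<Sum>j<4. w j * poly (N i j) t) = 0"
    have fw: "(\<Sum>j<4. C (w j) * f j) \<in> forms 3" by (intro forms_sum forms_C_mult f3) auto
    have "ev v (\<Sum>j<4. C (w j) * f j) = 0" if "ev v (l t) = 0" for v
    proof -
      have "ev v ?x = - t * ev v ?y" using that by (simp add: l_def eq_neg_iff_add_eq_0)
      then show ?thesis using restrict[of v t "ev v ?y" "ev v ?z" w] * by (simp add: all4)
    qed
    then show "l t dvd (\<Sum>j<4. C (w j) * f j)" by (rule dvdI_vanishing[OF lb fw])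
  qed
  define K where "K w \<longleftrightarrow> (\<exists>j<4. w j \<noteq> 0) \<and> (\<forall>i<4. (\<Sum>j<4. N i j * w j) = 0)" for w :: "nat \<Rightarrow> 'a poly"
  have "\<exists>w. (\<exists>j\<in>{..<4}. w j \<noteq> 0) \<and> (\<forall>i<4. (\<Sum>j\<in>{..<4}. N i j * w j) = 0)"
  proof (rule polynomial_kernel[OF alg_closed_infinite finite.emptyI])
    fix t :: 'a
    have "l t \<noteq> 0" "l t \<in> forms 1" using basis3_nonzero(1)[OF lb] basis3_forms(1)[OF lb] by auto
    then obtain p q r s where *: "l t dvd C p * c1 + C q * c2 + C r * c3 + C s * d" "p \<noteq> 0 \<or> q \<noteq> 0 \<or> r \<noteq> 0 \<or> s \<noteq> 0"
      using failure_combination[OF ind c] by metis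
    define w where "w = (!) [p, q, r, s]"
    have "(\<Sum>j<4. C (w j) * f j) = C p * c1 + C q * c2 + C r * c3 + C s * d"
      by (simp add: w_def f_def numeral_eq_Suc add.assoc)
    then have "\<forall>i<4. (\<Sum>j<4. w j * poly (N i j) t) = 0" using dvd_kernel[of t w] *(1) by simp
    moreover have "\<exists>j<4. w j \<noteq> 0"
    proof (rule ccontr)
      assume "\<not> ?thesis"
      then have "\<forall>j<4. w j = 0" by blast
      then show False using *(2) unfolding all4 by (simp add: w_def)
    qed
    ultimately show "\<exists>w. (\<exists>j\<in>{..<4}. w j \<noteq> 0) \<and> (\<forall>i<4. (\<Sum>j\<in>{..<4}. poly (N i j) t * w j) = 0)"
      by (intro exI[of _ w]) (auto simp: mult.commute)
  qed auto
  then obtain w0 where w0: "K w0" by (auto simp: K_def)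
  have "\<exists>n w. K w \<and> (\<forall>j<4. degree (w j) \<le> n)"
    by (intro exI[of _ "Max ((\<lambda>j. degree (w0 j)) ` {..<4})"] exI[of _ w0]) (auto simp: w0)
  \<comment> \<open>Minimality of the degree keeps the vector from being divisible by some
    \<open>t - t0\<close> and makes its leading coefficients usable.\<close>
  then obtain n where n: "\<exists>w. K w \<and> (\<forall>j<4. degree (w j) \<le> n)" "\<And>m. m < n \<Longrightarrow> \<not> (\<exists>w. K w \<and> (\<forall>j<4. degree (w j) \<le> m))"
    using exists_least_iff[of "\<lambda>n. \<exists>w. K w \<and> (\<forall>j<4. degree (w j) \<le> n)"] by blast
  obtain w where w: "K w" "\<And>j. j < 4 \<Longrightarrow> degree (w j) \<le> n" using n(1) by blast
  have Nw: "(\<Sum>j<4. N i j * w j) = 0" if "i < 4" for i using w(1) that by (auto simp: K_def)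
  have fin: thesis if "\<exists>j<4. u j \<noteq> 0" "u 3 = 0" "m \<in> forms 1" "m \<noteq> 0" "m dvd (\<Sum>j<4. C (u j) * f j)" for u m
  proof (rule \<open>\<And>l p q r. l \<in> forms 1 \<Longrightarrow> l \<noteq> 0 \<Longrightarrow> p \<noteq> 0 \<or> q \<noteq> 0 \<or> r \<noteq> 0 \<Longrightarrow>
      l dvd C p * c1 + C q * c2 + C r * c3 \<Longrightarrow> thesis\<close>)
    show "m \<in> forms 1" "m \<noteq> 0" by (fact that)+
    show "u 0 \<noteq> 0 \<or> u 1 \<noteq> 0 \<or> u 2 \<noteq> 0"
    proof (rule ccontr)
      assume "\<not> ?thesis"
      then have "\<forall>j<4. u j = 0" unfolding all4 using that(2) by simp
      then show False using that(1) by blast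
    qed
    show "m dvd C (u 0) * c1 + C (u 1) * c2 + C (u 2) * c3"
      using that(2,5) by (simp add: f_def numeral_eq_Suc C_simps add.assoc)
  qed
  show thesis
  proof (cases "\<exists>t. poly (w 3) t = 0")
    case True
    then obtain t where t: "poly (w 3) t = 0" by blast
    have "\<exists>j<4. poly (w j) t \<noteq> 0"
    proof (rule ccontr)
      assume "\<not> ?thesis"
      then have "\<exists>k. w j = [:- t, 1:] * k" if "j < 4" for j
        using that poly_eq_0_iff_dvd[of "w j" t] by (auto simp: dvd_def)
      then obtain k where k: "\<And>j. j < 4 \<Longrightarrow> w j = [:- t, 1:] * k j" by metis
      have Kk: "K k" unfolding K_def
      proof (intro conjI allI impI)
        obtain j where "j < 4" "w j \<noteq> 0" using w(1) by (auto simp: K_def)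
        then show "\<exists>j<4. k j \<noteq> 0" using k[of j] by (intro exI[of _ j]) auto
        fix i :: nat assume "i < 4"
        have "[:- t, 1:] * (\<Sum>j<4. N i j * k j) = (\<Sum>j<4. N i j * w j)"
          unfolding sum_distrib_left by (rule sum.cong[OF refl]) (simp only: k lessThan_iff mult.left_commute)
        then have "[:- t, 1:] * (\<Sum>j<4. N i j * k j) = 0" using Nw[OF \<open>i < 4\<close>] by (simp only:)
        then show "(\<Sum>j<4. N i j * k j) = 0" by (simp only: mult_eq_0_iff) simp
      qed
      have deg: "degree (k j) < n \<or> k j = 0" if "j < 4" for j
      proof (cases "k j = 0")
        case False
        then have "degree (w j) = Suc (degree (k j))" unfolding k[OF that] by (subst degree_mult_eq) auto
        then show ?thesis using w(2)[OF that] by simp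
      qed simp
      obtain j where "j < 4" "k j \<noteq> 0" using Kk by (auto simp: K_def)
      then have "n > 0" using deg[of j] by simp
      then have "\<forall>j<4. degree (k j) \<le> n - 1" using deg by fastforce
      then show False using n(2)[of "n - 1"] Kk \<open>n > 0\<close> by auto
    qed
    moreover have "(\<Sum>j<4. poly (w j) t * poly (N i j) t) = 0" if "i < 4" for i
      using arg_cong[OF Nw[OF that], of "\<lambda>p. poly p t"] by (simp add: poly_sum mult.commute)
    then have "l t dvd (\<Sum>j<4. C (poly (w j) t) * f j)" by (intro dvd_kernel[THEN iffD2]) blast
    ultimately show thesis
      using fin[of "\<lambda>j. poly (w j) t" "l t"] t basis3_forms(1)[OF lb] basis3_nonzero(1)[OF lb] by blast
  next
    case False
    then have "degree (w 3) = 0" using alg_closed_imp_poly_has_root[of "w 3"] by auto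
    \<comment> \<open>The limit of the kernel vector as \<open>t\<close> tends to infinity, where
      the line becomes \<open>y = 0\<close>. Comparing top coefficients in row \<open>i\<close>
      removes the monomial \<open>x^i z^(3-i)\<close>, so every remaining monomial contains
      \<open>y\<close>.\<close>
    define u where "u j = coeff (w j) n" for j
    have u_nz: "\<exists>j<4. u j \<noteq> 0"
    proof (rule ccontr)
      assume "\<not> ?thesis"
      then have u0: "coeff (w j) n = 0" if "j < 4" for j using that by (auto simp: u_def)
      have deg: "degree (w j) < n \<or> w j = 0" if "j < 4" for j
        using u0[OF that] w(2)[OF that] by (metis le_neq_implies_less leading_coeff_0_iff)
      obtain j where "j < 4" "w j \<noteq> 0" using w(1) by (auto simp: K_def)
      then have "n > 0" using deg[of j] by simp
      then have "\<forall>j<4. degree (w j) \<le> n - 1" using deg by fastforce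
      then show False using n(2)[of "n - 1"] w(1) \<open>n > 0\<close> by auto
    qed
    have hi: "coeff (w j) (Suc n) = 0" "coeff (w j) (Suc (Suc n)) = 0" "coeff (w j) (Suc (Suc (Suc n))) = 0" if "j < 4" for j
      using w(2)[OF that] by (auto intro!: coeff_eq_0)
    have top: "coeff (N 0 j * w j) n = u j * e j 9" "coeff (N 1 j * w j) (Suc n) = - (u j * e j 5)"
      "coeff (N 2 j * w j) (Suc (Suc n)) = u j * e j 2" "coeff (N 3 j * w j) (Suc (Suc (Suc n))) = - (u j * e j 0)" if "j < 4" for j
      using hi[OF that] by (simp_all add: N_def u_def)
    have s0: "(\<Sum>j<4. u j * e j 9) = 0"
      using arg_cong[OF Nw[of 0], of "\<lambda>p. coeff p n"] top(1) by (simp add: coeff_sum)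
    have s1: "(\<Sum>j<4. u j * e j 5) = 0"
      using arg_cong[OF Nw[of 1], of "\<lambda>p. coeff p (Suc n)"] top(2) by (simp add: coeff_sum sum_negf)
    have s2: "(\<Sum>j<4. u j * e j 2) = 0"
      using arg_cong[OF Nw[of 2], of "\<lambda>p. coeff p (Suc (Suc n))"] top(3) by (simp add: coeff_sum)
    have s3: "(\<Sum>j<4. u j * e j 0) = 0"
      using arg_cong[OF Nw[of 3], of "\<lambda>p. coeff p (Suc (Suc (Suc n)))"] top(4) by (simp add: coeff_sum sum_negf)
    have "?y dvd (\<Sum>j<4. C (u j) * f j)"
      unfolding comb cubic_sum s0 s1 s2 s3 by (simp add: C_simps power2_eq_square power3_eq_cube)
    moreover have "u 3 = 0"
    \<comment> \<open>For positive \<open>n\<close> the constant polynomial \<open>w 3\<close> has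
      no coefficient at \<open>n\<close>. For \<open>n = 0\<close> a constant vector would
      annihilate all ten coefficients, against the independence of the four cubics.\<close>
    proof (cases n)
      case 0
      have wj: "w j = [:u j:]" if j: "j < 4" for j
      proof -
        obtain a where "w j = [:a:]" using w(2)[OF j] 0 degree_eq_zeroE[of "w j"] by auto
        then show ?thesis by (simp add: u_def 0)
      qed
      have "(\<Sum>j<4. u j * coeff (N i j) k) = 0" if "i < 4" for i k
      proof -
        have "(\<Sum>j<4. u j * coeff (N i j) k) = coeff (\<Sum>j<4. N i j * w j) k"
          by (simp add: coeff_sum wj mult.commute)
        then show ?thesis using Nw[OF that] by simp
      qed
      note z = this[of 0 0] this[of 1 0] this[of 1 1] this[of 2 0] this[of 2 1] this[of 2 2]
        this[of 3 0] this[of 3 1] this[of 3 2] this[of 3 3]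
      have "(\<Sum>j<4. u j * e j i) = 0" if "i < 10" for i
      proof -
        have "\<forall>i<10. (\<Sum>j<4. u j * e j i) = 0"
          unfolding all_less_10 using z by (simp add: N_def sum_negf numeral_2_eq_2 numeral_3_eq_3)
        then show ?thesis using that by blast
      qed
      then have "(\<Sum>j<4. C (u j) * f j) = 0" unfolding comb by (simp add: C_simps)
      then show ?thesis using comb0 u_nz by blast
    next
      case (Suc m)
      then show ?thesis using \<open>degree (w 3) = 0\<close> by (simp add: u_def coeff_eq_0)
    qed
    ultimately show thesis using fin[OF u_nz, of ?y] basis3_nonzero(2)[OF b] by auto
  qed
qed

end

lemma linear_dvd_both:
  fixes x :: "'k::alg_closed_field poly3"
  assumes b: "basis3 x y z" and n: "n \<in> forms 1" "n \<noteq> 0"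
  shows "\<not> (n dvd x \<and> n dvd y)"
proof
  assume "n dvd x \<and> n dvd y"
  moreover have "n dvd x \<Longrightarrow> \<exists>c. x = C c * n" "n dvd y \<Longrightarrow> \<exists>c. y = C c * n"
    using dvd_formsE[OF n, of _ 0] basis3_forms[OF b] forms_0D by (metis One_nat_def mult.commute)+
  ultimately obtain c d where cd: "x = C c * n" "y = C d * n" by blast
  obtain v where v: "ev v x = 1" "ev v y = 0" using basis3_ev[OF b] by blast
  obtain w where w: "ev w x = 0" "ev w y = 1" using basis3_ev[OF b] by blast
  show False using v w unfolding cd by auto
qed

section \<open>Normal form of the syzygy at an eigenpoint\<close>

context lefschetz_failure
begin

text \<open>Here \<open>(0:0:1)\<close> is a point where the vectors \<open>p\<close> and \<open>a\<close> are parallel.\<close>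

lemma ex_eigenpoint:
  assumes nt: "\<not> two_term_syzygy"
  shows "\<exists>x y z c1 c2 c3. syzygy x y z c1 c2 c3 \<and>
    (\<forall>v. ev v x = 0 \<longrightarrow> ev v y = 0 \<longrightarrow> ev v c1 = 0 \<and> ev v c2 = 0 \<and> ev v c3 = 0)"
proof -
  obtain x0 y0 z0 e1 e2 e3 where s0: "syzygy x0 y0 z0 e1 e2 e3" using ex_syzygy[OF nt] by blast
  obtain d where d: "d \<in> forms 3" "d \<in> I" "indep4 e1 e2 e3 d"
    using extend_to_basis4[OF syzygyD(2-7,9)[OF s0]] .
  obtain x p q r where x: "x \<in> forms 1" "x \<noteq> 0" "p \<noteq> 0 \<or> q \<noteq> 0 \<or> r \<noteq> 0" "x dvd C p * e1 + C q * e2 + C r * e3"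
    using pencil_divisor[OF syzygyD(2-4)[OF s0] d(1) syzygyD(5-7)[OF s0] d(2,3)] .
  define w where "w = C p * e1 + C q * e2 + C r * e3"
  have w_nz: "w \<noteq> 0" using x(3) syzygyD(9)[OF s0] unfolding w_def indep3_def by blast
  obtain y z d1 d2 d3 where s: "syzygy x y z d1 d2 d3" and sp: "span3 d1 d2 d3 = span3 e1 e2 e3"
    using syzygy_first[OF s0 x(1,2)] by blast
  have "w \<in> span3 d1 d2 d3" unfolding sp unfolding span3_def w_def by blast
  then obtain v1 v2 v3 where w: "w = C v1 * d1 + C v2 * d2 + C v3 * d3" by (auto simp: span3_def)
  have vnz: "v1 \<noteq> 0 \<or> v2 \<noteq> 0 \<or> v3 \<noteq> 0" using w_nz unfolding w by (auto simp: C_simps)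
  note b = syzygyD(1)[OF s]
  note bf = basis3_forms[OF b]
  obtain a b' c where abc: "a \<in> forms 2" "b' \<in> forms 2" "c \<in> forms 2"
    and dd: "d1 = z * b' - y * c" "d2 = x * c - z * a" "d3 = y * a - x * b'"
    using koszul[OF b syzygyD(2-4)[OF s] syzygyD(8)[OF s]] .
  obtain a1 a2 where a: "a = x * a1 + a2" "a2 \<in> binary_forms y z 2" using division_by_variable[OF b abc(1)] by blast
  obtain b1 b2 where b2: "b' = x * b1 + b2" "b2 \<in> binary_forms y z 2" using division_by_variable[OF b abc(2)] by blast
  obtain c1 c2 where c: "c = x * c1 + c2" "c2 \<in> binary_forms y z 2" using division_by_variable[OF b abc(3)] by blast
  \<comment> \<open>On the line \<open>x = 0\<close> the cubics \<open>d1\<close>,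
    \<open>d2\<close>, \<open>d3\<close> restrict to \<open>e\<close>, \<open>- z a2\<close>,
    \<open>y a2\<close>. Hence a common zero of \<open>e\<close> and \<open>a2\<close> is wanted,
    and \<open>w\<close> restricts to \<open>v1 e + l a2\<close>.\<close>
  define e where "e = z * b2 - y * c2"
  have e3: "e \<in> binary_forms y z (Suc 2)" unfolding e_def
    by (intro binary_forms_diff binary_forms_mult_left binary_forms_mult_right b2 c)
  define l where "l = C v3 * y - C v2 * z"
  have la: "l * a2 = C v3 * (y * a2) - C v2 * (z * a2)" by (simp add: l_def algebra_simps)
  have weq: "w = x * (C v1 * (z * b1 - y * c1) + C v2 * (c - z * a1) + C v3 * (y * a1 - b')) + (C v1 * e + l * a2)"
    unfolding w dd a b2 c e_def l_def by (simp add: algebra_simps)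
  obtain k where k: "w = x * k" using x(4) unfolding w_def by blast
  have rel: "C v1 * e + l * a2 = 0"
  proof (rule binary_form_vanishing[OF b])
    show "C v1 * e + l * a2 \<in> binary_forms y z (Suc 2)"
      unfolding la
      by (intro binary_forms_add binary_forms_C_mult binary_forms_diff binary_forms_mult_left binary_forms_mult_right e3 a)
    fix v assume "ev v x = 0"
    then show "ev v (C v1 * e + l * a2) = 0" using arg_cong[OF weq, of "ev v"] arg_cong[OF k, of "ev v"] by simp
  qed
  \<comment> \<open>Since \<open>w\<close> vanishes on the line, \<open>e\<close> is a multiple of
    \<open>a2\<close> if \<open>v1\<close> is nonzero, and any linear factor of \<open>a2\<close>
    will do. Otherwise \<open>a2\<close> is zero and any factor of \<open>e\<close> will do.\<close>
  have "\<exists>\<alpha> \<gamma>. (\<alpha> \<noteq> 0 \<or> \<gamma> \<noteq> 0) \<and> (C \<alpha> * y + C \<gamma> * z) dvd a2 \<and> (C \<alpha> * y + C \<gamma> * z) dvd e"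
  proof (cases "v1 = 0")
    case False
    have "a2 \<in> binary_forms y z (Suc 1)" using a(2) by (simp add: numeral_2_eq_2)
    then obtain \<alpha> \<gamma> where m: "\<alpha> \<noteq> 0 \<or> \<gamma> \<noteq> 0" "(C \<alpha> * y + C \<gamma> * z) dvd a2"
      using binary_linear_factor[OF b] by blast
    have "e = - (C (inverse v1) * (l * a2))" using solve_for[OF rel False] .
    then have "(C \<alpha> * y + C \<gamma> * z) dvd e" using m(2) by simp
    then show ?thesis using m by blast
  next
    case True
    have "l \<noteq> 0"
    proof
      assume "l = 0"
      then have "C 0 * x + C v3 * y + C (- v2) * z = 0" by (simp add: l_def C_simps)
      from linear_coeffs_zero[OF b this] show False using vnz True by simp
    qed
    then have "a2 = 0" using rel True by (simp add: C_simps)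
    moreover obtain \<alpha> \<gamma> where m: "\<alpha> \<noteq> 0 \<or> \<gamma> \<noteq> 0" "(C \<alpha> * y + C \<gamma> * z) dvd e"
      using binary_linear_factor[OF b e3] by blast
    ultimately show ?thesis by auto
  qed
  then obtain \<alpha> \<gamma> where \<alpha>\<gamma>: "\<alpha> \<noteq> 0 \<or> \<gamma> \<noteq> 0" "(C \<alpha> * y + C \<gamma> * z) dvd a2" "(C \<alpha> * y + C \<gamma> * z) dvd e" by blast
  define m where "m = C \<alpha> * y + C \<gamma> * z"
  have vanish: "ev v f = 0" if "f \<in> span3 d1 d2 d3" "ev v x = 0" "ev v m = 0" for f v
  proof -
    have "ev v a2 = 0" "ev v e = 0" using \<alpha>\<gamma>(2,3) that(3) unfolding m_def[symmetric] by (auto simp: dvd_def)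
    then have "ev v d1 = 0" "ev v d2 = 0" "ev v d3 = 0" using that(2) unfolding dd a b2 c e_def by simp_all
    then show ?thesis using that(1) by (auto simp: span3_def)
  qed
  have "\<exists>t f1 f2 f3. syzygy x m t f1 f2 f3 \<and> span3 f1 f2 f3 = span3 d1 d2 d3"
  proof (cases "\<alpha> = 0")
    case False
    then show ?thesis using syzygy_change2[OF s False, of m 0 \<gamma>] by (auto simp: m_def C_simps)
  next
    case True
    then obtain f1 f2 f3 where f: "syzygy x y m f1 f2 f3" "span3 f1 f2 f3 = span3 d1 d2 d3"
      using syzygy_change3[OF s, of \<gamma> m 0 0] \<alpha>\<gamma>(1) by (auto simp: m_def C_simps)
    show ?thesis using syzygy_swap23[OF f(1)] f(2) span3_swap23[of f1 f3 f2] by blast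
  qed
  then obtain t f1 f2 f3 where "syzygy x m t f1 f2 f3" "span3 f1 f2 f3 = span3 d1 d2 d3" by blast
  then show ?thesis using vanish span3_self by metis
qed

text \<open>Suppose \<open>P1 = m n\<close> and \<open>P2 = m N\<close>; cancellation yields a
  quadric \<open>k\<close> with \<open>c n^2 = N k\<close>. If \<open>n\<close> divides
  \<open>N\<close>, the three cubics share the linear factor \<open>z + N / n\<close>, which gives a
  two-term syzygy. Otherwise \<open>n^2\<close> divides \<open>k\<close>, the forms
  \<open>a1\<close>, \<open>b1\<close> are scalar multiples of \<open>n\<close>, and these scalars
  appear in a linear relation between the cubics, so that \<open>P1 = 0\<close>.\<close>

lemma cofactor_cases:
  assumes nt: "\<not> two_term_syzygy" and s: "syzygy x y z c1 c2 c3"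
    and c: "c1 = z * (z * b1 + b2) - y * c" "c2 = x * c - z * (z * a1 + a2)" "c3 = y * (z * a1 + a2) - x * (z * b1 + b2)"
    and f: "a1 \<in> forms 1" "b1 \<in> forms 1" "a2 \<in> forms 2" "b2 \<in> forms 2" "c \<in> forms 2"
    and P1: "P1 = x * b1 - y * a1" and P2: "P2 = x * b2 - y * a2" and E: "E = a2 * b1 - a1 * b2"
    and det: "P2 * E + c * P1^2 = 0"
    and m: "P1 = m * n" "m \<in> forms 1" "m \<noteq> 0" "n \<in> forms 1" "n \<noteq> 0"
  shows "\<not> m dvd P2"
proof
  assume dv: "m dvd P2"
  note b = syzygyD(1)[OF s]
  note bf = basis3_forms[OF b] and bn = basis3_nonzero[OF b] and nd = basis3_not_dvd[OF b]
  have P2f: "P2 \<in> forms (Suc 2)" unfolding P2 by (intro forms_diff forms_mult'[OF bf(1) f(4)] forms_mult'[OF bf(2) f(3)]) simp_all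
  obtain N where N: "N \<in> forms 2" "P2 = m * N" using dvd_formsE[OF m(2,3) P2f dv] .
  have id1: "P2 * b1 - P1 * b2 = - (y * E)" "P2 * a1 - P1 * a2 = - (x * E)"
    unfolding P1 P2 E by (simp_all add: algebra_simps)
  have nf: "p * q \<in> forms 2" "p * r \<in> forms 3" if "p \<in> forms 1" "q \<in> forms 1" "r \<in> forms 2" for p q r :: "'a poly3"
    using forms_mult'[OF that(1,2), of 2] forms_mult'[OF that(1,3), of 3] by simp_all
  have diff3: "N * b1 - n * b2 \<in> forms 3" "N * a1 - n * a2 \<in> forms 3"
    using nf f m(4) N(1) by (auto intro!: forms_diff simp: mult.commute[of N])
  have "m * (y * (N * a1 - n * a2)) = m * (x * (N * b1 - n * b2))"
  proof -
    have "m * (y * (N * a1 - n * a2)) = y * (P2 * a1 - P1 * a2)" unfolding N(2) m(1) by (simp add: algebra_simps)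
    also have "\<dots> = x * (P2 * b1 - P1 * b2)" unfolding id1 by (simp add: algebra_simps)
    also have "\<dots> = m * (x * (N * b1 - n * b2))" unfolding N(2) m(1) by (simp add: algebra_simps)
    finally show ?thesis .
  qed
  then have yx: "y * (N * a1 - n * a2) = x * (N * b1 - n * b2)" using m(3) by simp
  then have "x dvd y * (N * a1 - n * a2)" by simp
  then have "x dvd N * a1 - n * a2" using linear_prime[OF bf(1) bn(1) bf(2) diff3(2)] nd by blast
  then obtain k where k: "k \<in> forms 2" "N * a1 - n * a2 = x * k"
    using dvd_formsE[OF bf(1) bn(1), of _ 2] diff3(2) by (metis numeral_2_eq_2 numeral_3_eq_3)
  have "x * (y * k) = x * (N * b1 - n * b2)" using yx unfolding k(2) by (simp add: algebra_simps)
  then have k': "N * b1 - n * b2 = y * k" using bn(1) by simp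
  have "m * (x * k) = P2 * a1 - P1 * a2" unfolding k(2)[symmetric] N(2) m(1) by (simp add: algebra_simps)
  also have "\<dots> = - (x * E)" by (fact id1)
  finally have "x * E + m * (x * k) = 0" by simp
  then have "x * (E + m * k) = 0" by (simp add: distrib_left mult.left_commute)
  then have Ek: "E = - (m * k)" using bn(1) by (simp add: eq_neg_iff_add_eq_0)
  \<comment> \<open>Substituting \<open>E = - m k\<close> and \<open>P2 = m N\<close> in
    \<open>det\<close> produces a factor \<open>m^2\<close>, which is cancelled.\<close>
  have "m * (m * (c * n^2 - N * k)) = 0"
    using det unfolding Ek N(2) m(1) by (simp add: algebra_simps power2_eq_square)
  then have Nk: "c * n^2 = N * k" using m(3) by simp
  have z3: "c3 = - (z * P1 + P2)" unfolding c(3) P1 P2 by (simp add: algebra_simps)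
  show False
  proof (cases "n dvd N")
    case True
    then obtain N1 where N1: "N1 \<in> forms 1" "N = n * N1"
      using dvd_formsE[OF m(4,5), of N 1] N(1) by (metis One_nat_def numeral_2_eq_2)
    have "n dvd x * k" "n dvd y * k" unfolding k(2)[symmetric] k'[symmetric] N1(2) by simp_all
    then have "n dvd k"
      using linear_prime[OF m(4,5) bf(1) k(1)] linear_prime[OF m(4,5) bf(2) k(1)]
        linear_dvd_both[OF b m(4,5)] by blast
    then obtain k1 where k1: "k1 \<in> forms 1" "k = n * k1"
      using dvd_formsE[OF m(4,5), of k 1] k(1) by (metis One_nat_def numeral_2_eq_2)
    have a2: "a2 = N1 * a1 - x * k1"
    proof -
      have "n * (N1 * a1 - a2 - x * k1) = 0" using k(2) unfolding N1(2) k1(2) by (simp add: algebra_simps)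
      then have "N1 * a1 - a2 - x * k1 = 0" using m(5) by (simp only: mult_eq_0_iff) simp
      then show ?thesis by (simp add: algebra_simps)
    qed
    have b2: "b2 = N1 * b1 - y * k1"
    proof -
      have "n * (N1 * b1 - b2 - y * k1) = 0" using k' unfolding N1(2) k1(2) by (simp add: algebra_simps)
      then have "N1 * b1 - b2 - y * k1 = 0" using m(5) by (simp only: mult_eq_0_iff) simp
      then show ?thesis by (simp add: algebra_simps)
    qed
    have cc: "c = N1 * k1"
    proof -
      have "n^2 * (c - N1 * k1) = 0" using Nk unfolding N1(2) k1(2) by (simp add: algebra_simps power2_eq_square)
      then show ?thesis using m(5) by simp
    qed
    define g where "g = z + N1"
    have g: "c1 = g * (z * b1 - y * k1)" "c2 = g * (x * k1 - z * a1)" "c3 = g * (y * a1 - x * b1)"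
      unfolding c a2 b2 cc g_def by (simp_all add: algebra_simps)
    have "g \<noteq> 0" using g syzygyD(9)[OF s] unfolding indep3_def by (metis C_eq_0_iff add_0 mult_zero_left mult_zero_right one_neq_zero)
    moreover have "g \<in> forms 1" unfolding g_def using bf(3) N1(1) by (rule forms_add)
    ultimately have two_term_syzygy using syzygy_common_factor[OF s, of g] g by simp
    then show False using nt by contradiction
  next
    case False
    have "n dvd N * k" unfolding Nk[symmetric] by (simp add: power2_eq_square)
    then have "n dvd k" using linear_prime[OF m(4,5) N(1) k(1)] False by blast
    then obtain k1 where k1: "k1 \<in> forms 1" "k = n * k1"
      using dvd_formsE[OF m(4,5), of k 1] k(1) by (metis One_nat_def numeral_2_eq_2)
    have "n * (c * n - N * k1) = 0" using Nk unfolding k1(2) by (simp add: algebra_simps power2_eq_square)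
    then have Nk1: "c * n = N * k1" using m(5) by simp
    have "n dvd N * k1" unfolding Nk1[symmetric] by simp
    then have "n dvd k1" using linear_prime[OF m(4,5) N(1) k1(1)] False by blast
    then obtain \<kappa> where \<kappa>: "k1 = n * C \<kappa>"
      using dvd_formsE[OF m(4,5), of k1 0] k1(1) forms_0D by (metis One_nat_def)
    have "n * (c - N * C \<kappa>) = 0" using Nk1 unfolding \<kappa> by (simp add: algebra_simps)
    then have cc: "c = C \<kappa> * N" using m(5) by (simp add: mult.commute)
    have lin: "\<exists>\<beta>. p = C \<beta> * n" if p: "p \<in> forms 1" "n dvd N * p" for p
    proof -
      have "n dvd p" using linear_prime[OF m(4,5) N(1) p] False by blast
      then show ?thesis using dvd_formsE[OF m(4,5), of p 0] p(1) forms_0D by (metis One_nat_def mult.commute)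
    qed
    have "N * a1 = n * (a2 + x * k1)" "N * b1 = n * (b2 + y * k1)"
      using k(2) k' unfolding k1(2) by (simp_all add: algebra_simps)
    then have "n dvd N * a1" "n dvd N * b1" by simp_all
    then obtain \<alpha> \<beta> where ab: "a1 = C \<alpha> * n" "b1 = C \<beta> * n" using lin f(1,2) by blast
    have a2: "a2 = C \<alpha> * N - C \<kappa> * (x * n)"
    proof -
      have "n * (C \<alpha> * N - C \<kappa> * (x * n) - a2) = 0" using k(2) unfolding k1(2) \<kappa> ab by (simp add: algebra_simps)
      then show ?thesis using m(5) by simp
    qed
    have b2: "b2 = C \<beta> * N - C \<kappa> * (y * n)"
    proof -
      have "n * (C \<beta> * N - C \<kappa> * (y * n) - b2) = 0" using k' unfolding k1(2) \<kappa> ab by (simp add: algebra_simps)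
      then show ?thesis using m(5) by simp
    qed
    have "C \<alpha> * c1 + C \<beta> * c2 + C \<kappa> * c3 = 0"
      unfolding c a2 b2 cc ab by (simp add: algebra_simps)
    then have "\<alpha> = 0" "\<beta> = 0" using syzygyD(9)[OF s] unfolding indep3_def by blast+
    then have "P1 = 0" unfolding P1 ab by (simp add: C_simps)
    then show False using m by simp
  qed
qed

lemma linear_dvd_linear:
  fixes n :: "'a poly3"
  assumes "n \<in> forms 1" "n \<noteq> 0" "p \<in> forms 1" "n dvd p"
  shows "\<exists>\<beta>. p = C \<beta> * n"
  using dvd_formsE[OF assms(1,2), of p 0] assms(3,4) forms_0D by (metis One_nat_def mult.commute)

text \<open>If all lines through the point \<open>(0:0:1)\<close> divide a cubic of the ideal, then the relation
  \<open>P\<^sub>2 E + c P\<^sub>1\<^sup>2 = 0\<close> between binary forms holds, which forces \<open>P\<^sub>1 = 0\<close>.\<close>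

lemma eigenpoint_normal_form:
  assumes nt: "\<not> two_term_syzygy" and s: "syzygy x y z c1 c2 c3"
    and van: "\<And>v. ev v x = 0 \<Longrightarrow> ev v y = 0 \<Longrightarrow> ev v c1 = 0 \<and> ev v c2 = 0 \<and> ev v c3 = 0"
  obtains a b c where "a \<in> binary_forms x y 2" "b \<in> binary_forms x y 2" "c \<in> binary_forms x y 2"
    "c1 = z * b - y * c" "c2 = x * c - z * a" "c3 = y * a - x * b"
proof -
  note sD = syzygyD[OF s]
  note b = sD(1)
  note bf = basis3_forms[OF b] and bn = basis3_nonzero[OF b] and nd = basis3_not_dvd[OF b]
  have bz: "basis3 z x y" using basis3_swap12[OF basis3_swap23[OF b]] .
  obtain v0 where v0: "ev v0 x = 0" "ev v0 y = 0" "ev v0 z = 1" using basis3_ev[OF b] by blast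
  obtain a0 b0 c0 where abc0: "a0 \<in> forms 2" "b0 \<in> forms 2" "c0 \<in> forms 2"
    "c1 = z * b0 - y * c0" "c2 = x * c0 - z * a0" "c3 = y * a0 - x * b0"
    using koszul[OF b sD(2-4) sD(8)] .
  \<comment> \<open>Subtracting a linear multiple of \<open>(x, y, z)\<close> from
    \<open>(a0, b0, c0)\<close> does not change the cross product. The multiple \<open>l\<close> is
    chosen to free the third entry of \<open>z\<close>.\<close>
  obtain l c where l: "c0 = z * l + c" "c \<in> binary_forms x y 2" "l \<in> forms 1"
    using division_by_variable[OF bz abc0(3)] by auto
  have xl: "x * l \<in> forms 2" "y * l \<in> forms 2" using forms_mult'[OF bf(1) l(3), of 2] forms_mult'[OF bf(2) l(3), of 2] by simp_all
  obtain a1 a2 where a: "a0 - x * l = z * a1 + a2" "a2 \<in> binary_forms x y 2" "a1 \<in> forms 1"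
    using division_by_variable[OF bz, of "a0 - x * l" 2] abc0(1) xl by auto
  obtain b1 b2 where b': "b0 - y * l = z * b1 + b2" "b2 \<in> binary_forms x y 2" "b1 \<in> forms 1"
    using division_by_variable[OF bz, of "b0 - y * l" 2] abc0(2) xl by auto
  have c1: "c1 = z * (z * b1 + b2) - y * c" and c2: "c2 = x * c - z * (z * a1 + a2)" and c3: "c3 = y * (z * a1 + a2) - x * (z * b1 + b2)"
    unfolding abc0 a(1)[symmetric] b'(1)[symmetric] l(1) by (simp_all add: algebra_simps)
  have f2: "a2 \<in> forms 2" "b2 \<in> forms 2" "c \<in> forms 2" using binary_forms_subset_forms bf a b' l by blast+
  have b0v: "ev v a2 = 0" "ev v b2 = 0" "ev v c = 0" if "ev v x = 0" "ev v y = 0" for v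
    using binary_ev_0[of _ x y 1 v] a(2) b'(2) l(2) that by (simp_all add: numeral_2_eq_2)
  have lin: "p \<in> binary_forms x y 1" if p: "p \<in> forms 1" "ev v0 p = 0" for p
  proof -
    obtain q r t where e: "p = C q * x + C r * y + C t * z" using forms_1E[OF b p(1)] .
    then have "t = 0" using p(2) v0 by simp
    then show ?thesis using binary_forms_1[of q x r y] unfolding e by (simp add: C_simps)
  qed
  have a1b: "a1 \<in> binary_forms x y 1" by (rule lin[OF a(3)]) (use van[OF v0(1,2)] v0 b0v[OF v0(1,2)] in \<open>simp add: c2\<close>)
  have b1b: "b1 \<in> binary_forms x y 1" by (rule lin[OF b'(3)]) (use van[OF v0(1,2)] v0 b0v[OF v0(1,2)] in \<open>simp add: c1\<close>)
  obtain d where d: "d \<in> forms 3" "d \<in> I" "indep4 c1 c2 c3 d"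
    using extend_to_basis4[OF sD(2-7) sD(9)] .
  \<comment> \<open>The other three basis cubics vanish at the point, so a zero of \<open>d\<close>
    there would make it a base point.\<close>
  have d0: "ev v0 d \<noteq> 0"
  proof
    assume 0: "ev v0 d = 0"
    obtain k where k: "\<And>v. ev v x = 0 \<Longrightarrow> ev v y = 0 \<Longrightarrow> ev v d = k * ev v z ^ 3"
      using ev_on_axis[OF b d(1)] by blast
    then have k0: "k = 0" using k[of v0] 0 v0 by simp
    have two_term_syzygy
    proof (rule base_point[OF b])
      fix f v assume f: "f \<in> forms 3" "f \<in> I" and v: "ev v x = 0" "ev v y = 0"
      obtain p q r t where "f = C p * c1 + C q * c2 + C r * c3 + C t * d"
        using cubics_span[OF sD(2-4) d(1) sD(5-7) d(2,3) f] .
      then show "ev v f = 0" using van[OF v] k[OF v] k0 by simp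
    qed
    then show False using nt by contradiction
  qed
  define P1 P2 E where "P1 = x * b1 - y * a1" and "P2 = x * b2 - y * a2" and "E = a2 * b1 - a1 * b2"
  have P1f: "P1 \<in> forms 2" unfolding P1_def using forms_mult'[OF bf(1) b'(3), of 2] forms_mult'[OF bf(2) a(3), of 2] by auto
  have P2f: "P2 \<in> forms 3" unfolding P2_def using forms_mult'[OF bf(1) f2(2), of 3] forms_mult'[OF bf(2) f2(1), of 3] by auto
  have Ef: "E \<in> forms 3" unfolding E_def using forms_mult'[OF f2(1) b'(3), of 3] forms_mult'[OF a(3) f2(2), of 3] by auto
  have det: "P2 * E + c * P1^2 = 0"
  proof (rule form_zero_of_vanishing[of _ 6])
    have "P1^2 \<in> forms 4" using P1f by (rule forms_power) simp
    then show "P2 * E + c * P1^2 \<in> forms 6"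
      using forms_mult'[OF P2f Ef, of 6] forms_mult'[OF f2(3), of "P1^2" 4 6] by auto
    fix v
    define \<xi> \<eta> where "\<xi> = ev v x" and "\<eta> = ev v y"
    show "ev v (P2 * E + c * P1^2) = 0"
    proof (cases "\<xi> = 0 \<and> \<eta> = 0")
      case True
      then show ?thesis using b0v[of v] by (simp add: P2_def \<xi>_def \<eta>_def)
    next
      case False
      \<comment> \<open>The line joining \<open>(0:0:1)\<close> to the point with first coordinates
        \<xi>, \<eta>. Because \<open>d\<close> is nonzero at \<open>(0:0:1)\<close>, the cubic
        divisible by \<open>h\<close> involves only \<open>c1\<close>, \<open>c2\<close>,
        \<open>c3\<close>.\<close>
      define h where "h = C \<eta> * x - C \<xi> * y"
      have h: "h \<in> forms 1" unfolding h_def using bf by auto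
      have h0: "h \<noteq> 0"
      proof
        assume "h = 0"
        then have "C \<eta> * x + C (- \<xi>) * y + C 0 * z = 0" by (simp add: h_def C_simps)
        from linear_coeffs_zero[OF b this] show False using False by simp
      qed
      obtain p q r t where comb: "h dvd C p * c1 + C q * c2 + C r * c3 + C t * d" and nz: "p \<noteq> 0 \<or> q \<noteq> 0 \<or> r \<noteq> 0 \<or> t \<noteq> 0"
        using failure_combination[OF d(3) sD(2-4) d(1) sD(5-7) d(2) h h0] .
      have z0: "ev w (C p * c1 + C q * c2 + C r * c3 + C t * d) = 0" if w: "ev w h = 0" for w
      proof -
        obtain k where k: "C p * c1 + C q * c2 + C r * c3 + C t * d = h * k" using comb by blast
        show ?thesis unfolding k using w by simp
      qed
      have t: "t = 0" using z0[of v0] v0 van[of v0] d0 by (simp add: h_def)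
      define A1 B1 A2 B2 c' where "A1 = ev v a1" and "B1 = ev v b1" and "A2 = ev v a2" and "B2 = ev v b2" and "c' = ev v c"
      have "(r * (\<eta> * A2 - \<xi> * B2) + (q * \<xi> - p * \<eta>) * c') + (p * B2 - q * A2 + r * (\<eta> * A1 - \<xi> * B1)) * \<zeta> +
        (p * B1 - q * A1) * \<zeta>^2 + 0 * \<zeta>^3 = 0" for \<zeta>
      proof -
        obtain w where w: "ev w x = \<xi>" "ev w y = \<eta>" "ev w z = \<zeta>" using basis3_ev[OF b] by blast
        have same: "ev w f = ev v f" if "f \<in> binary_forms x y n" for f n
          by (rule binary_ev[OF that]) (use w in \<open>simp_all add: \<xi>_def \<eta>_def\<close>)
        have "ev w h = 0" using w by (simp add: h_def)
        from z0[OF this] show ?thesis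
          unfolding c1 c2 c3 t using w same[OF a1b] same[OF b1b] same[OF a(2)] same[OF b'(2)] same[OF l(2)]
          by (simp add: A1_def B1_def A2_def B2_def c'_def algebra_simps power2_eq_square)
      qed
      from cubic_polynomial_zero[OF this]
      have eqs: "r * (\<eta> * A2 - \<xi> * B2) + (q * \<xi> - p * \<eta>) * c' = 0"
        "p * B2 - q * A2 + r * (\<eta> * A1 - \<xi> * B1) = 0" "p * B1 - q * A1 = 0" by blast+
      \<comment> \<open>Up to sign the determinant of the three equations, regarded as a linear
        system in \<open>p\<close>, \<open>q\<close>, \<open>r\<close>.\<close>
      define D where "D = (\<xi> * B2 - \<eta> * A2) * (A2 * B1 - A1 * B2) + c' * (\<xi> * B1 - \<eta> * A1)^2"
      have "p * D = 0" using eqs unfolding D_def by Groebner_Basis.algebra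
      moreover have "q * D = 0" using eqs unfolding D_def by Groebner_Basis.algebra
      moreover have "r * D = 0" using eqs unfolding D_def by Groebner_Basis.algebra
      ultimately have "D = 0" using nz t by auto
      then show ?thesis
        by (simp add: D_def P1_def P2_def E_def A1_def B1_def A2_def B2_def c'_def \<xi>_def \<eta>_def)
    qed
  qed
  have id1: "P2 * b1 - P1 * b2 = - (y * E)" "P2 * a1 - P1 * a2 = - (x * E)"
    unfolding P1_def P2_def E_def by (simp_all add: algebra_simps)
  have z3: "c3 = - (z * P1 + P2)" unfolding c3 P1_def P2_def by (simp add: algebra_simps)
  have P1_0: "P1 = 0"
  proof (rule ccontr)
    assume P1_nz: "P1 \<noteq> 0"
    have "P1 \<in> binary_forms x y (Suc 1)" unfolding P1_def
      by (intro binary_forms_diff binary_forms_mult_left binary_forms_mult_right b1b a1b)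
    then obtain \<alpha> \<gamma> where m: "\<alpha> \<noteq> 0 \<or> \<gamma> \<noteq> 0" "(C \<alpha> * x + C \<gamma> * y) dvd P1"
      using binary_linear_factor[OF bz] by blast
    define m where "m = C \<alpha> * x + C \<gamma> * y"
    have mf: "m \<in> forms 1" unfolding m_def using bf by auto
    have m0: "m \<noteq> 0" using m(2) P1_nz by (auto simp: m_def)
    obtain n where n: "n \<in> forms 1" "P1 = m * n"
      using dvd_formsE[OF mf m0, of P1 1] P1f m(2) by (metis m_def One_nat_def numeral_2_eq_2)
    have n0: "n \<noteq> 0" using n P1_nz by auto
    have mP: "\<not> m dvd P2"
      by (rule cofactor_cases[OF nt s c1 c2 c3 a(3) b'(3) f2 P1_def P2_def E_def det n(2) mf m0 n(1) n0])
    have nP: "\<not> n dvd P2"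
      by (rule cofactor_cases[OF nt s c1 c2 c3 a(3) b'(3) f2 P1_def P2_def E_def det _ n(1) n0 mf m0]) (simp add: n mult.commute)
    \<comment> \<open>Neither factor of \<open>P1\<close> divides \<open>P2\<close>, so both divide
      \<open>E\<close>. Cancelling them leaves the scalars \<kappa>, \<beta>, \<delta>, each of
      which is zero because \<open>n\<close> does not divide \<open>P2\<close>.\<close>
    have "P2 * E = m * (n * (- (c * m * n)))" using det unfolding n(2)
      by (simp add: eq_neg_iff_add_eq_0 algebra_simps power2_eq_square)
    then have "m dvd P2 * E" "n dvd P2 * E" by simp_all
    then have mE: "m dvd E" "n dvd E" using linear_prime[OF mf m0 P2f Ef] linear_prime[OF n(1) n0 P2f Ef] mP nP by blast+
    have "P2 * b1 = P1 * b2 - y * E" "P2 * a1 = P1 * a2 - x * E" using id1 by (simp_all add: algebra_simps)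
    then have "m dvd P2 * b1" "m dvd P2 * a1" using mE unfolding n(2) by (auto intro!: dvd_diff)
    then have "m dvd b1" "m dvd a1" using linear_prime[OF mf m0 P2f b'(3)] linear_prime[OF mf m0 P2f a(3)] mP by blast+
    then obtain \<beta> \<delta> where ab: "b1 = C \<beta> * m" "a1 = C \<delta> * m" using linear_dvd_linear[OF mf m0] b'(3) a(3) by blast
    define T where "T = C \<beta> * a2 - C \<delta> * b2"
    have "T \<in> forms 2" unfolding T_def using f2 by auto
    moreover have "E = m * T" unfolding T_def E_def ab by (simp add: algebra_simps)
    ultimately have T: "T \<in> forms 2" "E = m * T" by blast+
    have "m * (P2 * T + c * m * n^2) = 0" using det unfolding T(2) n(2) by (simp add: algebra_simps power2_eq_square)
    then have PT: "P2 * T = - (c * m * n^2)" using m0 by (simp add: eq_neg_iff_add_eq_0)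
    then have "m dvd P2 * T" by simp
    then have "m dvd T" using linear_prime[OF mf m0 P2f T(1)] mP by blast
    then obtain T1 where T1: "T1 \<in> forms 1" "T = m * T1"
      using dvd_formsE[OF mf m0, of T 1] T(1) by (metis One_nat_def numeral_2_eq_2)
    have "m * (P2 * T1 + c * n^2) = 0" using PT unfolding T1(2) by (simp add: algebra_simps)
    then have PT1: "P2 * T1 = - (c * n^2)" using m0 by (simp add: eq_neg_iff_add_eq_0)
    then have "n dvd P2 * T1" by (simp add: power2_eq_square)
    then have "n dvd T1" using linear_prime[OF n(1) n0 P2f T1(1)] nP by blast
    then obtain \<kappa> where \<kappa>: "T1 = C \<kappa> * n" using linear_dvd_linear[OF n(1) n0 T1(1)] by blast
    have scalar: "\<mu> = 0" if "C \<mu> * P2 = n * u" for \<mu> u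
    proof (rule ccontr)
      assume "\<mu> \<noteq> 0"
      then have "P2 = n * (C (inverse \<mu>) * u)" using C_inverse[of \<mu> P2] that by (simp add: mult.left_commute)
      then show False using nP by simp
    qed
    have "n * (C \<kappa> * P2 + n * c) = 0" using PT1 unfolding \<kappa> by (simp add: algebra_simps power2_eq_square)
    then have "C \<kappa> * P2 = n * (- c)" using n0 by (simp add: eq_neg_iff_add_eq_0)
    then have "\<kappa> = 0" by (rule scalar)
    then have E0: "E = 0" using T(2) T1(2) \<kappa> by (simp add: C_simps)
    have "m * (C \<beta> * P2 - n * b2) = 0" "m * (C \<delta> * P2 - n * a2) = 0"
      using id1 unfolding E0 ab n(2) by (simp_all add: algebra_simps)
    then have "C \<beta> * P2 = n * b2" "C \<delta> * P2 = n * a2" using m0 by simp_all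
    then have "\<beta> = 0" "\<delta> = 0" using scalar by blast+
    then have "P1 = 0" unfolding P1_def ab by (simp add: C_simps)
    then show False using P1_nz by contradiction
  qed
  have P2_0: "P2 \<noteq> 0"
  proof
    assume "P2 = 0"
    then have "C 0 * c1 + C 0 * c2 + C 1 * c3 = 0" using z3 P1_0 by (simp add: C_simps)
    then show False using sD(9) unfolding indep3_def by (metis one_neq_zero)
  qed
  have "E = 0" using det P1_0 P2_0 by simp
  then have "a1 = 0" "b1 = 0" using id1 P1_0 P2_0 by simp_all
  then show ?thesis using that[OF a(2) b'(2) l(2)] c1 c2 c3 by simp
qed

end

section \<open>Nets of cubics singular at the eigenpoint\<close>

lemma binary_forms_2E:
  assumes "f \<in> binary_forms y z 2"
  obtains a b c where "f = C a * y^2 + C b * (y*z) + C c * z^2"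
proof -
  obtain e where "f = (\<Sum>i\<le>2. C (e i) * y^i * z^(2 - i))" using assms by (auto simp: binary_forms_def)
  then have "f = C (e 2) * y^2 + C (e 1) * (y*z) + C (e 0) * z^2" by (simp add: numeral_2_eq_2 algebra_simps)
  then show ?thesis using that by blast
qed

lemma binary_forms_2I: "C a * y^2 + C b * (y*z) + C c * z^2 \<in> binary_forms y z 2"
proof -
  have "y * (C a * y + C b * z) + z * (C 0 * y + C c * z) \<in> binary_forms y z (Suc 1)"
    by (intro binary_forms_add binary_forms_mult_left binary_forms_mult_right binary_forms_1)
  then show ?thesis by (simp add: C_simps algebra_simps power2_eq_square numeral_2_eq_2)
qed

lemma binary_forms_2_change:
  assumes "f \<in> binary_forms x y 2" "x = C p * u + C q * w" "y = C r * u + C s * w"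
  shows "f \<in> binary_forms u w 2"
proof -
  obtain a b c where "f = C a * x^2 + C b * (x*y) + C c * y^2" using binary_forms_2E[OF assms(1)] .
  then have "f = C (a * p * p + b * p * r + c * r * r) * u^2 + C (a * 2 * p * q + b * (p * s + q * r) + c * 2 * r * s) * (u * w) +
      C (a * q * q + b * q * s + c * s * s) * w^2"
    unfolding assms(2,3) by (simp add: C_simps algebra_simps power2_eq_square)
  then show ?thesis using binary_forms_2I by metis
qed

context lefschetz_failure
begin

text \<open>With \<open>a\<close>, \<open>b\<close>, \<open>c\<close> free of \<open>z\<close>, each
  of the three cubics is singular at \<open>(0:0:1)\<close>, and \<open>c3\<close> is a binary cubic
  in \<open>x\<close>, \<open>y\<close>.\<close>

definition normal :: "'a poly3 \<Rightarrow> 'a poly3 \<Rightarrow> 'a poly3 \<Rightarrow> 'a poly3 \<Rightarrow> 'a poly3 \<Rightarrow> 'a poly3 \<Rightarrow> 'a poly3 \<Rightarrow> 'a poly3 \<Rightarrow> 'a poly3 \<Rightarrow> bool"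
  where "normal x y z a b c c1 c2 c3 \<longleftrightarrow> syzygy x y z c1 c2 c3 \<and>
    a \<in> binary_forms x y 2 \<and> b \<in> binary_forms x y 2 \<and> c \<in> binary_forms x y 2 \<and>
    c1 = z * b - y * c \<and> c2 = x * c - z * a \<and> c3 = y * a - x * b"

lemma normal_swap:
  assumes "normal x y z a b c c1 c2 c3"
  shows "normal y x z (- b) (- a) (- c) c2 c1 c3"
proof -
  have flip: "- f \<in> binary_forms y x 2" if f: "f \<in> binary_forms x y 2" for f
  proof -
    obtain p q r where "f = C p * x^2 + C q * (x*y) + C r * y^2" using binary_forms_2E[OF f] .
    then have "- f = C (- r) * y^2 + C (- q) * (y*x) + C (- p) * x^2" by (simp add: C_simps algebra_simps)
    then show ?thesis using binary_forms_2I by metis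
  qed
  show ?thesis using assms syzygy_swap12 unfolding normal_def by (auto simp: flip)
qed

text \<open>The vector \<open>(a, b, c)\<close> is adapted so that it still has the cubics as cross
  product with the new coordinates. Since \<open>c3\<close> stays the same, its linear factors can
  be moved to \<open>y\<close> one at a time.\<close>

lemma normal_shear:
  assumes n: "normal x y z a b c c1 c2 c3" and "\<mu>2 \<noteq> 0" and m: "m = C \<mu>1 * x + C \<mu>2 * y"
  shows "normal x m z (C (1/\<mu>2) * a) (b + C (\<mu>1/\<mu>2) * a) (C (1/\<mu>2) * c) (c1 - C (\<mu>1/\<mu>2) * c2) (C (1/\<mu>2) * c2) c3"
proof -
  have s: "syzygy x y z c1 c2 c3" using n unfolding normal_def by blast
  note sD = syzygyD[OF s]
  have one: "C \<mu>2 * C (1/\<mu>2) = 1" using assms(2) by (simp add: C_simps(4)[symmetric] C_simps(2))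
  have frac: "C (\<mu>1/\<mu>2) = C \<mu>1 * C (1/\<mu>2)" by (simp add: C_simps(4)[symmetric])
  have onef: "C \<mu>2 * (C (1/\<mu>2) * f) = f" for f using one by (simp add: mult.assoc[symmetric])
  have b: "basis3 x m z" using basis3_change2[OF sD(1) assms(2), of m \<mu>1 0] m by (simp add: C_simps)
  have ind: "indep3 (c1 - C (\<mu>1/\<mu>2) * c2) (C (1/\<mu>2) * c2) c3" unfolding indep3_def
  proof (intro allI impI)
    fix p q r assume "C p * (c1 - C (\<mu>1/\<mu>2) * c2) + C q * (C (1/\<mu>2) * c2) + C r * c3 = 0"
    then have "C p * c1 + C (q * (1/\<mu>2) - p * (\<mu>1/\<mu>2)) * c2 + C r * c3 = 0"
      by (simp only: C_simps algebra_simps)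
    then have "p = 0" "q * (1/\<mu>2) - p * (\<mu>1/\<mu>2) = 0" "r = 0" using sD(9) unfolding indep3_def by blast+
    then show "p = 0 \<and> q = 0 \<and> r = 0" using assms(2) by simp
  qed
  have "x * (c1 - C (\<mu>1/\<mu>2) * c2) + m * (C (1/\<mu>2) * c2) + z * c3 = x * c1 + C \<mu>2 * (C (1/\<mu>2) * (y * c2)) + z * c3"
    unfolding m frac by (simp add: algebra_simps)
  also have "\<dots> = 0" unfolding onef by (fact sD(8))
  finally have e: "x * (c1 - C (\<mu>1/\<mu>2) * c2) + m * (C (1/\<mu>2) * c2) + z * c3 = 0" .
  have syz: "syzygy x m z (c1 - C (\<mu>1/\<mu>2) * c2) (C (1/\<mu>2) * c2) c3"
    unfolding syzygy_def using b ind e sD(2-7) by auto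
  have x: "x = C 1 * x + C 0 * m" by (simp add: C_simps)
  have "C (1/\<mu>2) * m = C (\<mu>1/\<mu>2) * x + C \<mu>2 * (C (1/\<mu>2) * y)" unfolding m frac by (simp add: algebra_simps)
  then have "y = C (1/\<mu>2) * m - C (\<mu>1/\<mu>2) * x" unfolding onef by simp
  then have y: "y = C (- (\<mu>1/\<mu>2)) * x + C (1/\<mu>2) * m" by (simp add: C_simps)
  have bin: "f \<in> binary_forms x m 2" if "f \<in> binary_forms x y 2" for f
    by (rule binary_forms_2_change[OF that x y])
  have nD: "a \<in> binary_forms x y 2" "b \<in> binary_forms x y 2" "c \<in> binary_forms x y 2"
     "c1 = z * b - y * c" "c2 = x * c - z * a" "c3 = y * a - x * b" using n by (auto simp: normal_def)
  have "c1 - C (\<mu>1/\<mu>2) * c2 = z * (b + C (\<mu>1/\<mu>2) * a) - (C \<mu>2 * (C (1/\<mu>2) * (y * c)) + C (\<mu>1/\<mu>2) * x * c)"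
    unfolding nD(4,5) onef by (simp add: algebra_simps)
  also have "C \<mu>2 * (C (1/\<mu>2) * (y * c)) + C (\<mu>1/\<mu>2) * x * c = m * (C (1/\<mu>2) * c)"
    unfolding m frac by (simp add: algebra_simps)
  finally have 1: "c1 - C (\<mu>1/\<mu>2) * c2 = z * (b + C (\<mu>1/\<mu>2) * a) - m * (C (1/\<mu>2) * c)" .
  have 2: "C (1/\<mu>2) * c2 = x * (C (1/\<mu>2) * c) - z * (C (1/\<mu>2) * a)" unfolding nD(5) by (simp add: algebra_simps)
  have "m * (C (1/\<mu>2) * a) - x * (b + C (\<mu>1/\<mu>2) * a) = C \<mu>2 * (C (1/\<mu>2) * (y * a)) - x * b"
    unfolding m frac by (simp add: algebra_simps)
  then have 3: "c3 = m * (C (1/\<mu>2) * a) - x * (b + C (\<mu>1/\<mu>2) * a)" unfolding onef nD(6) by simp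
  show ?thesis unfolding normal_def
    using syz 1 2 3 nD(1-3) by (auto intro!: bin binary_forms_C_mult binary_forms_add)
qed

text \<open>If \<open>y\<close> did not divide \<open>a\<close>, then there would be a second eigenpoint on the line \<open>y = 0\<close>,
  at which not all cubics of the net are singular.\<close>

lemma normal_factor:
  assumes nt: "\<not> two_term_syzygy" and n: "normal x y z a b c c1 c2 c3" and dv: "y dvd c3"
  shows "y dvd a \<and> y dvd b"
proof -
  have s: "syzygy x y z c1 c2 c3" using n unfolding normal_def by blast
  note sD = syzygyD[OF s]
  note bf = basis3_forms[OF sD(1)] and bn = basis3_nonzero[OF sD(1)] and nd = basis3_not_dvd[OF sD(1)]
  have nD: "a \<in> binary_forms x y 2" "b \<in> binary_forms x y 2" "c \<in> binary_forms x y 2"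
     "c1 = z * b - y * c" "c2 = x * c - z * a" "c3 = y * a - x * b" using n by (auto simp: normal_def)
  have bf2: "b \<in> forms 2" using binary_forms_subset_forms bf nD by blast
  have "x * b = y * a - c3" using nD(6) by simp
  then have "y dvd x * b" using dv by (auto intro: dvd_diff)
  then have yb: "y dvd b" using linear_prime[OF bf(2) bn(2) bf(1) bf2] nd by blast
  obtain \<omega> a1 a2 where a: "a = C \<omega> * x^2 + C a1 * (x*y) + C a2 * y^2" using binary_forms_2E[OF nD(1)] .
  obtain c0 c4 c5 where c: "c = C c0 * x^2 + C c4 * (x*y) + C c5 * y^2" using binary_forms_2E[OF nD(3)] .
  have "\<omega> = 0"
  proof (rule ccontr)
    assume \<omega>: "\<omega> \<noteq> 0"
    \<comment> \<open>Chosen to cancel the term \<open>x^2\<close> of \<open>c - \<rho> a\<close>.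
      With \<open>z'\<close> in place of \<open>z\<close>, the point \<open>z' = y = 0\<close>
      becomes an eigenpoint as well.\<close>
    define \<rho> where "\<rho> = c0 / \<omega>"
    define z' where "z' = z - C \<rho> * x"
    define c' where "c' = c - C \<rho> * a"
    define e1 where "e1 = c1 + C \<rho> * c3"
    have e1: "e1 = z' * b - y * c'" unfolding e1_def z'_def c'_def nD by (simp add: algebra_simps)
    have c2: "c2 = x * c' - z' * a" unfolding z'_def c'_def nD by (simp add: algebra_simps)
    have b': "basis3 x y z'" using basis3_change3[OF sD(1), of 1 z' "- \<rho>" 0] by (simp add: z'_def C_simps)
    have ind: "indep3 e1 c2 c3" unfolding indep3_def
    proof (intro allI impI)
      fix p q r assume "C p * e1 + C q * c2 + C r * c3 = 0"
      then have "C p * c1 + C q * c2 + C (r + p * \<rho>) * c3 = 0" unfolding e1_def by (simp add: C_simps algebra_simps)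
      then have "p = 0" "q = 0" "r + p * \<rho> = 0" using sD(9) unfolding indep3_def by blast+
      then show "p = 0 \<and> q = 0 \<and> r = 0" by simp
    qed
    have "x * e1 + y * c2 + z' * c3 = x * c1 + y * c2 + z * c3" unfolding e1_def z'_def by (simp add: algebra_simps)
    then have "x * e1 + y * c2 + z' * c3 = 0" using sD(8) by simp
    then have "syzygy x y z' e1 c2 c3"
      unfolding syzygy_def using b' ind sD(2-7) by (auto simp: e1_def)
    then have s': "syzygy z' y x c3 c2 e1" using syzygy_swap12 syzygy_swap23 by blast
    have c'e: "c' = y * (C (c4 - \<rho> * a1) * x + C (c5 - \<rho> * a2) * y)"
    proof -
      have "C c0 = C \<rho> * C \<omega>" using \<omega> by (simp add: \<rho>_def C_simps(4)[symmetric])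
      then show ?thesis unfolding c'_def c a by (simp add: C_simps algebra_simps power2_eq_square)
    qed
    obtain b'' where b'': "b = y * b''" using yb by blast
    have van: "ev v c3 = 0 \<and> ev v c2 = 0 \<and> ev v e1 = 0" if "ev v z' = 0" "ev v y = 0" for v
      using that unfolding nD(6) c2 e1 c'e b'' by simp
    obtain \<alpha> \<beta> \<gamma> where abg: "\<alpha> \<in> binary_forms z' y 2" "\<gamma> \<in> binary_forms z' y 2" "c2 = z' * \<gamma> - x * \<alpha>"
      using eigenpoint_normal_form[OF nt s' van] by blast
    obtain \<alpha>1 \<alpha>2 \<alpha>3 where \<alpha>: "\<alpha> = C \<alpha>1 * z'^2 + C \<alpha>2 * (z'*y) + C \<alpha>3 * y^2" using binary_forms_2E[OF abg(1)] .
    obtain \<gamma>1 \<gamma>2 \<gamma>3 where \<gamma>: "\<gamma> = C \<gamma>1 * z'^2 + C \<gamma>2 * (z'*y) + C \<gamma>3 * y^2" using binary_forms_2E[OF abg(2)] .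
    \<comment> \<open>On \<open>y = 0\<close> the normal form at the second eigenpoint is at most
      linear in \<open>x\<close>, whereas \<open>c2\<close> restricts to
      \<open>- \<omega> z' x^2\<close> there.\<close>
    have "\<gamma>1 + (- \<alpha>1) * t + \<omega> * t^2 + 0 * t^3 = 0" for t
    proof -
      obtain v where v: "ev v x = t" "ev v y = 0" "ev v z' = 1" using basis3_ev[OF b'] by blast
      have "ev v (z' * \<gamma> - x * \<alpha>) = ev v (x * c' - z' * a)" using abg(3) c2 by simp
      then show ?thesis using v unfolding \<alpha> \<gamma> c'e a by (simp add: algebra_simps)
    qed
    from cubic_polynomial_zero(3)[OF this] show False using \<omega> by contradiction
  qed
  then have "a = y * (C a1 * x + C a2 * y)" unfolding a by (simp add: C_simps algebra_simps power2_eq_square)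
  then show ?thesis using yb by simp
qed

lemma normal_linear_factor:
  assumes nt: "\<not> two_term_syzygy" and n: "normal x y z a b c c1 c2 c3"
    and m: "m = C \<mu>1 * x + C \<mu>2 * y" "m \<noteq> 0" "m dvd c3"
  shows "m dvd a \<and> m dvd b"
proof (cases "\<mu>2 = 0")
  case False
  have 1: "m dvd C (1/\<mu>2) * a" "m dvd b + C (\<mu>1/\<mu>2) * a"
    using normal_factor[OF nt normal_shear[OF n False m(1)] m(3)] by blast+
  have "a = C \<mu>2 * (C (1/\<mu>2) * a)" using False by (simp add: mult.assoc[symmetric] C_simps(4)[symmetric] C_simps(2))
  then have ma: "m dvd a" using 1(1) by (metis dvd_mult)
  then have "m dvd b" using 1(2) by (metis dvd_add_left_iff dvd_mult)
  then show ?thesis using ma by blast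
next
  case True
  then have \<mu>1: "\<mu>1 \<noteq> 0" "m = C \<mu>1 * x" using m by (auto simp: C_simps)
  have x: "m dvd f" if xf: "x dvd f" for f
  proof -
    obtain k where k: "f = x * k" using xf by blast
    have "x = C (inverse \<mu>1) * m" using C_inverse[OF \<mu>1(1)] \<mu>1(2) by simp
    then have "f = m * (C (inverse \<mu>1) * k)" using k by (simp add: ac_simps)
    then show ?thesis by simp
  qed
  have "x dvd c3" using m(3) \<mu>1(2) by (metis dvd_mult_right)
  then have "x dvd - b \<and> x dvd - a" using normal_factor[OF nt normal_swap[OF n]] by blast
  then show ?thesis using x by simp
qed

lemma normal_first:
  assumes n: "normal x y z a b c c1 c2 c3" and m: "m = C \<mu>1 * x + C \<mu>2 * y" "m \<noteq> 0"
  shows "\<exists>x' a' b' c' c1' c2'. normal x' m z a' b' c' c1' c2' c3"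
proof (cases "\<mu>2 = 0")
  case False
  show ?thesis using normal_shear[OF n False m(1)] by blast
next
  case True
  then have \<mu>1: "\<mu>1 \<noteq> 0" using m by (auto simp: C_simps)
  have "m = C \<mu>2 * y + C \<mu>1 * x" using m(1) by simp
  from normal_shear[OF normal_swap[OF n] \<mu>1 this] show ?thesis by blast
qed

text \<open>Each linear factor of the binary cubic \<open>c3\<close> divides both \<open>a\<close>
  and \<open>b\<close>. With \<open>c3 = y m k\<close> and \<open>m\<close> not proportional to
  \<open>y\<close>, the quadrics \<open>a\<close>, \<open>b\<close> are scalar multiples of
  \<open>y m\<close>, so \<open>k\<close> has to be proportional to \<open>y\<close> or to
  \<open>m\<close>.\<close>

lemma normal_square_factor:
  assumes nt: "\<not> two_term_syzygy" and n0: "normal x0 y0 z a0 b0 c0 c10 c20 c3"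
  shows "\<exists>x y a b c c1 c2. normal x y z a b c c1 c2 c3 \<and> y^2 dvd c3"
proof -
  have s0: "syzygy x0 y0 z c10 c20 c3" using n0 unfolding normal_def by blast
  have bz0: "basis3 z x0 y0" using basis3_swap12[OF basis3_swap23[OF syzygyD(1)[OF s0]]] .
  have c3e0: "c3 = y0 * a0 - x0 * b0" "a0 \<in> binary_forms x0 y0 2" "b0 \<in> binary_forms x0 y0 2" using n0 by (auto simp: normal_def)
  have "c3 \<in> binary_forms x0 y0 (Suc 2)"
    unfolding c3e0(1) by (intro binary_forms_diff binary_forms_mult_left binary_forms_mult_right c3e0)
  then obtain \<mu>1 \<mu>2 where \<mu>: "\<mu>1 \<noteq> 0 \<or> \<mu>2 \<noteq> 0" "(C \<mu>1 * x0 + C \<mu>2 * y0) dvd c3"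
    using binary_linear_factor[OF bz0] by blast
  define y where "y = C \<mu>1 * x0 + C \<mu>2 * y0"
  have y0: "y \<noteq> 0"
  proof
    assume "y = 0"
    then have "C 0 * z + C \<mu>1 * x0 + C \<mu>2 * y0 = 0" by (simp add: y_def C_simps)
    from linear_coeffs_zero[OF bz0 this] show False using \<mu>(1) by simp
  qed
  obtain x a b c c1 c2 where n: "normal x y z a b c c1 c2 c3" using normal_first[OF n0 y_def y0] by blast
  have dv: "y dvd c3" using \<mu>(2) by (simp add: y_def)
  have s: "syzygy x y z c1 c2 c3" using n unfolding normal_def by blast
  note sD = syzygyD[OF s]
  note bf = basis3_forms[OF sD(1)] and bn = basis3_nonzero[OF sD(1)] and nd = basis3_not_dvd[OF sD(1)]
  have bz: "basis3 z x y" using basis3_swap12[OF basis3_swap23[OF sD(1)]] .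
  have nD: "a \<in> binary_forms x y 2" "b \<in> binary_forms x y 2" "c3 = y * a - x * b" using n by (auto simp: normal_def)
  have yab: "y dvd a" "y dvd b" using normal_factor[OF nt n dv] by blast+
  have y_form: "\<exists>r t. f = y * (C r * x + C t * y)" if f: "f \<in> binary_forms x y 2" "y dvd f" for f
  proof -
    obtain q r t where e: "f = C q * x^2 + C r * (x*y) + C t * y^2" using binary_forms_2E[OF f(1)] .
    obtain k where k: "f = y * k" using f(2) by blast
    obtain v where "ev v x = 1" "ev v y = 0" using basis3_ev[OF sD(1)] by blast
    then have "q = 0" using arg_cong[OF k, of "ev v"] by (simp add: e)
    then show ?thesis by (intro exI[of _ r] exI[of _ t]) (simp add: e C_simps algebra_simps power2_eq_square)
  qed
  obtain a1 a2 where a: "a = y * (C a1 * x + C a2 * y)" using y_form[OF nD(1) yab(1)] by blast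
  obtain b1 b2 where b: "b = y * (C b1 * x + C b2 * y)" using y_form[OF nD(2) yab(2)] by blast
  define e where "e = y * (C a1 * x + C a2 * y) - x * (C b1 * x + C b2 * y)"
  have c3: "c3 = y * e" unfolding nD(3) a b e_def by (simp add: algebra_simps)
  have "e \<in> binary_forms x y (Suc 1)"
    unfolding e_def by (intro binary_forms_diff binary_forms_mult_left binary_forms_mult_right binary_forms_1)
  then obtain \<nu>1 \<nu>2 where \<nu>: "\<nu>1 \<noteq> 0 \<or> \<nu>2 \<noteq> 0" "(C \<nu>1 * x + C \<nu>2 * y) dvd e"
    using binary_linear_factor[OF bz] by blast
  define m where "m = C \<nu>1 * x + C \<nu>2 * y"
  have me: "m dvd e" using \<nu>(2) by (simp add: m_def)
  have mf: "m \<in> forms 1" unfolding m_def using bf by auto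
  have m0: "m \<noteq> 0"
  proof
    assume "m = 0"
    then have "C 0 * z + C \<nu>1 * x + C \<nu>2 * y = 0" by (simp add: m_def C_simps)
    from linear_coeffs_zero[OF bz this] show False using \<nu>(1) by simp
  qed
  show ?thesis
  proof (cases "m dvd y")
    case True
    then obtain \<beta> where \<beta>: "y = C \<beta> * m" using linear_dvd_linear[OF mf m0 bf(2)] by blast
    have "\<beta> \<noteq> 0" using \<beta> y0 by (auto simp: C_simps)
    then have "m = C (inverse \<beta>) * y" using C_inverse[of \<beta> m] \<beta> by simp
    then have "y dvd m" by simp
    then have "y dvd e" using me dvd_trans by blast
    then have "y^2 dvd c3" unfolding c3 power2_eq_square by (intro mult_dvd_mono) auto
    then show ?thesis using n by blast
  next
    case False
    have "m dvd c3" using me c3 by simp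
    then have mab: "m dvd a" "m dvd b" using normal_linear_factor[OF nt n m_def m0] by blast+
    have lin: "C r * x + C t * y \<in> forms 1" for r t using bf by auto
    have "m dvd C a1 * x + C a2 * y" "m dvd C b1 * x + C b2 * y"
      using linear_prime[OF mf m0 bf(2) lin] mab False unfolding a b by blast+
    then obtain s' t' where st: "C a1 * x + C a2 * y = C s' * m" "C b1 * x + C b2 * y = C t' * m"
      using linear_dvd_linear[OF mf m0 lin] by blast
    define k where "k = C (- t') * x + C s' * y"
    have ek: "e = m * k" unfolding e_def st k_def by (simp add: C_simps algebra_simps)
    have c3nz: "c3 \<noteq> 0"
    proof
      assume "c3 = 0"
      then have "C 0 * c1 + C 0 * c2 + C 1 * c3 = 0" by (simp add: C_simps)
      then show False using sD(9) unfolding indep3_def by (metis one_neq_zero)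
    qed
    have k0: "k \<noteq> 0" using c3nz c3 ek by auto
    have kf: "k \<in> forms 1" unfolding k_def by (rule lin)
    have "k dvd c3" unfolding c3 ek by simp
    then have kab: "k dvd a" "k dvd b" using normal_linear_factor[OF nt n k_def k0] by blast+
    have ab: "a = C s' * (y * m)" "b = C t' * (y * m)" unfolding a b st by (simp_all add: ac_simps)
    have "s' \<noteq> 0 \<or> t' \<noteq> 0" using k0 by (auto simp: k_def C_simps)
    then have "k dvd y * m" using kab unfolding ab by (metis C_inverse dvd_mult)
    then have "k dvd y \<or> k dvd m" using linear_prime[OF kf k0 bf(2) mf] by blast
    then show ?thesis
    proof
      assume "k dvd y"
      then obtain \<beta> where \<beta>: "y = C \<beta> * k" using linear_dvd_linear[OF kf k0 bf(2)] by blast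
      have "\<beta> \<noteq> 0" using \<beta> y0 by (auto simp: C_simps)
      then have "k = C (inverse \<beta>) * y" using C_inverse[of \<beta> k] \<beta> by simp
      then have "c3 = y^2 * (C (inverse \<beta>) * m)" unfolding c3 ek by (simp add: power2_eq_square ac_simps)
      then have "y^2 dvd c3" by simp
      then show ?thesis using n by blast
    next
      assume "k dvd m"
      then obtain \<beta> where \<beta>: "m = C \<beta> * k" using linear_dvd_linear[OF kf k0 mf] by blast
      have "\<beta> \<noteq> 0" using \<beta> m0 by (auto simp: C_simps)
      then have "k = C (inverse \<beta>) * m" using C_inverse[of \<beta> k] \<beta> by simp
      then have "c3 = m^2 * (C (inverse \<beta>) * y)" unfolding c3 ek by (simp add: power2_eq_square ac_simps)
      then have "m^2 dvd c3" by simp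
      then show ?thesis using normal_first[OF n m_def m0] by blast
    qed
  qed
qed

text \<open>Here \<open>c3\<close> is \<open>y^2\<close> times a linear form \<open>m\<close>. If
  \<open>m\<close> is independent of \<open>y\<close>, it divides \<open>b\<close>, which forces
  \<open>b = 0\<close>, and \<open>m\<close> becomes the new \<open>x\<close>; if \<open>m\<close>
  is proportional to \<open>y\<close>, the second alternative results.\<close>

lemma normal_types:
  assumes nt: "\<not> two_term_syzygy" and n0: "normal x0 y0 z a0 b0 c0 c10 c20 c30"
  shows "\<exists>x y a b c c1 c2 c3 \<beta> \<gamma>. normal x y z a b c c1 c2 c3 \<and>
    (a = x * y \<and> b = 0 \<or> \<gamma> \<noteq> 0 \<and> a = y * (C \<beta> * x + C \<gamma> * y) \<and> b = C \<beta> * y^2)"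
proof -
  obtain x y a b c c1 c2 where n: "normal x y z a b c c1 c2 c30" and sq: "y^2 dvd c30"
    using normal_square_factor[OF nt n0] by blast
  have s: "syzygy x y z c1 c2 c30" using n unfolding normal_def by blast
  note sD = syzygyD[OF s]
  note bf = basis3_forms[OF sD(1)] and bn = basis3_nonzero[OF sD(1)] and nd = basis3_not_dvd[OF sD(1)]
  have nD: "a \<in> binary_forms x y 2" "b \<in> binary_forms x y 2" "c30 = y * a - x * b" using n by (auto simp: normal_def)
  obtain k where k: "c30 = y^2 * k" using sq by blast
  then have "c30 = y * (y * k)" by (simp add: power2_eq_square)
  then have dv: "y dvd c30" by simp
  have yab: "y dvd a" "y dvd b" using normal_factor[OF nt n dv] by blast+
  obtain a' where a': "a = y * a'" using yab by blast
  obtain b' where b': "b = y * b'" using yab by blast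
  have "y * (y * k) = y * (y * a' - x * b')" using nD(3) k unfolding a' b' by (simp add: algebra_simps power2_eq_square)
  then have "y * k = y * a' - x * b'" using bn(2) by (simp only: mult_cancel_left) simp
  then have xb: "x * b' = y * (a' - k)" by (simp add: algebra_simps)
  have ab2: "a \<in> forms (Suc 1)" "b \<in> forms (Suc 1)"
    using binary_forms_subset_forms[OF bf(1,2) nD(1)] binary_forms_subset_forms[OF bf(1,2) nD(2)] by (simp_all add: numeral_2_eq_2)
  have lf: "a' \<in> forms 1" "b' \<in> forms 1"
    using dvd_formsE[OF bf(2) bn(2) ab2(1) yab(1)] dvd_formsE[OF bf(2) bn(2) ab2(2) yab(2)] a' b' bn(2)
    by (metis mult_cancel_left)+
  have "y dvd x * b'" unfolding xb by simp
  then have "y dvd b'" using linear_prime[OF bf(2) bn(2) bf(1) lf(2)] nd by blast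
  then obtain \<beta> where \<beta>: "b' = C \<beta> * y" using linear_dvd_linear[OF bf(2) bn(2) lf(2)] by blast
  obtain a1 a2 a3 where a1: "a' = C a1 * x + C a2 * y + C a3 * z" using forms_1E[OF sD(1) lf(1)] .
  have a3: "a3 = 0"
  proof -
    obtain v where v: "ev v x = 0" "ev v y = 1" "ev v z = 0" using basis3_ev[OF sD(1)] by blast
    obtain w where w: "ev w x = 0" "ev w y = 1" "ev w z = 1" using basis3_ev[OF sD(1)] by blast
    have "ev v a = ev w a" by (rule binary_ev[OF nD(1)]) (simp_all add: v w)
    then show ?thesis unfolding a' a1 using v w by simp
  qed
  have a: "a = y * (C a1 * x + C a2 * y)" unfolding a' a1 a3 by (simp add: C_simps)
  have b: "b = C \<beta> * y^2" unfolding b' \<beta> by (simp add: power2_eq_square ac_simps)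
  define m where "m = C (a1 - \<beta>) * x + C a2 * y"
  have c3: "c30 = y^2 * m" unfolding nD(3) a b m_def by (simp add: C_simps algebra_simps power2_eq_square)
  have m0: "m \<noteq> 0"
  proof
    assume "m = 0"
    then have "C 0 * c1 + C 0 * c2 + C 1 * c30 = 0" using c3 by (simp add: C_simps)
    then show False using sD(9) unfolding indep3_def by (metis one_neq_zero)
  qed
  show ?thesis
  proof (cases "a1 = \<beta>")
    case True
    then have "a2 \<noteq> 0" using m0 by (auto simp: m_def C_simps)
    then show ?thesis using n a b True by blast
  next
    case False
    have "m dvd c30" unfolding c3 by simp
    then have "m dvd b" using normal_linear_factor[OF nt n m_def m0] by blast
    have "\<beta> = 0"
    proof (rule ccontr)
      assume "\<beta> \<noteq> 0"
      then have "m dvd y^2" using \<open>m dvd b\<close> unfolding b by (metis C_inverse dvd_mult)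
      obtain v where v: "ev v x = - a2 / (a1 - \<beta>)" "ev v y = 1" using basis3_ev[OF sD(1)] by blast
      obtain h where h: "y^2 = m * h" using \<open>m dvd y^2\<close> by blast
      have "ev v m = 0" using v False by (simp add: m_def)
      then show False using arg_cong[OF h, of "ev v"] v by simp
    qed
    then have b0: "b = 0" and am: "a = y * m" and a10: "a1 \<noteq> 0" using False unfolding a b m_def by (simp_all add: C_simps)
    have m': "m = C a2 * y + C a1 * x" using \<open>\<beta> = 0\<close> by (simp add: m_def)
    have n': "normal y m z (C (1/a1) * (- b)) (- a + C (a2/a1) * (- b)) (C (1/a1) * (- c)) (c2 - C (a2/a1) * c1) (C (1/a1) * c1) c30"
      by (rule normal_shear[OF normal_swap[OF n] a10 m'])
    from normal_swap[OF this] have "normal m y z a 0 (- (C (1/a1) * (- c))) (C (1/a1) * c1) (c2 - C (a2/a1) * c1) c30"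
      using b0 by simp
    moreover have "a = m * y" using am by (simp add: mult.commute)
    ultimately show ?thesis by blast
  qed
qed

lemma quintic_zero:
  fixes e0 :: 'a
  assumes "\<And>t. e0 + e1 * t + e2 * t^2 + e3 * t^3 + e4 * t^4 + e5 * t^5 = 0"
  shows "e4 = 0" "e5 = 0"
proof -
  have "poly [:e0, e1, e2, e3, e4, e5:] t = 0" for t
    using assms[of t] by (simp add: algebra_simps power2_eq_square power3_eq_cube numeral_eq_Suc)
  then have "[:e0, e1, e2, e3, e4, e5:] = 0" by (rule poly_fun_zero)
  then show "e4 = 0" "e5 = 0" by simp_all
qed

theorem two_term_syzygy_of_failure: two_term_syzygy
proof (rule ccontr)
  assume nt: "\<not> two_term_syzygy"
  obtain x0 y0 z f1 f2 f3 where s0: "syzygy x0 y0 z f1 f2 f3"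
    and van0: "\<And>v. ev v x0 = 0 \<Longrightarrow> ev v y0 = 0 \<Longrightarrow> ev v f1 = 0 \<and> ev v f2 = 0 \<and> ev v f3 = 0"
    using ex_eigenpoint[OF nt] by metis
  obtain a0 b0 c0 where "normal x0 y0 z a0 b0 c0 f1 f2 f3"
    using eigenpoint_normal_form[OF nt s0 van0] s0 unfolding normal_def by metis
  then obtain x y a b c c1 c2 c3 \<beta> \<gamma> where n: "normal x y z a b c c1 c2 c3"
    and type: "a = x * y \<and> b = 0 \<or> \<gamma> \<noteq> 0 \<and> a = y * (C \<beta> * x + C \<gamma> * y) \<and> b = C \<beta> * y^2"
    using normal_types[OF nt] by metis
  have s: "syzygy x y z c1 c2 c3" using n unfolding normal_def by blast
  note sD = syzygyD[OF s]
  note bb = sD(1)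
  note bf = basis3_forms[OF bb] and bn = basis3_nonzero[OF bb]
  have nD: "c \<in> binary_forms x y 2" "c1 = z * b - y * c" "c2 = x * c - z * a" "c3 = y * a - x * b" using n by (auto simp: normal_def)
  have yab: "y dvd a" "y dvd b" using type by (auto simp: power2_eq_square)
  obtain \<kappa> k1 k2 where c: "c = C \<kappa> * x^2 + C k1 * (x*y) + C k2 * y^2" using binary_forms_2E[OF nD(1)] .
  \<comment> \<open>Otherwise \<open>y\<close> divides \<open>a\<close>, \<open>b\<close>,
    \<open>c\<close> and therefore the whole net.\<close>
  have \<kappa>: "\<kappa> \<noteq> 0"
  proof
    assume "\<kappa> = 0"
    then have "c = y * (C k1 * x + C k2 * y)" unfolding c by (simp add: C_simps algebra_simps power2_eq_square)
    then have "y dvd c" by simp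
    then have "y dvd c1" "y dvd c2" "y dvd c3" unfolding nD using yab by (auto intro!: dvd_diff)
    then show False using syzygy_common_factor[OF s bf(2) bn(2)] nt by blast
  qed
  obtain d where d: "d \<in> forms 3" "d \<in> I" "indep4 c1 c2 c3 d"
    using extend_to_basis4[OF sD(2-7) sD(9)] .
  obtain d1 d2 d3 d4 d5 d6 d7 d8 d9 k where de: "d = C d1 * x^3 + C d2 * (x^2*y) + C d3 * (x^2*z) + C d4 * (x*y^2) +
      C d5 * (x*y*z) + C d6 * (x*z^2) + C d7 * y^3 + C d8 * (y^2*z) + C d9 * (y*z^2) + C k * z^3"
    using forms_3E[OF bb d(1)] .
  \<comment> \<open>The coefficient of \<open>z^3\<close> in \<open>d\<close> is its value at
    \<open>(0:0:1)\<close>, where the net vanishes; it is nonzero as there is no base point.\<close>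
  have k: "k \<noteq> 0"
  proof
    assume k0: "k = 0"
    have two_term_syzygy
    proof (rule base_point[OF bb])
      fix f v assume f: "f \<in> forms 3" "f \<in> I" and v: "ev v x = 0" "ev v y = 0"
      obtain p q r t where fe: "f = C p * c1 + C q * c2 + C r * c3 + C t * d"
        using cubics_span[OF sD(2-4) d(1) sD(5-7) d(2,3) f] .
      have "ev v a = 0" "ev v b = 0" "ev v c = 0" using yab v by (auto simp: dvd_def c)
      then show "ev v f = 0" unfolding fe nD(2-4) de using v k0 by simp
    qed
    then show False using nt by contradiction
  qed
  from type show False
  proof (elim disjE conjE)
    assume ab: "a = x * y" "b = 0"
    \<comment> \<open>Lines \<open>z = \<mu> y\<close>. Elimination of \<open>p\<close> and
      \<open>q\<close> from the restricted cubic leaves this polynomial in \<mu>, whose leading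
      coefficient \<open>\<kappa>^2 * k\<close> is nonzero.\<close>
    have "(\<kappa>^2 * d7 - k2 * (\<kappa> * d2 - d1 * k1)) + (\<kappa>^2 * d8 - k2 * \<kappa> * d3) * \<mu> + (\<kappa>^2 * d9) * \<mu>^2 + (\<kappa>^2 * k) * \<mu>^3 = 0" for \<mu>
    proof -
      define h where "h = z - C \<mu> * y"
      have hb: "basis3 x y h" using basis3_change3[OF bb, of 1 h 0 "- \<mu>"] by (simp add: h_def C_simps)
      obtain p q r t where comb: "h dvd C p * c1 + C q * c2 + C r * c3 + C t * d" and nz: "p \<noteq> 0 \<or> q \<noteq> 0 \<or> r \<noteq> 0 \<or> t \<noteq> 0"
        using failure_combination[OF d(3) sD(2-4) d(1) sD(5-7) d(2) basis3_forms(3)[OF hb] basis3_nonzero(3)[OF hb]] .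
      obtain g where g: "C p * c1 + C q * c2 + C r * c3 + C t * d = h * g" using comb by blast
      have "(- p * k2 + t * (d7 + d8 * \<mu> + d9 * \<mu>^2 + k * \<mu>^3)) +
        (- p * k1 + q * (k2 - \<mu>) + r + t * (d4 + d5 * \<mu> + d6 * \<mu>^2)) * \<xi> +
        (- p * \<kappa> + q * k1 + t * (d2 + d3 * \<mu>)) * \<xi>^2 + (q * \<kappa> + t * d1) * \<xi>^3 = 0" for \<xi>
      proof -
        obtain v where v: "ev v x = \<xi>" "ev v y = 1" "ev v z = \<mu>" using basis3_ev[OF bb] by blast
        have "ev v (h * g) = 0" using v by (simp add: h_def)
        then have "ev v (C p * c1 + C q * c2 + C r * c3 + C t * d) = 0" unfolding g .
        then show ?thesis unfolding nD(2-4) ab c de using v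
          by (simp add: algebra_simps power2_eq_square power3_eq_cube)
      qed
      from cubic_polynomial_zero[OF this]
      have eqs: "- p * k2 + t * (d7 + d8 * \<mu> + d9 * \<mu>^2 + k * \<mu>^3) = 0"
        "- p * k1 + q * (k2 - \<mu>) + r + t * (d4 + d5 * \<mu> + d6 * \<mu>^2) = 0"
        "- p * \<kappa> + q * k1 + t * (d2 + d3 * \<mu>) = 0" "q * \<kappa> + t * d1 = 0" by blast+
      have t: "t \<noteq> 0"
      proof
        assume "t = 0"
        then show False using eqs \<kappa> nz by auto
      qed
      have "t * ((\<kappa>^2 * d7 - k2 * (\<kappa> * d2 - d1 * k1)) + (\<kappa>^2 * d8 - k2 * \<kappa> * d3) * \<mu> + (\<kappa>^2 * d9) * \<mu>^2 + (\<kappa>^2 * k) * \<mu>^3) = 0"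
        using eqs(1,3,4) by Groebner_Basis.algebra
      then show ?thesis using t by simp
    qed
    from cubic_polynomial_zero(4)[OF this] show False using \<kappa> k by simp
  next
    assume ab: "\<gamma> \<noteq> 0" "a = y * (C \<beta> * x + C \<gamma> * y)" "b = C \<beta> * y^2"
    \<comment> \<open>The corresponding eliminant for the lines \<open>z = \<omega> x\<close>. Its
      coefficient at \<open>\<omega>^5\<close> is \<open>k * \<beta>^2\<close>; once \<beta> is
      zero, the one at \<open>\<omega>^4\<close> is \<open>k * \<kappa> * \<gamma>\<close>.\<close>
    define P where "P \<omega> = (d1 + d3 * \<omega> + d6 * \<omega>^2 + k * \<omega>^3) * ((k1 - \<omega> * \<beta>)^2 - \<kappa> * (k2 - \<omega> * \<gamma>)) -
      \<kappa> * (d2 + d5 * \<omega> + d9 * \<omega>^2) * (k1 - \<omega> * \<beta>) + \<kappa>^2 * (d4 + d8 * \<omega>)" for \<omega>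
    have P0: "P \<omega> = 0" for \<omega>
    proof -
      define h where "h = z - C \<omega> * x"
      have hb: "basis3 x y h" using basis3_change3[OF bb, of 1 h "- \<omega>" 0] by (simp add: h_def C_simps)
      obtain p q r t where comb: "h dvd C p * c1 + C q * c2 + C r * c3 + C t * d" and nz: "p \<noteq> 0 \<or> q \<noteq> 0 \<or> r \<noteq> 0 \<or> t \<noteq> 0"
        using failure_combination[OF d(3) sD(2-4) d(1) sD(5-7) d(2) basis3_forms(3)[OF hb] basis3_nonzero(3)[OF hb]] .
      obtain g where g: "C p * c1 + C q * c2 + C r * c3 + C t * d = h * g" using comb by blast
      have "(- p * k2 + r * \<gamma> + t * d7) + (p * (\<omega> * \<beta> - k1) + q * (k2 - \<omega> * \<gamma>) + t * (d4 + d8 * \<omega>)) * \<xi> +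
        (- p * \<kappa> + q * (k1 - \<omega> * \<beta>) + t * (d2 + d5 * \<omega> + d9 * \<omega>^2)) * \<xi>^2 +
        (q * \<kappa> + t * (d1 + d3 * \<omega> + d6 * \<omega>^2 + k * \<omega>^3)) * \<xi>^3 = 0" for \<xi>
      proof -
        obtain v where v: "ev v x = \<xi>" "ev v y = 1" "ev v z = \<omega> * \<xi>" using basis3_ev[OF bb] by blast
        have "ev v (h * g) = 0" using v by (simp add: h_def)
        then have "ev v (C p * c1 + C q * c2 + C r * c3 + C t * d) = 0" unfolding g .
        then show ?thesis unfolding nD(2-4) ab(2,3) c de using v
          by (simp add: algebra_simps power2_eq_square power3_eq_cube)
      qed
      from cubic_polynomial_zero[OF this]
      have eqs: "- p * k2 + r * \<gamma> + t * d7 = 0" "p * (\<omega> * \<beta> - k1) + q * (k2 - \<omega> * \<gamma>) + t * (d4 + d8 * \<omega>) = 0"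
        "- p * \<kappa> + q * (k1 - \<omega> * \<beta>) + t * (d2 + d5 * \<omega> + d9 * \<omega>^2) = 0"
        "q * \<kappa> + t * (d1 + d3 * \<omega> + d6 * \<omega>^2 + k * \<omega>^3) = 0" by blast+
      have t: "t \<noteq> 0"
      proof
        assume "t = 0"
        then show False using eqs \<kappa> ab(1) nz by auto
      qed
      have "t * P \<omega> = 0" using eqs(2-4) unfolding P_def by Groebner_Basis.algebra
      then show ?thesis using t by simp
    qed
    have "(d1 * (k1^2 - \<kappa> * k2) - \<kappa> * d2 * k1 + \<kappa>^2 * d4) +
      (d1 * (- 2 * k1 * \<beta> + \<kappa> * \<gamma>) + d3 * (k1^2 - \<kappa> * k2) - \<kappa> * (d5 * k1 - d2 * \<beta>) + \<kappa>^2 * d8) * \<omega> +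
      (d1 * \<beta>^2 + d3 * (- 2 * k1 * \<beta> + \<kappa> * \<gamma>) + d6 * (k1^2 - \<kappa> * k2) - \<kappa> * (d9 * k1 - d5 * \<beta>)) * \<omega>^2 +
      (d3 * \<beta>^2 + d6 * (- 2 * k1 * \<beta> + \<kappa> * \<gamma>) + k * (k1^2 - \<kappa> * k2) + \<kappa> * d9 * \<beta>) * \<omega>^3 +
      (d6 * \<beta>^2 + k * (- 2 * k1 * \<beta> + \<kappa> * \<gamma>)) * \<omega>^4 + (k * \<beta>^2) * \<omega>^5 = 0" for \<omega>
      using P0[of \<omega>] unfolding P_def by Groebner_Basis.algebra
    note q = quintic_zero[OF this]
    have "\<beta> = 0" using q(2) k by simp
    then show False using q(1) k \<kappa> ab(1) by simp
  qed
qed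

end

section \<open>The double structure of a two-term syzygy\<close>

text \<open>A density argument, one variable at a time. In the applications \<open>s\<close>,
  \<open>t\<close> parametrise lines, and the bilinear polynomial is the condition that the line
  pass through the exceptional point \<open>v0\<close>.\<close>

lemma cross_vanish:
  fixes A1 :: "'k::alg_closed_field poly"
  assumes e: "e0 \<noteq> 0 \<or> e1 \<noteq> 0 \<or> e2 \<noteq> 0 \<or> e3 \<noteq> 0"
    and *: "\<And>s t. e0 + e1 * s + (e2 + e3 * s) * t \<noteq> 0 \<Longrightarrow> poly A1 s * poly B2 t = poly A2 s * poly B1 t"
  shows "poly A1 s * poly B2 t = poly A2 s * poly B1 t"
proof -
  define E where "E = (if [:e0, e1:] = 0 then [:e2, e3:] else [:e0, e1:])"
  have E: "E \<noteq> 0" using e by (auto simp: E_def)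
  have good: "poly A1 s * poly B2 t = poly A2 s * poly B1 t" if Es: "poly E s \<noteq> 0" for s t
  proof -
    define L where "L = [:e0 + e1 * s, e2 + e3 * s:]"
    have L: "L \<noteq> 0" using Es by (auto simp: L_def E_def mult.commute split: if_splits)
    define R where "R = Polynomial.smult (poly A1 s) B2 - Polynomial.smult (poly A2 s) B1"
    have "poly (L * R) t = 0" for t
    proof -
      have "poly L t = e0 + e1 * s + (e2 + e3 * s) * t" by (simp add: L_def algebra_simps)
      moreover have "poly R t = poly A1 s * poly B2 t - poly A2 s * poly B1 t" by (simp add: R_def)
      ultimately show ?thesis using *[of s t] by (cases "poly L t = 0") simp_all
    qed
    then have "L * R = 0" by (rule poly_fun_zero)
    then have "R = 0" using L by simp
    then have "poly R t = 0" by simp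
    then show ?thesis by (simp add: R_def)
  qed
  define R where "R = Polynomial.smult (poly B2 t) A1 - Polynomial.smult (poly B1 t) A2"
  have "poly (E * R) s = 0" for s
    using good[of s t] by (auto simp: R_def algebra_simps)
  then have "E * R = 0" by (rule poly_fun_zero)
  then have "R = 0" using E by simp
  then have "poly R s = 0" by simp
  then show ?thesis by (simp add: R_def algebra_simps)
qed

text \<open>A point of the conic is moved to \<open>(0:0:1)\<close>, so that
  \<open>q = l z + r\<close> with \<open>r\<close> free of \<open>z\<close>. If \<open>l\<close> is
  nonzero, all of \<open>r\<close> except one square is absorbed into \<open>z\<close>; otherwise
  \<open>q\<close> is a binary form and factors. No completion of squares is involved, so
  characteristic 2 is covered.\<close>

lemma quadric_normal_form:
  fixes q :: "'k::alg_closed_field poly3"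
  assumes q: "q \<in> forms 2" "q \<noteq> 0"
  shows "\<exists>x y z. basis3 x y z \<and> (q = x * z - y^2 \<or> q = x * z \<or> q = x^2)"
proof -
  let ?x = "pvar 0 :: 'k poly3" and ?y = "pvar 1 :: 'k poly3" and ?z = "pvar 2 :: 'k poly3"
  note b0 = basis3_pvar[where 'k = 'k]
  obtain g0 h0 where gh: "q = ?x * g0 + h0" "h0 \<in> binary_forms ?y ?z 2" using division_by_variable[OF b0 q(1)] by blast
  have "h0 \<in> binary_forms ?y ?z (Suc 1)" using gh(2) by (simp add: numeral_2_eq_2)
  then obtain \<alpha> \<gamma> where ac: "\<alpha> \<noteq> 0 \<or> \<gamma> \<noteq> 0" "(C \<alpha> * ?y + C \<gamma> * ?z) dvd h0" using binary_linear_factor[OF b0] by blast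
  define y where "y = C \<alpha> * ?y + C \<gamma> * ?z"
  obtain z where b: "basis3 ?x y z" using basis3_binary[OF b0 ac(1) y_def] by blast
  define x where "x = ?x"
  note b = b[folded x_def]
  note bf = basis3_forms[OF b]
  obtain a1 a2 a3 a4 a5 a6 where e: "q = C a1 * x^2 + C a2 * (x*y) + C a3 * (x*z) + C a4 * y^2 + C a5 * (y*z) + C a6 * z^2"
    using forms_2E[OF b q(1)] .
  have "a6 = 0"
  proof -
    obtain v where v: "ev v x = 0" "ev v y = 0" "ev v z = 1" using basis3_ev[OF b] by blast
    have "ev v h0 = 0" using ac(2) v(2) unfolding y_def[symmetric] by (auto simp: dvd_def)
    then have "ev v q = 0" using v(1) by (simp add: gh(1) x_def)
    then show ?thesis unfolding e using v by simp
  qed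
  define r where "r = C a1 * x^2 + C a2 * (x*y) + C a4 * y^2"
  have r: "r \<in> binary_forms x y 2" unfolding r_def by (rule binary_forms_2I)
  define l where "l = C a3 * x + C a5 * y"
  have qe: "q = l * z + r" unfolding e r_def l_def \<open>a6 = 0\<close> by (simp add: C_simps algebra_simps)
  have bz: "basis3 z x y" using basis3_swap12[OF basis3_swap23[OF b]] .
  show ?thesis
  proof (cases "a3 \<noteq> 0 \<or> a5 \<noteq> 0")
    case True
    have "\<exists>w p p' s s'. basis3 l w z \<and> x = C p * l + C p' * w \<and> y = C s * l + C s' * w"
    proof (cases "a3 = 0")
      case False
      have "basis3 l y z" using basis3_change1[OF b False, of l a5 0] by (simp add: l_def C_simps)
      moreover have "x = C (inverse a3) * l + C (- inverse a3 * a5) * y"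
        using C_inverse[OF False, of x] by (simp add: l_def C_simps algebra_simps)
      moreover have "y = C 0 * l + C 1 * y" by (simp add: C_simps)
      ultimately show ?thesis by blast
    next
      case a30: True
      then have a5: "a5 \<noteq> 0" using True by simp
      have "basis3 x l z" using basis3_change2[OF b a5, of l a3 0] by (simp add: l_def C_simps)
      then have "basis3 l x z" by (rule basis3_swap12)
      moreover have "y = C (inverse a5) * l + C 0 * x"
        using C_inverse[OF a5, of y] a30 by (simp add: l_def C_simps)
      moreover have "x = C 0 * l + C 1 * x" by (simp add: C_simps)
      ultimately show ?thesis by blast
    qed
    then obtain w p p' s s' where w: "basis3 l w z" "x = C p * l + C p' * w" "y = C s * l + C s' * w" by blast
    have "r \<in> binary_forms l w 2" by (rule binary_forms_2_change[OF r w(2,3)])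
    then obtain r1 r2 r3 where re: "r = C r1 * l^2 + C r2 * (l*w) + C r3 * w^2" using binary_forms_2E by blast
    define z' where "z' = C r1 * l + C r2 * w + C 1 * z"
    have b': "basis3 l w z'" by (rule basis3_change3[OF w(1) _ z'_def]) simp
    have qz: "q = l * z' + C r3 * w^2" unfolding qe re z'_def by (simp add: C_simps algebra_simps power2_eq_square)
    show ?thesis
    proof (cases "r3 = 0")
      case True
      then have "q = l * z'" using qz by (simp add: C_simps)
      then show ?thesis using b' by blast
    next
      case False
      obtain \<sigma> where \<sigma>: "\<sigma>^2 = - r3" using nth_root_exists[of 2 "- r3"] by auto
      then have "\<sigma> \<noteq> 0" using False by auto
      then have "basis3 l (C \<sigma> * w) z'" using basis3_change2[OF b', of \<sigma> "C \<sigma> * w" 0 0] by (simp add: C_simps)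
      moreover have "q = l * z' - (C \<sigma> * w)^2"
        unfolding qz power_mult_distrib C_simps(7)[symmetric] \<sigma> by (simp add: C_simps)
      ultimately show ?thesis by blast
    qed
  next
    case False
    then have qr: "q = r" unfolding qe l_def by (simp add: C_simps)
    then have "q \<in> binary_forms x y (Suc 1)" using r by (simp add: numeral_2_eq_2)
    then obtain \<alpha>' \<gamma>' where m: "\<alpha>' \<noteq> 0 \<or> \<gamma>' \<noteq> 0" "(C \<alpha>' * x + C \<gamma>' * y) dvd q" using binary_linear_factor[OF bz] by blast
    define m where "m = C \<alpha>' * x + C \<gamma>' * y"
    obtain w where bm: "basis3 z m w" using basis3_binary[OF bz m(1) m_def] by blast
    have "q \<in> forms (Suc 1)" using q(1) by (simp add: numeral_2_eq_2)
    then obtain n where n: "n \<in> forms 1" "q = m * n"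
      using dvd_formsE[OF basis3_forms(2)[OF bm] basis3_nonzero(2)[OF bm]] m(2) m_def by metis
    obtain p s t where ne: "n = C p * z + C s * m + C t * w" using forms_1E[OF bm n(1)] .
    consider "t \<noteq> 0" | "p \<noteq> 0" | "t = 0" "p = 0" by blast
    then show ?thesis
    proof cases
      case 1
      have "basis3 m z n" using basis3_swap12[OF basis3_change3[OF bm 1 ne]] .
      then show ?thesis using n(2) by blast
    next
      case 2
      have "basis3 m w n" using basis3_swap23[OF basis3_swap12[OF basis3_change1[OF bm 2 ne]]] .
      then show ?thesis using n(2) by blast
    next
      case 3
      then have qs: "q = C s * m^2" using n(2) ne by (simp add: C_simps power2_eq_square ac_simps)
      obtain \<sigma> where \<sigma>: "\<sigma>^2 = s" using nth_root_exists[of 2 s] by auto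
      have "\<sigma> \<noteq> 0" using \<sigma> q(2) qs by (auto simp: C_simps)
      then have "basis3 (C \<sigma> * m) z w"
        using basis3_change1[OF basis3_swap12[OF bm], of \<sigma> "C \<sigma> * m" 0 0] by (simp add: C_simps)
      moreover have "q = (C \<sigma> * m)^2" unfolding qs power_mult_distrib C_simps(7)[symmetric] \<sigma> ..
      ultimately show ?thesis by blast
    qed
  qed
qed

text \<open>The cubics \<open>c\<close>, \<open>d\<close> complete the two multiples of
  \<open>q\<close> to a basis of \<open>I_3\<close>. The vector \<open>v0\<close> represents the
  point \<open>u1 = u2 = 0\<close>; a multiple \<open>l q\<close> lies in \<open>I\<close> whenever
  \<open>l\<close> vanishes there.\<close>

locale two_term = lefschetz_failure +
  fixes u1 u2 u3 q c d v0
  assumes u: "basis3 u1 u2 u3" and q: "q \<in> forms 2" "q \<noteq> 0" "u1 * q \<in> I" "u2 * q \<in> I"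
    and cd: "c \<in> forms 3" "c \<in> I" "d \<in> forms 3" "d \<in> I" and ind: "indep4 (u1 * q) (u2 * q) c d"
    and v0: "ev v0 u1 = 0" "ev v0 u2 = 0" "ev v0 u3 = 1"
begin

lemma uq_forms: "u1 * q \<in> forms 3" "u2 * q \<in> forms 3"
  using forms_mult'[OF basis3_forms(1)[OF u] q(1), of 3] forms_mult'[OF basis3_forms(2)[OF u] q(1), of 3] by simp_all

text \<open>A multiple of \<open>q\<close> not spanned by \<open>u1 q\<close> and
  \<open>u2 q\<close> would put \<open>u3 q\<close> into \<open>I\<close> too. Then all linear forms
  would kill \<open>q\<close>, which would be a socle element of degree 2.\<close>

lemma pencil_not_multiple:
  assumes l: "l \<in> forms 1" and e: "C \<alpha> * c + C \<beta> * d = q * l"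
  shows "\<alpha> = 0 \<and> \<beta> = 0"
proof -
  obtain l1 l2 l3 where le: "l = C l1 * u1 + C l2 * u2 + C l3 * u3" using forms_1E[OF u l] .
  have e': "C (- l1) * (u1 * q) + C (- l2) * (u2 * q) + C \<alpha> * c + C \<beta> * d = C l3 * (u3 * q)"
    using e unfolding le by (simp add: C_simps algebra_simps)
  have "l3 = 0"
  proof (rule ccontr)
    assume "l3 \<noteq> 0"
    have "C l3 * (u3 * q) \<in> I" unfolding e'[symmetric] using q cd by auto
    then have "u3 * q \<in> I" using C_mult_mem \<open>l3 \<noteq> 0\<close> by blast
    then show False using quadric_socle[OF u q(1)] q by blast
  qed
  then have "C (- l1) * (u1 * q) + C (- l2) * (u2 * q) + C \<alpha> * c + C \<beta> * d = 0" using e' by (simp add: C_simps)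
  then show ?thesis using ind unfolding indep4_def by blast
qed

lemma cubicsE:
  assumes "f \<in> forms 3" "f \<in> I"
  obtains m \<alpha> \<beta> where "f = m * q + C \<alpha> * c + C \<beta> * d"
proof -
  obtain p r s t where "f = C p * (u1 * q) + C r * (u2 * q) + C s * c + C t * d"
    using cubics_span[OF uq_forms cd(1,3) q(3,4) cd(2,4) ind assms] .
  then have "f = (C p * u1 + C r * u2) * q + C s * c + C t * d" by (simp add: algebra_simps)
  then show ?thesis using that by blast
qed

lemma no_common: "x \<in> forms 1 \<Longrightarrow> x \<noteq> 0 \<Longrightarrow> x dvd q \<Longrightarrow> x dvd c \<Longrightarrow> x dvd d \<Longrightarrow> False"
  by (rule no_common_factor[of x]) (auto elim!: cubicsE)

text \<open>A combination of \<open>u1 q\<close> and \<open>u2 q\<close> alone is \<open>m q\<close>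
  with \<open>m\<close> zero at \<open>v0\<close>. If \<open>l\<close> divides it, then
  \<open>m\<close> is a multiple of \<open>l\<close>, and \<open>m = 0\<close> because
  \<open>l\<close> is nonzero at \<open>v0\<close>.\<close>

lemma general_line:
  assumes l: "l \<in> forms 1" "ev v0 l \<noteq> 0" "\<not> l dvd q"
  obtains m \<alpha> \<beta> where "m \<in> forms 1" "\<alpha> \<noteq> 0 \<or> \<beta> \<noteq> 0" "l dvd m * q + C \<alpha> * c + C \<beta> * d"
proof -
  have l0: "l \<noteq> 0" using l(2) by auto
  obtain p r \<alpha> \<beta> where *: "l dvd C p * (u1 * q) + C r * (u2 * q) + C \<alpha> * c + C \<beta> * d" "p \<noteq> 0 \<or> r \<noteq> 0 \<or> \<alpha> \<noteq> 0 \<or> \<beta> \<noteq> 0"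
    using failure_combination[OF ind uq_forms cd(1,3) q(3,4) cd(2,4) l(1) l0] .
  define m where "m = C p * u1 + C r * u2"
  have m: "m \<in> forms 1" unfolding m_def using basis3_forms[OF u] by auto
  have dv: "l dvd m * q + C \<alpha> * c + C \<beta> * d" using *(1) unfolding m_def by (simp add: algebra_simps)
  have "\<alpha> \<noteq> 0 \<or> \<beta> \<noteq> 0"
  proof (rule ccontr)
    assume "\<not> ?thesis"
    then have z: "\<alpha> = 0" "\<beta> = 0" by auto
    then have "l dvd m * q" using dv by (simp add: C_simps)
    then have "l dvd m" using linear_prime[OF l(1) l0 m q(1)] l(3) by blast
    then obtain \<kappa> where \<kappa>: "m = C \<kappa> * l" using linear_dvd_linear[OF l(1) l0 m] by blast
    have "ev v0 m = 0" using v0 by (simp add: m_def)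
    then have "\<kappa> = 0" using l(2) unfolding \<kappa> by simp
    then have "C p * u1 + C r * u2 + C 0 * u3 = 0" using \<kappa> by (simp add: m_def C_simps)
    from linear_coeffs_zero[OF u this] show False using *(2) z by simp
  qed
  then show ?thesis using that m dv by blast
qed

lemma v0_nonzero:
  assumes b: "basis3 x y z"
  shows "ev v0 x \<noteq> 0 \<or> ev v0 y \<noteq> 0 \<or> ev v0 z \<noteq> 0"
proof -
  obtain a1 a2 a3 where "u3 = C a1 * x + C a2 * y + C a3 * z" using forms_1E[OF b basis3_forms(3)[OF u]] .
  then show ?thesis using v0(3) by auto
qed

text \<open>At a point common to \<open>l\<close> and \<open>q\<close> the term \<open>m q\<close>
  drops out, so one member of the pencil of \<open>c\<close> and \<open>d\<close> vanishes at both
  points.\<close>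

lemma cross_of_general_line:
  assumes l: "l \<in> forms 1" "ev v0 l \<noteq> 0" "\<not> l dvd q" and "ev v l = 0" "ev v q = 0" "ev w l = 0" "ev w q = 0"
  shows "ev v c * ev w d = ev v d * ev w c"
proof -
  obtain m \<alpha> \<beta> where *: "\<alpha> \<noteq> 0 \<or> \<beta> \<noteq> 0" "l dvd m * q + C \<alpha> * c + C \<beta> * d" using general_line[OF l] by metis
  obtain k where k: "m * q + C \<alpha> * c + C \<beta> * d = l * k" using *(2) by blast
  have 1: "\<alpha> * ev v c + \<beta> * ev v d = 0" using arg_cong[OF k, of "ev v"] assms by simp
  have 2: "\<alpha> * ev w c + \<beta> * ev w d = 0" using arg_cong[OF k, of "ev w"] assms by simp
  have "\<alpha> * (ev v c * ev w d - ev v d * ev w c) = 0" using 1 2 by Groebner_Basis.algebra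
  moreover have "\<beta> * (ev v c * ev w d - ev v d * ev w c) = 0" using 1 2 by Groebner_Basis.algebra
  ultimately show ?thesis using *(1) by auto
qed

text \<open>Two points of the conic lie on a common line, so the ratio of \<open>c\<close> to
  \<open>d\<close> is the same at both and hence constant on the conic. Some member of the pencil
  then vanishes on the conic and is a multiple of \<open>q\<close>.\<close>

lemma not_conic:
  assumes b: "basis3 x y z" and qe: "q = x * z - y^2"
  shows False
proof -
  note bf = basis3_forms[OF b]
  have curve: "\<exists>p. (\<forall>v t. ev v x = 1 \<longrightarrow> ev v y = t \<longrightarrow> ev v z = t^2 \<longrightarrow> ev v f = poly p t) \<and> (p = 0 \<longrightarrow> (\<exists>l\<in>forms 1. f = q * l))"
    if f: "f \<in> forms 3" for f
  proof -
    obtain a1 a2 a3 a4 a5 a6 a7 a8 a9 a10 where e: "f = C a1 * x^3 + C a2 * (x^2*y) + C a3 * (x^2*z) + C a4 * (x*y^2) +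
      C a5 * (x*y*z) + C a6 * (x*z^2) + C a7 * y^3 + C a8 * (y^2*z) + C a9 * (y*z^2) + C a10 * z^3"
      using forms_3E[OF b f] .
    define p where "p = [:a1, a2, a3 + a4, a5 + a7, a6 + a8, a9, a10:]"
    have 1: "ev v f = poly p t" if v: "ev v x = 1" "ev v y = t" "ev v z = t^2" for v t
      unfolding e using v by (simp add: p_def algebra_simps power2_eq_square power3_eq_cube)
    have 2: "\<exists>l\<in>forms 1. f = q * l" if p0: "p = 0"
    proof -
      have z: "a1 = 0" "a2 = 0" "a9 = 0" "a10 = 0" "a3 = - a4" "a7 = - a5" "a6 = - a8"
        using p0 by (simp_all add: p_def eq_neg_iff_add_eq_0 add.commute)
      have "f = q * (C a3 * x + C a5 * y + C a6 * z)"
        unfolding e qe z by (simp add: C_simps algebra_simps power2_eq_square power3_eq_cube)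
      then show ?thesis using bf by blast
    qed
    show ?thesis using 1 2 by blast
  qed
  obtain pc where pc: "\<And>v t. ev v x = 1 \<Longrightarrow> ev v y = t \<Longrightarrow> ev v z = t^2 \<Longrightarrow> ev v c = poly pc t" using curve[OF cd(1)] by blast
  obtain pd where pd: "\<And>v t. ev v x = 1 \<Longrightarrow> ev v y = t \<Longrightarrow> ev v z = t^2 \<Longrightarrow> ev v d = poly pd t" using curve[OF cd(3)] by blast
  define x0 y0 z0 where "x0 = ev v0 x" and "y0 = ev v0 y" and "z0 = ev v0 z"
  have cross: "poly pc s * poly pd t = poly pd s * poly pc t" for s t
  proof (rule cross_vanish[of z0 "- y0" "- y0" x0])
    show "z0 \<noteq> 0 \<or> - y0 \<noteq> 0 \<or> - y0 \<noteq> 0 \<or> x0 \<noteq> 0" using v0_nonzero[OF b] by (auto simp: x0_def y0_def z0_def)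
    fix s t assume nz: "z0 + - y0 * s + (- y0 + x0 * s) * t \<noteq> 0"
    define l where "l = z - C (s + t) * y + C (s * t) * x"
    have l: "l \<in> forms 1" unfolding l_def using bf by auto
    have l0: "ev v0 l \<noteq> 0" using nz by (simp add: l_def x0_def y0_def z0_def algebra_simps)
    obtain \<eta> where \<eta>: "\<eta> \<notin> {s, t}" using alg_closed_infinite ex_new_if_finite[of "{s, t}"] by blast
    have "\<not> l dvd q"
    proof
      assume "l dvd q"
      then obtain k where k: "q = l * k" by blast
      obtain v where v: "ev v x = 1" "ev v y = \<eta>" "ev v z = (s + t) * \<eta> - s * t" using basis3_ev[OF b] by blast
      have "ev v l = 0" using v by (simp add: l_def)
      then have "ev v q = 0" unfolding k by simp
      moreover have "ev v q = - ((\<eta> - s) * (\<eta> - t))" unfolding qe using v by (simp add: algebra_simps power2_eq_square)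
      ultimately show False using \<eta> by auto
    qed
    moreover obtain v where v: "ev v x = 1" "ev v y = s" "ev v z = s^2" using basis3_ev[OF b] by blast
    moreover obtain w where w: "ev w x = 1" "ev w y = t" "ev w z = t^2" using basis3_ev[OF b] by blast
    moreover have "ev v l = 0" "ev w l = 0" using v w by (simp_all add: l_def algebra_simps power2_eq_square)
    moreover have "ev v q = 0" "ev w q = 0" unfolding qe using v w by simp_all
    ultimately have "ev v c * ev w d = ev v d * ev w c" using cross_of_general_line[OF l l0] by blast
    then show "poly pc s * poly pd t = poly pd s * poly pc t" using pc[OF v] pd[OF v] pc[OF w] pd[OF w] by simp
  qed
  have contra: False if ab: "\<alpha> \<noteq> 0 \<or> \<beta> \<noteq> 0" and z: "\<And>t. \<alpha> * poly pc t + \<beta> * poly pd t = 0" for \<alpha> \<beta>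
  proof -
    have f: "C \<alpha> * c + C \<beta> * d \<in> forms 3" using cd by auto
    obtain p where p: "\<And>v t. ev v x = 1 \<Longrightarrow> ev v y = t \<Longrightarrow> ev v z = t^2 \<Longrightarrow> ev v (C \<alpha> * c + C \<beta> * d) = poly p t"
      "p = 0 \<Longrightarrow> \<exists>l\<in>forms 1. C \<alpha> * c + C \<beta> * d = q * l" using curve[OF f] by blast
    have "poly p t = 0" for t
    proof -
      obtain v where v: "ev v x = 1" "ev v y = t" "ev v z = t^2" using basis3_ev[OF b] by blast
      show ?thesis using p(1)[OF v] pc[OF v] pd[OF v] z[of t] by simp
    qed
    then have "p = 0" by (rule poly_fun_zero)
    then show False using p(2) pencil_not_multiple ab by blast
  qed
  show False
  proof (cases "\<exists>t. poly pc t \<noteq> 0 \<or> poly pd t \<noteq> 0")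
    case True
    then obtain t where t: "poly pc t \<noteq> 0 \<or> poly pd t \<noteq> 0" by blast
    show False
      by (rule contra[of "poly pd t" "- poly pc t"]) (use t cross[of t] in \<open>auto simp: algebra_simps\<close>)
  next
    case False
    then show False using contra[of 1 0] by simp
  qed
qed

text \<open>Here the lines join a point of \<open>x = 0\<close> to a point of \<open>z = 0\<close>.
  Comparing ratios across the two components makes one member of the pencil vanish on both, unless
  \<open>c\<close> and \<open>d\<close> both vanish on one component, which would be a common factor
  of \<open>I_3\<close>.\<close>

lemma not_line_pair:
  assumes b: "basis3 x y z" and qe: "q = x * z"
  shows False
proof -
  note bf = basis3_forms[OF b] and bn = basis3_nonzero[OF b]
  have curve: "\<exists>p1 p2. (\<forall>v t. ev v x = 0 \<longrightarrow> ev v y = t \<longrightarrow> ev v z = 1 \<longrightarrow> ev v f = poly p1 t) \<and>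
      (\<forall>v t. ev v x = 1 \<longrightarrow> ev v y = t \<longrightarrow> ev v z = 0 \<longrightarrow> ev v f = poly p2 t) \<and>
      (p1 = 0 \<longrightarrow> x dvd f) \<and> (p2 = 0 \<longrightarrow> z dvd f) \<and> (p1 = 0 \<longrightarrow> p2 = 0 \<longrightarrow> (\<exists>l\<in>forms 1. f = q * l))"
    if f: "f \<in> forms 3" for f
  proof -
    obtain a1 a2 a3 a4 a5 a6 a7 a8 a9 a10 where e: "f = C a1 * x^3 + C a2 * (x^2*y) + C a3 * (x^2*z) + C a4 * (x*y^2) +
      C a5 * (x*y*z) + C a6 * (x*z^2) + C a7 * y^3 + C a8 * (y^2*z) + C a9 * (y*z^2) + C a10 * z^3"
      using forms_3E[OF b f] .
    define p1 p2 where "p1 = [:a10, a9, a8, a7:]" and "p2 = [:a1, a2, a4, a7:]"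
    have 1: "ev v f = poly p1 t" if v: "ev v x = 0" "ev v y = t" "ev v z = 1" for v t
      unfolding e using v by (simp add: p1_def algebra_simps power2_eq_square power3_eq_cube)
    have 2: "ev v f = poly p2 t" if v: "ev v x = 1" "ev v y = t" "ev v z = 0" for v t
      unfolding e using v by (simp add: p2_def algebra_simps power2_eq_square power3_eq_cube)
    have 3: "x dvd f" if "p1 = 0"
      using that unfolding e by (simp add: p1_def C_simps power2_eq_square power3_eq_cube)
    have 4: "z dvd f" if "p2 = 0"
      using that unfolding e by (simp add: p2_def C_simps power2_eq_square power3_eq_cube)
    have 5: "\<exists>l\<in>forms 1. f = q * l" if "p1 = 0" "p2 = 0"
    proof -
      have "f = q * (C a3 * x + C a5 * y + C a6 * z)"
        using that unfolding e qe by (simp add: p1_def p2_def C_simps algebra_simps power2_eq_square)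
      then show ?thesis using bf by blast
    qed
    show ?thesis using 1 2 3 4 5 by blast
  qed
  obtain c1 c2 where c: "\<And>v t. ev v x = 0 \<Longrightarrow> ev v y = t \<Longrightarrow> ev v z = 1 \<Longrightarrow> ev v c = poly c1 t"
    "\<And>v t. ev v x = 1 \<Longrightarrow> ev v y = t \<Longrightarrow> ev v z = 0 \<Longrightarrow> ev v c = poly c2 t" "c1 = 0 \<Longrightarrow> x dvd c" "c2 = 0 \<Longrightarrow> z dvd c"
    using curve[OF cd(1)] by blast
  obtain d1 d2 where d: "\<And>v t. ev v x = 0 \<Longrightarrow> ev v y = t \<Longrightarrow> ev v z = 1 \<Longrightarrow> ev v d = poly d1 t"
    "\<And>v t. ev v x = 1 \<Longrightarrow> ev v y = t \<Longrightarrow> ev v z = 0 \<Longrightarrow> ev v d = poly d2 t" "d1 = 0 \<Longrightarrow> x dvd d" "d2 = 0 \<Longrightarrow> z dvd d"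
    using curve[OF cd(3)] by blast
  define x0 y0 z0 where "x0 = ev v0 x" and "y0 = ev v0 y" and "z0 = ev v0 z"
  have cross: "poly c1 s * poly d2 t = poly d1 s * poly c2 t" for s t
  proof (rule cross_vanish[of y0 "- z0" "- x0" 0])
    show "y0 \<noteq> 0 \<or> - z0 \<noteq> 0 \<or> - x0 \<noteq> 0 \<or> (0::'a) \<noteq> 0" using v0_nonzero[OF b] by (auto simp: x0_def y0_def z0_def)
    fix s t assume nz: "y0 + - z0 * s + (- x0 + 0 * s) * t \<noteq> 0"
    define l where "l = y - C t * x - C s * z"
    have l: "l \<in> forms 1" unfolding l_def using bf by auto
    have l0: "ev v0 l \<noteq> 0" using nz by (simp add: l_def x0_def y0_def z0_def algebra_simps)
    have "\<not> l dvd q"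
    proof
      assume "l dvd q"
      then obtain k where k: "q = l * k" by blast
      obtain v where v: "ev v x = 1" "ev v y = s + t" "ev v z = 1" using basis3_ev[OF b] by blast
      have "ev v l = 0" using v by (simp add: l_def)
      then have "ev v q = 0" unfolding k by simp
      then show False unfolding qe using v by simp
    qed
    moreover obtain v where v: "ev v x = 0" "ev v y = s" "ev v z = 1" using basis3_ev[OF b] by blast
    moreover obtain w where w: "ev w x = 1" "ev w y = t" "ev w z = 0" using basis3_ev[OF b] by blast
    moreover have "ev v l = 0" "ev w l = 0" using v w by (simp_all add: l_def)
    moreover have "ev v q = 0" "ev w q = 0" unfolding qe using v w by simp_all
    ultimately have "ev v c * ev w d = ev v d * ev w c" using cross_of_general_line[OF l l0] by blast
    then show "poly c1 s * poly d2 t = poly d1 s * poly c2 t" using c(1)[OF v] d(1)[OF v] c(2)[OF w] d(2)[OF w] by simp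
  qed
  have "\<exists>s. poly c1 s \<noteq> 0 \<or> poly d1 s \<noteq> 0"
  proof (rule ccontr)
    assume "\<not> ?thesis"
    then have "c1 = 0" "d1 = 0" using poly_fun_zero by blast+
    then show False using no_common[OF bf(1) bn(1)] c(3) d(3) qe by simp
  qed
  then obtain s0 where s0: "poly c1 s0 \<noteq> 0 \<or> poly d1 s0 \<noteq> 0" by blast
  have "\<exists>s. poly c2 s \<noteq> 0 \<or> poly d2 s \<noteq> 0"
  proof (rule ccontr)
    assume "\<not> ?thesis"
    then have "c2 = 0" "d2 = 0" using poly_fun_zero by blast+
    then show False using no_common[OF bf(3) bn(3)] c(4) d(4) qe by simp
  qed
  then obtain t0 where t0: "poly c2 t0 \<noteq> 0 \<or> poly d2 t0 \<noteq> 0" by blast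
  define \<alpha> \<beta> where "\<alpha> = poly d1 s0" and "\<beta> = - poly c1 s0"
  have z2: "\<alpha> * poly c2 t + \<beta> * poly d2 t = 0" for t using cross[of s0 t] by (simp add: \<alpha>_def \<beta>_def)
  have z1: "\<alpha> * poly c1 s + \<beta> * poly d1 s = 0" for s
  proof -
    have "poly c2 t0 * (\<alpha> * poly c1 s + \<beta> * poly d1 s) = 0" "poly d2 t0 * (\<alpha> * poly c1 s + \<beta> * poly d1 s) = 0"
      using cross[of s0 t0] cross[of s t0] unfolding \<alpha>_def \<beta>_def by Groebner_Basis.algebra+
    then show ?thesis using t0 by auto
  qed
  have f: "C \<alpha> * c + C \<beta> * d \<in> forms 3" using cd by auto
  obtain p1 p2 where p: "\<And>v t. ev v x = 0 \<Longrightarrow> ev v y = t \<Longrightarrow> ev v z = 1 \<Longrightarrow> ev v (C \<alpha> * c + C \<beta> * d) = poly p1 t"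
    "\<And>v t. ev v x = 1 \<Longrightarrow> ev v y = t \<Longrightarrow> ev v z = 0 \<Longrightarrow> ev v (C \<alpha> * c + C \<beta> * d) = poly p2 t"
    "p1 = 0 \<Longrightarrow> p2 = 0 \<Longrightarrow> \<exists>l\<in>forms 1. C \<alpha> * c + C \<beta> * d = q * l" using curve[OF f] by blast
  have "poly p1 t = 0" for t
  proof -
    obtain v where v: "ev v x = 0" "ev v y = t" "ev v z = 1" using basis3_ev[OF b] by blast
    show ?thesis using p(1)[OF v] c(1)[OF v] d(1)[OF v] z1[of t] by simp
  qed
  moreover have "poly p2 t = 0" for t
  proof -
    obtain v where v: "ev v x = 1" "ev v y = t" "ev v z = 0" using basis3_ev[OF b] by blast
    show ?thesis using p(2)[OF v] c(2)[OF v] d(2)[OF v] z2[of t] by simp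
  qed
  ultimately have "p1 = 0" "p2 = 0" using poly_fun_zero by blast+
  then have "\<alpha> = 0 \<and> \<beta> = 0" using p(3) pencil_not_multiple by blast
  then show False using s0 by (simp add: \<alpha>_def \<beta>_def)
qed

end

section \<open>Double lines\<close>

context gorenstein_ideal
begin

lemma quadric_kills_monomials:
  assumes b: "basis3 x y z" and r: "r \<in> forms 2"
    and m: "x^3 * r \<in> I" "x^2 * y * r \<in> I" "x^2 * z * r \<in> I" "x * y^2 * r \<in> I" "x * y * z * r \<in> I" "x * z^2 * r \<in> I"
      "y^3 * r \<in> I" "y^2 * z * r \<in> I" "y * z^2 * r \<in> I" "z^3 * r \<in> I"
  shows "r = 0"
proof (rule quadric_kills[OF r])
  fix p :: "'k poly3" assume "p \<in> forms 3"
  then obtain a1 a2 a3 a4 a5 a6 a7 a8 a9 a10 where e: "p = C a1 * x^3 + C a2 * (x^2*y) + C a3 * (x^2*z) + C a4 * (x*y^2) +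
      C a5 * (x*y*z) + C a6 * (x*z^2) + C a7 * y^3 + C a8 * (y^2*z) + C a9 * (y*z^2) + C a10 * z^3"
    using forms_3E[OF b] by blast
  have "p * r = C a1 * (x^3 * r) + C a2 * (x^2*y * r) + C a3 * (x^2*z * r) + C a4 * (x*y^2 * r) +
      C a5 * (x*y*z * r) + C a6 * (x*z^2 * r) + C a7 * (y^3 * r) + C a8 * (y^2*z * r) + C a9 * (y*z^2 * r) + C a10 * (z^3 * r)"
    unfolding e by (simp add: distrib_right mult.assoc)
  also have "\<dots> \<in> I" by (rule m | rule add | rule mult)+
  finally show "p * r \<in> I" .
qed

definition exceptional_in :: "'k poly3 \<Rightarrow> 'k poly3 \<Rightarrow> 'k poly3 \<Rightarrow> bool"
  where "exceptional_in x y z \<longleftrightarrow> basis3 x y z \<and> x^2 * y \<in> I \<and> x^2 * z \<in> I \<and> y^3 \<in> I \<and> z^3 \<in> I \<and> x^4 + y^2 * z^2 \<in> I"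

end

lemma numeral_poly3: "(numeral k :: 'k::comm_ring_1) = 0 \<Longrightarrow> (numeral k :: 'k poly3) = 0"
  using C_simps(8)[where 'a = 'k, of k] by (simp add: C_simps)

context two_term
begin

lemma multiple_mem:
  assumes "l \<in> forms 1" "ev v0 l = 0" shows "l * q \<in> I"
proof -
  obtain a1 a2 a3 where l: "l = C a1 * u1 + C a2 * u2 + C a3 * u3" using forms_1E[OF u assms(1)] .
  then have "a3 = 0" using assms(2) v0 by simp
  then have "l * q = C a1 * (u1 * q) + C a2 * (u2 * q)" unfolding l by (simp add: C_simps algebra_simps)
  then show ?thesis using q by auto
qed

text \<open>Both \<open>u1\<close> and \<open>u2\<close> kill \<open>x^2\<close>, and
  \<open>x\<close> completes them to coordinates. Among the cubic monomials only \<open>x^3\<close>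
  can therefore pair nontrivially with \<open>x^2\<close>.\<close>

lemma fifth_power_not_mem:
  assumes x: "x \<in> forms 1" "ev v0 x \<noteq> 0" and qe: "q = x^2"
  shows "x^5 \<notin> I"
proof
  assume x5: "x^5 \<in> I"
  obtain a1 a2 a3 where l: "x = C a1 * u1 + C a2 * u2 + C a3 * u3" using forms_1E[OF u x(1)] .
  then have "a3 \<noteq> 0" using x(2) v0 by simp
  then have b: "basis3 u1 u2 x" using basis3_change3[OF u _ l] by blast
  have U: "u1 * x^2 \<in> I" "u2 * x^2 \<in> I" using q(3,4) unfolding qe by auto
  have m: "m * n * x^2 \<in> I" if "n * x^2 \<in> I" for m n using mult[OF that, of m] by (simp add: mult.assoc)
  have "x^2 = 0"
  proof (rule quadric_kills_monomials[OF b])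
    show "x^2 \<in> forms 2" using q(1) qe by simp
    show "u1^3 * x^2 \<in> I" "u1^2 * u2 * x^2 \<in> I" "u1 * u2^2 * x^2 \<in> I" "u2^3 * x^2 \<in> I"
      using m[OF U(1), of "u1^2"] m[OF U(1), of "u1 * u2"] m[OF U(1), of "u2^2"] m[OF U(2), of "u2^2"]
      by (simp_all add: power2_eq_square power3_eq_cube ac_simps)
    show "u1^2 * x * x^2 \<in> I" "u1 * u2 * x * x^2 \<in> I" "u1 * x^2 * x^2 \<in> I" "u2^2 * x * x^2 \<in> I" "u2 * x^2 * x^2 \<in> I"
      using m[OF U(1), of "u1 * x"] m[OF U(1), of "u2 * x"] m[OF U(1), of "x^2"] m[OF U(2), of "u2 * x"] m[OF U(2), of "x^2"]
      by (simp_all add: power2_eq_square ac_simps)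
    show "x^3 * x^2 \<in> I" using x5 by (simp add: power_add[symmetric])
  qed
  then show False using q(2) qe by simp
qed

end

locale double_line = two_term +
  fixes x y z
  assumes b: "basis3 x y z" and qe: "q = x^2"
begin

lemma sq_mem: "l \<in> forms 1 \<Longrightarrow> ev v0 l = 0 \<Longrightarrow> x^2 * l \<in> I"
  using multiple_mem[of l] unfolding qe by (simp add: mult.commute)

text \<open>The expansion of a cubic along the line \<open>x = 0\<close> up to first order:
  \<open>h\<close>, \<open>i\<close>, \<open>j\<close>, \<open>k\<close> give the restriction and
  \<open>a\<close>, \<open>e\<close>, \<open>n\<close> the normal derivative. The rest is a linear
  multiple of \<open>q\<close>.\<close>

definition shape :: "'a poly3 \<Rightarrow> 'a \<Rightarrow> 'a \<Rightarrow> 'a \<Rightarrow> 'a \<Rightarrow> 'a \<Rightarrow> 'a \<Rightarrow> 'a \<Rightarrow> bool"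
  where "shape f h i j k a e n \<longleftrightarrow> (\<exists>l\<in>forms 1. f = C h * y^3 + C i * (y^2*z) + C j * (y*z^2) + C k * z^3 +
    x * (C a * y^2 + C e * (y*z) + C n * z^2) + x^2 * l)"

lemma ex_shape:
  assumes "f \<in> forms 3" shows "\<exists>h i j k a e n. shape f h i j k a e n"
proof -
  obtain a1 a2 a3 a4 a5 a6 a7 a8 a9 a10 where e: "f = C a1 * x^3 + C a2 * (x^2*y) + C a3 * (x^2*z) + C a4 * (x*y^2) +
      C a5 * (x*y*z) + C a6 * (x*z^2) + C a7 * y^3 + C a8 * (y^2*z) + C a9 * (y*z^2) + C a10 * z^3"
    using forms_3E[OF b assms] .
  have "C a1 * x + C a2 * y + C a3 * z \<in> forms 1" using basis3_forms[OF b] by auto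
  moreover have "f = C a7 * y^3 + C a8 * (y^2*z) + C a9 * (y*z^2) + C a10 * z^3 +
    x * (C a4 * y^2 + C a5 * (y*z) + C a6 * z^2) + x^2 * (C a1 * x + C a2 * y + C a3 * z)"
    unfolding e by (simp add: algebra_simps power2_eq_square power3_eq_cube)
  ultimately show ?thesis unfolding shape_def by blast
qed

lemma shape_comb:
  assumes "shape f h i j k a e n" "shape f' h' i' j' k' a' e' n'"
  shows "shape (C \<alpha> * f + C \<beta> * f') (\<alpha> * h + \<beta> * h') (\<alpha> * i + \<beta> * i') (\<alpha> * j + \<beta> * j') (\<alpha> * k + \<beta> * k')
    (\<alpha> * a + \<beta> * a') (\<alpha> * e + \<beta> * e') (\<alpha> * n + \<beta> * n')"
proof -
  obtain l where l: "l \<in> forms 1" "f = C h * y^3 + C i * (y^2*z) + C j * (y*z^2) + C k * z^3 +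
    x * (C a * y^2 + C e * (y*z) + C n * z^2) + x^2 * l" using assms(1) unfolding shape_def by blast
  obtain l' where l': "l' \<in> forms 1" "f' = C h' * y^3 + C i' * (y^2*z) + C j' * (y*z^2) + C k' * z^3 +
    x * (C a' * y^2 + C e' * (y*z) + C n' * z^2) + x^2 * l'" using assms(2) unfolding shape_def by blast
  have "C \<alpha> * l + C \<beta> * l' \<in> forms 1" using l l' by auto
  then show ?thesis unfolding shape_def l(2) l'(2)
    by (intro bexI[of _ "C \<alpha> * l + C \<beta> * l'"]) (simp_all add: C_simps algebra_simps)
qed

text \<open>Restriction to the lines \<open>z = t y + r x\<close>, along which \<open>q = x\<^sup>2\<close> vanishes doubly at one point.\<close>

lemma tangency:
  assumes sc: "shape c h i j k a e n" and sd: "shape d h' i' j' k' a' e' n'"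
  defines "\<gamma>0 \<equiv> [:h, i, j, k:]" and "\<gamma>1 \<equiv> [:a, e, n:]" and "\<delta>0 \<equiv> [:h', i', j', k':]" and "\<delta>1 \<equiv> [:a', e', n':]"
  shows "\<gamma>0 * \<delta>1 = \<delta>0 * \<gamma>1" and "\<gamma>0 * [:i', 2 * j', 3 * k':] = \<delta>0 * [:i, 2 * j, 3 * k:]"
proof -
  note bf = basis3_forms[OF b]
  obtain l where l: "l \<in> forms 1" "c = C h * y^3 + C i * (y^2*z) + C j * (y*z^2) + C k * z^3 +
    x * (C a * y^2 + C e * (y*z) + C n * z^2) + x^2 * l" using sc unfolding shape_def by blast
  obtain l' where l': "l' \<in> forms 1" "d = C h' * y^3 + C i' * (y^2*z) + C j' * (y*z^2) + C k' * z^3 +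
    x * (C a' * y^2 + C e' * (y*z) + C n' * z^2) + x^2 * l'" using sd unfolding shape_def by blast
  define x0 y0 z0 where "x0 = ev v0 x" and "y0 = ev v0 y" and "z0 = ev v0 z"
  define G0 where "G0 = \<gamma>0 * \<delta>1 - \<delta>0 * \<gamma>1"
  define G1 where "G1 = \<gamma>0 * [:i', 2 * j', 3 * k':] - \<delta>0 * [:i, 2 * j, 3 * k:]"
  \<comment> \<open>Double contact at the point \<open>(0:1:t)\<close> gives two linear equations
    for the pencil parameters. Their determinant \<open>G0 + r * G1\<close> is linear in the slope
    \<open>r\<close>, so both parts vanish; \<open>G1\<close> is the Wronskian of the two
    restrictions.\<close>
  have main: "poly G0 t * poly 1 r = poly (- G1) t * poly [:0, 1:] r" for t r
  proof (rule cross_vanish[of z0 "- y0" "- x0" 0])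
    show "z0 \<noteq> 0 \<or> - y0 \<noteq> 0 \<or> - x0 \<noteq> 0 \<or> (0::'a) \<noteq> 0" using v0_nonzero[OF b] by (auto simp: x0_def y0_def z0_def)
    fix t r assume nz: "z0 + - y0 * t + (- x0 + 0 * t) * r \<noteq> 0"
    define L where "L = z - C t * y - C r * x"
    have L: "L \<in> forms 1" unfolding L_def using bf by auto
    have L0: "ev v0 L \<noteq> 0" using nz by (simp add: L_def x0_def y0_def z0_def algebra_simps)
    have Lq: "\<not> L dvd q"
    proof
      assume "L dvd q"
      then obtain k where k: "q = L * k" by blast
      obtain v where v: "ev v x = 1" "ev v y = 0" "ev v z = r" using basis3_ev[OF b] by blast
      have "ev v L = 0" using v by (simp add: L_def)
      then have "ev v q = 0" unfolding k by simp
      then show False unfolding qe using v by simp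
    qed
    obtain m \<alpha> \<beta> where m: "m \<in> forms 1" "\<alpha> \<noteq> 0 \<or> \<beta> \<noteq> 0" "L dvd m * q + C \<alpha> * c + C \<beta> * d"
      using general_line[OF L L0 Lq] .
    obtain w where w: "m * q + C \<alpha> * c + C \<beta> * d = L * w" using m(3) by blast
    have "C \<alpha> * l + C \<beta> * l' + m \<in> forms 1" using l l' m by auto
    then obtain n1 n2 n3 where n: "C \<alpha> * l + C \<beta> * l' + m = C n1 * x + C n2 * y + C n3 * z" using forms_1E[OF b] by blast
    define H I' J K A E G where "H = \<alpha> * h + \<beta> * h'" and "I' = \<alpha> * i + \<beta> * i'" and "J = \<alpha> * j + \<beta> * j'" and "K = \<alpha> * k + \<beta> * k'"
      and "A = \<alpha> * a + \<beta> * a'" and "E = \<alpha> * e + \<beta> * e'" and "G = \<alpha> * n + \<beta> * n'"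
    have "m * q + C \<alpha> * c + C \<beta> * d = C H * y^3 + C I' * (y^2*z) + C J * (y*z^2) + C K * z^3 +
      x * (C A * y^2 + C E * (y*z) + C G * z^2) + x^2 * (C \<alpha> * l + C \<beta> * l' + m)"
      unfolding l(2) l'(2) qe H_def I'_def J_def K_def A_def E_def G_def by (simp add: C_simps algebra_simps)
    then have comb: "L * w = C H * y^3 + C I' * (y^2*z) + C J * (y*z^2) + C K * z^3 +
      x * (C A * y^2 + C E * (y*z) + C G * z^2) + x^2 * (C n1 * x + C n2 * y + C n3 * z)" unfolding w n .
    have "(H + I' * t + J * t^2 + K * t^3) + (r * (I' + 2 * J * t + 3 * K * t^2) + (A + E * t + G * t^2)) * \<xi> +
      (J * r^2 + 3 * K * t * r^2 + E * r + 2 * G * t * r + n2 + n3 * t) * \<xi>^2 + (K * r^3 + G * r^2 + n1 + n3 * r) * \<xi>^3 = 0" for \<xi>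
    proof -
      obtain v where v: "ev v x = \<xi>" "ev v y = 1" "ev v z = t + r * \<xi>" using basis3_ev[OF b] by blast
      have "ev v (L * w) = 0" using v by (simp add: L_def algebra_simps)
      then have "H + I' * (t + r * \<xi>) + J * (t + r * \<xi>)^2 + K * (t + r * \<xi>)^3 +
        \<xi> * (A + E * (t + r * \<xi>) + G * (t + r * \<xi>)^2) + \<xi>^2 * (n1 * \<xi> + n2 + n3 * (t + r * \<xi>)) = 0"
        unfolding comb using v by simp
      then show ?thesis by Groebner_Basis.algebra
    qed
    from cubic_polynomial_zero(1,2)[OF this]
    have eqs: "H + I' * t + J * t^2 + K * t^3 = 0" "r * (I' + 2 * J * t + 3 * K * t^2) + (A + E * t + G * t^2) = 0" by blast+
    define p0 p1 pd where "p0 = poly \<gamma>0 t" and "p1 = poly \<gamma>1 t" and "pd = poly [:i, 2 * j, 3 * k:] t"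
    define r0 r1 rd where "r0 = poly \<delta>0 t" and "r1 = poly \<delta>1 t" and "rd = poly [:i', 2 * j', 3 * k':] t"
    have "\<alpha> * p0 + \<beta> * r0 = 0"
      using eqs(1) unfolding H_def I'_def J_def K_def p0_def r0_def \<gamma>0_def \<delta>0_def
      by (simp add: algebra_simps power2_eq_square power3_eq_cube)
    moreover have "\<alpha> * (r * pd + p1) + \<beta> * (r * rd + r1) = 0"
      using eqs(2) unfolding I'_def J_def K_def A_def E_def G_def pd_def rd_def p1_def r1_def \<gamma>1_def \<delta>1_def
      by (simp add: algebra_simps power2_eq_square)
    ultimately have "\<alpha> * (p0 * (r * rd + r1) - r0 * (r * pd + p1)) = 0" "\<beta> * (p0 * (r * rd + r1) - r0 * (r * pd + p1)) = 0"
      by Groebner_Basis.algebra+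
    then have "p0 * (r * rd + r1) - r0 * (r * pd + p1) = 0" using m(2) by auto
    then show "poly G0 t * poly 1 r = poly (- G1) t * poly [:0, 1:] r"
      unfolding G0_def G1_def poly_diff poly_mult poly_minus p0_def[symmetric] p1_def[symmetric] pd_def[symmetric]
        r0_def[symmetric] r1_def[symmetric] rd_def[symmetric] by (simp add: algebra_simps)
  qed
  have "poly G0 t = 0" for t using main[of t 0] by simp
  then have "G0 = 0" by (rule poly_fun_zero)
  then show "\<gamma>0 * \<delta>1 = \<delta>0 * \<gamma>1" by (simp add: G0_def)
  have "poly G1 t = 0" for t using main[of t 1] \<open>G0 = 0\<close> by simp
  then have "G1 = 0" by (rule poly_fun_zero)
  then show "\<gamma>0 * [:i', 2 * j', 3 * k':] = \<delta>0 * [:i, 2 * j, 3 * k:]" by (simp add: G1_def)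
qed

text \<open>By the first identity of \<open>tangency\<close>, the first-order part \<open>F\<close>
  of a member that vanishes on \<open>x = 0\<close> is annihilated by both restrictions. Either
  \<open>F = 0\<close> and this member is a multiple of \<open>q\<close>, or \<open>x\<close>
  divides both \<open>c\<close> and \<open>d\<close>.\<close>

lemma restrictions_independent:
  assumes sc: "shape c h i j k a e n" and sd: "shape d h' i' j' k' a' e' n'"
    and "\<alpha> \<noteq> 0 \<or> \<beta> \<noteq> 0" and z: "\<alpha> * h + \<beta> * h' = 0" "\<alpha> * i + \<beta> * i' = 0" "\<alpha> * j + \<beta> * j' = 0" "\<alpha> * k + \<beta> * k' = 0"
  shows False
proof -
  define \<gamma>0 \<gamma>1 \<delta>0 \<delta>1 where "\<gamma>0 = [:h, i, j, k:]" and "\<gamma>1 = [:a, e, n:]" and "\<delta>0 = [:h', i', j', k':]" and "\<delta>1 = [:a', e', n':]"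
  have t: "\<gamma>0 * \<delta>1 = \<delta>0 * \<gamma>1" using tangency(1)[OF sc sd] by (simp only: \<gamma>0_def \<gamma>1_def \<delta>0_def \<delta>1_def)
  define F where "F = Polynomial.smult \<alpha> \<gamma>1 + Polynomial.smult \<beta> \<delta>1"
  have z0: "Polynomial.smult \<alpha> \<gamma>0 + Polynomial.smult \<beta> \<delta>0 = 0" using z by (simp add: \<gamma>0_def \<delta>0_def)
  have "\<gamma>0 * F = \<gamma>1 * (Polynomial.smult \<alpha> \<gamma>0 + Polynomial.smult \<beta> \<delta>0)"
    using t by (simp add: F_def distrib_left mult.commute)
  moreover have "\<delta>0 * F = \<delta>1 * (Polynomial.smult \<alpha> \<gamma>0 + Polynomial.smult \<beta> \<delta>0)"
    using t by (simp add: F_def distrib_left mult.commute)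
  ultimately have gd: "\<gamma>0 * F = 0" "\<delta>0 * F = 0" unfolding z0 by simp_all
  show False
  proof (cases "F = 0")
    case True
    then have F0: "\<alpha> * a + \<beta> * a' = 0" "\<alpha> * e + \<beta> * e' = 0" "\<alpha> * n + \<beta> * n' = 0" by (simp_all add: F_def \<gamma>1_def \<delta>1_def)
    have "shape (C \<alpha> * c + C \<beta> * d) 0 0 0 0 0 0 0" using shape_comb[OF sc sd, of \<alpha> \<beta>] unfolding z F0 .
    then obtain l where "l \<in> forms 1" "C \<alpha> * c + C \<beta> * d = q * l" unfolding shape_def qe by (auto simp: C_simps)
    then show False using pencil_not_multiple assms(3) by blast
  next
    case False
    then have "\<gamma>0 = 0" "\<delta>0 = 0" using gd by simp_all
    then have "h = 0" "i = 0" "j = 0" "k = 0" "h' = 0" "i' = 0" "j' = 0" "k' = 0" by (simp_all add: \<gamma>0_def \<delta>0_def)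
    then have "x dvd c" "x dvd d" using sc sd unfolding shape_def by (auto simp: C_simps power2_eq_square)
    then show False using no_common[of x] basis3_forms[OF b] basis3_nonzero[OF b] qe by (simp add: power2_eq_square)
  qed
qed

lemma minors_nonzero:
  assumes sc: "shape c h i j k a e n" and sd: "shape d h' i' j' k' a' e' n'"
  shows "\<not> (h * i' = i * h' \<and> h * j' = j * h' \<and> h * k' = k * h' \<and> i * j' = j * i' \<and> i * k' = k * i' \<and> j * k' = k * j')"
proof
  assume *: "h * i' = i * h' \<and> h * j' = j * h' \<and> h * k' = k * h' \<and> i * j' = j * i' \<and> i * k' = k * i' \<and> j * k' = k * j'"
  note r = restrictions_independent[OF sc sd]
  consider "h \<noteq> 0 \<or> h' \<noteq> 0" | "i \<noteq> 0 \<or> i' \<noteq> 0" | "j \<noteq> 0 \<or> j' \<noteq> 0" | "k \<noteq> 0 \<or> k' \<noteq> 0" | "h = 0" "i = 0" "j = 0" "k = 0" by blast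
  then show False
  proof cases
    case 1 then show False using r[of h' "- h"] * by (auto simp: mult.commute)
  next
    case 2 then show False using r[of i' "- i"] * by (auto simp: mult.commute)
  next
    case 3 then show False using r[of j' "- j"] * by (auto simp: mult.commute)
  next
    case 4 then show False using r[of k' "- k"] * by (auto simp: mult.commute)
  next
    case 5 then show False using r[of 1 0] by simp
  qed
qed

lemma tangency_comb:
  assumes sc: "shape c h i j k a e n" and sd: "shape d h' i' j' k' a' e' n'"
  shows "[:\<alpha>*h+\<beta>*h', \<alpha>*i+\<beta>*i', \<alpha>*j+\<beta>*j', \<alpha>*k+\<beta>*k':] * [:\<gamma>*a+\<delta>*a', \<gamma>*e+\<delta>*e', \<gamma>*n+\<delta>*n':] =
    [:\<gamma>*h+\<delta>*h', \<gamma>*i+\<delta>*i', \<gamma>*j+\<delta>*j', \<gamma>*k+\<delta>*k':] * [:\<alpha>*a+\<beta>*a', \<alpha>*e+\<beta>*e', \<alpha>*n+\<beta>*n':]"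
proof -
  define p0 p1 r0 r1 where "p0 = [:h, i, j, k:]" and "p1 = [:a, e, n:]" and "r0 = [:h', i', j', k':]" and "r1 = [:a', e', n':]"
  have t: "p0 * r1 = r0 * p1" using tangency(1)[OF sc sd] by (simp only: p0_def p1_def r0_def r1_def)
  have c: "[:\<alpha>*h+\<beta>*h', \<alpha>*i+\<beta>*i', \<alpha>*j+\<beta>*j', \<alpha>*k+\<beta>*k':] = Polynomial.smult \<alpha> p0 + Polynomial.smult \<beta> r0"
    "[:\<alpha>*a+\<beta>*a', \<alpha>*e+\<beta>*e', \<alpha>*n+\<beta>*n':] = Polynomial.smult \<alpha> p1 + Polynomial.smult \<beta> r1" for \<alpha> \<beta>
    by (simp_all add: p0_def p1_def r0_def r1_def)
  have "(Polynomial.smult \<alpha> p0 + Polynomial.smult \<beta> r0) * (Polynomial.smult \<gamma> p1 + Polynomial.smult \<delta> r1) -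
    (Polynomial.smult \<gamma> p0 + Polynomial.smult \<delta> r0) * (Polynomial.smult \<alpha> p1 + Polynomial.smult \<beta> r1) =
    Polynomial.smult (\<alpha> * \<delta> - \<beta> * \<gamma>) (p0 * r1 - r0 * p1)"
    by (simp add: algebra_simps smult_diff_left smult_diff_right)
  then show ?thesis unfolding c t by simp
qed

text \<open>The 2 by 2 minors are the Pluecker coordinates of the pencil of restrictions, with
  indices 0 to 3 for \<open>h\<close>, \<open>i\<close>, \<open>j\<close>, \<open>k\<close>. A zero
  Wronskian means that \<open>p01\<close>, \<open>2 p02\<close>, \<open>3 p03 + p12\<close>,
  \<open>2 p13\<close> and \<open>p23\<close> vanish. The Pluecker relation then gives
  \<open>3 p03^2 = 0\<close> outside characteristics 2 and 3. In characteristic 3 only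
  \<open>p03\<close> survives, the pencil of \<open>y^3\<close> and \<open>z^3\<close>. In
  characteristic 2 the pencil consists of a linear form times the squares.\<close>

lemma double_line_normal_form:
  shows "(3::'a) = 0 \<and> (\<exists>l\<in>forms 1. \<exists>l'\<in>forms 1. y^3 + x^2 * l \<in> I \<and> z^3 + x^2 * l' \<in> I) \<or>
    (2::'a) = 0 \<and> (\<exists>m0 m1 \<rho>. (m0 \<noteq> 0 \<or> m1 \<noteq> 0) \<and> (\<exists>l\<in>forms 1. \<exists>l'\<in>forms 1.
      (C m0 * y + C m1 * z + C \<rho> * x) * y^2 + x^2 * l \<in> I \<and> (C m0 * y + C m1 * z + C \<rho> * x) * z^2 + x^2 * l' \<in> I))"
proof -
  obtain h i j k a e n where sc: "shape c h i j k a e n" using ex_shape[OF cd(1)] by blast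
  obtain h' i' j' k' a' e' n' where sd: "shape d h' i' j' k' a' e' n'" using ex_shape[OF cd(3)] by blast
  have w: "[:h, i, j, k:] * [:i', 2 * j', 3 * k':] - [:h', i', j', k':] * [:i, 2 * j, 3 * k:] = 0"
    using tangency(2)[OF sc sd] by (simp only: right_minus_eq)
  have w3: "i * j' + 3 * k' * h = i' * j + 3 * k * h'" using w by (simp add: algebra_simps)
  then have W3: "3 * (h * k' - k * h') + (i * j' - j * i') = 0" by Groebner_Basis.algebra
  have W': "h * i' = i * h'" "2 * (h * j' - j * h') = 0" "2 * (i * k' - k * i') = 0" "j * k' = k * j'"
    using w by (simp_all add: algebra_simps)
  note W = W'(1,2) W3 W'(3,4)
  have plucker: "(h * i' - i * h') * (j * k' - k * j') - (h * j' - j * h') * (i * k' - k * i') + (h * k' - k * h') * (i * j' - j * i') = 0"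
    by (simp add: algebra_simps)
  note nz = minors_nonzero[OF sc sd]
  have mem: "C \<alpha> * c + C \<beta> * d \<in> I" for \<alpha> \<beta> using cd by auto
  consider "(2::'a) \<noteq> 0" "(3::'a) \<noteq> 0" | "(2::'a) \<noteq> 0" "(3::'a) = 0" | "(2::'a) = 0" by blast
  then show ?thesis
  proof cases
    case 1
    then have 2: "h * j' - j * h' = 0" "i * k' - k * i' = 0" using W by simp_all
    have "3 * (h * k' - k * h')^2 = 0" using plucker W(1,3,5) 2 by Groebner_Basis.algebra
    then have "h * k' - k * h' = 0" using 1 by simp
    moreover from this have "i * j' - j * i' = 0" using W(3) by simp
    ultimately show ?thesis using nz W(1,5) 2 by simp
  next
    case 2
    then have M: "h * j' = j * h'" "i * k' = k * i'" "i * j' = j * i'" using W by simp_all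
    define D where "D = h * k' - k * h'"
    have D: "D \<noteq> 0" using nz M W by (auto simp: D_def)
    \<comment> \<open>The inverse of the matrix formed by the coefficients of \<open>y^3\<close> and
      \<open>z^3\<close>.\<close>
    define \<alpha> \<beta> \<gamma> \<delta> where "\<alpha> = k' / D" and "\<beta> = - k / D" and "\<gamma> = - h' / D" and "\<delta> = h / D"
    have co: "\<alpha>*h+\<beta>*h' = 1" "\<alpha>*i+\<beta>*i' = 0" "\<alpha>*j+\<beta>*j' = 0" "\<alpha>*k+\<beta>*k' = 0"
      "\<gamma>*h+\<delta>*h' = 0" "\<gamma>*i+\<delta>*i' = 0" "\<gamma>*j+\<delta>*j' = 0" "\<gamma>*k+\<delta>*k' = 1"
      using D M W(1,5) unfolding \<alpha>_def \<beta>_def \<gamma>_def \<delta>_def by (simp_all add: field_simps) (simp_all add: D_def algebra_simps)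
    note t = tangency_comb[OF sc sd, of \<alpha> \<beta> \<gamma> \<delta>, unfolded co]
    have z: "\<alpha>*a+\<beta>*a' = 0" "\<alpha>*e+\<beta>*e' = 0" "\<alpha>*n+\<beta>*n' = 0" "\<gamma>*a+\<delta>*a' = 0" "\<gamma>*e+\<delta>*e' = 0" "\<gamma>*n+\<delta>*n' = 0"
      using t by simp_all
    have "shape (C \<alpha> * c + C \<beta> * d) 1 0 0 0 0 0 0" using shape_comb[OF sc sd, of \<alpha> \<beta>] unfolding co z .
    then obtain l where l: "l \<in> forms 1" "C \<alpha> * c + C \<beta> * d = y^3 + x^2 * l" unfolding shape_def by (auto simp: C_simps)
    have "shape (C \<gamma> * c + C \<delta> * d) 0 0 0 1 0 0 0" using shape_comb[OF sc sd, of \<gamma> \<delta>] unfolding co z .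
    then obtain l' where l': "l' \<in> forms 1" "C \<gamma> * c + C \<delta> * d = z^3 + x^2 * l'" unfolding shape_def by (auto simp: C_simps)
    have "y^3 + x^2 * l \<in> I" "z^3 + x^2 * l' \<in> I" using mem[of \<alpha> \<beta>] mem[of \<gamma> \<delta>] l l' by simp_all
    then show ?thesis using 2 l(1) l'(1) by blast
  next
    case 3
    \<comment> \<open>The witnesses eliminate one coefficient: \<open>(k', - k)\<close> removes
      \<open>z^3\<close> and \<open>(- i', i)\<close> removes \<open>y^2 z\<close>. If the minors
      \<open>p03\<close> and \<open>p13\<close> vanish, only \<open>p02\<close> is left; the pairs
      \<open>(j', - j)\<close> and \<open>(- h', h)\<close> then give \<open>y^3\<close> and
      \<open>y z^2\<close>.\<close>
    have "\<exists>\<alpha> \<beta> \<gamma> \<delta> m0 m1. (m0 \<noteq> 0 \<or> m1 \<noteq> 0) \<and> \<alpha>*h+\<beta>*h' = m0 \<and> \<alpha>*i+\<beta>*i' = m1 \<and> \<alpha>*j+\<beta>*j' = 0 \<and> \<alpha>*k+\<beta>*k' = 0 \<and>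
      \<gamma>*h+\<delta>*h' = 0 \<and> \<gamma>*i+\<delta>*i' = 0 \<and> \<gamma>*j+\<delta>*j' = m0 \<and> \<gamma>*k+\<delta>*k' = m1"
    proof (cases "h * k' = k * h' \<and> i * k' = k * i'")
      case False
      have "(3::'a) = 2 + 1" by simp
      then have three: "(3::'a) = 1" unfolding 3 by simp
      have neg: "- t = t" for t :: 'a using 3 mult_2[of t] by (simp add: neg_eq_iff_add_eq_0)
      have "(i * j' - j * i') + (h * k' - k * h') = 0" using W(3) unfolding three by (simp add: add.commute)
      then have "i * j' - j * i' = - (h * k' - k * h')" by (simp only: eq_neg_iff_add_eq_0)
      then have "i * j' - j * i' = h * k' - k * h'" unfolding neg .
      then have "- i' * j + i * j' = h * k' - k * h'" by (simp add: algebra_simps)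
      moreover have "k' * j + - k * j' = 0" "- i' * h + i * h' = 0" using W(1,5) by (simp_all add: algebra_simps)
      moreover have "k' * h + - k * h' = h * k' - k * h'" "k' * i + - k * i' = i * k' - k * i'"
        "k' * k + - k * k' = 0" "- i' * i + i * i' = 0" "- i' * k + i * k' = i * k' - k * i'" by (simp_all add: algebra_simps)
      moreover have "h * k' - k * h' \<noteq> 0 \<or> i * k' - k * i' \<noteq> 0" using False by auto
      ultimately show ?thesis by blast
    next
      case True
      then have ij: "i * j' = j * i'" using W(3) by simp
      have "h * j' - j * h' \<noteq> 0" using nz True W(1,5) ij by auto
      moreover have "j' * i + - j * i' = 0" "j' * k + - j * k' = 0" "- h' * i + h * i' = 0" "- h' * k + h * k' = 0"
        using True W(1,5) ij by (simp_all add: algebra_simps)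
      moreover have "j' * h + - j * h' = h * j' - j * h'" "j' * j + - j * j' = 0" "- h' * h + h * h' = 0"
        "- h' * j + h * j' = h * j' - j * h'" by (simp_all add: algebra_simps)
      ultimately show ?thesis by blast
    qed
    then obtain \<alpha> \<beta> \<gamma> \<delta> m0 m1 where m: "m0 \<noteq> 0 \<or> m1 \<noteq> 0"
      and co: "\<alpha>*h+\<beta>*h' = m0" "\<alpha>*i+\<beta>*i' = m1" "\<alpha>*j+\<beta>*j' = 0" "\<alpha>*k+\<beta>*k' = 0"
      "\<gamma>*h+\<delta>*h' = 0" "\<gamma>*i+\<delta>*i' = 0" "\<gamma>*j+\<delta>*j' = m0" "\<gamma>*k+\<delta>*k' = m1" by blast
    define A E G A' E' G' where "A = \<alpha>*a+\<beta>*a'" and "E = \<alpha>*e+\<beta>*e'" and "G = \<alpha>*n+\<beta>*n'"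
      and "A' = \<gamma>*a+\<delta>*a'" and "E' = \<gamma>*e+\<delta>*e'" and "G' = \<gamma>*n+\<delta>*n'"
    note defs = A_def[symmetric] E_def[symmetric] G_def[symmetric] A'_def[symmetric] E'_def[symmetric] G'_def[symmetric]
    have t: "[:m0, m1, 0, 0:] * [:A', E', G':] = [:0, 0, m0, m1:] * [:A, E, G:]"
      using tangency_comb[OF sc sd, of \<alpha> \<beta> \<gamma> \<delta>] unfolding co defs .
    \<comment> \<open>Cancelling the nonzero factor shows that the first-order parts are
      \<open>A y^2\<close> and \<open>A z^2\<close>, so \<open>A x\<close> can be added to the
      common linear factor.\<close>
    have "[:m0, m1:] * [:A', E', G' - A, - E, - G:] = [:m0, m1, 0, 0:] * [:A', E', G':] - [:0, 0, m0, m1:] * [:A, E, G:]"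
      by (simp add: algebra_simps)
    then have "[:m0, m1:] * [:A', E', G' - A, - E, - G:] = 0" unfolding t by simp
    then have z: "A' = 0" "E' = 0" "G' = A" "E = 0" "G = 0" using m by (auto simp: mult_eq_0_iff simp del: mult_pCons_left mult_pCons_right)
    have "shape (C \<alpha> * c + C \<beta> * d) m0 m1 0 0 A 0 0" using shape_comb[OF sc sd, of \<alpha> \<beta>] unfolding co defs z .
    then obtain l where l: "l \<in> forms 1" "C \<alpha> * c + C \<beta> * d = C m0 * y^3 + C m1 * (y^2*z) + x * (C A * y^2) + x^2 * l"
      unfolding shape_def by (auto simp: C_simps)
    have "shape (C \<gamma> * c + C \<delta> * d) 0 0 m0 m1 0 0 A" using shape_comb[OF sc sd, of \<gamma> \<delta>] unfolding co defs z .
    then obtain l' where l': "l' \<in> forms 1" "C \<gamma> * c + C \<delta> * d = C m0 * (y*z^2) + C m1 * z^3 + x * (C A * z^2) + x^2 * l'"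
      unfolding shape_def by (auto simp: C_simps)
    have "(C m0 * y + C m1 * z + C A * x) * y^2 + x^2 * l \<in> I"
      using mem[of \<alpha> \<beta>] unfolding l(2) by (simp add: algebra_simps power2_eq_square power3_eq_cube)
    moreover have "(C m0 * y + C m1 * z + C A * x) * z^2 + x^2 * l' \<in> I"
      using mem[of \<gamma> \<delta>] unfolding l'(2) by (simp add: algebra_simps power2_eq_square power3_eq_cube)
    ultimately show ?thesis using 3 m l(1) l'(1) by blast
  qed
qed

end

section \<open>The double line in characteristics 3 and 2\<close>

context double_line
begin

text \<open>Each cubic monomial in \<open>x\<close>, \<open>s\<close>, \<open>t\<close> other than
  \<open>t^3\<close> is divisible by \<open>x\<close> or by \<open>s\<close>, so under these
  assumptions every cubic would kill \<open>x^2\<close>.\<close>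

lemma no_kill_by_axis:
  assumes x: "x^3 \<in> I" and b': "basis3 x s t" and "x^2 * s \<in> I" "x^2 * t^3 \<in> I"
  shows False
proof -
  have m: "m * n \<in> I" if "n = x^3 \<or> n = x^2 * s" for m n using that x assms(3) by auto
  have "x^2 = 0"
  proof (rule quadric_kills_monomials[OF b'])
    show "x^2 \<in> forms 2" using q(1) qe by simp
    show "x^3 * x^2 \<in> I" "x^2 * s * x^2 \<in> I" using mult_right[OF x] mult_right[OF assms(3)] by blast+
    show "x^2 * t * x^2 \<in> I" "x * s^2 * x^2 \<in> I" "x * s * t * x^2 \<in> I" "x * t^2 * x^2 \<in> I"
      using m[of "x^3" "x * t"] m[of "x^3" "s^2"] m[of "x^3" "s * t"] m[of "x^3" "t^2"]
      by (simp_all add: power2_eq_square power3_eq_cube ac_simps)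
    show "s^3 * x^2 \<in> I" "s^2 * t * x^2 \<in> I" "s * t^2 * x^2 \<in> I"
      using m[of "x^2 * s" "s^2"] m[of "x^2 * s" "s * t"] m[of "x^2 * s" "t^2"]
      by (simp_all add: power2_eq_square power3_eq_cube ac_simps)
    show "t^3 * x^2 \<in> I" using assms(4) by (simp add: mult.commute)
  qed
  then show False using q(2) qe by simp
qed

lemma cube_on_axis:
  assumes b': "basis3 x s t" and x0: "ev v0 x = 0" and st: "x^2 * s^3 \<in> I" "x^2 * t^3 \<in> I"
  shows False
proof -
  note bf = basis3_forms[OF b']
  have x3: "x^3 \<in> I" using sq_mem[OF bf(1) x0] by (simp add: power2_eq_square power3_eq_cube mult.assoc)
  show False
  proof (cases "ev v0 s = 0")
    case True
    show False by (rule no_kill_by_axis[OF x3 b' sq_mem[OF bf(2) True] st(2)])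
  next
    case False
    define t' where "t' = t - C (ev v0 t / ev v0 s) * s"
    have "basis3 x s t'" using basis3_change3[OF b', of 1 t' 0 "- (ev v0 t / ev v0 s)"] by (simp add: t'_def C_simps)
    then have b'': "basis3 x t' s" by (rule basis3_swap23)
    have "ev v0 t' = 0" using False by (simp add: t'_def)
    then show False using no_kill_by_axis[OF x3 b'' _ st(1)] sq_mem[OF basis3_forms(2)[OF b'']] by blast
  qed
qed

text \<open>Modulo \<open>I\<close> the product \<open>x^2 l\<close> depends only on the value of
  \<open>l\<close> at \<open>v0\<close>, so the tail becomes a scalar multiple of one fixed
  product.\<close>

lemma reduce_tail:
  assumes "w \<in> forms 1" "ev v0 w \<noteq> 0" "l \<in> forms 1" "f + x^2 * l \<in> I"
  shows "f + C (ev v0 l / ev v0 w) * (x^2 * w) \<in> I"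
proof -
  have "l - C (ev v0 l / ev v0 w) * w \<in> forms 1" using assms by auto
  moreover have "ev v0 (l - C (ev v0 l / ev v0 w) * w) = 0" using assms(2) by simp
  ultimately have "x^2 * (l - C (ev v0 l / ev v0 w) * w) \<in> I" by (rule sq_mem)
  from diff[OF assms(4) this] show ?thesis by (simp add: algebra_simps)
qed

text \<open>If \<open>x\<close> vanished at \<open>v0\<close>, then \<open>x^3\<close> would lie in
  \<open>I\<close> and \<open>x^2\<close> would be killed by all cubics. Otherwise a tail is a
  multiple of \<open>x^3\<close>, and the Frobenius map absorbs it into the cube of a shifted
  coordinate. The quartic generator follows since \<open>x^5\<close> and \<open>x Y^2 Z^2\<close>
  both span the socle.\<close>

lemma double_line_char_3:
  assumes three: "(3::'a) = 0" and l: "l \<in> forms 1" "l' \<in> forms 1" and yl: "y^3 + x^2 * l \<in> I" and zl: "z^3 + x^2 * l' \<in> I"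
  shows "\<exists>x y z. exceptional_in x y z"
proof -
  note bf = basis3_forms[OF b]
  have three': "(3::'a poly3) = 0" using numeral_poly3[OF three] .
  have x0: "ev v0 x \<noteq> 0"
  proof
    assume x0: "ev v0 x = 0"
    have x3: "x^3 \<in> I" using sq_mem[OF bf(1) x0] by (simp add: power2_eq_square power3_eq_cube mult.assoc)
    have "x^2 * y^3 = x^2 * (y^3 + x^2 * l) - (x * l) * x^3" by (simp add: algebra_simps power2_eq_square power3_eq_cube)
    then have "x^2 * y^3 \<in> I" using yl x3 by auto
    moreover have "x^2 * z^3 = x^2 * (z^3 + x^2 * l') - (x * l') * x^3" by (simp add: algebra_simps power2_eq_square power3_eq_cube)
    then have "x^2 * z^3 \<in> I" using zl x3 by auto
    ultimately show False using cube_on_axis[OF b x0] by blast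
  qed
  have x5: "x^5 \<notin> I" by (rule fifth_power_not_mem[OF bf(1) x0 qe])
  have shift: "\<exists>\<sigma>. (w + C \<sigma> * x)^3 \<in> I \<and> x^2 * (w + C \<sigma> * x) \<in> I"
    if w: "w \<in> forms 1" and k: "k \<in> forms 1" and wk: "w^3 + x^2 * k \<in> I" for w k
  proof -
    have r: "w^3 + C (ev v0 k / ev v0 x) * (x^2 * x) \<in> I" by (rule reduce_tail[OF bf(1) x0 k wk])
    obtain \<sigma> where \<sigma>: "\<sigma>^3 = ev v0 k / ev v0 x" using nth_root_exists[of 3] by auto
    define W where "W = w + C \<sigma> * x"
    have Wf: "W \<in> forms 1" unfolding W_def using w bf by auto
    have "W^3 = w^3 + C \<sigma> ^ 3 * x^3 + 3 * (w * w * (C \<sigma> * x) + w * (C \<sigma> * x) * (C \<sigma> * x))"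
      unfolding W_def by Groebner_Basis.algebra
    also have "\<dots> = w^3 + C (ev v0 k / ev v0 x) * (x^2 * x)"
      unfolding three' C_simps(7)[symmetric] \<sigma> by (simp add: power2_eq_square power3_eq_cube ac_simps)
    finally have W3: "W^3 \<in> I" using r by simp
    define a where "a = ev v0 W / ev v0 x"
    have U: "W - C a * x \<in> forms 1" "ev v0 (W - C a * x) = 0" using Wf bf x0 by (auto simp: a_def)
    have x2W: "x^2 * (W - C a * x) \<in> I" by (rule sq_mem[OF U])
    \<comment> \<open>Modulo \<open>I\<close>, \<open>x^2 W\<close> is \<open>a x^3\<close>, so
      \<open>x^2 W^3\<close> is \<open>a^3 x^5\<close>. As \<open>x^5\<close> is not in
      \<open>I\<close>, this forces \<open>a = 0\<close>.\<close>
    have "C (a^3) * x^5 = x^2 * W^3 - (W^2 + C a * (W * x) + C a * C a * x^2) * (x^2 * (W - C a * x))"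
      unfolding C_simps by Groebner_Basis.algebra
    then have "C (a^3) * x^5 \<in> I" using W3 x2W by auto
    then have "a = 0" using C_mult_mem x5 by (metis power_not_zero)
    then have "x^2 * W \<in> I" using x2W by (simp add: C_simps)
    then show ?thesis using W3 unfolding W_def by blast
  qed
  obtain \<sigma> where \<sigma>: "(y + C \<sigma> * x)^3 \<in> I" "x^2 * (y + C \<sigma> * x) \<in> I" using shift[OF bf(2) l(1) yl] by blast
  obtain \<tau> where \<tau>: "(z + C \<tau> * x)^3 \<in> I" "x^2 * (z + C \<tau> * x) \<in> I" using shift[OF bf(3) l(2) zl] by blast
  define Y Z where "Y = y + C \<sigma> * x" and "Z = z + C \<tau> * x"
  have "basis3 x Y z" using basis3_change2[OF b, of 1 Y \<sigma> 0] by (simp add: Y_def C_simps add.commute)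
  then have B: "basis3 x Y Z" using basis3_change3[of x Y z 1 Z \<tau> 0] by (simp add: Z_def C_simps add.commute)
  note Bf = basis3_forms[OF B]
  have m: "Y^3 \<in> I" "Z^3 \<in> I" "x^2 * Y \<in> I" "x^2 * Z \<in> I" using \<sigma> \<tau> by (simp_all add: Y_def Z_def)
  have M: "f * n \<in> I" "n * f \<in> I" if "n = Y^3 \<or> n = Z^3 \<or> n = x^2 * Y \<or> n = x^2 * Z" for f n using that m by auto
  have sq: "Y^2 \<in> forms 2" "Z^2 \<in> forms 2" using Bf by auto
  define w where "w = x * Y^2 * Z^2"
  have w_notin: "w \<notin> I"
  proof
    assume wI: "w \<in> I"
    have "Y^2 = 0"
    proof (rule quadric_kills_monomials[OF B sq(1)])
      show "x^3 * Y^2 \<in> I" "x^2 * Y * Y^2 \<in> I" "x^2 * Z * Y^2 \<in> I" "x * Y^2 * Y^2 \<in> I" "x * Y * Z * Y^2 \<in> I"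
        "Y^3 * Y^2 \<in> I" "Y^2 * Z * Y^2 \<in> I" "Y * Z^2 * Y^2 \<in> I" "Z^3 * Y^2 \<in> I"
        using M(1)[of "x^2 * Y" "x * Y"] M(1)[of "x^2 * Y" "Y^2"] M(1)[of "x^2 * Z" "Y^2"] M(1)[of "Y^3" "x * Y"] M(1)[of "Y^3" "x * Z"]
          M(1)[of "Y^3" "Y^2"] M(1)[of "Y^3" "Y * Z"] M(1)[of "Y^3" "Z^2"] M(1)[of "Z^3" "Y^2"]
        by (simp_all add: power2_eq_square power3_eq_cube ac_simps)
      show "x * Z^2 * Y^2 \<in> I" using wI by (simp add: w_def ac_simps)
    qed
    then show False using basis3_nonzero(2)[OF B] by simp
  qed
  have x5f: "x^5 \<in> forms 5" using bf(1) by auto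
  have wf: "w \<in> forms 5" unfolding w_def using forms_5[of "Y^2" "x * Z^2"] sq forms_mult'[OF bf(1) sq(2), of 3] by (simp add: ac_simps)
  \<comment> \<open>The scalar for which \<open>x F\<close> has \<phi>-value zero. The products
    \<open>Y F\<close> and \<open>Z F\<close> lie in \<open>I\<close> for every scalar, so
    \<open>F\<close> is annihilated by all linear forms.\<close>
  define \<rho> where "\<rho> = - (\<phi> (x^5) / \<phi> w)"
  have \<phi>nz: "\<phi> w \<noteq> 0" "\<phi> (x^5) \<noteq> 0" using \<phi>_kernel[OF wf] \<phi>_kernel[OF x5f] w_notin x5 by auto
  define F where "F = x^4 + C \<rho> * (Y^2 * Z^2)"
  have xF: "x * F \<in> I"
  proof -
    have "x * F = x^5 + C \<rho> * w" unfolding F_def w_def by (simp add: distrib_left ac_simps numeral_eq_Suc)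
    moreover have "\<phi> (x^5 + C \<rho> * w) = 0" using \<phi>nz by (simp add: \<phi>_add \<phi>_C x5f wf forms_C_mult \<rho>_def)
    moreover have "x^5 + C \<rho> * w \<in> forms 5" using x5f wf by auto
    ultimately show ?thesis using \<phi>_kernel by metis
  qed
  have "Y * F = x^2 * (x^2 * Y) + (C \<rho> * Z^2) * Y^3" unfolding F_def by (simp add: algebra_simps numeral_eq_Suc)
  then have YF: "Y * F \<in> I" by (simp only:) (rule m | rule add | rule mult)+
  have "Z * F = x^2 * (x^2 * Z) + (C \<rho> * Y^2) * Z^3" unfolding F_def by (simp add: algebra_simps numeral_eq_Suc)
  then have ZF: "Z * F \<in> I" by (simp only:) (rule m | rule add | rule mult)+
  have "x^4 \<in> forms 4" "Y^2 * Z^2 \<in> forms 4" using bf(1) sq by (auto intro: forms_mult')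
  then have Ff: "F \<in> forms 4" unfolding F_def by auto
  have FI: "F \<in> I"
  proof (rule no_socle[OF Ff, of 1])
    fix k :: "'a poly3" assume "k \<in> forms 1"
    then obtain a1 a2 a3 where k: "k = C a1 * x + C a2 * Y + C a3 * Z" using forms_1E[OF B] by blast
    have "k * F = C a1 * (x * F) + C a2 * (Y * F) + C a3 * (Z * F)" unfolding k by (simp add: algebra_simps)
    then show "k * F \<in> I" using xF YF ZF by auto
  qed simp
  obtain s where s: "s^2 = \<rho>" using nth_root_exists[of 2] by auto
  have "s \<noteq> 0" using s \<phi>nz by (auto simp: \<rho>_def)
  then have B': "basis3 x (C s * Y) Z" using basis3_change2[OF B, of s "C s * Y" 0 0] by (simp add: C_simps)
  have "x^2 * (C s * Y) \<in> I" using mult[OF m(3), of "C s"] by (simp add: mult.left_commute)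
  moreover have "(C s * Y)^3 \<in> I" using mult[OF m(1), of "C s ^ 3"] by (simp add: power_mult_distrib)
  moreover have "x^4 + (C s * Y)^2 * Z^2 = F"
    unfolding F_def power_mult_distrib C_simps(7)[symmetric] s by (simp add: ac_simps)
  ultimately have "exceptional_in x (C s * Y) Z" using B' m FI unfolding exceptional_in_def by simp
  then show ?thesis by blast
qed

text \<open>Squaring is additive, so \<open>M^2\<close> is a combination of \<open>x^2\<close>,
  \<open>y^2\<close>, \<open>z^2\<close>, and \<open>M^3\<close> joins \<open>M t^2\<close> among
  the cubics known modulo \<open>x^2\<close>. In each position of \<open>v0\<close> some nonzero
  quadric, namely \<open>x^2\<close>, \<open>M^2\<close> or \<open>N^2\<close>, is then killed by
  all cubics.\<close>

lemma double_line_char_2: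
  assumes two: "(2::'a) = 0" and m: "m0 \<noteq> 0 \<or> m1 \<noteq> 0" and l: "l \<in> forms 1" "l' \<in> forms 1"
    and yl: "(C m0 * y + C m1 * z + C \<rho> * x) * y^2 + x^2 * l \<in> I"
    and zl: "(C m0 * y + C m1 * z + C \<rho> * x) * z^2 + x^2 * l' \<in> I"
  shows False
proof -
  note bf = basis3_forms[OF b]
  have two': "(2::'a poly3) = 0" using numeral_poly3[OF two] .
  have dbl: "p + p = 0" for p :: "'a poly3" using two' mult_2[of p] by simp
  define M where "M = C m0 * y + C m1 * z + C \<rho> * x"
  have Mf: "M \<in> forms 1" unfolding M_def using bf by auto
  define L1 where "L1 = C (m0^2) * l + C (m1^2) * l' - C (\<rho>^2) * M"
  have L1: "L1 \<in> forms 1" unfolding L1_def using l Mf by auto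
  have "M^2 = C (m0^2) * y^2 + C (m1^2) * z^2 + C (\<rho>^2) * x^2 +
      2 * (C m0 * C m1 * y * z + C m0 * C \<rho> * y * x + C m1 * C \<rho> * z * x)"
    unfolding M_def C_simps by Groebner_Basis.algebra
  then have M2: "M^2 = C (m0^2) * y^2 + C (m1^2) * z^2 + C (\<rho>^2) * x^2" unfolding two' by simp
  have "M^3 = M * M^2" by (simp add: power2_eq_square power3_eq_cube)
  then have "M^3 + x^2 * L1 = C (m0^2) * (M * y^2 + x^2 * l) + C (m1^2) * (M * z^2 + x^2 * l')"
    unfolding M2 L1_def by (simp add: algebra_simps)
  then have M3: "M^3 + x^2 * L1 \<in> I" using yl zl unfolding M_def[symmetric] by auto
  have "\<exists>t L2. basis3 x M t \<and> L2 \<in> forms 1 \<and> M * t^2 + x^2 * L2 \<in> I"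
  proof (cases "m0 = 0")
    case False
    have "basis3 x M z" using basis3_change2[OF b False, of M \<rho> m1] by (simp add: M_def ac_simps)
    then show ?thesis using zl l(2) unfolding M_def[symmetric] by blast
  next
    case True
    then have "m1 \<noteq> 0" using m by simp
    then have "basis3 x y M" using basis3_change3[OF b _, of m1 M \<rho> m0] by (simp add: M_def ac_simps)
    then show ?thesis using yl l(1) basis3_swap23 unfolding M_def[symmetric] by blast
  qed
  then obtain t L2 where B: "basis3 x M t" and L2: "L2 \<in> forms 1" and Mt: "M * t^2 + x^2 * L2 \<in> I" by blast
  note Bf = basis3_forms[OF B]
  have M2f: "M^2 \<in> forms 2" using Mf by auto
  show False
  proof (cases "ev v0 x = 0")
    case x0: True
    have x3: "x^3 \<in> I" using sq_mem[OF bf(1) x0] by (simp add: power2_eq_square power3_eq_cube mult.assoc)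
    show False
    proof (cases "ev v0 M = 0")
      case False
      have "x^2 * M^3 = x^2 * (M^3 + x^2 * L1) - (x * L1) * x^3" by (simp add: algebra_simps power2_eq_square power3_eq_cube)
      then have xM: "x^2 * M^3 \<in> I" using M3 x3 by auto
      define t' where "t' = t - C (ev v0 t / ev v0 M) * M"
      have "basis3 x M t'" using basis3_change3[OF B, of 1 t' 0 "- (ev v0 t / ev v0 M)"] by (simp add: t'_def C_simps)
      then have b'': "basis3 x t' M" by (rule basis3_swap23)
      have "ev v0 t' = 0" using False by (simp add: t'_def)
      then show False using no_kill_by_axis[OF x3 b'' _ xM] sq_mem[OF basis3_forms(2)[OF b'']] by blast
    next
      case M0: True
      have xM: "x^2 * M \<in> I" by (rule sq_mem[OF Mf M0])
      have t0: "ev v0 t \<noteq> 0" using v0_nonzero[OF B] x0 M0 by simp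
      define \<alpha> \<beta> where "\<alpha> = ev v0 L1 / ev v0 t" and "\<beta> = ev v0 L2 / ev v0 t"
      have ra: "M^3 + C \<alpha> * (x^2 * t) \<in> I" unfolding \<alpha>_def by (rule reduce_tail[OF Bf(3) t0 L1 M3])
      have rb: "M * t^2 + C \<beta> * (x^2 * t) \<in> I" unfolding \<beta>_def by (rule reduce_tail[OF Bf(3) t0 L2 Mt])
      have xt: "x^2 * t^3 \<notin> I" using no_kill_by_axis[OF x3 B xM] by blast
      \<comment> \<open>The product \<open>M^3 t^2\<close> is computed from either relation; what
        remains is \<alpha> times an element outside \<open>I\<close>.\<close>
      have "C \<alpha> * (x^2 * t^3) = t^2 * (M^3 + C \<alpha> * (x^2 * t)) - M^2 * (M * t^2 + C \<beta> * (x^2 * t)) + (C \<beta> * M * t) * (x^2 * M)"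
        by (simp add: algebra_simps power2_eq_square power3_eq_cube)
      then have "C \<alpha> * (x^2 * t^3) \<in> I" using ra rb xM by auto
      then have "\<alpha> = 0" using C_mult_mem xt by blast
      then have M3': "M^3 \<in> I" using ra by (simp add: C_simps)
      have m: "p * n \<in> I" if "n = M^3 \<or> n = x^2 * M \<or> n = M * t^2 + C \<beta> * (x^2 * t)" for p n using that M3' xM rb by auto
      have "M^2 = 0"
      proof (rule quadric_kills_monomials[OF B M2f])
        show "x^3 * M^2 \<in> I" "x^2 * M * M^2 \<in> I" "x^2 * t * M^2 \<in> I" "x * M^2 * M^2 \<in> I" "x * M * t * M^2 \<in> I"
          "M^3 * M^2 \<in> I" "M^2 * t * M^2 \<in> I" "M * t^2 * M^2 \<in> I"
          using m[of "x^2 * M" "x * M"] m[of "x^2 * M" "M^2"] m[of "x^2 * M" "t * M"] m[of "M^3" "x * M"] m[of "M^3" "x * t"]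
            m[of "M^3" "M^2"] m[of "M^3" "M * t"] m[of "M^3" "t^2"]
          by (simp_all add: power2_eq_square power3_eq_cube ac_simps)
        have "x * t^2 * M^2 = (x * M) * (M * t^2 + C \<beta> * (x^2 * t)) - (C \<beta> * x * t) * (x^2 * M)"
          by (simp add: algebra_simps power2_eq_square)
        then show "x * t^2 * M^2 \<in> I" using rb xM by auto
        have "t^3 * M^2 = (M * t) * (M * t^2 + C \<beta> * (x^2 * t)) - (C \<beta> * t^2) * (x^2 * M)"
          by (simp add: algebra_simps power2_eq_square power3_eq_cube)
        then show "t^3 * M^2 \<in> I" using rb xM by auto
      qed
      then show False using basis3_nonzero(2)[OF B] by simp
    qed
  next
    case x0: False
    have x5: "x^5 \<notin> I" by (rule fifth_power_not_mem[OF bf(1) x0 qe])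
    \<comment> \<open>Shifts for which \<open>N\<close> and \<open>T\<close> vanish at
      \<open>v0\<close>, so that \<open>x^2\<close> kills both.\<close>
    define a d' where "a = ev v0 M / ev v0 x" and "d' = ev v0 t / ev v0 x"
    define N T where "N = M - C a * x" and "T = t - C d' * x"
    have NT: "x^2 * N \<in> I" "x^2 * T \<in> I"
      unfolding N_def T_def by (rule sq_mem; use Mf Bf bf x0 in \<open>auto simp: a_def d'_def\<close>)+
    have MN: "M = N + C a * x" "t = T + C d' * x" by (simp_all add: N_def T_def)
    define \<alpha> \<beta> where "\<alpha> = ev v0 L1 / ev v0 x" and "\<beta> = ev v0 L2 / ev v0 x"
    have ra: "M^3 + C \<alpha> * (x^2 * x) \<in> I" unfolding \<alpha>_def by (rule reduce_tail[OF bf(1) x0 L1 M3])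
    have rb: "M * t^2 + C \<beta> * (x^2 * x) \<in> I" unfolding \<beta>_def by (rule reduce_tail[OF bf(1) x0 L2 Mt])
    \<comment> \<open>After multiplication by \<open>x^2\<close> only powers of \<open>x\<close>
      survive modulo \<open>I\<close>. As \<open>x^5\<close> is not in \<open>I\<close>, the two
      tails \<alpha> and \<beta> are determined by the shifts.\<close>
    have "C (a^3 + \<alpha>) * x^5 = x^2 * (M^3 + C \<alpha> * (x^2 * x)) - (N^2 + 3 * C a * N * x + 3 * C a * C a * x^2) * (x^2 * N)"
      unfolding MN C_simps by Groebner_Basis.algebra
    then have "C (a^3 + \<alpha>) * x^5 \<in> I" using ra NT by auto
    then have \<alpha>: "\<alpha> = - (a^3)" using C_mult_mem x5 by (metis add.commute eq_neg_iff_add_eq_0)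
    have "C (a * d'^2 + \<beta>) * x^5 = x^2 * (M * t^2 + C \<beta> * (x^2 * x)) - (t^2) * (x^2 * N) - (C a * x * (T + 2 * C d' * x)) * (x^2 * T)"
      unfolding MN C_simps by Groebner_Basis.algebra
    then have "C (a * d'^2 + \<beta>) * x^5 \<in> I" using rb NT by auto
    then have \<beta>: "\<beta> = - (a * d'^2)" using C_mult_mem x5 by (metis add.commute eq_neg_iff_add_eq_0)
    have "N^3 + C a * (N^2 * x) = (M^3 + C \<alpha> * (x^2 * x)) - 3 * C a * C a * (x^2 * N) - 2 * (C a * (N^2 * x))"
      unfolding MN \<alpha> C_simps by Groebner_Basis.algebra
    then have N3: "N^3 + C a * (N^2 * x) \<in> I" using ra NT unfolding two' by auto
    have "N * T^2 + C a * (x * T^2) = (M * t^2 + C \<beta> * (x^2 * x)) - C d' * C d' * (x^2 * N) - 2 * (C d' * x * T * (N + C a * x))"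
      unfolding MN \<beta> C_simps by Groebner_Basis.algebra
    then have NT2: "N * T^2 + C a * (x * T^2) \<in> I" using rb NT unfolding two' by auto
    \<comment> \<open>This multiplies the relation by \<open>N - a x\<close>: the mixed terms
      cancel, and what is left over is a multiple of \<open>x^2 N\<close>.\<close>
    have "N^4 = N * (N^3 + C a * (N^2 * x)) - (C a * x) * (N^3 + C a * (N^2 * x)) + (C a * C a * N) * (x^2 * N)"
      by Groebner_Basis.algebra
    then have N4: "N^4 \<in> I" using N3 NT by auto
    have "x * N^3 = x * (N^3 + C a * (N^2 * x)) - (C a * N) * (x^2 * N)" by Groebner_Basis.algebra
    then have xN3: "x * N^3 \<in> I" using N3 NT by auto
    have "N^2 * T^2 = N * (N * T^2 + C a * (x * T^2)) - (C a * x) * (N * T^2 + C a * (x * T^2)) + (C a * C a * T) * (x^2 * T)"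
      by Groebner_Basis.algebra
    then have N2T2: "N^2 * T^2 \<in> I" using NT2 NT by auto
    have "basis3 x N t" using basis3_change2[OF B, of 1 N "- a" 0] by (simp add: N_def C_simps)
    then have B': "basis3 x N T" using basis3_change3[of x N t 1 T "- d'" 0] by (simp add: T_def C_simps)
    have N2f: "N^2 \<in> forms 2" using basis3_forms(2)[OF B'] by auto
    have m: "p * n \<in> I" if "n = N^4 \<or> n = x * N^3 \<or> n = N^2 * T^2 \<or> n = x^2 * N" for p n using that N4 xN3 N2T2 NT by auto
    have "N^2 = 0"
    proof (rule quadric_kills_monomials[OF B' N2f])
      show "x^3 * N^2 \<in> I" "x^2 * N * N^2 \<in> I" "x^2 * T * N^2 \<in> I" "x * N^2 * N^2 \<in> I" "x * N * T * N^2 \<in> I" "x * T^2 * N^2 \<in> I"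
        "N^3 * N^2 \<in> I" "N^2 * T * N^2 \<in> I" "N * T^2 * N^2 \<in> I" "T^3 * N^2 \<in> I"
        using m[of "x^2 * N" "x * N"] m[of "x^2 * N" "N^2"] m[of "x^2 * N" "T * N"] m[of "N^4" x] m[of "x * N^3" T] m[of "N^2 * T^2" x]
          m[of "N^4" N] m[of "N^4" T] m[of "N^2 * T^2" N] m[of "N^2 * T^2" T]
        by (simp_all add: numeral_eq_Suc ac_simps)
    qed
    then show False using basis3_nonzero(2)[OF B'] by simp
  qed
qed

lemma exceptional_of_double_line: "(3::'a) = 0 \<and> (\<exists>x y z. exceptional_in x y z)"
proof -
  consider (three) l l' where "(3::'a) = 0" "l \<in> forms 1" "l' \<in> forms 1" "y^3 + x^2 * l \<in> I" "z^3 + x^2 * l' \<in> I"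
    | (two) m0 m1 \<rho> l l' where "(2::'a) = 0" "m0 \<noteq> 0 \<or> m1 \<noteq> 0" "l \<in> forms 1" "l' \<in> forms 1"
    "(C m0 * y + C m1 * z + C \<rho> * x) * y^2 + x^2 * l \<in> I" "(C m0 * y + C m1 * z + C \<rho> * x) * z^2 + x^2 * l' \<in> I"
    using double_line_normal_form by blast
  then show ?thesis
  proof cases
    case three
    then show ?thesis using double_line_char_3 by blast
  next
    case two
    from double_line_char_2[OF this] show ?thesis by blast
  qed
qed

end

theorem (in lefschetz_failure) exceptional_of_failure: "(3::'a) = 0 \<and> (\<exists>x y z. exceptional_in x y z)"
proof -
  obtain u1 u2 u3 q where u: "basis3 u1 u2 u3" and q: "q \<in> forms 2" "q \<noteq> 0" "u1 * q \<in> I" "u2 * q \<in> I"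
    using two_term_syzygy_of_failure unfolding two_term_syzygy_def by blast
  have uq: "u1 * q \<in> forms 3" "u2 * q \<in> forms 3"
    using forms_mult'[OF basis3_forms(1)[OF u] q(1), of 3] forms_mult'[OF basis3_forms(2)[OF u] q(1), of 3] by simp_all
  have "indep2 (u1 * q) (u2 * q)" unfolding indep2_def
  proof (intro allI impI)
    fix p r assume "C p * (u1 * q) + C r * (u2 * q) = 0"
    then have "(C p * u1 + C r * u2 + C 0 * u3) * q = 0" by (simp add: C_simps algebra_simps)
    then have "C p * u1 + C r * u2 + C 0 * u3 = 0" using q(2) by (simp only: mult_eq_0_iff) simp
    from linear_coeffs_zero[OF u this] show "p = 0 \<and> r = 0" by simp
  qed
  then obtain c where c: "c \<in> forms 3" "c \<in> I" "indep3 (u1 * q) (u2 * q) c" using extend_to_basis3[OF uq q(3,4)] by blast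
  obtain d where d: "d \<in> forms 3" "d \<in> I" "indep4 (u1 * q) (u2 * q) c d"
    using extend_to_basis4[OF uq c(1) q(3,4) c(2,3)] .
  obtain v0 where v0: "ev v0 u1 = 0" "ev v0 u2 = 0" "ev v0 u3 = 1" using basis3_ev[OF u] by blast
  interpret two_term I \<phi> g u1 u2 u3 q c d v0
    by unfold_locales (fact u q c(1,2) d v0)+
  obtain x y z where b: "basis3 x y z" "q = x * z - y^2 \<or> q = x * z \<or> q = x^2" using quadric_normal_form[OF q(1,2)] by blast
  then have qe: "q = x^2" using not_conic not_line_pair by blast
  interpret double_line I \<phi> g u1 u2 u3 q c d v0 x y z by unfold_locales (fact b(1) qe)+
  show ?thesis by (rule exceptional_of_double_line)
qed

section \<open>From the quotient ring to polynomials\<close>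

lemma polyring_simps [simp]:
  "carrier (polyring :: 'k::comm_ring_1 poly3 ring) = UNIV"
  "f \<otimes>\<^bsub>polyring\<^esub> h = f * h" "f \<oplus>\<^bsub>polyring\<^esub> h = f + h" "\<zero>\<^bsub>polyring\<^esub> = 0"
  by (simp_all add: ring_of_type_algebra_def)

lemma ideal_polyring_iff:
  fixes J :: "'k::comm_ring_1 poly3 set"
  shows "ideal J polyring \<longleftrightarrow> 0 \<in> J \<and> (\<forall>p\<in>J. \<forall>q\<in>J. p + q \<in> J) \<and> (\<forall>q\<in>J. \<forall>p. p * q \<in> J)"
    (is "?L \<longleftrightarrow> ?R")
proof
  assume ?L
  then interpret ideal J polyring .
  have "0 \<in> J" using additive_subgroup.zero_closed[OF additive_subgroup_axioms] by simp
  moreover have "p + q \<in> J" if "p \<in> J" "q \<in> J" for p q using additive_subgroup.a_closed[OF additive_subgroup_axioms that] by simp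
  moreover have "p * q \<in> J" if "q \<in> J" for p q using I_l_closed[OF that, of p] by simp
  ultimately show ?R by blast
next
  assume R: ?R
  have "inv\<^bsub>add_monoid (polyring :: 'k poly3 ring)\<^esub> f = - f" for f :: "'k poly3"
    using ring.axioms(1)[OF ring_from_type_algebra, THEN abelian_group.minus_equality, of "- f" f]
    by (simp add: a_inv_def)
  moreover have "- f \<in> J" if "f \<in> J" for f using R that by (metis mult_minus1)
  ultimately have "subgroup J (add_monoid polyring)" using R by (intro subgroup.intro) auto
  then show ?L
    by (rule idealI[OF ring_from_type_algebra]) (use R in \<open>auto simp: mult.commute\<close>)
qed

lemma ideal_genideal: "ideal (Idl\<^bsub>polyring\<^esub> G) (polyring :: 'k::comm_ring_1 poly3 ring)"
  by (rule ring.genideal_ideal[OF ring_from_type_algebra]) simp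

lemma genideal_subset: "G \<subseteq> Idl\<^bsub>polyring\<^esub> (G :: 'k::comm_ring_1 poly3 set)"
  by (rule ring.genideal_self[OF ring_from_type_algebra]) simp

lemma genideal_least: "ideal J polyring \<Longrightarrow> G \<subseteq> J \<Longrightarrow> Idl\<^bsub>polyring\<^esub> G \<subseteq> (J :: 'k::comm_ring_1 poly3 set)"
  by (rule ring.genideal_minimal[OF ring_from_type_algebra])

lemma homogeneous_ideal_is_ideal: "homogeneous_ideal I \<Longrightarrow> ideal I polyring"
  by (auto simp: homogeneous_ideal_def ideal_genideal)

text \<open>The polynomials with all components in \<open>I\<close> form an ideal containing the
  homogeneous generators; closure under multiplication has to be checked for constants and variables
  only.\<close>

lemma homogeneous_ideal_hcomp:
  fixes I :: "'k::comm_ring_1 poly3 set"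
  assumes "homogeneous_ideal I" "f \<in> I"
  shows "hcomp d f \<in> I"
proof -
  obtain G where G: "G \<subseteq> (\<Union>d. forms d)" "I = Idl\<^bsub>polyring\<^esub> G" using assms(1) by (auto simp: homogeneous_ideal_def)
  have I: "0 \<in> I" "\<And>p q. p \<in> I \<Longrightarrow> q \<in> I \<Longrightarrow> p + q \<in> I" "\<And>p q. q \<in> I \<Longrightarrow> p * q \<in> I"
    using ideal_genideal[of G] unfolding G(2)[symmetric] ideal_polyring_iff by blast+
  define J where "J = {f. \<forall>d. hcomp d f \<in> I}"
  have add: "p + q \<in> J" if "p \<in> J" "q \<in> J" for p q using that I(2) by (auto simp: J_def hcomp_add)
  have "p * q \<in> J" if "q \<in> J" for p q
    using that
  proof (induction p arbitrary: q rule: poly3_induct)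
    case (const c)
    then show ?case using I(3) by (auto simp: J_def hcomp_C_mult)
  next
    case (var i)
    then show ?case using I(1,3) by (auto simp: J_def hcomp_pvar_mult)
  next
    case (add f g)
    then show ?case using \<open>\<And>p q. p \<in> J \<Longrightarrow> q \<in> J \<Longrightarrow> p + q \<in> J\<close> by (simp add: distrib_right)
  next
    case (mult f g)
    then show ?case by (simp add: mult.assoc)
  qed
  then have "ideal J polyring" using add I(1) by (auto simp: ideal_polyring_iff J_def)
  moreover have "G \<subseteq> J"
  proof
    fix f assume "f \<in> G"
    then obtain e where "f \<in> forms e" "f \<in> I" using G genideal_subset by blast
    then show "f \<in> J" using I(1) by (auto simp: J_def hcomp_of_form)
  qed
  ultimately have "I \<subseteq> J" unfolding G(2) by (rule genideal_least)
  then show ?thesis using assms(2) by (auto simp: J_def)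
qed

section \<open>Polynomial representatives of bases of the quotient\<close>

locale quotient_algebra =
  fixes I :: "'k::field poly3 set"
  assumes ideal: "ideal I polyring"
begin

lemma I_0: "0 \<in> I" and I_add: "p \<in> I \<Longrightarrow> q \<in> I \<Longrightarrow> p + q \<in> I" and I_mult: "q \<in> I \<Longrightarrow> p * q \<in> I"
  using ideal by (auto simp: ideal_polyring_iff)

lemma I_uminus: "q \<in> I \<Longrightarrow> - q \<in> I" using I_mult[of q "-1"] by simp
lemma I_diff: "p \<in> I \<Longrightarrow> q \<in> I \<Longrightarrow> p - q \<in> I" using I_add[of p "- q"] I_uminus by simp
lemma I_sum: "(\<And>s. s \<in> S \<Longrightarrow> F s \<in> I) \<Longrightarrow> sum F S \<in> I"
  by (induction S rule: infinite_finite_induct) (auto intro: I_0 I_add)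
lemma I_C_mult: "C c * p \<in> I \<Longrightarrow> c \<noteq> 0 \<Longrightarrow> p \<in> I"
  using I_mult[of "C c * p" "C (inverse c)"] C_inverse[of c p] by simp

lemma residue_eq_iff: "residue_class I f = residue_class I h \<longleftrightarrow> f - h \<in> I"
proof -
  have r: "residue_class I f = (\<lambda>p. p + f) ` I" for f by (auto simp: a_r_coset_def')
  show ?thesis
  proof
    assume "residue_class I f = residue_class I h"
    then have "f \<in> (\<lambda>p. p + h) ` I" using I_0 unfolding r by (metis add_0 image_eqI)
    then show "f - h \<in> I" by auto
  next
    assume *: "f - h \<in> I"
    have "p + f \<in> (\<lambda>p. p + h) ` I" if "p \<in> I" for p
      using I_add[OF that *] by (auto intro!: image_eqI[of _ _ "p + (f - h)"])
    moreover have "p + h \<in> (\<lambda>p. p + f) ` I" if "p \<in> I" for p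
      using I_diff[OF that *] by (auto intro!: image_eqI[of _ _ "p - (f - h)"])
    ultimately show "residue_class I f = residue_class I h" unfolding r by blast
  qed
qed

lemma quotient_ring: "ring (quot I)" by (rule ideal.quotient_is_ring[OF ideal])

lemma residue_simps:
  "carrier (quot I) = range (residue_class I)"
  "residue_class I f \<oplus>\<^bsub>quot I\<^esub> residue_class I h = residue_class I (f + h)"
  "residue_class I f \<otimes>\<^bsub>quot I\<^esub> residue_class I h = residue_class I (f * h)"
  "\<zero>\<^bsub>quot I\<^esub> = residue_class I 0"
proof -
  have "abelian_subgroup I polyring"
    by (rule abelian_subgroupI3[OF ideal.axioms(1)[OF ideal] ring.is_abelian_group[OF ring_from_type_algebra]])
  then show "residue_class I f \<oplus>\<^bsub>quot I\<^esub> residue_class I h = residue_class I (f + h)"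
    using abelian_subgroup.a_rcos_sum[of I polyring f h] by (simp add: FactRing_def)
  show "residue_class I f \<otimes>\<^bsub>quot I\<^esub> residue_class I h = residue_class I (f * h)"
    using ideal.rcoset_mult_add[OF ideal, of f h] by (simp add: FactRing_def)
  show "carrier (quot I) = range (residue_class I)" by (auto simp: FactRing_def A_RCOSETS_def')
  show "\<zero>\<^bsub>quot I\<^esub> = residue_class I 0" by (auto simp: FactRing_def a_r_coset_def')
qed

text \<open>The inductive dimension predicate is unfolded into polynomials whose residues form a
  basis, each line extension contributing one. A relation in which the new polynomial has a nonzero
  coefficient would put its residue into the previous subspace.\<close>

lemma dimension_basis:
  assumes "ring.dimension (quot I) n (scalars I) E"
  shows "\<exists>h. E = range (\<lambda>c. residue_class I (\<Sum>j<n. C (c j) * h j)) \<and>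
    (\<forall>c. (\<Sum>j<n. C (c j) * h j) \<in> I \<longrightarrow> (\<forall>j<n. c j = 0))"
proof -
  interpret Q: ring "quot I" by (rule quotient_ring)
  show ?thesis using assms
  proof (induction n "scalars I" E rule: Q.dimension.induct)
    case zero_dim
    then show ?case by (simp add: residue_simps)
  next
    case (Suc_dim v E n)
    from Suc_dim.hyps obtain h where h: "E = range (\<lambda>c. residue_class I (\<Sum>j<n. C (c j) * h j))"
      "\<And>c. (\<Sum>j<n. C (c j) * h j) \<in> I \<Longrightarrow> \<forall>j<n. c j = 0" by blast
    obtain f where f: "v = residue_class I f" using \<open>v \<in> carrier (quot I)\<close> by (auto simp: residue_simps)
    define h' where "h' = h(n := f)"
    have s: "(\<Sum>j<Suc n. C (c j) * h' j) = (\<Sum>j<n. C (c j) * h j) + C (c n) * f" for c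
      by (simp add: h'_def)
    have mem: "u \<in> Q.line_extension (scalars I) v E \<longleftrightarrow>
      u \<in> range (\<lambda>c. residue_class I (\<Sum>j<Suc n. C (c j) * h' j))" for u
    proof
      assume "u \<in> Q.line_extension (scalars I) v E"
      then obtain a c where u: "u = residue_class I (C a * f + (\<Sum>j<n. C (c j) * h j))"
        unfolding Q.line_extension_mem_iff scalars_def h(1) f by (auto simp: residue_simps simp del: polyring_simps)
      have "(\<Sum>j<n. C (c j) * h j) = (\<Sum>j<n. C ((c(n := a)) j) * h j)" by (intro sum.cong) auto
      then have "u = residue_class I (\<Sum>j<Suc n. C ((c(n := a)) j) * h' j)"
        unfolding u s by (simp add: add.commute)
      then show "u \<in> range (\<lambda>c. residue_class I (\<Sum>j<Suc n. C (c j) * h' j))" by blast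
    next
      assume "u \<in> range (\<lambda>c. residue_class I (\<Sum>j<Suc n. C (c j) * h' j))"
      then obtain c where "u = residue_class I (C (c n)) \<otimes>\<^bsub>quot I\<^esub> v \<oplus>\<^bsub>quot I\<^esub>
          residue_class I (\<Sum>j<n. C (c j) * h j)"
        unfolding s f by (auto simp only: residue_simps add.commute)
      then show "u \<in> Q.line_extension (scalars I) v E"
        unfolding Q.line_extension_mem_iff scalars_def h(1) by blast
    qed
    have indep: "\<forall>j<Suc n. c j = 0" if c: "(\<Sum>j<Suc n. C (c j) * h' j) \<in> I" for c
    proof -
      have "c n = 0"
      proof (rule ccontr)
        assume n: "c n \<noteq> 0"
        define e where "e j = - (inverse (c n) * c j)" for j
        have "C (inverse (c n)) * (\<Sum>j<Suc n. C (c j) * h' j) = f - (\<Sum>j<n. C (e j) * h j)"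
          unfolding s distrib_left C_inverse[OF n]
          by (simp add: e_def C_simps sum_distrib_left sum_negf mult.assoc)
        then have "f - (\<Sum>j<n. C (e j) * h j) \<in> I" using I_mult[OF c, of "C (inverse (c n))"] by (simp only:)
        then have "v \<in> E" unfolding f h(1) by (auto simp: residue_eq_iff)
        then show False using Suc_dim.hyps by blast
      qed
      then show ?thesis using h(2)[of c] c unfolding s by (simp add: C_simps All_less_Suc)
    qed
    show ?case using Set.set_eqI[OF mem] indep by blast
  qed
qed

text \<open>The residues found by \<open>dimension_basis\<close> lie in the graded part, so each
  representative can be exchanged for a form of degree \<open>d\<close> with the same
  residue.\<close>

lemma graded_basis:
  assumes "ring.dimension (quot I) n (scalars I) (graded_part I d)"
  shows "\<exists>h. (\<forall>j<n. h j \<in> forms d) \<and> (\<forall>f\<in>forms d. \<exists>c. f - (\<Sum>j<n. C (c j) * h j) \<in> I) \<and>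
    (\<forall>c. (\<Sum>j<n. C (c j) * h j) \<in> I \<longrightarrow> (\<forall>j<n. c j = 0))"
proof -
  obtain h where h: "graded_part I d = range (\<lambda>c. residue_class I (\<Sum>j<n. C (c j) * h j))"
    "\<And>c. (\<Sum>j<n. C (c j) * h j) \<in> I \<Longrightarrow> \<forall>j<n. c j = 0" using dimension_basis[OF assms] by blast
  have "\<exists>f\<in>forms d. f - h j \<in> I" if j: "j < n" for j
  proof -
    have "residue_class I (\<Sum>i<n. C ((\<lambda>i. if i = j then 1 else 0) i) * h i) \<in> graded_part I d"
      unfolding h(1) by (rule range_eqI[of _ _ "\<lambda>i. if i = j then 1 else 0"]) simp
    moreover have "(\<Sum>i<n. C ((\<lambda>i. if i = j then 1 else 0) i) * h i) = (\<Sum>i<n. if i = j then h i else 0)"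
      by (intro sum.cong) (auto simp: C_simps)
    ultimately have "residue_class I (h j) \<in> graded_part I d" using j by simp
    then obtain f where "f \<in> forms d" "residue_class I f = residue_class I (h j)" by (auto simp: graded_part_def)
    then show ?thesis by (auto simp: residue_eq_iff)
  qed
  then obtain h' where h': "\<And>j. j < n \<Longrightarrow> h' j \<in> forms d" "\<And>j. j < n \<Longrightarrow> h' j - h j \<in> I" by metis
  have d: "(\<Sum>j<n. C (c j) * h' j) - (\<Sum>j<n. C (c j) * h j) \<in> I" for c
    unfolding sum_subtractf[symmetric] right_diff_distrib[symmetric] using h'(2) by (auto intro!: I_sum I_mult)
  show ?thesis
  proof (intro exI[of _ h'] conjI allI impI ballI)
    show "\<exists>c. f - (\<Sum>j<n. C (c j) * h' j) \<in> I" if "f \<in> forms d" for f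
    proof -
      have "residue_class I f \<in> graded_part I d" using that by (simp add: graded_part_def)
      then obtain c where "f - (\<Sum>j<n. C (c j) * h j) \<in> I" unfolding h(1) by (auto simp: residue_eq_iff)
      then have "f - (\<Sum>j<n. C (c j) * h' j) \<in> I" using I_diff[OF _ d, of "f - (\<Sum>j<n. C (c j) * h j)" c] by simp
      then show ?thesis by blast
    qed
    show "c j = 0" if c: "(\<Sum>j<n. C (c j) * h' j) \<in> I" and j: "j < n" for c j
    proof -
      have "(\<Sum>j<n. C (c j) * h j) \<in> I" using I_diff[OF c d[of c]] by simp
      then show ?thesis using h(2) j by blast
    qed
  qed (use h'(1) in blast)
qed

lemma residue_in_socle:
  assumes "\<And>i. pvar i * p \<in> I"
  shows "residue_class I p \<in> socle I"
proof -
  have "ideal {f. f * p \<in> I} polyring"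
    by (auto simp: ideal_polyring_iff distrib_right mult.assoc intro: I_0 I_add I_mult)
  then have "Idl\<^bsub>polyring\<^esub> (range pvar) \<subseteq> {f. f * p \<in> I}" by (rule genideal_least) (use assms in auto)
  then show ?thesis by (auto simp: socle_def residue_simps residue_eq_iff mult.commute[of p])
qed

end

text \<open>Degree 6 is zero in the quotient, so the quintic \<open>h\<close> represents a nonzero
  socle element and therefore spans the socle. Nothing in lower degrees is killed by all variables,
  and multiplying up to degree 5 gives the nondegenerate pairing. The functional \<phi> is the
  coefficient of \<open>h\<close>.\<close>

lemma gorenstein_ideal_of_hilbert_function:
  fixes I :: "'k::alg_closed_field poly3 set"
  assumes hom: "homogeneous_ideal I" and gor: "gorenstein_artinian I"
    and hil: "has_hilbert_function I [1, 3, 6, 6, 3, 1]"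
  shows "\<exists>\<phi> g. gorenstein_ideal I \<phi> g"
proof -
  interpret quotient_algebra I by (rule quotient_algebra.intro[OF homogeneous_ideal_is_ideal[OF hom]])
  have l: "length [1, 3, 6, 6, 3, 1::nat] = 6" by simp
  have dim: "ring.dimension (quot I) (if i < 6 then [1, 3, 6, 6, 3, 1] ! i else 0) (scalars I) (graded_part I i)" for i
    using hil unfolding has_hilbert_function_def l by blast
  have "ring.dimension (quot I) 6 (scalars I) (graded_part I 2)" using dim[of 2] by simp
  from graded_basis[OF this] obtain q :: "nat \<Rightarrow> 'k poly3" where q: "\<forall>j<6. q j \<in> forms 2"
    "\<forall>f\<in>forms 2. \<exists>c. f - (\<Sum>j<6. C (c j) * q j) \<in> I"
    "\<forall>c. (\<Sum>j<6. C (c j) * q j) \<in> I \<longrightarrow> (\<forall>j<6. c j = 0)" by blast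
  have "ring.dimension (quot I) 6 (scalars I) (graded_part I 3)" using dim[of 3] by simp
  from graded_basis[OF this] obtain g :: "nat \<Rightarrow> 'k poly3" where g: "\<forall>j<6. g j \<in> forms 3"
    "\<forall>f\<in>forms 3. \<exists>c. f - (\<Sum>j<6. C (c j) * g j) \<in> I"
    "\<forall>c. (\<Sum>j<6. C (c j) * g j) \<in> I \<longrightarrow> (\<forall>j<6. c j = 0)" by blast
  have "ring.dimension (quot I) 1 (scalars I) (graded_part I 5)" using dim[of 5] by simp
  from graded_basis[OF this] obtain h' :: "nat \<Rightarrow> 'k poly3" where h': "\<forall>j<1. h' j \<in> forms 5"
    "\<forall>f\<in>forms 5. \<exists>c. f - (\<Sum>j<1. C (c j) * h' j) \<in> I"
    "\<forall>c. (\<Sum>j<1. C (c j) * h' j) \<in> I \<longrightarrow> (\<forall>j<1. c j = 0)" by blast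
  define h where "h = h' 0"
  have h: "h \<in> forms 5" "\<And>f. f \<in> forms 5 \<Longrightarrow> \<exists>c. f - C c * h \<in> I" "\<And>c. C c * h \<in> I \<Longrightarrow> c = 0"
  proof -
    show "h \<in> forms 5" using h'(1) by (simp add: h_def)
    show "\<exists>c. f - C c * h \<in> I" if "f \<in> forms 5" for f using h'(2) that by (auto simp: h_def)
    show "c = 0" if "C c * h \<in> I" for c using h'(3)[THEN spec, of "\<lambda>_. c"] that by (simp add: h_def)
  qed
  have "ring.dimension (quot I) 0 (scalars I) (graded_part I 6)" using dim[of 6] by simp
  from graded_basis[OF this] have deg6: "p \<in> I" if "p \<in> forms 6" for p using that by simp
  have "ring.dimension (quot I) 1 (scalars I) (socle I)" using gor by (simp add: gorenstein_artinian_def)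
  from dimension_basis[OF this] obtain s' where s': "socle I = range (\<lambda>c. residue_class I (C (c (0::nat)) * s' (0::nat)))"
    by auto
  define s where "s = s' 0"
  have s: "\<exists>c. p - C c * s \<in> I" if "\<And>i. pvar i * p \<in> I" for p
    using residue_in_socle[OF that] unfolding s' s_def by (auto simp: residue_eq_iff)
  have "pvar i * h \<in> I" for i by (intro deg6 forms_mult'[OF forms_pvar h(1)]) simp
  then obtain b where b: "h - C b * s \<in> I" using s by blast
  have b0: "b \<noteq> 0"
    using b h(3)[of 1] by (auto simp: C_simps)
  have socle: "p \<in> I" if p: "p \<in> forms d" "d < 5" "\<And>i. pvar i * p \<in> I" for p d
  proof -
    obtain a where a: "p - C a * s \<in> I" using s p(3) by blast
    have "C b * (p - C a * s) - C a * (h - C b * s) \<in> I" by (intro I_diff I_mult a b)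
    then have "C b * p - C a * h \<in> I" by (simp add: algebra_simps)
    \<comment> \<open>The component of degree \<open>d < 5\<close>, in which the term with
      \<open>h\<close> disappears.\<close>
    then have "hcomp d (C b * p + C (- a) * h) \<in> I"
      by (intro homogeneous_ideal_hcomp[OF hom]) (simp add: C_simps)
    then have "C b * p \<in> I" using p(1,2) h(1) by (simp add: hcomp_add hcomp_C_mult hcomp_of_form)
    then show ?thesis using b0 I_C_mult by blast
  qed
  have no_socle: "p \<in> I" if "p \<in> forms d" "d + e = 5" "\<And>q. q \<in> forms e \<Longrightarrow> q * p \<in> I" for p d e
    using that
  proof (induction e arbitrary: p d)
    case 0
    then show ?case using forms_C[of 1] by (force simp: C_simps)
  next
    case (Suc e)
    show ?case
    proof (rule socle[OF Suc.prems(1)])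
      show "d < 5" using Suc.prems(2) by simp
      show "pvar i * p \<in> I" for i
      proof (rule Suc.IH)
        show "pvar i * p \<in> forms (Suc d)" using Suc.prems(1) by (intro forms_mult'[OF forms_pvar]) auto
        show "Suc d + e = 5" using Suc.prems(2) by simp
        show "r * (pvar i * p) \<in> I" if "r \<in> forms e" for r
          using Suc.prems(3)[OF forms_mult'[OF that forms_pvar[of i]]] by (simp add: mult.assoc)
      qed
    qed
  qed
  have no_quadrics: "f = 0" if f: "f \<in> forms 2" "f \<in> I" for f
  proof -
    define F where "F i = (if i < 6 then q i else f)" for i :: nat
    have "F i \<in> forms 2" for i using q(1) f by (simp add: F_def)
    then have "\<exists>c. F i = (\<Sum>j<6. C (c j) * quadric_monomial (pvar 0) (pvar 1) (pvar 2) j)" for i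
      by (rule quadric_span[OF basis3_pvar])
    then obtain u where u: "\<exists>i<7. u i \<noteq> 0" "(\<Sum>i<7. C (u i) * F i) = 0"
      using dependent_of_span[of 6 7 F "quadric_monomial (pvar 0) (pvar 1) (pvar 2)"] by auto
    have "{..<7} = insert 6 {..<6::nat}" by auto
    then have e: "(\<Sum>i<6. C (u i) * q i) + C (u 6) * f = 0"
      using u(2) by (simp add: F_def add.commute)
    then have "(\<Sum>i<6. C (u i) * q i) = - (C (u 6) * f)" by (simp add: eq_neg_iff_add_eq_0)
    also have "\<dots> \<in> I" using f(2) by (intro I_uminus I_mult)
    finally have u6: "u j = 0" if "j < 6" for j using q(3) that by blast
    have "u 6 \<noteq> 0"
    proof
      assume "u 6 = 0"
      then have "u j = 0" if "j < 7" for j using u6 that by (cases "j = 6") auto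
      then show False using u(1) by blast
    qed
    moreover have "C (u 6) * f = 0" using e u6 by (simp add: C_simps)
    ultimately show ?thesis using C_inverse[of "u 6" f] by simp
  qed
  define \<phi> where "\<phi> p = (SOME c. p - C c * h \<in> I)" for p
  have \<phi>: "p - C (\<phi> p) * h \<in> I" if "p \<in> forms 5" for p
    unfolding \<phi>_def by (rule someI_ex[OF h(2)[OF that]])
  have \<phi>_eq: "\<phi> p = c" if "p \<in> forms 5" "p - C c * h \<in> I" for p c
  proof -
    have "C (\<phi> p - c) * h \<in> I" using I_diff[OF that(2) \<phi>[OF that(1)]] by (simp add: C_simps algebra_simps)
    then show ?thesis using h(3) by fastforce
  qed
  have "gorenstein_ideal I \<phi> g"
  proof
    show "\<phi> (p + r) = \<phi> p + \<phi> r" if "p \<in> forms 5" "r \<in> forms 5" for p r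
      using \<phi>_eq[OF forms_add[OF that], of "\<phi> p + \<phi> r"] I_add[OF \<phi>[OF that(1)] \<phi>[OF that(2)]]
      by (simp add: C_simps algebra_simps)
    show "\<phi> (C c * p) = c * \<phi> p" if "p \<in> forms 5" for p c
      using \<phi>_eq[OF forms_C_mult[OF that], of c "c * \<phi> p"] I_mult[OF \<phi>[OF that], of "C c"]
      by (simp add: C_simps right_diff_distrib mult.assoc)
    show "\<phi> p = 0 \<longleftrightarrow> p \<in> I" if "p \<in> forms 5" for p
      using \<phi>_eq[of p 0] \<phi>[OF that] that by (auto simp: C_simps)
    show "\<And>j. j < 6 \<Longrightarrow> g j \<in> forms 3"
      "\<And>f. f \<in> forms 3 \<Longrightarrow> \<exists>c. f - (\<Sum>j<6. C (c j) * g j) \<in> I"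
      "\<And>c j. (\<Sum>j<6. C (c j) * g j) \<in> I \<Longrightarrow> j < 6 \<Longrightarrow> c j = 0" using g by blast+
  qed (fact I_0 I_add I_mult no_quadrics no_socle deg6)+
  then show ?thesis by blast
qed

section \<open>Reduction of the Lefschetz property to degree 2\<close>

locale gorenstein_quotient = gorenstein_ideal + quotient_algebra
begin

text \<open>A kernel element of lower degree becomes a quadric in the kernel after multiplication by
  a power of a variable, and polynomials have no zero divisors.\<close>

lemma injective_of_injective_quadrics:
  fixes l :: "'a poly3"
  assumes inj: "\<And>q. q \<in> forms 2 \<Longrightarrow> l * q \<in> I \<Longrightarrow> q = 0" and "i \<le> 2" "f \<in> forms i" "l * f \<in> I"
  shows "f = 0"
proof -
  have "f * pvar 0 ^ (2 - i) = 0"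
  proof (rule inj)
    show "f * pvar 0 ^ (2 - i) \<in> forms 2"
      by (rule forms_mult'[OF assms(3) forms_power[OF forms_pvar refl]]) (use assms(2) in simp)
    show "l * (f * pvar 0 ^ (2 - i)) \<in> I" using mult_right[OF assms(4)] by (simp add: mult.assoc)
  qed
  then show ?thesis using basis3_nonzero(1)[OF basis3_pvar, where 'k = 'a] by auto
qed

text \<open>Injectivity gives a six-dimensional image in the six-dimensional \<open>A_3\<close>. In
  higher degrees surjectivity is inherited, since a form is a combination of the variables with
  cofactors of one degree less.\<close>

lemma surjective_of_injective_quadrics:
  fixes l :: "'a poly3"
  assumes l: "l \<in> forms 1" and inj: "\<And>q. q \<in> forms 2 \<Longrightarrow> l * q \<in> I \<Longrightarrow> q = 0" and "2 \<le> i" "f \<in> forms (Suc i)"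
  shows "\<exists>h\<in>forms i. f - l * h \<in> I"
  using assms(3,4)
proof (induction i arbitrary: f rule: dec_induct)
  case base
  let ?m = "quadric_monomial (pvar 0) (pvar 1) (pvar 2) :: nat \<Rightarrow> 'a poly3"
  note m = quadric_monomial_forms[OF basis3_pvar]
  define F where "F j = (if j < 6 then l * ?m j else f)" for j :: nat
  have "F j \<in> forms 3" for j
    using base m forms_mult'[OF l m, of j 3] by (simp add: F_def)
  then obtain u where u: "\<exists>i<7. u i \<noteq> 0" "(\<Sum>i<7. C (u i) * F i) \<in> I"
    using dependent_mod[of I 6 7 F g] g_span by auto
  define Q where "Q = (\<Sum>j<6. C (u j) * ?m j)"
  have Q: "Q \<in> forms 2" unfolding Q_def using m by auto
  have "{..<7} = insert 6 {..<6::nat}" by auto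
  then have e: "l * Q + C (u 6) * f \<in> I"
    using u(2) by (simp add: F_def Q_def sum_distrib_left mult.left_commute add.commute)
  have u6: "u 6 \<noteq> 0"
  proof
    assume 0: "u 6 = 0"
    then have "Q = 0" using e inj[OF Q] by (simp add: C_simps)
    then have "u j = 0" if "j < 6" for j using quadric_indep[OF basis3_pvar] that unfolding Q_def by blast
    then have "u j = 0" if "j < 7" for j using 0 that by (cases "j = 6") auto
    then show False using u(1) by blast
  qed
  have "f - l * (- (C (inverse (u 6)) * Q)) = C (inverse (u 6)) * (l * Q + C (u 6) * f)"
    by (simp only: mult_minus_right diff_minus_eq_add distrib_left C_inverse[OF u6] mult.left_commute[of l] add.commute)
  then have "f - l * (- (C (inverse (u 6)) * Q)) \<in> I" using mult[OF e] by simp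
  then show ?case using Q by blast
next
  case (step n)
  obtain k where k: "\<And>i. k i \<in> forms (Suc n)" "f = (\<Sum>i\<in>UNIV. pvar i * k i)"
    using forms_SucD[OF step.prems] by blast
  obtain h where h: "\<And>i. h i \<in> forms n" "\<And>i. k i - l * h i \<in> I" using step.IH[OF k(1)] by metis
  have "f - l * (\<Sum>i\<in>UNIV. pvar i * h i) = (\<Sum>i\<in>UNIV. pvar i * (k i - l * h i))"
    by (simp add: k(2) sum_distrib_left sum_subtractf algebra_simps)
  also have "\<dots> \<in> I" using h(2) by blast
  finally show ?case using h(1) by (intro bexI[of _ "\<Sum>i\<in>UNIV. pvar i * h i"] forms_sum forms_mult'[OF forms_pvar]) auto
qed

text \<open>Between the two spaces of dimension 6 injectivity and surjectivity are equivalent;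
  injectivity passes to lower degrees and surjectivity to higher ones.\<close>

lemma weak_lefschetz_iff: "weak_lefschetz I \<longleftrightarrow> (\<exists>l\<in>forms 1. \<forall>q\<in>forms 2. l * q \<in> I \<longrightarrow> q = 0)"
proof
  assume "\<exists>l\<in>forms 1. \<forall>q\<in>forms 2. l * q \<in> I \<longrightarrow> q = 0"
  then obtain l where l: "l \<in> forms 1" and inj: "\<And>q. q \<in> forms 2 \<Longrightarrow> l * q \<in> I \<Longrightarrow> q = 0" by blast
  show "weak_lefschetz I"
    unfolding weak_lefschetz_def
  proof (intro bexI allI)
    show "residue_class I l \<in> graded_part I 1" using l by (auto simp: graded_part_def)
    fix i
    show "inj_on (\<lambda>a. residue_class I l \<otimes>\<^bsub>quot I\<^esub> a) (graded_part I i) \<or>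
      (\<lambda>a. residue_class I l \<otimes>\<^bsub>quot I\<^esub> a) ` graded_part I i = graded_part I (Suc i)"
    proof (cases "i \<le> 2")
      case True
      have "f - h = 0" if "f \<in> forms i" "h \<in> forms i" "l * f - l * h \<in> I" for f h
        by (rule injective_of_injective_quadrics[OF inj True]) (use that in \<open>auto simp: right_diff_distrib\<close>)
      then have "inj_on (\<lambda>a. residue_class I l \<otimes>\<^bsub>quot I\<^esub> a) (graded_part I i)"
        by (fastforce simp: inj_on_def graded_part_def residue_simps residue_eq_iff)
      then show ?thesis by blast
    next
      case False
      have "l * f \<in> forms (Suc i)" if "f \<in> forms i" for f using forms_mult'[OF l that] by simp
      moreover have "\<exists>h\<in>forms i. residue_class I f = residue_class I (l * h)" if "f \<in> forms (Suc i)" for f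
        using surjective_of_injective_quadrics[OF l inj _ that] False by (auto simp: residue_eq_iff)
      ultimately have "(\<lambda>a. residue_class I l \<otimes>\<^bsub>quot I\<^esub> a) ` graded_part I i = graded_part I (Suc i)"
        unfolding graded_part_def image_image residue_simps by blast
      then show ?thesis by blast
    qed
  qed
next
  assume "weak_lefschetz I"
  then obtain l where l: "l \<in> forms 1" and
    wl: "inj_on (\<lambda>a. residue_class I l \<otimes>\<^bsub>quot I\<^esub> a) (graded_part I 2) \<or>
      (\<lambda>a. residue_class I l \<otimes>\<^bsub>quot I\<^esub> a) ` graded_part I 2 = graded_part I 3"
    by (auto simp: weak_lefschetz_def graded_part_def numeral_3_eq_3 numeral_2_eq_2)
  have "q = 0" if q: "q \<in> forms 2" "l * q \<in> I" for q
    using wl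
  proof
    assume "inj_on (\<lambda>a. residue_class I l \<otimes>\<^bsub>quot I\<^esub> a) (graded_part I 2)"
    then have "residue_class I q = residue_class I 0"
      by (rule inj_onD) (use q in \<open>auto simp: graded_part_def residue_simps residue_eq_iff\<close>)
    then show ?thesis using q no_quadrics by (simp add: residue_eq_iff)
  next
    assume *: "(\<lambda>a. residue_class I l \<otimes>\<^bsub>quot I\<^esub> a) ` graded_part I 2 = graded_part I 3"
    have "\<exists>Q\<in>forms 2. l * Q - g j \<in> I" if "j < 6" for j
    proof -
      have "residue_class I (g j) \<in> graded_part I 3" using g_forms[OF that] by (simp add: graded_part_def)
      then obtain Q where "Q \<in> forms 2" "residue_class I (g j) = residue_class I (l * Q)"
        unfolding *[symmetric] by (auto simp: graded_part_def residue_simps)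
      then show ?thesis by (metis residue_eq_iff)
    qed
    then obtain Q where Q: "\<And>j. j < 6 \<Longrightarrow> Q j \<in> forms 2" "\<And>j. j < 6 \<Longrightarrow> l * Q j - g j \<in> I" by metis
    define F where "F j = (if j < 6 then Q j else q)" for j :: nat
    have "F j \<in> forms 2" for j using Q(1) q(1) by (simp add: F_def)
    then have "\<exists>c. F i = (\<Sum>j<6. C (c j) * quadric_monomial (pvar 0) (pvar 1) (pvar 2) j)" for i
      by (rule quadric_span[OF basis3_pvar])
    then obtain u where u: "\<exists>i<7. u i \<noteq> 0" "(\<Sum>i<7. C (u i) * F i) = 0"
      using dependent_of_span[of 6 7 F "quadric_monomial (pvar 0) (pvar 1) (pvar 2)"] by auto
    have "{..<7} = insert 6 {..<6::nat}" by auto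
    then have e: "(\<Sum>i<6. C (u i) * Q i) + C (u 6) * q = 0"
      using u(2) by (simp add: F_def add.commute)
    have "(\<Sum>j<6. C (u j) * g j) = l * ((\<Sum>i<6. C (u i) * Q i) + C (u 6) * q)
        - C (u 6) * (l * q) - (\<Sum>j<6. C (u j) * (l * Q j - g j))"
      by (simp add: sum_subtractf sum_distrib_left algebra_simps)
    also have "\<dots> \<in> I" unfolding e by (intro diff sum_mem mult q(2) Q(2)) auto
    finally have u6: "u j = 0" if "j < 6" for j using g_indep that by blast
    have "u 6 \<noteq> 0"
    proof
      assume "u 6 = 0"
      then have "u j = 0" if "j < 7" for j using u6 that by (cases "j = 6") auto
      then show False using u(1) by blast
    qed
    moreover have "C (u 6) * q = 0" using e u6 by (simp add: C_simps)
    ultimately show ?thesis using C_inverse[of "u 6" q] by simp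
  qed
  then show "\<exists>l\<in>forms 1. \<forall>q\<in>forms 2. l * q \<in> I \<longrightarrow> q = 0" using l by blast
qed

end

section \<open>The exceptional ideal\<close>

text \<open>The ideal \<open>J\<close> is left open because the reductions are applied to the
  elements of \<open>I\<close> whose images lie in the exceptional ideal, not to \<open>I\<close>
  itself.\<close>

locale exceptional_generators =
  fixes x y z :: "'k::field poly3" and J :: "'k poly3 set"
  assumes b: "basis3 x y z"
    and J_0 [simp, intro]: "0 \<in> J"
    and J_add [intro]: "\<And>p q. p \<in> J \<Longrightarrow> q \<in> J \<Longrightarrow> p + q \<in> J"
    and J_mult [intro]: "\<And>p q. q \<in> J \<Longrightarrow> p * q \<in> J"
    and generators: "x^2*y \<in> J" "x^2*z \<in> J" "y^3 \<in> J" "z^3 \<in> J" "x^4 + y^2*z^2 \<in> J"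
begin

lemma J_combine: "p1*(x^2*y) + p2*(x^2*z) + p3*y^3 + p4*z^3 + p5*(x^4 + y^2*z^2) \<in> J"
  by (rule J_add[OF J_add[OF J_add[OF J_add[OF J_mult[OF generators(1)] J_mult[OF generators(2)]]
    J_mult[OF generators(3)]] J_mult[OF generators(4)]] J_mult[OF generators(5)]])

text \<open>The cubic generators kill every quartic monomial other than \<open>x^4\<close>,
  \<open>y^2 z^2\<close>, \<open>x y^2 z\<close> and \<open>x y z^2\<close>, and the last generator
  replaces \<open>x^4\<close> by \<open>- y^2 z^2\<close>.\<close>

lemma quartic_reduce:
  assumes "f \<in> forms 4"
  shows "\<exists>a b c. f - (C a * (y^2*z^2) + C b * (x*y^2*z) + C c * (x*y*z^2)) \<in> J"
proof -
  obtain p q r where p: "p \<in> forms 3" "q \<in> forms 3" "r \<in> forms 3" and f: "f = x*p + y*q + z*r"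
    using basis3_SucD[OF b, of f 3] assms by auto
  obtain a1 a2 a3 a4 a5 a6 a7 a8 a9 a10 where pe: "p = C a1 * x^3 + C a2 * (x^2*y) + C a3 * (x^2*z) + C a4 * (x*y^2) + C a5 * (x*y*z) +
    C a6 * (x*z^2) + C a7 * y^3 + C a8 * (y^2*z) + C a9 * (y*z^2) + C a10 * z^3" using forms_3E[OF b p(1)] .
  obtain b1 b2 b3 b4 b5 b6 b7 b8 b9 b10 where qe: "q = C b1 * x^3 + C b2 * (x^2*y) + C b3 * (x^2*z) + C b4 * (x*y^2) + C b5 * (x*y*z) +
    C b6 * (x*z^2) + C b7 * y^3 + C b8 * (y^2*z) + C b9 * (y*z^2) + C b10 * z^3" using forms_3E[OF b p(2)] .
  obtain c1 c2 c3 c4 c5 c6 c7 c8 c9 c10 where re: "r = C c1 * x^3 + C c2 * (x^2*y) + C c3 * (x^2*z) + C c4 * (x*y^2) + C c5 * (x*y*z) +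
    C c6 * (x*z^2) + C c7 * y^3 + C c8 * (y^2*z) + C c9 * (y*z^2) + C c10 * z^3" using forms_3E[OF b p(3)] .
  have "x*p - (C (-a1) * (y^2*z^2) + C a8 * (x*y^2*z) + C a9 * (x*y*z^2)) =
      (C a2*x + C a4*y + C a5*z)*(x^2*y) + (C a3*x + C a6*z)*(x^2*z) + (C a7*x)*y^3 + (C a10*x)*z^3 + C a1*(x^4 + y^2*z^2)"
    unfolding pe C_simps by Groebner_Basis.algebra
  then have 1: "x*p - (C (-a1) * (y^2*z^2) + C a8 * (x*y^2*z) + C a9 * (x*y*z^2)) \<in> J" using J_combine by metis
  have "y*q - (C b9 * (y^2*z^2) + C b5 * (x*y^2*z) + C b6 * (x*y*z^2)) =
      (C b1*x + C b2*y + C b3*z)*(x^2*y) + 0*(x^2*z) + (C b4*x + C b7*y + C b8*z)*y^3 + (C b10*y)*z^3 + 0*(x^4 + y^2*z^2)"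
    unfolding qe C_simps by Groebner_Basis.algebra
  then have 2: "y*q - (C b9 * (y^2*z^2) + C b5 * (x*y^2*z) + C b6 * (x*y*z^2)) \<in> J" using J_combine by metis
  have "z*r - (C c8 * (y^2*z^2) + C c4 * (x*y^2*z) + C c5 * (x*y*z^2)) =
      0*(x^2*y) + (C c1*x + C c2*y + C c3*z)*(x^2*z) + (C c7*z)*y^3 + (C c6*x + C c9*y + C c10*z)*z^3 + 0*(x^4 + y^2*z^2)"
    unfolding re C_simps by Groebner_Basis.algebra
  then have 3: "z*r - (C c8 * (y^2*z^2) + C c4 * (x*y^2*z) + C c5 * (x*y*z^2)) \<in> J" using J_combine by metis
  have "f - (C (- a1 + b9 + c8) * (y^2*z^2) + C (a8 + b5 + c4) * (x*y^2*z) + C (a9 + b6 + c5) * (x*y*z^2)) \<in> J"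
    using J_add[OF J_add[OF 1 2] 3] by (simp add: f C_simps algebra_simps)
  then show ?thesis by blast
qed

lemma quintic_reduce:
  assumes "f \<in> forms 5"
  shows "\<exists>a. f - C a * (x*y^2*z^2) \<in> J"
proof -
  obtain p q r where p: "p \<in> forms 4" "q \<in> forms 4" "r \<in> forms 4" and f: "f = x*p + y*q + z*r"
    using basis3_SucD[OF b, of f 4] assms by auto
  obtain a1 a2 a3 where a: "p - (C a1 * (y^2*z^2) + C a2 * (x*y^2*z) + C a3 * (x*y*z^2)) \<in> J" using quartic_reduce[OF p(1)] by blast
  obtain b1 b2 b3 where bb: "q - (C b1 * (y^2*z^2) + C b2 * (x*y^2*z) + C b3 * (x*y*z^2)) \<in> J" using quartic_reduce[OF p(2)] by blast
  obtain c1 c2 c3 where c: "r - (C c1 * (y^2*z^2) + C c2 * (x*y^2*z) + C c3 * (x*y*z^2)) \<in> J" using quartic_reduce[OF p(3)] by blast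
  have "f - C (a1 + b3 + c2) * (x*y^2*z^2) =
      x * (p - (C a1 * (y^2*z^2) + C a2 * (x*y^2*z) + C a3 * (x*y*z^2)))
    + y * (q - (C b1 * (y^2*z^2) + C b2 * (x*y^2*z) + C b3 * (x*y*z^2)))
    + z * (r - (C c1 * (y^2*z^2) + C c2 * (x*y^2*z) + C c3 * (x*y*z^2)))
    + ((C a2*y*z + C a3*z^2)*(x^2*y) + 0*(x^2*z) + (C b1*z^2 + C b2*x*z)*y^3 + (C c1*y^2 + C c3*x*y)*z^3 + 0*(x^4 + y^2*z^2))"
    unfolding f C_simps by Groebner_Basis.algebra
  also have "\<dots> \<in> J" by (intro J_add[OF _ J_combine] J_add J_mult a bb c)
  finally show ?thesis by blast
qed

lemma high_degree:
  assumes "6 \<le> n" "f \<in> forms n"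
  shows "f \<in> J"
  using assms
proof (induction n arbitrary: f rule: dec_induct)
  case base
  obtain p q r where p: "p \<in> forms 5" "q \<in> forms 5" "r \<in> forms 5" and f: "f = x*p + y*q + z*r"
    using basis3_SucD[OF b, of f 5] base by auto
  obtain a where a: "p - C a * (x*y^2*z^2) \<in> J" using quintic_reduce[OF p(1)] by blast
  obtain c where c: "q - C c * (x*y^2*z^2) \<in> J" using quintic_reduce[OF p(2)] by blast
  obtain d where d: "r - C d * (x*y^2*z^2) \<in> J" using quintic_reduce[OF p(3)] by blast
  have "f = x * (p - C a * (x*y^2*z^2)) + y * (q - C c * (x*y^2*z^2)) + z * (r - C d * (x*y^2*z^2))
    + ((C a*y*z^2)*(x^2*y) + 0*(x^2*z) + (C c*x*z^2)*y^3 + (C d*x*y^2)*z^3 + 0*(x^4 + y^2*z^2))"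
    unfolding f by Groebner_Basis.algebra
  also have "\<dots> \<in> J" by (intro J_add[OF _ J_combine] J_add J_mult a c d)
  finally show ?case .
next
  case (step n)
  obtain p q r where "p \<in> forms n" "q \<in> forms n" "r \<in> forms n" "f = x*p + y*q + z*r"
    using basis3_SucD[OF b step.prems] by blast
  then show ?case using step.IH by (auto intro!: J_add J_mult)
qed

end

context gorenstein_ideal
begin

lemma not_all_quintics: "\<not> forms 5 \<subseteq> I"
proof
  assume *: "forms 5 \<subseteq> I"
  have x2: "pvar 0 ^ 2 \<in> forms 2" by (rule forms_power[OF forms_pvar]) simp
  have "(pvar 0 ^ 2 :: 'k poly3) = 0"
    by (rule quadric_kills[OF x2]) (use * forms_5[OF x2] in \<open>auto simp: mult.commute\<close>)
  then show False using basis3_nonzero[OF basis3_pvar, where 'k = 'k] by simp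
qed

text \<open>
  Modulo the five generators every form of degree 5 is a multiple of \<open>x y\<^sup>2 z\<^sup>2\<close>, so this monomial
  generates the socle and detects, degree by degree, the elements of \<open>I\<close> among the standard monomials.
\<close>

lemma exceptional_form_in:
  assumes ex: "exceptional_in x y z" and "exceptional_generators x y z J" "J \<subseteq> I" and f: "f \<in> forms d" "f \<in> I"
  shows "f \<in> J"
proof -
  interpret exceptional_generators x y z J by fact
  let ?w = "x*y^2*z^2"
  have gens: "x^2*y \<in> I" "x^2*z \<in> I" "y^3 \<in> I" "z^3 \<in> I" using ex by (auto simp: exceptional_in_def)
  have w: "?w \<notin> I"
  proof
    assume "?w \<in> I"
    then have "f \<in> I" if "f \<in> forms 5" for f
      using quintic_reduce[OF that] \<open>J \<subseteq> I\<close> mult mem_of_diff by blast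
    then show False using not_all_quintics by blast
  qed
  consider "d \<le> 2" | "d = 3" | "d = 4" | "d = 5" | "6 \<le> d" by linarith
  then show ?thesis
  proof cases
    case 1
    have "f * x ^ (2 - d) = 0"
      by (intro no_quadrics forms_mult'[OF f(1) forms_power[OF basis3_forms(1)[OF b] refl]] mult_right f(2)) (use 1 in simp)
    then show ?thesis using basis3_nonzero(1)[OF b] by auto
  next
    case 2
    have "indep4 (x^2*y) (x^2*z) (y^3) (z^3)"
      unfolding indep4_def
    proof (intro allI impI)
      fix p q r s assume "C p * (x^2*y) + C q * (x^2*z) + C r * y^3 + C s * z^3 = 0"
      then have "C 0 * x^3 + C p * (x^2*y) + C q * (x^2*z) + C 0 * (x*y^2) + C 0 * (x*y*z) +
          C 0 * (x*z^2) + C r * y^3 + C 0 * (y^2*z) + C 0 * (y*z^2) + C s * z^3 = 0" by (simp add: C_simps)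
      from cubic_coeffs_zero[OF b this] show "p = 0 \<and> q = 0 \<and> r = 0 \<and> s = 0" by blast
    qed
    moreover have "x^2*y \<in> forms 3" "x^2*z \<in> forms 3" "y^3 \<in> forms 3" "z^3 \<in> forms 3"
      using cubic_monomial_forms[OF b, of 1] cubic_monomial_forms[OF b, of 2]
        cubic_monomial_forms[OF b, of 6] cubic_monomial_forms[OF b, of 9] by (simp_all add: cubic_monomial_def)
    ultimately obtain p q r s where "f = C p * (x^2*y) + C q * (x^2*z) + C r * y^3 + C s * z^3"
      using cubics_span[of "x^2*y" "x^2*z" "y^3" "z^3" f] gens f 2 by blast
    then show ?thesis using generators by (auto intro!: J_add J_mult)
  next
    case 3
    then obtain a c d where r: "f - (C a * (y^2*z^2) + C c * (x*y^2*z) + C d * (x*y*z^2)) \<in> J" using quartic_reduce f(1) by blast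
    define s where "s = C a * (y^2*z^2) + C c * (x*y^2*z) + C d * (x*y*z^2)"
    have "f - s \<in> I" using r \<open>J \<subseteq> I\<close> unfolding s_def by blast
    from diff[OF f(2) this] have s: "s \<in> I" by simp
    \<comment> \<open>Multiplication by \<open>x\<close>, \<open>z\<close> and \<open>y\<close> in
      turn carries exactly one standard monomial of \<open>s\<close> to the socle generator and the
      others into \<open>I\<close>.\<close>
    have "C a * ?w = x * s - ((C c * y*z + C d*z^2) * (x^2*y))" unfolding s_def by Groebner_Basis.algebra
    also have "\<dots> \<in> I" using s gens by blast
    finally have a: "a = 0" using w C_mult_mem by blast
    have "C c * ?w = z * s - ((C a * y^2 + C d*x*y) * z^3)" unfolding s_def by Groebner_Basis.algebra
    also have "\<dots> \<in> I" using s gens by blast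
    finally have c: "c = 0" using w C_mult_mem by blast
    have "C d * ?w = y * s - ((C a * z^2 + C c*x*z) * y^3)" unfolding s_def by Groebner_Basis.algebra
    also have "\<dots> \<in> I" using s gens by blast
    finally have "d = 0" using w C_mult_mem by blast
    then show ?thesis using r a c by (simp add: C_simps)
  next
    case 4
    then obtain a where r: "f - C a * ?w \<in> J" using quintic_reduce f(1) by blast
    then have "C a * ?w \<in> I" using diff[OF f(2), of "f - C a * ?w"] \<open>J \<subseteq> I\<close> by auto
    then have "a = 0" using w C_mult_mem by blast
    then show ?thesis using r by (simp add: C_simps)
  next
    case 5
    then show ?thesis using high_degree f(1) by blast
  qed
qed

end

section \<open>Linear substitutions and comparison with the exceptional ideal\<close>

lemma unital_hom_linear_subst: "unital_hom (linear_subst M)"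
  and linear_subst_C [simp]: "linear_subst M (C c) = C c"
  and linear_subst_pvar [simp]: "linear_subst M (pvar i) = (\<Sum>j\<in>UNIV. C (M $ i $ j) * pvar j)"
  unfolding linear_subst_eq
  by (simp_all add: insertion_hom[OF unital_hom_pconst] insertion_const[OF unital_hom_pconst] insertion_var[OF unital_hom_pconst])

lemmas linear_subst_simps = unital_homD[OF unital_hom_linear_subst]

text \<open>Variables are replaced by rows, so the substitution carried out first becomes the left
  factor.\<close>

lemma linear_subst_compose: "linear_subst R (linear_subst N f) = linear_subst (N ** R) f"
proof (induction f rule: poly3_induct)
  case (var i)
  have "linear_subst R (linear_subst N (pvar i)) = (\<Sum>j\<in>UNIV. \<Sum>k\<in>UNIV. C (N $ i $ j) * (C (R $ j $ k) * pvar k))"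
    by (simp add: linear_subst_simps sum_distrib_left)
  also have "\<dots> = (\<Sum>k\<in>UNIV. \<Sum>j\<in>UNIV. C (N $ i $ j) * (C (R $ j $ k) * pvar k))" by (rule sum.swap)
  also have "\<dots> = linear_subst (N ** R) (pvar i)"
    by (simp add: matrix_matrix_mult_def unital_homD[OF unital_hom_pconst] sum_distrib_right mult.assoc)
  finally show ?case .
qed (simp_all add: linear_subst_simps)

lemma linear_subst_mat_1 [simp]: "linear_subst (mat 1) f = f"
proof (induction f rule: poly3_induct)
  case (var i)
  have "(\<Sum>j\<in>UNIV. C ((mat 1 :: 'a^3^3) $ i $ j) * pvar j) = (\<Sum>j\<in>UNIV. if j = i then pvar j else 0)"
    by (intro sum.cong) (auto simp: mat_def C_simps)
  then show ?case by simp
qed (simp_all add: linear_subst_simps)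

lemma forms_linear_subst: "f \<in> forms d \<Longrightarrow> linear_subst M f \<in> forms d"
proof (induction d arbitrary: f)
  case 0
  then show ?case using forms_0D by force
next
  case (Suc d)
  then obtain g where g: "\<And>i. g i \<in> forms d" "f = (\<Sum>i\<in>UNIV. pvar i * g i)" using forms_SucD by blast
  have "(\<Sum>j\<in>UNIV. C (M $ i $ j) * pvar j) \<in> forms 1" for i by (intro forms_sum forms_C_mult forms_pvar)
  from forms_mult'[OF this Suc.IH[OF g(1)], of "Suc d"] show ?case
    unfolding g(2) linear_subst_simps linear_subst_pvar by (intro forms_sum) simp
qed

text \<open>The matrix \<open>R\<close> expresses the basis in the variables and \<open>M\<close>
  the variables in the basis. They are mutually inverse because the variables are linearly
  independent.\<close>

lemma basis3_linear_subst:
  fixes x y z :: "'k::alg_closed_field poly3"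
  assumes b: "basis3 x y z"
  obtains M R :: "'k^3^3" where "M ** R = mat 1" "R ** M = mat 1"
    "linear_subst M x = pvar 0" "linear_subst M y = pvar 1" "linear_subst M z = pvar 2"
proof -
  define u where "u i = (if i = 0 then x else if i = 1 then y else z)" for i :: 3
  have u: "u 0 = x" "u 1 = y" "u 2 = z" using three_neq by (simp_all add: u_def)
  have "\<exists>r. l = (\<Sum>j\<in>UNIV. C (r j) * w j)" if wl: "basis3 (w 0) (w 1) (w 2)" "l \<in> forms 1" for l and w :: "3 \<Rightarrow> 'k poly3"
  proof -
    obtain a b c where "l = C a * w 0 + C b * w 1 + C c * w 2" using basis3_span[OF wl] by blast
    then show ?thesis using three_neq
      by (intro exI[of _ "\<lambda>j. if j = 0 then a else if j = 1 then b else c"]) (simp add: sum_three)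
  qed
  note span = this
  have "u i \<in> forms 1" for i using basis3_forms[OF b] by (simp add: u_def)
  then have "\<forall>i. \<exists>r. u i = (\<Sum>j\<in>UNIV. C (r j) * pvar j)" using span[of pvar] basis3_pvar by blast
  then obtain r where r: "\<And>i. u i = (\<Sum>j\<in>UNIV. C (r i j) * pvar j)" by metis
  have "\<forall>i. \<exists>m. pvar i = (\<Sum>j\<in>UNIV. C (m j) * u j)" using span[of u] b u by (metis forms_pvar)
  then obtain m where m: "\<And>i. pvar i = (\<Sum>j\<in>UNIV. C (m i j) * u j)" by metis
  define M R :: "'k^3^3" where "M = (\<chi> i j. m i j)" and "R = (\<chi> i j. r i j)"
  have R: "linear_subst R (pvar i) = u i" for i by (simp add: R_def r)
  have "linear_subst M (pvar i) = (\<Sum>j\<in>UNIV. C (m i j) * pvar j)" for i by (simp add: M_def)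
  then have "linear_subst R (linear_subst M (pvar i)) = pvar i" for i
    by (simp add: linear_subst_simps R m[symmetric] del: linear_subst_pvar)
  then have *: "(\<Sum>j\<in>UNIV. C ((M ** R) $ i $ j) * pvar j) = pvar i" for i
    by (metis linear_subst_compose linear_subst_pvar)
  have one: "(\<Sum>j\<in>UNIV. C ((mat 1 :: 'k^3^3) $ i $ j) * pvar j) = pvar i" for i
    using linear_subst_mat_1[of "pvar i"] unfolding linear_subst_pvar .
  have "(\<Sum>j\<in>UNIV. C ((M ** R) $ i $ j - mat 1 $ i $ j) * pvar j) = 0" for i
    by (simp add: C_simps left_diff_distrib sum_subtractf * one)
  then have "C ((M ** R) $ i $ 0 - mat 1 $ i $ 0) * pvar 0 + C ((M ** R) $ i $ 1 - mat 1 $ i $ 1) * pvar 1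
      + C ((M ** R) $ i $ 2 - mat 1 $ i $ 2) * pvar 2 = 0" for i
    unfolding sum_three .
  note z = linear_coeffs_zero[OF basis3_pvar this]
  have "(M ** R) $ i $ j = mat 1 $ i $ j" for i j
  proof -
    have "j \<in> {0, 1, 2}" using UNIV_three by blast
    then consider "j = 0" | "j = 1" | "j = 2" by blast
    then show ?thesis by cases (use z[of i] in simp_all)
  qed
  then have MR: "M ** R = mat 1" by (simp add: vec_eq_iff)
  then have RM: "R ** M = mat 1" using matrix_left_right_inverse by blast
  have "linear_subst M (u i) = pvar i" for i
    unfolding R[symmetric] linear_subst_compose RM by (rule linear_subst_mat_1)
  then show ?thesis using that[OF MR RM] u by metis
qed

lemma ideal_exceptional_ideal: "ideal exceptional_ideal (polyring :: 'k::field poly3 ring)"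
  unfolding exceptional_ideal_def Let_def by (rule ideal_genideal)

lemma exceptional_ideal_generators:
  "pvar 0^2 * pvar 1 \<in> exceptional_ideal" "pvar 0^2 * pvar 2 \<in> exceptional_ideal" "pvar 1^3 \<in> exceptional_ideal"
  "pvar 2^3 \<in> exceptional_ideal" "pvar 0^4 + pvar 1^2 * pvar 2^2 \<in> exceptional_ideal"
  unfolding exceptional_ideal_def Let_def by (rule genideal_subset[THEN subsetD]; simp)+

text \<open>The auxiliary ideal \<open>J\<close> consists of the elements of \<open>I\<close> with
  image in the exceptional ideal. It contains the five generators, so
  \<open>exceptional_form_in\<close> puts every homogeneous component of an element of
  \<open>I\<close> into it.\<close>

lemma (in gorenstein_ideal) equal_up_to_linear_change_of_exceptional:
  assumes hcomp: "\<And>f d. f \<in> I \<Longrightarrow> hcomp d f \<in> I" and ex: "exceptional_in x y z"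
  shows "equal_up_to_linear_change I exceptional_ideal"
proof -
  have b: "basis3 x y z" using ex by (simp add: exceptional_in_def)
  obtain M R :: "'k^3^3" where MR: "M ** R = mat 1" "R ** M = mat 1"
    and M: "linear_subst M x = pvar 0" "linear_subst M y = pvar 1" "linear_subst M z = pvar 2"
    using basis3_linear_subst[OF b] .
  have inv: "linear_subst M (linear_subst R f) = f" "linear_subst R (linear_subst M f) = f" for f
    by (simp_all add: linear_subst_compose MR)
  define J where "J = {f\<in>I. linear_subst M f \<in> exceptional_ideal}"
  have E: "0 \<in> (exceptional_ideal :: 'k poly3 set)" "\<And>p q. p \<in> exceptional_ideal \<Longrightarrow> q \<in> exceptional_ideal \<Longrightarrow> p + q \<in> exceptional_ideal"
    "\<And>p q. q \<in> exceptional_ideal \<Longrightarrow> p * q \<in> (exceptional_ideal :: 'k poly3 set)"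
    using ideal_exceptional_ideal by (auto simp: ideal_polyring_iff)
  have J: "exceptional_generators x y z J"
  proof
    show "x^2*y \<in> J" "x^2*z \<in> J" "y^3 \<in> J" "z^3 \<in> J" "x^4 + y^2*z^2 \<in> J"
      using ex exceptional_ideal_generators by (auto simp: J_def exceptional_in_def linear_subst_simps M)
  qed (use b E in \<open>auto simp: J_def linear_subst_simps\<close>)
  have "I \<subseteq> J"
  proof
    fix f assume f: "f \<in> I"
    interpret exceptional_generators x y z J by (rule J)
    have "hcomp d f \<in> J" for d
      by (rule exceptional_form_in[OF ex J]) (use hcomp[OF f] in \<open>auto simp: J_def\<close>)
    then have "(\<Sum>d<N. hcomp d f) \<in> J" for N by (induction N) auto
    then show "f \<in> J" using sum_hcomp[of f] by metis
  qed
  then have "linear_subst M ` I \<subseteq> exceptional_ideal" by (auto simp: J_def)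
  moreover have "exceptional_ideal \<subseteq> linear_subst M ` I"
  proof -
    have im: "linear_subst M ` I = {f. linear_subst R f \<in> I}" 
    proof (intro Set.set_eqI iffI)
      fix f assume "f \<in> {f. linear_subst R f \<in> I}"
      then show "f \<in> linear_subst M ` I" using imageI[of "linear_subst R f" I "linear_subst M"] by (simp add: inv)
    qed (auto simp: inv)
    have "ideal (linear_subst M ` I) polyring"
      unfolding ideal_polyring_iff im by (auto simp: linear_subst_simps)
    moreover have "linear_subst R (pvar 0) = x" "linear_subst R (pvar 1) = y" "linear_subst R (pvar 2) = z"
      unfolding M[symmetric] inv by (rule refl)+
    then have "{pvar 0^2 * pvar 1, pvar 0^2 * pvar 2, pvar 1^3, pvar 2^3, pvar 0^4 + pvar 1^2 * pvar 2^2} \<subseteq> linear_subst M ` I"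
      using ex unfolding im by (simp add: linear_subst_simps exceptional_in_def del: linear_subst_pvar)
    ultimately show ?thesis unfolding exceptional_ideal_def Let_def by (rule genideal_least)
  qed
  ultimately show ?thesis using MR unfolding equal_up_to_linear_change_def invertible_def by blast
qed

text \<open>
  In characteristic 3, \<open>l = a x + m\<close> with \<open>m = b y + c z\<close> satisfies
  \<open>l m (2 a x + m) = 2 a\<^sup>2 x\<^sup>2 m + b\<^sup>3 y\<^sup>3 + c\<^sup>3 z\<^sup>3\<close>.
\<close>

lemma exceptional_ideal_failure:
  fixes l :: "'k::alg_closed_field poly3"
  assumes three: "(3::'k) = 0" and l: "l \<in> forms 1"
  shows "\<exists>q\<in>forms 2. q \<noteq> 0 \<and> l * q \<in> exceptional_ideal"
proof -
  let ?x = "pvar 0 :: 'k poly3" and ?y = "pvar 1 :: 'k poly3" and ?z = "pvar 2 :: 'k poly3"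
  have E: "p1*(?x^2*?y) + p2*(?x^2*?z) + p3*?y^3 + p4*?z^3 \<in> exceptional_ideal" for p1 p2 p3 p4
  proof -
    have E: "\<And>p q. p \<in> exceptional_ideal \<Longrightarrow> q \<in> exceptional_ideal \<Longrightarrow> p + q \<in> (exceptional_ideal :: 'k poly3 set)"
      "\<And>p q. q \<in> exceptional_ideal \<Longrightarrow> p * q \<in> (exceptional_ideal :: 'k poly3 set)"
      using ideal_exceptional_ideal by (auto simp: ideal_polyring_iff)
    show ?thesis by (intro E exceptional_ideal_generators)
  qed
  obtain a b c where le: "l = C a * ?x + C b * ?y + C c * ?z" using forms_1E[OF basis3_pvar l] .
  define m where "m = C b * ?y + C c * ?z"
  have m: "m \<in> forms 1" unfolding m_def by (intro forms_add forms_C_mult forms_pvar)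
  show ?thesis
  proof (cases "m = 0")
    case True
    have "l * (?x * ?y) = C a * (?x^2 * ?y) + 0*(?x^2*?z) + 0*?y^3 + 0*?z^3"
      using True unfolding le m_def by (simp add: add.assoc power2_eq_square algebra_simps)
    then have "l * (?x * ?y) \<in> exceptional_ideal" using E by metis
    moreover have "?x * ?y \<in> forms 2" by (rule forms_mult'[OF forms_pvar forms_pvar]) simp
    moreover have "?x * ?y \<noteq> 0" using basis3_nonzero[OF basis3_pvar, where 'k = 'k] by simp
    ultimately show ?thesis by blast
  next
    case False
    \<comment> \<open>In characteristic 3 this is \<open>m - a x\<close>, so
      \<open>l n = m^2 - a^2 x^2\<close>. After multiplication by \<open>m\<close>, the cube is
      additive and lies in the ideal, as does \<open>x^2 m\<close>.\<close>
    define n where "n = C (2*a) * ?x + C b * ?y + C c * ?z"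
    have n: "n \<in> forms 1" unfolding n_def by (intro forms_add forms_C_mult forms_pvar)
    have "n \<noteq> 0"
    proof
      assume "n = 0"
      from linear_coeffs_zero[OF basis3_pvar this[unfolded n_def]] have "m = 0" by (simp add: m_def C_simps)
      then show False using False by blast
    qed
    have 3: "(3 :: 'k poly3) = 0" using three unital_homD(8)[OF unital_hom_pconst, of "num.Bit1 num.One", where 'a = 'k] by (simp add: C_simps)
    have C2: "C (2*a) = 2 * C a" using unital_homD(8)[OF unital_hom_pconst, of "num.Bit0 num.One", where 'a = 'k] by (simp add: C_simps)
    have "l * (m * n) = (2 * C a^2 * C b)*(?x^2*?y) + (2 * C a^2 * C c)*(?x^2*?z) + (C b^3)*?y^3 + (C c^3)*?z^3
        + 3 * (C a * ?x * m^2 + C b^2 * C c * ?y^2 * ?z + C b * C c^2 * ?y * ?z^2)"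
      unfolding le m_def n_def C2 by Groebner_Basis.algebra
    then have "l * (m * n) \<in> exceptional_ideal" unfolding 3 using E[of "2 * C a^2 * C b" "2 * C a^2 * C c" "C b^3" "C c^3"] by simp
    moreover have "m * n \<in> forms 2" by (rule forms_mult'[OF m n]) simp
    ultimately show ?thesis using False \<open>n \<noteq> 0\<close> by (metis mult_eq_0_iff)
  qed
qed

lemma CHAR_eq_3_iff: "CHAR('k::field) = 3 \<longleftrightarrow> (3::'k) = 0"
proof
  assume "CHAR('k) = 3"
  then show "(3::'k) = 0" using of_nat_CHAR[where 'a = 'k] by simp
next
  assume "(3::'k) = 0"
  then have "CHAR('k) dvd 3" using of_nat_eq_0_iff_char_dvd[where 'a = 'k, of 3] by simp
  moreover have "prime (3::nat)" by simp
  ultimately have "CHAR('k) = 1 \<or> CHAR('k) = 3" using prime_nat_iff by blast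
  moreover have "CHAR('k) \<noteq> 1" using of_nat_CHAR[where 'a = 'k] by (metis of_nat_1 zero_neq_one)
  ultimately show "CHAR('k) = 3" by blast
qed

text \<open>The equivalence also records that the exception is genuine: the quadric killed by the
  image of \<open>l\<close> in the exceptional ideal is carried back by the inverse
  substitution.\<close>

theorem theorem3p8:
  fixes I :: "'k::alg_closed_field poly3 set"
  assumes "homogeneous_ideal I"
    and "gorenstein_artinian I"
    and "has_hilbert_function I [1, 3, 6, 6, 3, 1]"
  shows "weak_lefschetz I \<longleftrightarrow>
    \<not> (CHAR('k) = 3 \<and> equal_up_to_linear_change I exceptional_ideal)"
proof -
  obtain \<phi> g where "gorenstein_ideal I \<phi> g" using gorenstein_ideal_of_hilbert_function[OF assms] by blast
  then interpret gorenstein_ideal I \<phi> g .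
  interpret gorenstein_quotient I \<phi> g 
    by (intro gorenstein_quotient.intro gorenstein_ideal_axioms quotient_algebra.intro homogeneous_ideal_is_ideal[OF assms(1)])
  show ?thesis
  proof
    assume "weak_lefschetz I"
    then obtain l where l: "l \<in> forms 1" "\<And>q. q \<in> forms 2 \<Longrightarrow> l * q \<in> I \<Longrightarrow> q = 0"
      unfolding weak_lefschetz_iff by blast
    show "\<not> (CHAR('k) = 3 \<and> equal_up_to_linear_change I exceptional_ideal)"
    proof
      assume *: "CHAR('k) = 3 \<and> equal_up_to_linear_change I exceptional_ideal"
      then obtain M R :: "'k^3^3" where M: "linear_subst M ` I = exceptional_ideal" "M ** R = mat 1" "R ** M = mat 1"
        unfolding equal_up_to_linear_change_def invertible_def by blast
      obtain q where q: "q \<in> forms 2" "q \<noteq> 0" "linear_subst M l * q \<in> exceptional_ideal"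
        using exceptional_ideal_failure[OF _ forms_linear_subst[OF l(1)]] * CHAR_eq_3_iff[where 'k = 'k] by blast
      obtain f where f: "f \<in> I" "linear_subst M l * q = linear_subst M f" using q(3) M(1) by blast
      have "linear_subst R (linear_subst M l * q) \<in> I" unfolding f(2) linear_subst_compose M(2) using f(1) by simp
      then have "l * linear_subst R q \<in> I" by (simp add: linear_subst_simps linear_subst_compose M)
      then have "linear_subst R q = 0" by (rule l(2)[OF forms_linear_subst[OF q(1)]])
      then have "linear_subst M (linear_subst R q) = linear_subst M 0" by simp
      then show False using q(2) by (simp add: linear_subst_compose M linear_subst_simps)
    qed
  next
    assume *: "\<not> (CHAR('k) = 3 \<and> equal_up_to_linear_change I exceptional_ideal)"
    show "weak_lefschetz I"
    proof (rule ccontr)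
      assume "\<not> weak_lefschetz I"
      then interpret lefschetz_failure I \<phi> g
        by unfold_locales (auto simp: weak_lefschetz_iff)
      show False
        using exceptional_of_failure * equal_up_to_linear_change_of_exceptional homogeneous_ideal_hcomp[OF assms(1)]
        by (metis CHAR_eq_3_iff)
    qed
  qed
qed

end
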